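(* Let $d\ge1$ and $\rho\in(0,\infty)$. There exists a constant $C(d)<\infty$ such that for every $n\in\mathbb N$ and every function $u\in\mathcal H^1(\square_n)$ satisfying $\mathbb E_\rho[u\,|\,\mathcal G_n]=0$, we have $$\|u\|_{\mathcal L^2}\le C\Big(\mathbb E_\rho\Big[\int_{\square_n}|\nabla u|^2\,d\mu\Big]\Big)^{\frac12}+C\sum_{k=0}^n3^k\Big(\mathbb E_\rho\Big[\int_{\square_n}|\mathsf S_{n,k}\nabla u|^2\,d\mu\Big]\Big)^{\frac12}.$$
   Context: Configuration space. $\mathcal M_\delta(\mathbb R^d)$ is the set of $\sigma$-finite measures on $\mathbb R^d$ that are sums of Dirac masses; $\mathbb P_\rho$ is the law on it of the Poisson point process with constant density $\rho\in(0,\infty)$, $\mathbb E_\rho$ is its expectation, and $\mu$ is the canonical random variable. For Borel $U\subseteq\mathbb R^d$, $\mathcal F_U$ is the $\sigma$-algebra generated by the maps $\mu\mapsto\mu(V)$, $V\subseteq U$ Borel, completed with all $\mathbb P_\rho$-null sets; $\mathcal F:=\mathcal F_{\mathbb R^d}$. $\mu|_U$ denotes the restriction of $\mu$ to $U$. $\int_U g(\mu,x)\,d\mu(x)$ is the sum of $g(\mu,x)$ over the points $x$ of $\mu$ in $U$. Function spaces. $\mathcal L^2$ is the space of $\mathcal F$-measurable $f$ with $\|f\|_{\mathcal L^2}^2:=\mathbb E_\rho[f^2]<\infty$. For sufficiently smooth $f:\mathcal M_\delta(\mathbb R^d)\to\mathbb R$, $x\in\operatorname{supp}\mu$ and $k\in\{1,\dots,d\}$,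 $\mathbf e_k\cdot\nabla f(\mu,x):=\lim_{h\to0}h^{-1}\big(f(\mu-\delta_x+\delta_{x+h\mathbf e_k})-f(\mu)\big)$. For $U\subseteq\mathbb R^d$ open, $C^\infty(U)$ is the set of $\mathcal F$-measurable $f$ such that for every bounded open $V\subseteq U$, $\mu\in\mathcal M_\delta(\mathbb R^d)$, $n\in\mathbb N$, the function $(x_1,\dots,x_n)\mapsto f(\sum_{i=1}^n\delta_{x_i}+\mu|_{V^c})$ is infinitely differentiable on $V^n$. Set $\|f\|_{\mathcal H^1(U)}:=\big(\mathbb E_\rho[f^2]+\mathbb E_\rho[\int_U|\nabla f(\mu,x)|^2d\mu(x)]\big)^{1/2}$. $\mathcal H^1(U)$ is the completion of $\{f\in C^\infty(U):\|f\|_{\mathcal H^1(U)}<\infty\}$ for this norm (its elements need not be $\mathcal F_U$-measurable); $\nabla$ is extended by density. Multiscale notation. $\square_n:=(-3^n/2,3^n/2)^d$; $\mathcal Z_{n,k}:=3^k\mathbb Z^d\cap\square_n$ for $k\le n$; $\square_k(x)$ is the unique cube of the form $z+\square_k$, $z\in3^k\mathbb Z^d$, containing $x$ (defined for a.e. $x$). $\mathcal G_{n,k}:=\sigma\big((\mu(z+\square_k))_{z\in\mathcal Z_{n,k}},\ \mu|_{\mathbb R^d\setminus\square_n}\big)$ and $\mathcal G_n:=\mathcal G_{n,n}$. For a Borel set $V$ with $\mu(V)\in(0,\infty)$, $⨍_Vg\,d\mu:=\frac1{\mu(V)}\int_Vg\,d\mu$, and $⨍_Vg\,d\mu:=0$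 if $\mu(V)=0$ (here $⨍$ denotes the averaged integral). For $x\in\square_n$ and $u\in\mathcal H^1(\square_n)$, $$(\mathsf S_{n,k}\nabla u)(\mu,x):=\mathbb E_\rho\Big[⨍_{\square_k(x)}\nabla u\,d\mu\ \Big|\ \mathcal G_{n,k}\Big].$$ *)

theory Defs
  imports "HOL-Probability.Probability"
begin

section \<open>Point configurations\<close>

definition dirac_sum :: "nat set \<Rightarrow> (nat \<Rightarrow> real^'d) \<Rightarrow> (real^'d) measure" where
  "dirac_sum I x = measure_of UNIV (sets borel) (\<lambda>A. \<integral>\<^sup>+i. emeasure (return borel (x i)) A \<partial>count_space I)"

text \<open>Sigma-finiteness forces a sum of Dirac masses to be countable, so index sets
  in \<^typ>\<open>nat\<close> lose nothing. Repeated points are allowed.\<close>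

definition configs :: "(real^'d) measure set" where
  "configs = {\<mu>. sigma_finite_measure \<mu> \<and> (\<exists>I x. \<mu> = dirac_sum I x)}"

definition plus_measure :: "'a measure \<Rightarrow> 'a measure \<Rightarrow> 'a measure" where
  "plus_measure M N = measure_of (space M) (sets M) (\<lambda>A. emeasure M A + emeasure N A)"

text \<open>The restriction to \<open>A\<close>, kept as a measure on the whole space.\<close>

definition restr :: "(real^'d) measure \<Rightarrow> (real^'d) set \<Rightarrow> (real^'d) measure" where
  "restr \<mu> A = density \<mu> (indicator A)"

definition move_point :: "(real^'d) measure \<Rightarrow> real^'d \<Rightarrow> real^'d \<Rightarrow> (real^'d) measure" where
  "move_point \<mu> x y = plus_measure (diff_measure \<mu> (return borel x)) (return borel y)"

text \<open>Each \<^const>\<open>measure_of\<close> above does receive a countably additive function.\<close>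

lemma emeasure_dirac_sum: assumes "A \<in> sets borel"
 shows "emeasure (dirac_sum I x) A = (\<integral>\<^sup>+i. emeasure (return borel (x i)) A \<partial>count_space I)"
proof (rule emeasure_measure_of[OF dirac_sum_def])
  show "countably_additive (sets (dirac_sum I x)) (\<lambda>A. \<integral>\<^sup>+i. emeasure (return borel (x i)) A \<partial>count_space I)"
  proof (rule countably_additiveI)
    fix B :: "nat \<Rightarrow> (real^'a) set" assume B: "range B \<subseteq> sets (dirac_sum I x)" "disjoint_family B"
    have "sets (dirac_sum I x) = sets borel" unfolding dirac_sum_def
      by (metis sets.sigma_sets_eq sets_measure_of space_borel sets.space_closed)
    with B have B': "range B \<subseteq> sets borel" by auto
    have "(\<Sum>j. \<integral>\<^sup>+i. emeasure (return borel (x i)) (B j) \<partial>count_space I) = (\<integral>\<^sup>+i. (\<Sum>j. emeasure (return borel (x i)) (B j)) \<partial>count_space I)"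
      by (subst nn_integral_suminf) auto
    also have "\<dots> = (\<integral>\<^sup>+i. emeasure (return borel (x i)) (\<Union>j. B j) \<partial>count_space I)"
      using B' B(2) by (intro nn_integral_cong suminf_emeasure) auto
    finally show "(\<Sum>j. \<integral>\<^sup>+i. emeasure (return borel (x i)) (B j) \<partial>count_space I) = (\<integral>\<^sup>+i. emeasure (return borel (x i)) (\<Union>j. B j) \<partial>count_space I)" .
  qed
  show "A \<in> sets (dirac_sum I x)" unfolding dirac_sum_def using assms
      by (metis sets.sigma_sets_eq sets_measure_of space_borel sets.space_closed)
qed (auto simp: positive_def)

lemma emeasure_plus_measure: fixes M N :: "'a measure" assumes "sets N = sets M" "A \<in> sets M"
 shows "emeasure (plus_measure M N) A = emeasure M A + emeasure N A"
proof (rule emeasure_measure_of[OF plus_measure_def])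
  have s: "sets (plus_measure M N) = sets M" unfolding plus_measure_def by simp
  show "countably_additive (sets (plus_measure M N)) (\<lambda>A. emeasure M A + emeasure N A)"
  proof (rule countably_additiveI)
    fix B :: "nat \<Rightarrow> 'a set" assume B: "range B \<subseteq> sets (plus_measure M N)" "disjoint_family B"
    show "(\<Sum>i. emeasure M (B i) + emeasure N (B i)) = emeasure M (\<Union>i. B i) + emeasure N (\<Union>i. B i)"
      using B s assms by (simp add: suminf_add[symmetric] suminf_emeasure)
  qed
  show "A \<in> sets (plus_measure M N)" using s assms by simp
qed (auto simp: positive_def sets.space_closed)

lemma emeasure_diff_dirac: fixes M :: "(real^'d) measure"
 assumes sM: "sets M = sets borel" and le: "\<And>A. A \<in> sets borel \<Longrightarrow> indicator A x \<le> emeasure M A" and A: "A \<in> sets borel"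
 shows "emeasure (diff_measure M (return borel x)) A = emeasure M A - indicator A x"
proof -
  let ?N = "return borel x"
  have le': "emeasure ?N A \<le> emeasure M A" if "A \<in> sets borel" for A using le[OF that] that by simp
  have "emeasure (diff_measure M ?N) A = emeasure M A - emeasure ?N A"
  proof (rule emeasure_measure_of[OF diff_measure_def])
    show "countably_additive (sets (diff_measure M ?N)) (\<lambda>A. emeasure M A - emeasure ?N A)"
    proof (rule countably_additiveI)
      fix B :: "nat \<Rightarrow> (real^'d) set" assume B0: "range B \<subseteq> sets (diff_measure M ?N)" and d: "disjoint_family B"
      have B: "range B \<subseteq> sets borel" using B0 sM by simp
      have "emeasure M (\<Union>i. B i) = (\<Sum>i. emeasure M (B i))" using B d sM by (simp add: suminf_emeasure)
      also have "\<dots> = (\<Sum>i. (emeasure M (B i) - emeasure ?N (B i)) + emeasure ?N (B i))"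
        using B le' by (intro suminf_cong) (metis diff_add_cancel_ennreal rangeI subsetD)
      also have "\<dots> = (\<Sum>i. (emeasure M (B i) - emeasure ?N (B i))) + (\<Sum>i. emeasure ?N (B i))"
        by (simp add: suminf_add[symmetric])
      also have "(\<Sum>i. emeasure ?N (B i)) = emeasure ?N (\<Union>i. B i)" using B d by (intro suminf_emeasure) auto
      finally show "(\<Sum>i. emeasure M (B i) - emeasure ?N (B i)) = emeasure M (\<Union>i. B i) - emeasure ?N (\<Union>i. B i)"
        using B by (simp add: sets.countable_UN split: split_indicator)
    qed
    show "A \<in> sets (diff_measure M ?N)" using A sM by simp
  qed (auto simp: positive_def sets.space_closed)
  then show ?thesis using A by simp
qed

lemma emeasure_move_point:
  fixes \<mu> :: "(real^'d) measure"
  assumes "sets \<mu> = sets borel" "\<And>A. A \<in> sets borel \<Longrightarrow> indicator A x \<le> emeasure \<mu> A" "A \<in> sets borel"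
  shows "emeasure (move_point \<mu> x y) A = emeasure \<mu> A - indicator A x + indicator A y"
  unfolding move_point_def using assms by (simp add: emeasure_plus_measure emeasure_diff_dirac)

text \<open>The \<open>\<sigma>\<close>-algebra on \<^const>\<open>configs\<close> generated by the counts \<open>\<mu> \<mapsto> \<mu>(V)\<close>, \<open>V \<in> \<V>\<close>.\<close>

definition count_algebra :: "(real^'d) set set \<Rightarrow> (real^'d) measure measure" where
  "count_algebra \<V> = sigma configs {{\<mu> \<in> configs. emeasure \<mu> V \<in> B} | V B. V \<in> \<V> \<and> B \<in> sets borel}"

text \<open>\<open>P\<close> is the law of the Poisson point process with density \<open>\<rho>\<close>. These properties
  determine \<open>P\<close>. The \<open>\<sigma>\<close>-algebra of the paper, completed with the null sets, is that of
  \<^term>\<open>completion P\<close>; expectations below are integrals against \<^term>\<open>completion P\<close>.\<close>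

definition poisson_law :: "real \<Rightarrow> (real^'d) measure measure \<Rightarrow> bool" where
  "poisson_law \<rho> P \<longleftrightarrow>
     prob_space P \<and> sets P = sets (count_algebra (sets borel)) \<and>
     (\<forall>V\<in>sets borel. emeasure lborel V < \<infinity> \<longrightarrow>
        (\<forall>k::nat. measure P {\<mu> \<in> space P. emeasure \<mu> V = of_nat k} =
           (\<rho> * measure lborel V) ^ k / fact k * exp (- (\<rho> * measure lborel V)))) \<and>
     (\<forall>(m::nat) V. (\<forall>i<m. V i \<in> sets borel) \<and> disjoint_family_on V {..<m} \<longrightarrow>
        prob_space.indep_vars P (\<lambda>_. borel) (\<lambda>i \<mu>. emeasure \<mu> (V i)) {..<m})"

section \<open>Function spaces\<close>

text \<open>\<open>C\<^sup>m\<close> regularity on \<open>V\<^sup>n\<close> (with \<open>V\<close> open): all iterated partial derivatives up to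
  order \<open>m\<close> exist and are continuous. Since \<open>n\<close> varies, points of \<open>V\<^sup>n\<close> are
  extensional functions on \<^term>\<open>{..<n}\<close>, with the product topology.\<close>

primrec Ck_power :: "nat \<Rightarrow> nat \<Rightarrow> (real^'d) set \<Rightarrow> ((nat \<Rightarrow> real^'d) \<Rightarrow> real) \<Rightarrow> bool" where
  "Ck_power 0 n V F \<longleftrightarrow> continuous_on ({..<n} \<rightarrow>\<^sub>E V) F"
| "Ck_power (Suc m) n V F \<longleftrightarrow> continuous_on ({..<n} \<rightarrow>\<^sub>E V) F \<and>
     (\<exists>G. \<forall>i<n. \<forall>k.
        (\<forall>x\<in>{..<n} \<rightarrow>\<^sub>E V.
           ((\<lambda>h. F (x(i := x i + h *\<^sub>R axis k 1))) has_real_derivative G i k x) (at 0)) \<and>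
        Ck_power m n V (G i k))"

definition smooth_power :: "nat \<Rightarrow> (real^'d) set \<Rightarrow> ((nat \<Rightarrow> real^'d) \<Rightarrow> real) \<Rightarrow> bool" where
  "smooth_power n V F \<longleftrightarrow> (\<forall>m. Ck_power m n V F)"

definition Cinf :: "(real^'d) measure measure \<Rightarrow> (real^'d) set \<Rightarrow> ((real^'d) measure \<Rightarrow> real) set" where
  "Cinf P U = {f \<in> borel_measurable (completion P).
     \<forall>V. open V \<and> bounded V \<and> V \<subseteq> U \<longrightarrow>
       (\<forall>\<mu>\<in>configs. \<forall>n. smooth_power n V (\<lambda>x. f (plus_measure (dirac_sum {..<n} x) (restr \<mu> (- V)))))}"

text \<open>The gradient is meaningful only at the points of \<open>\<mu>\<close>, i.e. its atoms; the value
  \<open>0\<close> elsewhere is immaterial, because it is only integrated against \<open>\<mu>\<close>.\<close>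

definition grad :: "((real^'d) measure \<Rightarrow> real) \<Rightarrow> (real^'d) measure \<Rightarrow> real^'d \<Rightarrow> real^'d" where
  "grad f \<mu> x = (if emeasure \<mu> {x} = 0 then 0 else
     (\<chi> k. Lim (at 0) (\<lambda>h::real. (f (move_point \<mu> x (x + h *\<^sub>R axis k 1)) - f \<mu>) / h)))"

definition L2_sq :: "(real^'d) measure measure \<Rightarrow> ((real^'d) measure \<Rightarrow> real) \<Rightarrow> ennreal" where
  "L2_sq P f = (\<integral>\<^sup>+\<mu>. ennreal ((f \<mu>)\<^sup>2) \<partial>completion P)"

definition energy :: "(real^'d) measure measure \<Rightarrow> (real^'d) set \<Rightarrow>
    ((real^'d) measure \<Rightarrow> real^'d \<Rightarrow> real^'d) \<Rightarrow> ennreal" where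
  "energy P U g = (\<integral>\<^sup>+\<mu>. (\<integral>\<^sup>+x\<in>U. ennreal ((norm (g \<mu> x))\<^sup>2) \<partial>\<mu>) \<partial>completion P)"

text \<open>The completion of the smooth functions of finite \<open>H\<^sup>1\<close>-norm. The map \<open>f \<mapsto> (f, \<nabla>f)\<close> is
  an isometry into the product of \<open>L\<^sup>2(P)\<close> and \<open>L\<^sup>2(P(d\<mu>) \<mu>(dx))\<close>, so the completion is the
  closure of its image: an element is a pair \<open>(u, g)\<close> of \<open>L\<^sup>2\<close>-functions, and \<open>g\<close> is
  \<open>\<nabla>u\<close>, extended by density.\<close>

definition H1 :: "(real^'d) measure measure \<Rightarrow> (real^'d) set \<Rightarrow>
    (((real^'d) measure \<Rightarrow> real) \<times> ((real^'d) measure \<Rightarrow> real^'d \<Rightarrow> real^'d)) set" where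
  "H1 P U = {(u, g). u \<in> borel_measurable (completion P) \<and>
     case_prod g \<in> borel_measurable (completion P \<Otimes>\<^sub>M borel) \<and>
     (\<exists>f. (\<forall>j::nat. f j \<in> Cinf P U \<and> L2_sq P (f j) + energy P U (grad (f j)) < \<infinity>) \<and>
        (\<lambda>j. L2_sq P (\<lambda>\<mu>. f j \<mu> - u \<mu>) + energy P U (\<lambda>\<mu> x. grad (f j) \<mu> x - g \<mu> x))
          \<longlonglongrightarrow> 0)}"

section \<open>Multiscale notation\<close>

definition cube :: "nat \<Rightarrow> (real^'d) set" where
  "cube n = box (\<chi> i. - (3 ^ n / 2)) (\<chi> i. 3 ^ n / 2)"

definition lattice :: "nat \<Rightarrow> (real^'d) set" where
  "lattice k = {z. \<forall>i. \<exists>m::int. z $ i = 3 ^ k * of_int m}"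

definition grid :: "nat \<Rightarrow> nat \<Rightarrow> (real^'d) set" where
  "grid n k = lattice k \<inter> cube n"

text \<open>The cubes \<open>z + cube k\<close>, \<open>z \<in> lattice k\<close>, are pairwise disjoint, so this union is the
  unique one containing \<open>x\<close>, and empty for the null set of \<open>x\<close> contained in none.\<close>

definition cube_at :: "nat \<Rightarrow> real^'d \<Rightarrow> (real^'d) set" where
  "cube_at k x = \<Union>{Q. \<exists>z\<in>lattice k. Q = (+) z ` cube k \<and> x \<in> Q}"

definition scale_alg :: "nat \<Rightarrow> nat \<Rightarrow> (real^'d) measure measure" where
  "scale_alg n k = count_algebra ((\<lambda>z. (+) z ` cube k) ` grid n k \<union> {V \<in> sets borel. V \<subseteq> - cube n})"

text \<open>The convention \<open>0\<close> for \<open>\<mu>(V) = 0\<close> is provided by division by zero.\<close>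

definition avg :: "(real^'d) measure \<Rightarrow> (real^'d) set \<Rightarrow> (real^'d \<Rightarrow> real^'d) \<Rightarrow> real^'d" where
  "avg \<mu> V g = (1 / measure \<mu> V) *\<^sub>R (LINT x:V|\<mu>. g x)"

definition scale_avg :: "(real^'d) measure measure \<Rightarrow> nat \<Rightarrow> nat \<Rightarrow>
    ((real^'d) measure \<Rightarrow> real^'d \<Rightarrow> real^'d) \<Rightarrow> (real^'d) measure \<Rightarrow> real^'d \<Rightarrow> real^'d" where
  "scale_avg P n k g \<mu> x =
     (\<chi> i. real_cond_exp (completion P) (scale_alg n k) (\<lambda>\<nu>. avg \<nu> (cube_at k x) (g \<nu>) $ i) \<mu>)"

end

(* Conditionally on its number N of points in the cube and on the configuration outside, the
   Poisson process is N independent uniform points. It then suffices to bound, on a product space,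
   an L2 function u by its partial derivatives, with a constant independent of N; Minkowski's
   inequality in l2 over N recombines the bounds.

   On the product space the coordinates are revealed one at a time and one triadic scale at a
   time, giving orthogonal martingale increments D of u. A one-dimensional integration by parts
   writes <D, u> as the pairing of the derivative with a kernel of size 3^k times D. Up to a part
   of size 1, the distance to the centre of a cell telescopes over the scales j < k, and each
   piece only sees the derivative averaged over the cells of scale j. Bessel's inequality then
   sums the increments without loss.

   The averages over labelled cells of the product space agree with the conditional
   expectations given the counts: averaging an event over all relabellings of the points makes
   it a function of the counts, and points of one cell are exchangeable. *)
theory Submission
  imports Defs "HOL-Combinatorics.Multiset_Permutations"
begin

section \<open>Square-integrable functions\<close>

text \<open>The increments of distinct coordinates and scales are orthogonal, so the squared norm of
  u is a sum of one-dimensional contributions; this is why the number of points never enters the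
  constant. The obstacle is that an increment w at scale k meets the unaveraged derivative through a
  kernel of size 3^k, and estimating that pairing directly would cost 3^n times the full gradient.
  The way out: on a cell of length 3^(k-1), where w does not depend on its own coordinate, the
  kernel applied to w is affine with slope -w. Adding w times the distance to the centre of that
  cell leaves a function invariant within the cells of scale k-1 in every coordinate at once, hence
  one that pairs only with the derivative averaged at that scale. For this the slice integrals of w
  must vanish at every point and not just almost surely; the sigma-algebras are therefore defined by
  pointwise invariance, which allows bad slices to be cut out whole. A second difficulty is the
  gradient of a smooth function: it is a limit over displaced configurations of a function
  measurable only for the completion, so a jointly measurable version has to be built before it can
  be read on the product space.\<close>

definition sqint :: "'a measure => ('a => real) => bool" where
  "sqint M f \<longleftrightarrow> f \<in> borel_measurable M \<and> integrable M (\<lambda>x. (f x)^2)"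

definition nrm2 :: "'a measure => ('a => real) => real" where
  "nrm2 M f = sqrt (\<integral>x. (f x)^2 \<partial>M)"

lemma sqint_measurable [measurable_dest]: "sqint M f ==> f \<in> borel_measurable M"
  by (simp add: sqint_def)

lemma nrm2_nonneg [simp]: "0 \<le> nrm2 M f"
  by (simp add: nrm2_def)

lemma nrm2_sq: "(nrm2 M f)^2 = (\<integral>x. (f x)^2 \<partial>M)"
  by (simp add: nrm2_def)

lemma sqint_mult_integrable:
  assumes "sqint M f" "sqint M g"
  shows "integrable M (\<lambda>x. f x * g x)"
proof (rule Bochner_Integration.integrable_bound)
  show "integrable M (\<lambda>x. (f x)^2 + (g x)^2)" using assms by (simp add: sqint_def)
  have [measurable]: "f \<in> borel_measurable M" "g \<in> borel_measurable M" using assms by (auto simp: sqint_def)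
  show "(\<lambda>x. f x * g x) \<in> borel_measurable M" by measurable
  show "AE x in M. norm (f x * g x) \<le> norm ((f x)^2 + (g x)^2)"
  proof (intro AE_I2)
    fix x
    have "0 \<le> (\<bar>f x\<bar> - \<bar>g x\<bar>)^2 " by simp
    hence "2 * \<bar>f x * g x\<bar> \<le> (f x)^2 + (g x)^2" by (simp add: power2_diff abs_mult)
    thus "norm (f x * g x) \<le> norm ((f x)^2 + (g x)^2)" by simp
  qed
qed

lemma sqint_add: assumes "sqint M f" "sqint M g" shows "sqint M (\<lambda>x. f x + g x)"
proof -
  have [measurable]: "f \<in> borel_measurable M" "g \<in> borel_measurable M" using assms by (auto simp: sqint_def)
  show ?thesis using assms sqint_mult_integrable[OF assms] by (auto simp: sqint_def power2_sum mult.assoc)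
qed

lemma sqint_cmult: assumes "sqint M f" shows "sqint M (\<lambda>x. c * f x)"
proof -
  have [measurable]: "f \<in> borel_measurable M" using assms by (auto simp: sqint_def)
  show ?thesis using assms by (auto simp: sqint_def power_mult_distrib)
qed

lemma sqint_diff: assumes "sqint M f" "sqint M g" shows "sqint M (\<lambda>x. f x - g x)"
  using sqint_add[OF assms(1) sqint_cmult[OF assms(2), of "-1"]] by simp

lemma sqint_zero [simp]: "sqint M (\<lambda>x. 0)"
  by (simp add: sqint_def)

lemma sqint_bounded_mult:
  assumes "sqint M f" "h \<in> borel_measurable M" "\<And>x. x \<in> space M ==> \<bar>h x\<bar> \<le> B"
  shows "sqint M (\<lambda>x. h x * f x)"
proof -
  have [measurable]: "f \<in> borel_measurable M" "h \<in> borel_measurable M" using assms by (auto simp: sqint_def)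
  have int: "integrable M (\<lambda>x. B^2 * (f x)^2)" using assms by (simp add: sqint_def)
  have "integrable M (\<lambda>x. (h x * f x)^2)"
  proof (rule Bochner_Integration.integrable_bound[OF int])
    show "AE x in M. norm ((h x * f x)^2) \<le> norm (B^2 * (f x)^2)"
    proof (rule AE_I2)
      fix x assume "x \<in> space M"
      hence "(h x)^2 \<le> B^2" using assms(3)[of x] by (metis abs_ge_zero order.trans power2_abs power_mono)
      thus "norm ((h x * f x)^2) \<le> norm (B^2 * (f x)^2)" by (simp add: power_mult_distrib mult_right_mono)
    qed
  qed measurable
  thus ?thesis by (simp add: sqint_def)
qed

lemma nrm2_mono_scaled:
  assumes "sqint M f" "g \<in> borel_measurable M" "AE x in M. \<bar>g x\<bar> \<le> B * \<bar>f x\<bar>" "0 \<le> B"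
  shows "sqint M g" "nrm2 M g \<le> B * nrm2 M f"
proof -
  have ae: "AE x in M. (g x)^2 \<le> B^2 * (f x)^2"
    using assms(3)
  proof eventually_elim
    case (elim x)
    hence "\<bar>g x\<bar>^2 \<le> (B * \<bar>f x\<bar>)^2" by (intro power_mono) auto
    thus ?case by (simp add: power_mult_distrib)
  qed
  have int: "integrable M (\<lambda>x. B^2 * (f x)^2)" using assms by (simp add: sqint_def)
  have [measurable]: "g \<in> borel_measurable M" by fact
  have ig: "integrable M (\<lambda>x. (g x)^2)"
  proof (rule Bochner_Integration.integrable_bound[OF int])
    show "AE x in M. norm ((g x)^2) \<le> norm (B^2 * (f x)^2)" using ae by eventually_elim simp
  qed measurable
  thus "sqint M g" using assms by (simp add: sqint_def)
  have "(\<integral>x. (g x)^2 \<partial>M) \<le> (\<integral>x. B^2 * (f x)^2 \<partial>M)" by (rule integral_mono_AE[OF ig int ae])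
  also have "\<dots> = (B * nrm2 M f)^2" by (simp add: power_mult_distrib nrm2_sq)
  finally show "nrm2 M g \<le> B * nrm2 M f" unfolding nrm2_def[of M g]
    by (intro real_le_lsqrt) (use assms in auto)
qed

lemma sqint_AE_cong:
  assumes "sqint M f" "g \<in> borel_measurable M" "AE x in M. f x = g x"
  shows "sqint M g" "nrm2 M g = nrm2 M f"
proof -
  show s: "sqint M g" by (rule nrm2_mono_scaled(1)[OF assms(1,2), of 1]) (use assms(3) in auto)
  show "nrm2 M g = nrm2 M f"
  proof -
    have [measurable]: "f \<in> borel_measurable M" "g \<in> borel_measurable M" using assms by (auto simp: sqint_def)
    have "AE x in M. (g x)^2 = (f x)^2" using assms(3) by eventually_elim simp
    thus ?thesis unfolding nrm2_def by (intro arg_cong[of _ _ sqrt] integral_cong_AE) measurable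
  qed
qed

lemma integral_mult_le_nrm2:
  assumes "sqint M f" "sqint M g"
  shows "\<bar>\<integral>x. f x * g x \<partial>M\<bar> \<le> nrm2 M f * nrm2 M g"
proof -
  define a b c where "a = (\<integral>x. (f x)^2 \<partial>M)" and "b = (\<integral>x. f x * g x \<partial>M)" and "c = (\<integral>x. (g x)^2 \<partial>M)"
  have ge: "0 \<le> a + 2 * t * b + t^2 * c" for t
  proof -
    have "0 \<le> (\<integral>x. (f x + t * g x)^2 \<partial>M)" by simp
    also have "\<dots> = (\<integral>x. (f x)^2 + (2 * t * (f x * g x) + t^2 * (g x)^2) \<partial>M)"
      by (rule Bochner_Integration.integral_cong) (auto simp: power2_eq_square algebra_simps)
    also have "\<dots> = a + (2 * t * b + t^2 * c)"
      using assms sqint_mult_integrable[OF assms] by (simp add: sqint_def a_def b_def c_def)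
    finally show ?thesis by simp
  qed
  have a0: "0 \<le> a" and c0: "0 \<le> c" by (auto simp: a_def c_def)
  have "b^2 \<le> a * c"
  proof (cases "c = 0")
    case True
    have "b = 0"
    proof (rule ccontr)
      assume b: "b \<noteq> 0"
      \<comment> \<open>With \<open>c = 0\<close> the polynomial is affine in t; this t brings it to
        the value -1.\<close>
      have "0 \<le> a + 2 * (- (a + 1) / (2 * b)) * b" using ge[of "- (a + 1) / (2 * b)"] True by simp
      also have "\<dots> = -1" using b by (simp add: field_simps)
      finally show False by simp
    qed
    thus ?thesis using True by simp
  next
    case False
    have "0 \<le> a + 2 * (- b / c) * b + (- b / c)^2 * c" by (rule ge)
    also have "\<dots> = a - b^2 / c" using False by (simp add: field_simps power2_eq_square)
    finally show ?thesis using False c0 by (simp add: field_simps)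
  qed
  hence "sqrt (b^2) \<le> sqrt (a * c)" by (rule real_sqrt_le_mono)
  hence "\<bar>b\<bar> \<le> sqrt a * sqrt c" by (simp only: real_sqrt_abs real_sqrt_mult)
  thus ?thesis unfolding a_def b_def c_def nrm2_def .
qed

lemma nrm2_triangle:
  assumes "sqint M f" "sqint M g"
  shows "nrm2 M (\<lambda>x. f x + g x) \<le> nrm2 M f + nrm2 M g"
proof -
  have "(\<integral>x. (f x + g x)^2 \<partial>M) = (\<integral>x. (f x)^2 + (2 * (f x * g x) + (g x)^2) \<partial>M)"
    by (rule Bochner_Integration.integral_cong) (auto simp: power2_sum)
  also have "\<dots> = (nrm2 M f)^2 + (2 * (\<integral>x. f x * g x \<partial>M) + (nrm2 M g)^2)"
    using assms sqint_mult_integrable[OF assms] by (simp add: sqint_def nrm2_sq)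
  also have "\<dots> \<le> (nrm2 M f + nrm2 M g)^2"
    using integral_mult_le_nrm2[OF assms] by (simp add: power2_sum)
  finally show ?thesis unfolding nrm2_def[of M "\<lambda>x. f x + g x"] by (intro real_le_lsqrt) auto
qed

lemma nrm2_uminus: "nrm2 M (\<lambda>x. - f x) = nrm2 M f"
  by (simp add: nrm2_def)

lemma nrm2_diff_le:
  assumes "sqint M f" "sqint M g"
  shows "nrm2 M (\<lambda>x. f x - g x) \<le> nrm2 M f + nrm2 M g"
  using nrm2_triangle[OF assms(1) sqint_cmult[OF assms(2), of "-1"]] by (simp add: nrm2_uminus)

lemma (in finite_measure) sqint_integrable:
  assumes "sqint M f" shows "integrable M f"
proof -
  have "sqint M (\<lambda>x. 1)" by (simp add: sqint_def)
  from sqint_mult_integrable[OF assms this] show ?thesis by simp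
qed

text \<open>Jensen's inequality for the square gives the contraction. With the last clause the
  conditional expectation can be used as an orthogonal projection in L2.\<close>

lemma (in finite_measure_subalgebra) sqint_cond_exp:
  assumes u: "sqint M u"
  shows "sqint M (real_cond_exp M F u)" "nrm2 M (real_cond_exp M F u) \<le> nrm2 M u"
    "\<And>v. sqint M v ==> v \<in> borel_measurable F ==>
       (\<integral>x. v x * real_cond_exp M F u x \<partial>M) = (\<integral>x. v x * u x \<partial>M)"
proof -
  have iu: "integrable M u" using sqint_integrable u by blast
  have iu2: "integrable M (\<lambda>x. (u x)^2)" using u by (simp add: sqint_def)
  have conv: "convex_on UNIV (\<lambda>x::real. x^2)" by (rule convex_power2)
  have jens: "AE x in M. (real_cond_exp M F u x)^2 \<le> real_cond_exp M F (\<lambda>x. (u x)^2) x"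
    by (rule real_cond_exp_jensens_inequality(2)[OF iu _ _ iu2 conv]) auto
  have [measurable]: "real_cond_exp M F u \<in> borel_measurable M" by simp
  have i2: "integrable M (real_cond_exp M F (\<lambda>x. (u x)^2))" using real_cond_exp_int(1)[OF iu2] .
  have i3: "integrable M (\<lambda>x. (real_cond_exp M F u x)^2)"
  proof (rule Bochner_Integration.integrable_bound[OF i2])
    show "AE x in M. norm ((real_cond_exp M F u x)^2) \<le> norm (real_cond_exp M F (\<lambda>x. (u x)^2) x)"
      using jens by eventually_elim simp
  qed measurable
  thus s: "sqint M (real_cond_exp M F u)" by (simp add: sqint_def)
  have "(\<integral>x. (real_cond_exp M F u x)^2 \<partial>M) \<le> (\<integral>x. real_cond_exp M F (\<lambda>x. (u x)^2) x \<partial>M)"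
    by (rule integral_mono_AE[OF i3 i2 jens])
  also have "\<dots> = (\<integral>x. (u x)^2 \<partial>M)" by (rule real_cond_exp_int(2)[OF iu2])
  finally show "nrm2 M (real_cond_exp M F u) \<le> nrm2 M u" by (simp add: nrm2_def)
  fix v assume v: "sqint M v" "v \<in> borel_measurable F"
  show "(\<integral>x. v x * real_cond_exp M F u x \<partial>M) = (\<integral>x. v x * u x \<partial>M)"
    by (rule real_cond_exp_intg(2)[OF sqint_mult_integrable[OF v(1) u] v(2) sqint_measurable[OF u]])
qed

lemma L2_set_sum_le:
  assumes "finite J"
  shows "L2_set (\<lambda>i. \<Sum>j\<in>J. f j i) A \<le> (\<Sum>j\<in>J. L2_set (f j) A)"
  using assms
proof (induction J)
  case (insert j J)
  show ?case using insert L2_set_triangle_ineq[of "f j" "\<lambda>i. \<Sum>j\<in>J. f j i" A] by simp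
qed (simp add: L2_set_def)

section \<open>Triadic cells of the line\<close>

text \<open>Half-integer multiples of 3^j, because the cells, like the cubes, are centred at the
  points of the lattice 3^j Z.\<close>

definition wall :: "nat => int => real" where
  "wall j m = 3 ^ j * (of_int m + 1 / 2)"

text \<open>Level \<open>Suc j\<close> is the partition into open intervals of length \<open>3 ^ j\<close> and single
  walls; level \<open>0\<close> is the partition into points.\<close>

definition sim :: "nat => real => real => bool" where
  "sim k s t = (case k of 0 => s = t | Suc j => \<forall>m. sgn (s - wall j m) = sgn (t - wall j m))"

text \<open>The lattice point of 3^j Z nearest to t, that is, the centre of its cell. The floor
  makes it total: a wall is assigned to the cell on its right.\<close>

definition ctr :: "nat => real => real" where
  "ctr j t = 3 ^ j * of_int \<lfloor>t / 3 ^ j + 1 / 2\<rfloor>"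

definition interval3 :: "nat => real set" where
  "interval3 n = {- (3 ^ n / 2)<..<3 ^ n / 2}"

lemma sim_0 [simp]: "sim 0 s t \<longleftrightarrow> s = t"
  by (simp add: sim_def)

lemma sim_Suc: "sim (Suc j) s t \<longleftrightarrow> (\<forall>m. sgn (s - wall j m) = sgn (t - wall j m))"
  by (simp add: sim_def)

lemma sim_refl [simp]: "sim k s s"
  by (simp add: sim_def split: nat.split)

lemma sim_sym: "sim k s t \<longleftrightarrow> sim k t s"
  by (auto simp: sim_def split: nat.split)

lemma sim_trans: "sim k s t ==> sim k t r ==> sim k s r"
  by (auto simp: sim_def split: nat.splits)

text \<open>Since 3 is odd, 3 (m + 1/2) = (3 m + 1) + 1/2: every coarse wall is also a fine wall, so
  the centred triadic partitions are nested.\<close>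

lemma wall_Suc: "wall (Suc j) m = wall j (3 * m + 1)"
  by (simp add: wall_def algebra_simps)

lemma sim_Suc_mono: "sim k s t ==> sim (Suc k) s t"
  by (cases k) (auto simp: sim_Suc wall_Suc)

lemma sim_mono: "j \<le> k ==> sim j s t ==> sim k s t"
  by (induction rule: dec_induct) (auto intro: sim_Suc_mono)

lemma floor_wall_iff: "of_int m \<le> t / 3 ^ j + 1 / 2 \<longleftrightarrow> wall j (m - 1) \<le> t"
  by (simp add: wall_def field_simps)

lemma sgn_eq_ge_iff: "sgn (s - w) = sgn (t - w) ==> w \<le> s \<longleftrightarrow> w \<le> (t::real)"
  by (auto simp: sgn_if split: if_splits)

text \<open>The floor in \<open>ctr\<close> asks only which walls lie at or below the point, and the
  signs in \<open>sim\<close> record exactly that.\<close>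

lemma sim_ctr: assumes "sim (Suc j) s t" shows "ctr j s = ctr j t"
proof -
  have "of_int m \<le> s / 3 ^ j + 1 / 2 \<longleftrightarrow> of_int m \<le> t / 3 ^ j + 1 / 2" for m
    using assms sgn_eq_ge_iff unfolding floor_wall_iff sim_Suc by blast
  hence "m \<le> \<lfloor>s / 3 ^ j + 1 / 2\<rfloor> \<longleftrightarrow> m \<le> \<lfloor>t / 3 ^ j + 1 / 2\<rfloor>" for m
    by (simp add: le_floor_iff)
  hence "\<lfloor>s / 3 ^ j + 1 / 2\<rfloor> = \<lfloor>t / 3 ^ j + 1 / 2\<rfloor>" by (meson order_antisym order_refl)
  thus ?thesis by (simp add: ctr_def)
qed

lemma ctr_le: "ctr j t - 3 ^ j / 2 \<le> t" and less_ctr: "t < ctr j t + 3 ^ j / 2"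
proof -
  define m where "m = \<lfloor>t / 3 ^ j + 1 / 2\<rfloor>"
  have c: "ctr j t = 3 ^ j * of_int m" by (simp add: ctr_def m_def)
  have e: "3 ^ j * (t / 3 ^ j + 1 / 2) = t + 3 ^ j / 2" by (simp add: distrib_left)
  have "of_int m \<le> t / 3 ^ j + 1 / 2" by (simp add: m_def)
  hence "3 ^ j * of_int m \<le> 3 ^ j * (t / 3 ^ j + 1 / 2)" by (intro mult_left_mono) auto
  thus "ctr j t - 3 ^ j / 2 \<le> t" unfolding c e by simp
  have "t / 3 ^ j + 1 / 2 < of_int m + 1" unfolding m_def by linarith
  hence "3 ^ j * (t / 3 ^ j + 1 / 2) < 3 ^ j * (of_int m + 1)" by (intro mult_strict_left_mono) auto
  thus "t < ctr j t + 3 ^ j / 2" unfolding c e by (simp add: distrib_left)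
qed

lemma ctr_dist: "\<bar>t - ctr j t\<bar> \<le> 3 ^ j / 2"
  using ctr_le[of j t] less_ctr[of t j] by linarith

text \<open>Both centres are within half a cell of t, and 3^j/2 + 3^(j+1)/2 = 2 * 3^j.\<close>

lemma ctr_dist_Suc: "\<bar>ctr j t - ctr (Suc j) t\<bar> \<le> 2 * 3 ^ j"
  using ctr_dist[of t j] ctr_dist[of t "Suc j"] by (simp add: abs_if split: if_splits)

lemma wall_ctr: "ctr j t - 3 ^ j / 2 = wall j (\<lfloor>t / 3 ^ j + 1 / 2\<rfloor> - 1)"
    "ctr j t + 3 ^ j / 2 = wall j \<lfloor>t / 3 ^ j + 1 / 2\<rfloor>"
  by (simp_all add: ctr_def wall_def algebra_simps)

lemma wall_less_iff: "wall j m < wall j m' \<longleftrightarrow> m < m'"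
  by (simp add: wall_def)

text \<open>By monotonicity the two walls next to \<open>s\<close> decide the signs at all the
  others. A wall is excluded because its class is a single point.\<close>

lemma sim_iff_cell:
  assumes nw: "s \<notin> range (wall j)"
  shows "sim (Suc j) s t \<longleftrightarrow> t \<in> {ctr j s - 3 ^ j / 2<..<ctr j s + 3 ^ j / 2}"
proof -
  let ?m = "\<lfloor>s / 3 ^ j + 1 / 2\<rfloor>"
  have s: "wall j (?m - 1) < s" "s < wall j ?m"
    using ctr_le[of j s] less_ctr[of s j] nw unfolding wall_ctr by (metis order_le_less rangeI)+
  show ?thesis unfolding wall_ctr
  proof
    assume "sim (Suc j) s t"
    hence "sgn (s - wall j (?m - 1)) = sgn (t - wall j (?m - 1))" "sgn (s - wall j ?m) = sgn (t - wall j ?m)"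
      by (auto simp: sim_Suc)
    with s show "t \<in> {wall j (?m - 1)<..<wall j ?m}" by (auto simp: sgn_if split: if_splits)
  next
    assume t: "t \<in> {wall j (?m - 1)<..<wall j ?m}"
    show "sim (Suc j) s t" unfolding sim_Suc
    proof
      fix m
      show "sgn (s - wall j m) = sgn (t - wall j m)"
      proof (cases "m \<le> ?m - 1")
        case True
        hence "wall j m \<le> wall j (?m - 1)" using wall_less_iff[of j] by (meson not_le)
        thus ?thesis using s t by (auto simp: sgn_if)
      next
        case False
        hence "wall j ?m \<le> wall j m" using wall_less_iff[of j] by (meson not_le zle_diff1_eq)
        thus ?thesis using s t by (auto simp: sgn_if)
      qed
    qed
  qed
qed

text \<open>Convexity of the classes: in \<open>kap_slice_diff\<close> it keeps an increment
  constant along the segment between two points of a cell.\<close>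

lemma sim_between:
  assumes "sim (Suc j) s t" "s \<le> r" "r \<le> t" shows "sim (Suc j) s r"
  unfolding sim_Suc
proof
  fix m
  have "sgn (s - wall j m) = sgn (t - wall j m)" using assms(1) by (simp add: sim_Suc)
  thus "sgn (s - wall j m) = sgn (r - wall j m)" using assms(2,3) by (auto simp: sgn_if split: if_splits)
qed

lemma interval3_walls: "interval3 n = {wall n (- 1)<..<wall n 0}"
  by (simp add: interval3_def wall_def)

text \<open>Both endpoints of the interval are walls of scale n, so no class of level at most
  \<open>Suc n\<close> crosses them: a coordinate moved within its cell never leaves the
  window.\<close>

lemma sim_interval3:
  assumes "k \<le> Suc n" "sim k s t" shows "s \<in> interval3 n \<longleftrightarrow> t \<in> interval3 n"
proof -
  have "sim (Suc n) s t" using sim_mono assms by blast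
  hence "sgn (s - wall n (- 1)) = sgn (t - wall n (- 1))" "sgn (s - wall n 0) = sgn (t - wall n 0)"
    by (simp_all add: sim_Suc)
  thus ?thesis by (auto simp: interval3_walls sgn_if split: if_splits)
qed

lemma measurable_ctr [measurable]: "ctr j \<in> borel_measurable borel"
  unfolding ctr_def by measurable

lemma measurable_sim [measurable]:
  assumes [measurable]: "f \<in> borel_measurable M" "g \<in> borel_measurable M"
  shows "Measurable.pred M (\<lambda>x. sim k (f x) (g x))"
proof (cases k)
  case 0
  show ?thesis unfolding 0 sim_0 by measurable
next
  case (Suc j)
  show ?thesis unfolding Suc sim_Suc by measurable
qed

lemma AE_nonwall: "AE t in lborel. t \<notin> range (wall j)"
  using AE_not_in[of "range (wall j)" lborel] countable_imp_null_set_lborel[of "range (wall j)"] by simp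

lemma interval3_measurable [measurable]: "interval3 n \<in> sets borel"
  by (simp add: interval3_def)

lemma emeasure_interval3: "emeasure lborel (interval3 n) = 3 ^ n"
  unfolding interval3_def by (simp add: ennreal_power[symmetric] del: ennreal_power)

section \<open>The one-dimensional mean value kernel\<close>

text \<open>With a the left end of the cell of r, this is (r - a)/3^j minus the indicator of s < r:
  the kernel that expresses a function minus its cell mean through its derivative. The first
  argument is the point where the derivative is taken.\<close>

definition kap :: "nat => real => real => real" where
  "kap j r s = (if sim (Suc j) r s then (r - ctr j r) / 3 ^ j + 1 / 2 - (if s < r then 1 else 0) else 0)"

lemma kap_bound: "\<bar>kap j r s\<bar> \<le> (if sim (Suc j) r s then 1 else 0)"
proof -
  have "\<bar>(r - ctr j r) / 3 ^ j\<bar> \<le> 1 / 2" using ctr_dist[of r j] by (simp add: abs_divide field_simps)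
  thus ?thesis by (simp only: kap_def abs_le_iff split: if_split) linarith
qed

lemma measurable_kap [measurable]:
  assumes [measurable]: "f \<in> borel_measurable M" "g \<in> borel_measurable M"
  shows "(\<lambda>x. kap j (f x) (g x)) \<in> borel_measurable M"
  unfolding kap_def by measurable

text \<open>Average \<phi> s - \<phi> t over t and write each difference as an integral of \<psi>.
  Fubini then collects, as the weight of \<psi> r, the signed length of the set of those t which r
  separates from s.\<close>

lemma mean_value_kernel:
  fixes \<phi> \<psi> :: "real => real"
  assumes ab: "a < b" and s: "s \<in> {a<..<b}"
    and der: "\<And>t. t \<in> {a<..<b} ==> (\<phi> has_real_derivative \<psi> t) (at t)"
    and cont: "continuous_on {a<..<b} \<psi>"
    and i1: "set_integrable lborel {a<..<b} \<phi>" and i2: "set_integrable lborel {a<..<b} \<psi>"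
  shows "\<phi> s - (LBINT t:{a<..<b}. \<phi> t) / (b - a) =
     (LBINT r:{a<..<b}. ((r - a) / (b - a) - (if s < r then 1 else 0)) * \<psi> r)"
proof -
  define g where "g = (\<lambda>r. indicator {a<..<b} r * \<psi> r)"
  have ig: "integrable lborel g" using i2 by (simp add: g_def set_integrable_def)
  have [measurable]: "g \<in> borel_measurable borel" using borel_measurable_integrable[OF ig] by simp
  \<comment> \<open>Signed indicator that r lies between t and s; the sign treats t < s and s < t at
    once.\<close>
  define D where "D = (\<lambda>t r. (if t \<le> r \<and> r \<le> s then 1 else 0) - (if s \<le> r \<and> r \<le> t then 1 else 0 :: real))"
  define h where "h = (\<lambda>(t, r). indicator {a<..<b} t * (D t r * g r))"
  have [measurable]: "h \<in> borel_measurable (lborel \<Otimes>\<^sub>M lborel)" unfolding h_def D_def by measurable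
  have FTC: "(\<integral>r. (if x \<le> r \<and> r \<le> y then 1 else 0) * g r \<partial>lborel) = \<phi> y - \<phi> x"
    if "x \<in> {a<..<b}" "y \<in> {a<..<b}" "x \<le> y" for x y
  proof -
    have sub: "{x..y} \<subseteq> {a<..<b}" using that by auto
    have "(\<integral>r. \<psi> r * indicator {x..y} r \<partial>lborel) = \<phi> y - \<phi> x"
      by (rule integral_FTC_Icc_real[OF that(3)])
        (use sub der cont in \<open>auto intro!: has_field_derivative_at_within continuous_on_subset[OF cont, THEN continuous_on_interior]
          simp: subset_iff continuous_on_eq_continuous_at\<close>)
    also have "(\<integral>r. \<psi> r * indicator {x..y} r \<partial>lborel) = (\<integral>r. (if x \<le> r \<and> r \<le> y then 1 else 0) * g r \<partial>lborel)"
      by (rule Bochner_Integration.integral_cong) (use sub in \<open>auto simp: g_def indicator_def\<close>)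
    finally show ?thesis .
  qed
  have intc: "integrable lborel (\<lambda>r. (if x \<le> r \<and> r \<le> y then 1 else 0) * g r)" for x y
    by (rule Bochner_Integration.integrable_bound[OF ig]) auto
  have inner: "(\<integral>r. h (t, r) \<partial>lborel) = indicator {a<..<b} t * (\<phi> s - \<phi> t)" for t
  proof (cases "t \<in> {a<..<b}")
    case True
    have "(\<integral>r. h (t, r) \<partial>lborel) = (\<integral>r. (if t \<le> r \<and> r \<le> s then 1 else 0) * g r - (if s \<le> r \<and> r \<le> t then 1 else 0) * g r \<partial>lborel)"
      using True by (intro Bochner_Integration.integral_cong) (auto simp: h_def D_def)
    also have "\<dots> = (\<integral>r. (if t \<le> r \<and> r \<le> s then 1 else 0) * g r \<partial>lborel) - (\<integral>r. (if s \<le> r \<and> r \<le> t then 1 else 0) * g r \<partial>lborel)"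
      by (rule Bochner_Integration.integral_diff[OF intc intc])
    also have "\<dots> = \<phi> s - \<phi> t"
    proof (cases t s rule: linorder_cases)
      case less
      hence "(\<lambda>r. (if s \<le> r \<and> r \<le> t then 1 else 0) * g r) = (\<lambda>r. 0)" by (auto simp: fun_eq_iff)
      thus ?thesis using FTC[of t s] True s less by simp
    next
      case greater
      hence "(\<lambda>r. (if t \<le> r \<and> r \<le> s then 1 else 0) * g r) = (\<lambda>r. 0)" by (auto simp: fun_eq_iff)
      thus ?thesis using FTC[of s t] True s greater by simp
    qed simp
    finally show ?thesis using True by simp
  qed (simp add: h_def)
  \<comment> \<open>Dominates \<open>h\<close>, since \<open>D\<close> takes values in {-1, 0, 1};
    its integrability on the product is what Fubini requires.\<close>
  define q :: "real \<times> real => real" where "q = (\<lambda>(t, r). indicator {a<..<b} t * g r)"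
  have "integrable (lborel \<Otimes>\<^sub>M lborel) q"
  proof (rule lborel_pair.Fubini_integrable)
    have "integrable lborel (\<lambda>t. indicator {a<..<b} t * (\<integral>r. norm (g r) \<partial>lborel) :: real)"
      using ab by (intro integrable_mult_left integrable_real_indicator) auto
    thus "integrable lborel (\<lambda>t. \<integral>r. norm (q (t, r)) \<partial>lborel)"
      by (simp add: q_def abs_mult)
    show "AE t in lborel. integrable lborel (\<lambda>r. q (t, r))"
      using ig by (simp add: q_def)
    show "q \<in> borel_measurable (lborel \<Otimes>\<^sub>M lborel)" unfolding q_def by measurable
  qed
  hence ih: "integrable (lborel \<Otimes>\<^sub>M lborel) h"
    by (rule Bochner_Integration.integrable_bound) (auto simp: q_def h_def D_def abs_mult indicator_def)
  have "(\<integral>t. indicator {a<..<b} t * (\<phi> s - \<phi> t) \<partial>lborel) = (\<integral>t. \<integral>r. h (t, r) \<partial>lborel \<partial>lborel)"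
    by (simp add: inner)
  also have "\<dots> = (\<integral>r. \<integral>t. h (t, r) \<partial>lborel \<partial>lborel)"
    using lborel_pair.Fubini_integral[of "\<lambda>t r. h (t, r)"] ih by simp
  also have "\<dots> = (\<integral>r. ((r - a) - (if s < r then b - a else 0)) * g r \<partial>lborel)"
  proof (rule integral_cong_AE)
    show "AE r in lborel. (\<integral>t. h (t, r) \<partial>lborel) = ((r - a) - (if s < r then b - a else 0)) * g r"
      \<comment> \<open>At r = s both halves of \<open>D\<close> are active and the formula fails,
        but this is a single point.\<close>
      using AE_lborel_singleton[of s]
    proof eventually_elim
      case (elim r)
      show ?case
      proof (cases "r \<in> {a<..<b}")
        case True
        have "(\<integral>t. h (t, r) \<partial>lborel) = (\<integral>t. (if r < s then indicator {a<..r} t else - indicator {r..<b} t) * g r \<partial>lborel)"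
          using True elim s by (intro Bochner_Integration.integral_cong) (auto simp: h_def D_def indicator_def)
        also have "\<dots> = ((r - a) - (if s < r then b - a else 0)) * g r"
          using True elim by (cases "r < s") (auto simp: algebra_simps)
        finally show ?thesis .
      qed (simp add: h_def g_def)
    qed
  qed measurable
  finally have eq: "(\<integral>t. indicator {a<..<b} t * (\<phi> s - \<phi> t) \<partial>lborel) = (\<integral>r. ((r - a) - (if s < r then b - a else 0)) * g r \<partial>lborel)" .
  have "(\<integral>t. indicator {a<..<b} t * (\<phi> s - \<phi> t) \<partial>lborel) = (\<integral>t. indicator {a<..<b} t * \<phi> s - indicator {a<..<b} t * \<phi> t \<partial>lborel)"
    by (simp add: right_diff_distrib)
  also have "\<dots> = (b - a) * \<phi> s - (LBINT t:{a<..<b}. \<phi> t)"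
    using i1 ab by (subst Bochner_Integration.integral_diff) (auto simp: set_integrable_def set_lebesgue_integral_def)
  finally have "\<phi> s - (LBINT t:{a<..<b}. \<phi> t) / (b - a) = (\<integral>r. ((r - a) - (if s < r then b - a else 0)) * g r \<partial>lborel) / (b - a)"
    using ab eq by (simp add: field_simps)
  also have "\<dots> = (\<integral>r. ((r - a) - (if s < r then b - a else 0)) * g r / (b - a) \<partial>lborel)"
    by simp
  also have "\<dots> = (LBINT r:{a<..<b}. ((r - a) / (b - a) - (if s < r then 1 else 0)) * \<psi> r)"
    unfolding set_lebesgue_integral_def
    by (rule Bochner_Integration.integral_cong) (use ab in \<open>auto simp: g_def field_simps\<close>)
  finally show ?thesis .
qed

section \<open>Probability spaces with resampled coordinates\<close>

definition unif3 :: "nat => real measure" where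
  "unif3 n = density lborel (\<lambda>t. ennreal (indicator (interval3 n) t / 3 ^ n))"

lemma sets_unif3 [measurable_cong, simp]: "sets (unif3 n) = sets borel"
  by (simp add: unif3_def)

lemma space_unif3 [simp]: "space (unif3 n) = UNIV"
  by (simp add: unif3_def)

lemma prob_space_unif3: "prob_space (unif3 n)"
proof
  have "emeasure (unif3 n) (space (unif3 n)) = (\<integral>\<^sup>+t. ennreal (1 / 3 ^ n) * indicator (interval3 n) t \<partial>lborel)"
    unfolding unif3_def by (subst emeasure_density) (auto intro!: nn_integral_cong simp: indicator_def)
  also have "\<dots> = ennreal (1 / 3 ^ n) * ennreal (3 ^ n)"
    by (subst nn_integral_cmult_indicator) (auto simp: emeasure_interval3 ennreal_power[symmetric] simp del: ennreal_power)
  also have "\<dots> = 1" by (subst ennreal_mult[symmetric]) auto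
  finally show "emeasure (unif3 n) (space (unif3 n)) = 1" .
qed

lemma nn_integral_unif3:
  assumes [measurable]: "f \<in> borel_measurable borel"
  shows "(\<integral>\<^sup>+t. f t \<partial>unif3 n) = ennreal (1 / 3 ^ n) * (\<integral>\<^sup>+t. indicator (interval3 n) t * f t \<partial>lborel)"
proof -
  have "(\<integral>\<^sup>+t. f t \<partial>unif3 n) = (\<integral>\<^sup>+t. ennreal (1 / 3 ^ n) * (indicator (interval3 n) t * f t) \<partial>lborel)"
    unfolding unif3_def by (subst nn_integral_density) (auto intro!: nn_integral_cong simp: indicator_def)
  also have "\<dots> = ennreal (1 / 3 ^ n) * (\<integral>\<^sup>+t. indicator (interval3 n) t * f t \<partial>lborel)"
    by (rule nn_integral_cmult) simp
  finally show ?thesis .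
qed

lemma AE_unif3:
  assumes "AE t in lborel. P t" shows "AE t in unif3 n. P t \<and> t \<in> interval3 n"
  unfolding unif3_def using assms by (subst AE_density) (auto elim!: eventually_mono split: split_indicator)

text \<open>Polymorphic in the target, so that one indicator serves both Bochner integrals and
  integrals in the extended nonnegative reals.\<close>

abbreviation sind :: "nat => real => real => 'z::zero_neq_one" where
  "sind k s t \<equiv> (if sim k s t then 1 else 0)"

lemma emeasure_cell:
  assumes "s \<notin> range (wall j)" shows "(\<integral>\<^sup>+t. sind (Suc j) s t \<partial>lborel) = 3 ^ j"
proof -
  have "(\<integral>\<^sup>+t. sind (Suc j) s t \<partial>lborel) = (\<integral>\<^sup>+t. indicator {ctr j s - 3 ^ j / 2<..<ctr j s + 3 ^ j / 2} t \<partial>lborel)"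
    using sim_iff_cell[OF assms] by (intro nn_integral_cong) (simp add: indicator_def)
  also have "\<dots> = ennreal (3 ^ j)" by simp
  finally show ?thesis by (simp add: ennreal_power[symmetric] del: ennreal_power)
qed

text \<open>What one-coordinate arguments use of a product space: a coordinate can be replaced, and
  \<open>resample\<close> says that it is uniform and independent of the rest. Nothing else about
  the form of the space is fixed, so the configuration outside the window can be carried along as an
  inert component.\<close>

locale resample_space =
  fixes M :: "'a measure" and K :: "'k set" and X :: "'k => 'a => real"
    and upd :: "'k => 'a => real => 'a" and n :: nat
  assumes prob: "prob_space M" and finK: "finite K"
    and X_meas [measurable]: "m \<in> K ==> X m \<in> borel_measurable M"
    and upd_meas: "m \<in> K ==> (\<lambda>(\<xi>, t). upd m \<xi> t) \<in> M \<Otimes>\<^sub>M borel \<rightarrow>\<^sub>M M"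
    and X_upd: "m \<in> K ==> \<xi> \<in> space M ==> X m (upd m \<xi> t) = t"
    and X_upd_other: "m \<in> K ==> m' \<in> K ==> m' \<noteq> m ==> \<xi> \<in> space M ==> X m' (upd m \<xi> t) = X m' \<xi>"
    and upd_X: "m \<in> K ==> \<xi> \<in> space M ==> upd m \<xi> (X m \<xi>) = \<xi>"
    and upd_upd: "m \<in> K ==> \<xi> \<in> space M ==> upd m (upd m \<xi> s) t = upd m \<xi> t"
    and upd_comm: "m \<in> K ==> m' \<in> K ==> m' \<noteq> m ==> \<xi> \<in> space M ==>
      upd m' (upd m \<xi> s) t = upd m (upd m' \<xi> t) s"
    and resample: "m \<in> K ==> h \<in> borel_measurable M ==>
      (\<integral>\<^sup>+\<xi>. h \<xi> \<partial>M) = (\<integral>\<^sup>+\<xi>. \<integral>\<^sup>+t. h (upd m \<xi> t) \<partial>unif3 n \<partial>M)"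
begin

sublocale prob_space M by (rule prob)

lemma upd_measurable [measurable (raw)]:
  assumes "m \<in> K" and [measurable]: "f \<in> N \<rightarrow>\<^sub>M M" "g \<in> borel_measurable N"
  shows "(\<lambda>x. upd m (f x) (g x)) \<in> N \<rightarrow>\<^sub>M M"
  using measurable_compose[OF measurable_Pair[OF assms(2,3)] upd_meas[OF assms(1)]] by simp

lemma X_measurable [measurable (raw)]:
  assumes "m \<in> K" and [measurable]: "f \<in> N \<rightarrow>\<^sub>M M"
  shows "(\<lambda>x. X m (f x)) \<in> borel_measurable N"
  using measurable_compose[OF assms(2) X_meas[OF assms(1)]] by simp

lemma upd_space: "m \<in> K ==> \<xi> \<in> space M ==> upd m \<xi> t \<in> space M"
  using measurable_space[OF upd_meas[of m], of "(\<xi>, t)"] by (simp add: space_pair_measure)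

text \<open>The identity \<open>resample\<close> applied to the indicator of a null set: almost
  every slice meets that set in a null set.\<close>

lemma AE_resample:
  assumes m [simp]: "m \<in> K" and ae: "AE \<xi> in M. P \<xi>"
  shows "AE \<xi> in M. AE t in unif3 n. P (upd m \<xi> t)"
proof -
  from ae obtain N where N: "N \<in> null_sets M" "{\<xi>\<in>space M. \<not> P \<xi>} \<subseteq> N" by (auto simp: eventually_ae_filter)
  have [measurable]: "N \<in> sets M" using N by auto
  interpret U: prob_space "unif3 n" by (rule prob_space_unif3)
  have "(\<integral>\<^sup>+\<xi>. \<integral>\<^sup>+t. indicator N (upd m \<xi> t) \<partial>unif3 n \<partial>M) = (\<integral>\<^sup>+\<xi>. indicator N \<xi> \<partial>M)"
    by (rule resample[symmetric]) simp_all
  also have "\<dots> = 0" using N by auto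
  finally have "AE \<xi> in M. (\<integral>\<^sup>+t. indicator N (upd m \<xi> t) \<partial>unif3 n) = (0::ennreal)"
    by (subst (asm) nn_integral_0_iff_AE) measurable
  from this AE_space show ?thesis
  proof eventually_elim
    case (elim \<xi>)
    hence w [measurable]: "\<xi> \<in> space M" and z: "(\<integral>\<^sup>+t. indicator N (upd m \<xi> t) \<partial>unif3 n) = (0::ennreal)" by auto
    have "AE t in unif3 n. indicator N (upd m \<xi> t) = (0::ennreal)"
      using z by (subst (asm) nn_integral_0_iff_AE) measurable
    thus ?case
      by (rule eventually_mono) (use N(2) upd_space[OF m w] in \<open>auto simp: indicator_def split: if_splits\<close>)
  qed
qed

lemma AE_X:
  assumes m [simp]: "m \<in> K" and ae: "AE t in lborel. Q t" and [measurable]: "Measurable.pred borel Q"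
  shows "AE \<xi> in M. Q (X m \<xi>) \<and> X m \<xi> \<in> interval3 n"
proof -
  interpret U: prob_space "unif3 n" by (rule prob_space_unif3)
  define N where "N = {\<xi>\<in>space M. \<not> (Q (X m \<xi>) \<and> X m \<xi> \<in> interval3 n)}"
  have [measurable]: "N \<in> sets M" unfolding N_def by measurable
  have z: "(\<integral>\<^sup>+t. indicator N (upd m \<xi> t) \<partial>unif3 n) = (0::ennreal)" if [measurable]: "\<xi> \<in> space M" for \<xi>
  proof (subst nn_integral_0_iff_AE)
    show "AE t in unif3 n. indicator N (upd m \<xi> t) = (0::ennreal)"
      using AE_unif3[OF ae, of n] by eventually_elim (auto simp: N_def X_upd that indicator_def)
  qed measurable
  have "(\<integral>\<^sup>+\<xi>. indicator N \<xi> \<partial>M) = (\<integral>\<^sup>+\<xi>. \<integral>\<^sup>+t. indicator N (upd m \<xi> t) \<partial>unif3 n \<partial>M)"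
    by (rule resample) simp_all
  also have "\<dots> = (\<integral>\<^sup>+\<xi>. 0 \<partial>M)" by (rule nn_integral_cong) (simp add: z)
  finally have "emeasure M N = 0" by simp
  thus ?thesis by (intro AE_I[of _ _ N]) (auto simp: N_def)
qed

lemma AE_X_generic:
  assumes "m \<in> K" shows "AE \<xi> in M. X m \<xi> \<notin> range (wall j) \<and> X m \<xi> \<in> interval3 n"
proof (rule AE_X[OF assms AE_nonwall])
  have [measurable]: "range (wall j) \<in> sets borel" by (simp add: sets.countable)
  show "Measurable.pred borel (\<lambda>t. t \<notin> range (wall j))" by measurable
qed

text \<open>Resampling replaces the current coordinate by an independent uniform variable, on the
  same footing as t. Fubini exchanges the two, and resampling backwards removes the auxiliary
  one.\<close>

lemma swap_nn_unif:
  assumes m [simp]: "m \<in> K" and [measurable]: "case_prod h \<in> borel_measurable (M \<Otimes>\<^sub>M borel)"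
  shows "(\<integral>\<^sup>+\<xi>. \<integral>\<^sup>+t. h \<xi> t \<partial>unif3 n \<partial>M) = (\<integral>\<^sup>+\<xi>. \<integral>\<^sup>+t. h (upd m \<xi> t) (X m \<xi>) \<partial>unif3 n \<partial>M)"
proof -
  interpret U: prob_space "unif3 n" by (rule prob_space_unif3)
  interpret UU: pair_sigma_finite "unif3 n" "unif3 n" ..
  have "(\<integral>\<^sup>+\<xi>. \<integral>\<^sup>+t. h \<xi> t \<partial>unif3 n \<partial>M) = (\<integral>\<^sup>+\<xi>. \<integral>\<^sup>+s. \<integral>\<^sup>+t. h (upd m \<xi> s) t \<partial>unif3 n \<partial>unif3 n \<partial>M)"
    by (rule resample) measurable
  also have "\<dots> = (\<integral>\<^sup>+\<xi>. \<integral>\<^sup>+s. \<integral>\<^sup>+t. h (upd m \<xi> t) s \<partial>unif3 n \<partial>unif3 n \<partial>M)"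
    by (intro nn_integral_cong UU.Fubini') measurable
  also have "\<dots> = (\<integral>\<^sup>+\<xi>. \<integral>\<^sup>+s. \<integral>\<^sup>+t. h (upd m (upd m \<xi> s) t) (X m (upd m \<xi> s)) \<partial>unif3 n \<partial>unif3 n \<partial>M)"
    by (intro nn_integral_cong) (simp add: upd_upd X_upd)
  also have "\<dots> = (\<integral>\<^sup>+\<xi>. \<integral>\<^sup>+t. h (upd m \<xi> t) (X m \<xi>) \<partial>unif3 n \<partial>M)"
    by (rule resample[symmetric]) measurable
  finally show ?thesis .
qed

text \<open>Pairs consisting of a point and a value for its \<open>m\<close>-th coordinate in the same cell. Exchanging
  that value with the current coordinate preserves this measure; the transposition identities
  come from this symmetry.\<close>

definition pairs :: "nat => 'k => ('a \<times> real) measure" where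
  "pairs j m = density (M \<Otimes>\<^sub>M lborel) (\<lambda>(\<xi>, t). sind (Suc j) (X m \<xi>) t)"

definition swp :: "'k => 'a \<times> real => 'a \<times> real" where
  "swp m = (\<lambda>(\<xi>, t). (upd m \<xi> t, X m \<xi>))"

lemma sets_pairs [measurable_cong, simp]: "sets (pairs j m) = sets (M \<Otimes>\<^sub>M borel)"
  by (simp add: pairs_def cong: sets_pair_measure_cong)

lemma space_pairs: "space (pairs j m) = space M \<times> UNIV"
  by (simp add: pairs_def space_pair_measure)

lemma nn_integral_pairs:
  assumes m [simp]: "m \<in> K" and [measurable]: "h \<in> borel_measurable (M \<Otimes>\<^sub>M borel)"
  shows "(\<integral>\<^sup>+p. h p \<partial>pairs j m) = (\<integral>\<^sup>+\<xi>. \<integral>\<^sup>+t. sind (Suc j) (X m \<xi>) t * h (\<xi>, t) \<partial>lborel \<partial>M)"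
proof -
  have h [measurable]: "h \<in> borel_measurable (M \<Otimes>\<^sub>M lborel)" by measurable
  have "(\<integral>\<^sup>+p. h p \<partial>pairs j m) = (\<integral>\<^sup>+p. sind (Suc j) (X m (fst p)) (snd p) * h p \<partial>(M \<Otimes>\<^sub>M lborel))"
    unfolding pairs_def by (subst nn_integral_density) (simp_all add: split_def)
  also have "\<dots> = (\<integral>\<^sup>+\<xi>. \<integral>\<^sup>+t. sind (Suc j) (X m \<xi>) t * h (\<xi>, t) \<partial>lborel \<partial>M)"
    by (subst lborel.nn_integral_fst[symmetric]) simp_all
  finally show ?thesis .
qed

text \<open>A cell of scale at most n that meets the interval lies inside it, and there the uniform
  law is Lebesgue measure divided by 3^n.\<close>

lemma nn_integral_cell_unif:
  assumes "j \<le> n" "s \<in> interval3 n" and [measurable]: "f \<in> borel_measurable borel"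
  shows "(\<integral>\<^sup>+t. sind (Suc j) s t * f t \<partial>lborel) = 3 ^ n * (\<integral>\<^sup>+t. sind (Suc j) s t * f t \<partial>unif3 n)"
proof -
  have "(\<integral>\<^sup>+t. sind (Suc j) s t * f t \<partial>unif3 n) =
      ennreal (1 / 3 ^ n) * (\<integral>\<^sup>+t. indicator (interval3 n) t * (sind (Suc j) s t * f t) \<partial>lborel)"
    by (rule nn_integral_unif3) simp
  also have "(\<integral>\<^sup>+t. indicator (interval3 n) t * (sind (Suc j) s t * f t) \<partial>lborel) = (\<integral>\<^sup>+t. sind (Suc j) s t * f t \<partial>lborel)"
    using sim_interval3[of "Suc j" n s] assms by (intro nn_integral_cong) (auto simp: indicator_def)
  finally have "3 ^ n * (\<integral>\<^sup>+t. sind (Suc j) s t * f t \<partial>unif3 n) =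
      (ennreal (3 ^ n) * ennreal (1 / 3 ^ n)) * (\<integral>\<^sup>+t. sind (Suc j) s t * f t \<partial>lborel)"
    by (simp add: mult.assoc ennreal_power[symmetric] del: ennreal_power)
  also have "ennreal (3 ^ n) * ennreal (1 / 3 ^ n) = 1" by (subst ennreal_mult[symmetric]) auto
  finally show ?thesis by simp
qed

lemma swp_measurable [measurable]: "m \<in> K ==> swp m \<in> M \<Otimes>\<^sub>M borel \<rightarrow>\<^sub>M M \<Otimes>\<^sub>M borel"
  unfolding swp_def by measurable

text \<open>The exchange symmetry \<open>swap_nn_unif\<close> of the uniform law survives the
  restriction to pairs in one cell, because \<open>sim\<close> is a symmetric relation.\<close>

lemma distr_swp:
  assumes m [simp]: "m \<in> K" and j: "j \<le> n"
  shows "distr (pairs j m) (pairs j m) (swp m) = pairs j m"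
proof (rule measure_eqI)
  fix B assume "B \<in> sets (distr (pairs j m) (pairs j m) (swp m))"
  hence B [measurable]: "B \<in> sets (M \<Otimes>\<^sub>M borel)" by simp
  define h where "h = (\<lambda>\<xi> t. sind (Suc j) (X m \<xi>) t * indicator B (\<xi>, t) :: ennreal)"
  have [measurable]: "case_prod h \<in> borel_measurable (M \<Otimes>\<^sub>M borel)" unfolding h_def by measurable
  \<comment> \<open>Lebesgue measure on the cell is traded for the uniform law, where the exchange
    is known; the factor 3^n appears on both sides of the final equation.\<close>
  have lift: "(\<integral>\<^sup>+\<xi>. \<integral>\<^sup>+t. sind (Suc j) (X m \<xi>) t * g (\<xi>, t) \<partial>lborel \<partial>M) =
      3 ^ n * (\<integral>\<^sup>+\<xi>. \<integral>\<^sup>+t. sind (Suc j) (X m \<xi>) t * g (\<xi>, t) \<partial>unif3 n \<partial>M)"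
    if g [measurable]: "g \<in> borel_measurable (M \<Otimes>\<^sub>M borel)" for g
  proof -
    interpret U: prob_space "unif3 n" by (rule prob_space_unif3)
    have "(\<integral>\<^sup>+\<xi>. \<integral>\<^sup>+t. sind (Suc j) (X m \<xi>) t * g (\<xi>, t) \<partial>lborel \<partial>M) =
        (\<integral>\<^sup>+\<xi>. 3 ^ n * (\<integral>\<^sup>+t. sind (Suc j) (X m \<xi>) t * g (\<xi>, t) \<partial>unif3 n) \<partial>M)"
    proof (rule nn_integral_cong_AE)
      show "AE \<xi> in M. (\<integral>\<^sup>+t. sind (Suc j) (X m \<xi>) t * g (\<xi>, t) \<partial>lborel) =
          3 ^ n * (\<integral>\<^sup>+t. sind (Suc j) (X m \<xi>) t * g (\<xi>, t) \<partial>unif3 n)"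
        using AE_X_generic[OF m, of 0] AE_space
      proof eventually_elim
        case (elim \<xi>)
        hence [measurable]: "\<xi> \<in> space M" by simp
        show ?case by (rule nn_integral_cell_unif) (use elim j in auto)
      qed
    qed
    also have "\<dots> = 3 ^ n * (\<integral>\<^sup>+\<xi>. \<integral>\<^sup>+t. sind (Suc j) (X m \<xi>) t * g (\<xi>, t) \<partial>unif3 n \<partial>M)"
      by (rule nn_integral_cmult) measurable
    finally show ?thesis .
  qed
  have "emeasure (distr (pairs j m) (pairs j m) (swp m)) B = (\<integral>\<^sup>+p. indicator B (swp m p) \<partial>pairs j m)"
    by (subst nn_integral_indicator[symmetric], simp, subst nn_integral_distr) (simp_all cong: measurable_cong_sets)
  also have "\<dots> = 3 ^ n * (\<integral>\<^sup>+\<xi>. \<integral>\<^sup>+t. sind (Suc j) (X m \<xi>) t * indicator B (swp m (\<xi>, t)) \<partial>unif3 n \<partial>M)"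
    by (subst nn_integral_pairs[OF m]) (simp_all add: lift[of "\<lambda>p. indicator B (swp m p)"])
  also have "(\<integral>\<^sup>+\<xi>. \<integral>\<^sup>+t. sind (Suc j) (X m \<xi>) t * indicator B (swp m (\<xi>, t)) \<partial>unif3 n \<partial>M) =
      (\<integral>\<^sup>+\<xi>. \<integral>\<^sup>+t. h (upd m \<xi> t) (X m \<xi>) \<partial>unif3 n \<partial>M)"
    by (intro nn_integral_cong) (auto simp: h_def swp_def X_upd indicator_def sim_sym[of _ "X _ _"] dest: sim_sym[THEN iffD1])
  also have "\<dots> = (\<integral>\<^sup>+\<xi>. \<integral>\<^sup>+t. h \<xi> t \<partial>unif3 n \<partial>M)" by (rule swap_nn_unif[symmetric]) simp_all
  also have "3 ^ n * \<dots> = (\<integral>\<^sup>+p. indicator B p \<partial>pairs j m)"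
    by (subst nn_integral_pairs[OF m]) (simp_all add: lift[of "indicator B"] h_def)
  also have "\<dots> = emeasure (pairs j m) B" by simp
  finally show "emeasure (distr (pairs j m) (pairs j m) (swp m)) B = emeasure (pairs j m) B" .
qed simp

lemma integral_swp:
  fixes F :: "'a \<times> real => real"
  assumes m [simp]: "m \<in> K" and j: "j \<le> n" and [measurable]: "F \<in> borel_measurable (M \<Otimes>\<^sub>M borel)"
  shows "(\<integral>p. F (swp m p) \<partial>pairs j m) = (\<integral>p. F p \<partial>pairs j m)"
    "integrable (pairs j m) (\<lambda>p. F (swp m p)) \<longleftrightarrow> integrable (pairs j m) F"
proof -
  have s: "swp m \<in> pairs j m \<rightarrow>\<^sub>M pairs j m" by (simp cong: measurable_cong_sets)
  have F: "F \<in> borel_measurable (pairs j m)" by (simp cong: measurable_cong_sets)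
  show "(\<integral>p. F (swp m p) \<partial>pairs j m) = (\<integral>p. F p \<partial>pairs j m)"
    using integral_distr[OF s F] distr_swp[OF m j] by simp
  show "integrable (pairs j m) (\<lambda>p. F (swp m p)) \<longleftrightarrow> integrable (pairs j m) F"
    using integrable_distr_eq[OF s F] distr_swp[OF m j] by simp
qed

lemma nn_integral_pairs_fst:
  assumes m [simp]: "m \<in> K" and [measurable]: "f \<in> borel_measurable M"
  shows "(\<integral>\<^sup>+p. f (fst p) \<partial>pairs j m) = 3 ^ j * (\<integral>\<^sup>+\<xi>. f \<xi> \<partial>M)"
proof -
  have "(\<integral>\<^sup>+p. f (fst p) \<partial>pairs j m) = (\<integral>\<^sup>+\<xi>. \<integral>\<^sup>+t. sind (Suc j) (X m \<xi>) t * f \<xi> \<partial>lborel \<partial>M)"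
    by (subst nn_integral_pairs) simp_all
  also have "\<dots> = (\<integral>\<^sup>+\<xi>. 3 ^ j * f \<xi> \<partial>M)"
  proof (rule nn_integral_cong_AE)
    show "AE \<xi> in M. (\<integral>\<^sup>+t. sind (Suc j) (X m \<xi>) t * f \<xi> \<partial>lborel) = 3 ^ j * f \<xi>"
      using AE_X_generic[OF m, of j] by eventually_elim (subst nn_integral_multc; simp add: emeasure_cell)
  qed
  also have "\<dots> = 3 ^ j * (\<integral>\<^sup>+\<xi>. f \<xi> \<partial>M)" by (rule nn_integral_cmult) simp
  finally show ?thesis .
qed

text \<open>Integral operator acting on the m-th coordinate alone, with kernel \<open>a\<close> cut
  off to the cell of that coordinate. For the constant kernel 1 it is 3^j times the cell mean; for
  \<open>kap\<close> it plays the part of an antiderivative.\<close>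

definition Kop :: "nat => (real => real => real) => 'k => ('a => real) => 'a => real" where
  "Kop j a m \<phi> \<xi> = (\<integral>t. sind (Suc j) (X m \<xi>) t * (a (X m \<xi>) t * \<phi> (upd m \<xi> t)) \<partial>lborel)"

lemma Kop_measurable [measurable]:
  assumes m [simp]: "m \<in> K" and [measurable]: "case_prod a \<in> borel_measurable (borel \<Otimes>\<^sub>M borel)" "\<phi> \<in> borel_measurable M"
  shows "Kop j a m \<phi> \<in> borel_measurable M"
  unfolding Kop_def by measurable

lemma integral_pairs:
  fixes F :: "'a \<times> real => real"
  assumes m [simp]: "m \<in> K" and [measurable]: "F \<in> borel_measurable (M \<Otimes>\<^sub>M borel)" and int: "integrable (pairs j m) F"
  shows "(\<integral>p. F p \<partial>pairs j m) = (\<integral>\<xi>. \<integral>t. sind (Suc j) (X m \<xi>) t * F (\<xi>, t) \<partial>lborel \<partial>M)"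
proof -
  interpret p: pair_sigma_finite M lborel ..
  define w :: "'a \<times> real => real" where "w = (\<lambda>p. sind (Suc j) (X m (fst p)) (snd p))"
  have [measurable]: "w \<in> borel_measurable (M \<Otimes>\<^sub>M lborel)" unfolding w_def by measurable
  have F [measurable]: "F \<in> borel_measurable (M \<Otimes>\<^sub>M lborel)" by measurable
  have eq: "pairs j m = density (M \<Otimes>\<^sub>M lborel) (\<lambda>p. ennreal (w p))"
    unfolding pairs_def w_def by (intro arg_cong[of _ _ "density _"]) (auto simp: fun_eq_iff)
  have int': "integrable (M \<Otimes>\<^sub>M lborel) (\<lambda>p. w p *\<^sub>R F p)"
    using int unfolding eq by (subst (asm) integrable_density) (auto simp: w_def)
  have "(\<integral>p. F p \<partial>pairs j m) = (\<integral>p. w p *\<^sub>R F p \<partial>(M \<Otimes>\<^sub>M lborel))"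
    unfolding eq by (rule integral_density) (auto simp: w_def)
  also have "\<dots> = (\<integral>\<xi>. \<integral>t. w (\<xi>, t) *\<^sub>R F (\<xi>, t) \<partial>lborel \<partial>M)"
    by (rule p.integral_fst'[OF int', symmetric])
  finally show ?thesis by (simp add: w_def)
qed

lemma sqint_pairs_fst:
  assumes m [simp]: "m \<in> K" and \<phi>: "sqint M \<phi>" shows "sqint (pairs j m) (\<lambda>p. \<phi> (fst p))"
proof -
  have [measurable]: "\<phi> \<in> borel_measurable M" using \<phi> by (rule sqint_measurable)
  have fin: "(\<integral>\<^sup>+\<xi>. ennreal ((\<phi> \<xi>)^2) \<partial>M) < \<infinity>" using \<phi> unfolding sqint_def integrable_iff_bounded by simp
  have "(\<integral>\<^sup>+p. ennreal ((\<phi> (fst p))^2) \<partial>pairs j m) = 3 ^ j * (\<integral>\<^sup>+\<xi>. ennreal ((\<phi> \<xi>)^2) \<partial>M)"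
    by (rule nn_integral_pairs_fst) simp_all
  also have "\<dots> < \<infinity>" using fin by (simp add: ennreal_mult_less_top ennreal_power[symmetric] power_less_top_ennreal del: ennreal_power)
  finally show ?thesis unfolding sqint_def integrable_iff_bounded by simp
qed

lemma sqint_pairs_upd:
  assumes m [simp]: "m \<in> K" and j: "j \<le> n" and \<phi>: "sqint M \<phi>"
  shows "sqint (pairs j m) (\<lambda>p. \<phi> (upd m (fst p) (snd p)))"
proof -
  have [measurable]: "\<phi> \<in> borel_measurable M" using \<phi> by (rule sqint_measurable)
  have "integrable (pairs j m) (\<lambda>p. (\<phi> (fst p))^2)" using sqint_pairs_fst[OF m \<phi>] by (simp add: sqint_def)
  hence "integrable (pairs j m) (\<lambda>p. (\<phi> (fst (swp m p)))^2)"
    by (subst integral_swp(2)[OF m j, of "\<lambda>p. (\<phi> (fst p))^2"]) simp_all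
  thus ?thesis by (simp add: sqint_def swp_def split_def)
qed

text \<open>The change of variables \<open>swp\<close> exchanges the two arguments of the kernel and
  carries v from the base point to the resampled one, \<phi> the other way.\<close>

lemma Kop_transpose:
  assumes m [simp]: "m \<in> K" and j: "j \<le> n" and a [measurable]: "case_prod a \<in> borel_measurable (borel \<Otimes>\<^sub>M borel)"
    and ab: "\<And>s t. \<bar>a s t\<bar> \<le> 1" and v: "sqint M v" and \<phi>: "sqint M \<phi>"
  shows "(\<integral>\<xi>. v \<xi> * Kop j a m \<phi> \<xi> \<partial>M) = (\<integral>\<xi>. \<phi> \<xi> * Kop j (\<lambda>s t. a t s) m v \<xi> \<partial>M)"
proof -
  have [measurable]: "v \<in> borel_measurable M" "\<phi> \<in> borel_measurable M" using v \<phi> by (auto intro: sqint_measurable)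
  define F where "F = (\<lambda>p. v (fst p) * (a (X m (fst p)) (snd p) * \<phi> (upd m (fst p) (snd p))))"
  define F' where "F' = (\<lambda>p. \<phi> (fst p) * (a (snd p) (X m (fst p)) * v (upd m (fst p) (snd p))))"
  have [measurable]: "F \<in> borel_measurable (M \<Otimes>\<^sub>M borel)" "F' \<in> borel_measurable (M \<Otimes>\<^sub>M borel)"
    unfolding F_def F'_def by measurable
  have "sqint (pairs j m) (\<lambda>p. a (X m (fst p)) (snd p) * \<phi> (upd m (fst p) (snd p)))"
    by (rule sqint_bounded_mult[OF sqint_pairs_upd[OF m j \<phi>], where B = 1]) (measurable, simp add: ab)
  hence iF: "integrable (pairs j m) F" unfolding F_def using sqint_mult_integrable[OF sqint_pairs_fst[OF m v]] by blast
  have "sqint (pairs j m) (\<lambda>p. a (snd p) (X m (fst p)) * v (upd m (fst p) (snd p)))"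
    by (rule sqint_bounded_mult[OF sqint_pairs_upd[OF m j v], where B = 1]) (measurable, simp add: ab)
  hence iF': "integrable (pairs j m) F'" unfolding F'_def using sqint_mult_integrable[OF sqint_pairs_fst[OF m \<phi>]] by blast
  have "(\<integral>\<xi>. v \<xi> * Kop j a m \<phi> \<xi> \<partial>M) = (\<integral>p. F p \<partial>pairs j m)"
    unfolding integral_pairs[OF m \<open>F \<in> _\<close> iF]
    by (auto simp: Kop_def F_def simp flip: integral_mult_right_zero intro!: Bochner_Integration.integral_cong)
  also have "\<dots> = (\<integral>p. F (swp m p) \<partial>pairs j m)" by (rule integral_swp(1)[symmetric, OF m j]) simp
  also have "\<dots> = (\<integral>p. F' p \<partial>pairs j m)"
    by (rule Bochner_Integration.integral_cong) (auto simp: F_def F'_def swp_def split_def space_pairs upd_upd upd_X X_upd)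
  also have "\<dots> = (\<integral>\<xi>. \<phi> \<xi> * Kop j (\<lambda>s t. a t s) m v \<xi> \<partial>M)"
    unfolding integral_pairs[OF m \<open>F' \<in> _\<close> iF']
    by (auto simp: Kop_def F'_def simp flip: integral_mult_right_zero intro!: Bochner_Integration.integral_cong)
  finally show ?thesis .
qed

text \<open>By the exchange symmetry the resampled point has the same marginal as the base point,
  namely 3^j times the law of the space.\<close>

lemma cell_sq_nn_integral:
  assumes m [simp]: "m \<in> K" and j: "j \<le> n" and \<phi>: "sqint M \<phi>"
  shows "(\<integral>\<^sup>+\<xi>. \<integral>\<^sup>+t. sind (Suc j) (X m \<xi>) t * ennreal ((\<phi> (upd m \<xi> t))^2) \<partial>lborel \<partial>M) = 3 ^ j * ennreal ((nrm2 M \<phi>)^2)"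
proof -
  have [measurable]: "\<phi> \<in> borel_measurable M" using \<phi> by (rule sqint_measurable)
  have s: "swp m \<in> pairs j m \<rightarrow>\<^sub>M pairs j m" by (simp cong: measurable_cong_sets)
  have "(\<integral>\<^sup>+\<xi>. \<integral>\<^sup>+t. sind (Suc j) (X m \<xi>) t * ennreal ((\<phi> (upd m \<xi> t))^2) \<partial>lborel \<partial>M) =
      (\<integral>\<^sup>+p. ennreal ((\<phi> (fst (swp m p)))^2) \<partial>pairs j m)"
    by (subst nn_integral_pairs) (simp_all add: swp_def)
  also have "\<dots> = (\<integral>\<^sup>+p. ennreal ((\<phi> (fst p))^2) \<partial>distr (pairs j m) (pairs j m) (swp m))"
    by (rule nn_integral_distr[symmetric, OF s]) (simp cong: measurable_cong_sets)
  also have "\<dots> = 3 ^ j * (\<integral>\<^sup>+\<xi>. ennreal ((\<phi> \<xi>)^2) \<partial>M)"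
    unfolding distr_swp[OF m j] by (rule nn_integral_pairs_fst) simp_all
  also have "(\<integral>\<^sup>+\<xi>. ennreal ((\<phi> \<xi>)^2) \<partial>M) = ennreal ((nrm2 M \<phi>)^2)"
    unfolding nrm2_sq by (rule nn_integral_eq_integral) (use \<phi> in \<open>auto simp: sqint_def\<close>)
  finally show ?thesis .
qed

text \<open>Cauchy-Schwarz against the indicator of the cell, whose mass is 3^j.\<close>

lemma slice_cell_integrable:
  assumes m [simp]: "m \<in> K" and [measurable]: "\<xi> \<in> space M" "\<phi> \<in> borel_measurable M"
    and fin: "(\<integral>\<^sup>+t. sind (Suc j) (X m \<xi>) t * ennreal ((\<phi> (upd m \<xi> t))^2) \<partial>lborel) < \<infinity>"
    and nw: "X m \<xi> \<notin> range (wall j)"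
  shows "integrable lborel (\<lambda>t. sind (Suc j) (X m \<xi>) t * \<phi> (upd m \<xi> t))"
    "(\<integral>t. \<bar>sind (Suc j) (X m \<xi>) t * \<phi> (upd m \<xi> t)\<bar> \<partial>lborel)^2 \<le>
      3 ^ j * (\<integral>t. sind (Suc j) (X m \<xi>) t * (\<phi> (upd m \<xi> t))^2 \<partial>lborel)"
proof -
  define f :: "real => real" where "f = (\<lambda>t. sind (Suc j) (X m \<xi>) t)"
  define g where "g = (\<lambda>t. sind (Suc j) (X m \<xi>) t * \<phi> (upd m \<xi> t))"
  have [measurable]: "f \<in> borel_measurable lborel" "g \<in> borel_measurable lborel"
    unfolding f_def g_def by measurable
  have nf: "(\<integral>\<^sup>+t. ennreal (f t) \<partial>lborel) = 3 ^ j"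
  proof -
    have "(\<integral>\<^sup>+t. ennreal (f t) \<partial>lborel) = (\<integral>\<^sup>+t. sind (Suc j) (X m \<xi>) t \<partial>lborel)"
      by (rule nn_integral_cong) (simp add: f_def)
    thus ?thesis using emeasure_cell[OF nw] by simp
  qed
  have "integrable lborel f"
  proof (rule integrableI_nonneg)
    show "(\<integral>\<^sup>+t. ennreal (f t) \<partial>lborel) < \<infinity>" unfolding nf by (simp add: power_less_top_ennreal)
  qed (auto simp: f_def)
  moreover have "(f t)^2 = f t" for t by (simp add: f_def)
  ultimately have f: "sqint lborel f" by (simp add: sqint_def)
  have "integrable lborel (\<lambda>t. (g t)^2)"
  proof (rule integrableI_bounded)
    have "(\<integral>\<^sup>+t. ennreal (norm ((g t)^2)) \<partial>lborel) = (\<integral>\<^sup>+t. sind (Suc j) (X m \<xi>) t * ennreal ((\<phi> (upd m \<xi> t))^2) \<partial>lborel)"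
      by (rule nn_integral_cong) (simp add: g_def)
    thus "(\<integral>\<^sup>+t. ennreal (norm ((g t)^2)) \<partial>lborel) < \<infinity>" using fin by simp
  qed measurable
  hence g: "sqint lborel g" by (simp add: sqint_def)
  have fg: "f t * g t = g t" for t by (simp add: f_def g_def)
  show ig: "integrable lborel (\<lambda>t. sind (Suc j) (X m \<xi>) t * \<phi> (upd m \<xi> t))"
  proof -
    have "integrable lborel (\<lambda>t. g t)" using sqint_mult_integrable[OF f g] by (simp only: fg)
    thus ?thesis by (simp only: g_def)
  qed
  have "integrable lborel (\<lambda>t. (\<bar>g t\<bar>)^2)" using g by (simp add: sqint_def)
  hence g': "sqint lborel (\<lambda>t. \<bar>g t\<bar>)" by (simp add: sqint_def)
  have "\<bar>\<integral>t. f t * \<bar>g t\<bar> \<partial>lborel\<bar>^2 \<le> (nrm2 lborel f * nrm2 lborel (\<lambda>t. \<bar>g t\<bar>))^2"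
    by (intro power_mono integral_mult_le_nrm2 f g') simp
  also have "\<dots> = (\<integral>t. (f t)^2 \<partial>lborel) * (\<integral>t. (g t)^2 \<partial>lborel)"
    by (simp add: power_mult_distrib nrm2_sq)
  also have "(\<integral>t. (f t)^2 \<partial>lborel) = (\<integral>t. f t \<partial>lborel)" by (rule Bochner_Integration.integral_cong) (auto simp: f_def)
  also have "(\<integral>t. f t \<partial>lborel) = 3 ^ j"
  proof -
    have "enn2real (3 ^ j) = 3 ^ j" by (metis enn2real_ennreal ennreal_numeral ennreal_power zero_le_numeral zero_le_power)
    moreover have "(\<integral>t. f t \<partial>lborel) = enn2real (\<integral>\<^sup>+t. ennreal (f t) \<partial>lborel)"
      by (rule integral_eq_nn_integral) (auto simp: f_def)
    ultimately show ?thesis by (simp add: nf)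
  qed
  also have "(\<lambda>t. f t * \<bar>g t\<bar>) = (\<lambda>t. \<bar>g t\<bar>)" by (auto simp: f_def g_def)
  also have "(\<integral>t. (g t)^2 \<partial>lborel) = (\<integral>t. sind (Suc j) (X m \<xi>) t * (\<phi> (upd m \<xi> t))^2 \<partial>lborel)"
    by (rule Bochner_Integration.integral_cong) (auto simp: g_def)
  finally show "(\<integral>t. \<bar>sind (Suc j) (X m \<xi>) t * \<phi> (upd m \<xi> t)\<bar> \<partial>lborel)^2 \<le>
      3 ^ j * (\<integral>t. sind (Suc j) (X m \<xi>) t * (\<phi> (upd m \<xi> t))^2 \<partial>lborel)" by (simp add: g_def)
qed

lemma AE_slice_finite:
  assumes m [simp]: "m \<in> K" and j: "j \<le> n" and \<phi>: "sqint M \<phi>"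
  shows "AE \<xi> in M. (\<integral>\<^sup>+t. sind (Suc j) (X m \<xi>) t * ennreal ((\<phi> (upd m \<xi> t))^2) \<partial>lborel) < \<infinity>"
proof -
  have [measurable]: "\<phi> \<in> borel_measurable M" using \<phi> by (rule sqint_measurable)
  have "AE \<xi> in M. (\<integral>\<^sup>+t. sind (Suc j) (X m \<xi>) t * ennreal ((\<phi> (upd m \<xi> t))^2) \<partial>lborel) \<noteq> \<infinity>"
  proof (rule nn_integral_PInf_AE)
    show "(\<integral>\<^sup>+\<xi>. \<integral>\<^sup>+t. sind (Suc j) (X m \<xi>) t * ennreal ((\<phi> (upd m \<xi> t))^2) \<partial>lborel \<partial>M) \<noteq> \<infinity>"
      unfolding cell_sq_nn_integral[OF m j \<phi>] by (simp add: ennreal_mult_eq_top_iff power_eq_top_ennreal)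
  qed measurable
  thus ?thesis by (auto simp: less_top)
qed

text \<open>In the square, Cauchy-Schwarz on each slice costs one factor 3^j and the mass of the
  pair measure another; hence operator norm 3^j.\<close>

lemma Kop_bound:
  assumes m [simp]: "m \<in> K" and j: "j \<le> n" and a [measurable]: "case_prod a \<in> borel_measurable (borel \<Otimes>\<^sub>M borel)"
    and ab: "\<And>s t. \<bar>a s t\<bar> \<le> 1" and \<phi>: "sqint M \<phi>"
  shows "sqint M (Kop j a m \<phi>)" "nrm2 M (Kop j a m \<phi>) \<le> 3 ^ j * nrm2 M \<phi>"
proof -
  have [measurable]: "\<phi> \<in> borel_measurable M" using \<phi> by (rule sqint_measurable)
  have pt: "AE \<xi> in M. ennreal ((Kop j a m \<phi> \<xi>)^2) \<le> 3 ^ j * (\<integral>\<^sup>+t. sind (Suc j) (X m \<xi>) t * ennreal ((\<phi> (upd m \<xi> t))^2) \<partial>lborel)"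
    using AE_slice_finite[OF m j \<phi>] AE_X_generic[OF m, of j] AE_space
  proof eventually_elim
    case (elim \<xi>)
    hence [measurable]: "\<xi> \<in> space M" by simp
    note sl = slice_cell_integrable[OF m \<open>\<xi> \<in> space M\<close> \<open>\<phi> \<in> _\<close> elim(1)]
    have nw: "X m \<xi> \<notin> range (wall j)" using elim by simp
    have "\<bar>Kop j a m \<phi> \<xi>\<bar> \<le> (\<integral>t. \<bar>sind (Suc j) (X m \<xi>) t * \<phi> (upd m \<xi> t)\<bar> \<partial>lborel)"
      unfolding Kop_def
    proof (rule order.trans[OF integral_abs_bound], rule integral_mono_AE')
      show "integrable lborel (\<lambda>t. \<bar>sind (Suc j) (X m \<xi>) t * \<phi> (upd m \<xi> t)\<bar>)"
        using sl(1)[OF nw] by (rule integrable_abs)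
    qed (auto simp: abs_mult intro!: mult_left_le_one_le ab)
    hence "(Kop j a m \<phi> \<xi>)^2 \<le> (\<integral>t. \<bar>sind (Suc j) (X m \<xi>) t * \<phi> (upd m \<xi> t)\<bar> \<partial>lborel)^2"
      by (metis abs_ge_zero power2_abs power_mono)
    also have "\<dots> \<le> 3 ^ j * (\<integral>t. sind (Suc j) (X m \<xi>) t * (\<phi> (upd m \<xi> t))^2 \<partial>lborel)" by (rule sl(2)[OF nw])
    finally have "ennreal ((Kop j a m \<phi> \<xi>)^2) \<le> ennreal (3 ^ j * (\<integral>t. sind (Suc j) (X m \<xi>) t * (\<phi> (upd m \<xi> t))^2 \<partial>lborel))"
      by (rule ennreal_leI)
    also have "\<dots> = 3 ^ j * ennreal (\<integral>t. sind (Suc j) (X m \<xi>) t * (\<phi> (upd m \<xi> t))^2 \<partial>lborel)"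
      by (simp add: ennreal_mult' ennreal_power[symmetric] del: ennreal_power)
    also have "ennreal (\<integral>t. sind (Suc j) (X m \<xi>) t * (\<phi> (upd m \<xi> t))^2 \<partial>lborel) =
        (\<integral>\<^sup>+t. ennreal (sind (Suc j) (X m \<xi>) t * (\<phi> (upd m \<xi> t))^2) \<partial>lborel)"
    proof (rule nn_integral_eq_integral[symmetric])
      have e: "ennreal (norm (sind (Suc j) (X m \<xi>) t * (\<phi> (upd m \<xi> t))^2)) = sind (Suc j) (X m \<xi>) t * ennreal ((\<phi> (upd m \<xi> t))^2)" for t
        by simp
      show "integrable lborel (\<lambda>t. sind (Suc j) (X m \<xi>) t * (\<phi> (upd m \<xi> t))^2)"
        by (rule integrableI_bounded, measurable) (use elim(1) in \<open>simp only: e\<close>)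
    qed auto
    also have "\<dots> = (\<integral>\<^sup>+t. sind (Suc j) (X m \<xi>) t * ennreal ((\<phi> (upd m \<xi> t))^2) \<partial>lborel)"
      by (rule nn_integral_cong) simp
    finally show ?case .
  qed
  have "(\<integral>\<^sup>+\<xi>. ennreal ((Kop j a m \<phi> \<xi>)^2) \<partial>M) \<le>
      (\<integral>\<^sup>+\<xi>. 3 ^ j * (\<integral>\<^sup>+t. sind (Suc j) (X m \<xi>) t * ennreal ((\<phi> (upd m \<xi> t))^2) \<partial>lborel) \<partial>M)"
    by (rule nn_integral_mono_AE[OF pt])
  also have "\<dots> = 3 ^ j * (3 ^ j * ennreal ((nrm2 M \<phi>)^2))"
    by (subst nn_integral_cmult) (simp_all add: cell_sq_nn_integral[OF m j \<phi>])
  also have "\<dots> = ennreal ((3 ^ j * nrm2 M \<phi>)^2)"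
    by (simp add: power_mult_distrib power2_eq_square ennreal_mult' ennreal_power[symmetric] mult.assoc mult.left_commute del: ennreal_power)
  finally have le: "(\<integral>\<^sup>+\<xi>. ennreal ((Kop j a m \<phi> \<xi>)^2) \<partial>M) \<le> ennreal ((3 ^ j * nrm2 M \<phi>)^2)" .
  have int: "integrable M (\<lambda>\<xi>. (Kop j a m \<phi> \<xi>)^2)"
    by (rule integrableI_bounded) (use le in \<open>auto intro: le_less_trans\<close>)
  thus "sqint M (Kop j a m \<phi>)" by (simp add: sqint_def)
  have "(\<integral>\<xi>. (Kop j a m \<phi> \<xi>)^2 \<partial>M) \<le> (3 ^ j * nrm2 M \<phi>)^2"
    using le nn_integral_eq_integral[OF int] by (simp add: ennreal_le_iff)
  thus "nrm2 M (Kop j a m \<phi>) \<le> 3 ^ j * nrm2 M \<phi>"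
    unfolding nrm2_def[of M "Kop j a m \<phi>"] by (intro real_le_lsqrt) auto
qed

end

section \<open>The filtration of labels\<close>

context resample_space
begin

text \<open>Level 0 means that the coordinate is known exactly, level \<open>Suc j\<close> that only
  its cell of length 3^j is. Invariance is asked at every point and not up to null sets, so that
  measurable functions are literally constant on cells (\<open>measurable_A_D\<close>).\<close>

definition invar :: "('k => nat) => 'a set set" where
  "invar \<kappa> = {S \<in> sets M. \<forall>m\<in>K. \<forall>\<xi>\<in>space M. \<forall>t. sim (\<kappa> m) (X m \<xi>) t --> (upd m \<xi> t \<in> S \<longleftrightarrow> \<xi> \<in> S)}"

definition A :: "('k => nat) => 'a measure" where
  "A \<kappa> = sigma (space M) (invar \<kappa>)"

lemma invar_sigma_algebra: "sigma_algebra (space M) (invar \<kappa>)"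
  unfolding sigma_algebra_iff2
proof (intro conjI ballI allI impI)
  show "invar \<kappa> \<subseteq> Pow (space M)" by (auto simp: invar_def dest: sets.sets_into_space)
  show "{} \<in> invar \<kappa>" by (simp add: invar_def)
  show "space M - S \<in> invar \<kappa>" if "S \<in> invar \<kappa>" for S
    using that by (auto simp: invar_def upd_space)
  show "\<Union> (range F) \<in> invar \<kappa>" if "range F \<subseteq> invar \<kappa>" for F :: "nat => _"
  proof -
    have F: "F i \<in> invar \<kappa>" for i using that by auto
    have "\<Union> (range F) \<in> sets M" using F by (auto simp: invar_def)
    thus ?thesis using F by (fastforce simp: invar_def)
  qed
qed

lemma sets_A: "sets (A \<kappa>) = invar \<kappa>"
  unfolding A_def using invar_sigma_algebra sigma_algebra.sets_measure_of_eq by blast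

lemma space_A [simp]: "space (A \<kappa>) = space M"
  unfolding A_def by (rule space_measure_of) (auto simp: invar_def dest: sets.sets_into_space)

lemma subalg_A: "subalgebra M (A \<kappa>)"
  by (auto simp: subalgebra_def sets_A invar_def)

lemma fsub: "finite_measure_subalgebra M (A \<kappa>)"
  by (intro finite_measure_subalgebra.intro finite_measure_subalgebra_axioms.intro subalg_A) unfold_locales

lemma measurable_AI:
  assumes "\<phi> \<in> M \<rightarrow>\<^sub>M N"
    and "\<And>m \<xi> t. m \<in> K ==> \<xi> \<in> space M ==> sim (\<kappa> m) (X m \<xi>) t ==> \<phi> (upd m \<xi> t) = \<phi> \<xi>"
  shows "\<phi> \<in> A \<kappa> \<rightarrow>\<^sub>M N"
proof (rule measurableI)
  show "\<phi> \<xi> \<in> space N" if "\<xi> \<in> space (A \<kappa>)" for \<xi> using that measurable_space[OF assms(1)] by simp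
  show "\<phi> -` B \<inter> space (A \<kappa>) \<in> sets (A \<kappa>)" if "B \<in> sets N" for B
    using measurable_sets[OF assms(1) that] assms(2) by (auto simp: sets_A invar_def upd_space)
qed

text \<open>The level set of \<phi> through \<xi> is itself an invariant event.\<close>

lemma measurable_A_D:
  fixes \<phi> :: "'a => real"
  assumes "\<phi> \<in> borel_measurable (A \<kappa>)" "m \<in> K" "\<xi> \<in> space M" "sim (\<kappa> m) (X m \<xi>) t"
  shows "\<phi> (upd m \<xi> t) = \<phi> \<xi>"
proof -
  have "\<phi> -` {\<phi> \<xi>} \<inter> space (A \<kappa>) \<in> sets (A \<kappa>)" by (rule measurable_sets[OF assms(1)]) simp
  hence "\<phi> -` {\<phi> \<xi>} \<inter> space M \<in> invar \<kappa>" by (simp add: sets_A)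
  thus ?thesis using assms(2-) by (auto simp: invar_def)
qed

lemma measurable_A_M: "\<phi> \<in> borel_measurable (A \<kappa>) ==> \<phi> \<in> borel_measurable M"
  by (rule measurable_from_subalg[OF subalg_A])

text \<open>Coarser levels allow larger moves and so leave fewer events invariant: a larger \<kappa>
  gives a smaller algebra.\<close>

lemma A_mono: assumes "\<And>m. m \<in> K ==> \<kappa> m \<le> \<kappa>' m" shows "subalgebra (A \<kappa>) (A \<kappa>')"
  using assms sim_mono unfolding subalgebra_def sets_A invar_def by (auto, blast+)

lemma A_cong: assumes "\<And>m. m \<in> K ==> \<kappa> m = \<kappa>' m" shows "A \<kappa> = A \<kappa>'"
proof -
  have "invar \<kappa> = invar \<kappa>'" using assms by (auto simp: invar_def)
  thus ?thesis by (simp add: A_def)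
qed

definition E :: "('k => nat) => ('a => real) => 'a => real" where
  "E \<kappa> = real_cond_exp M (A \<kappa>)"

lemma E_measurable_A [measurable]: "E \<kappa> u \<in> borel_measurable (A \<kappa>)"
  by (simp add: E_def)

lemma E_measurable [measurable]: "E \<kappa> u \<in> borel_measurable M"
  by (simp add: E_def)

lemma E_sqint: "sqint M u ==> sqint M (E \<kappa> u)" "sqint M u ==> nrm2 M (E \<kappa> u) \<le> nrm2 M u"
  unfolding E_def by (rule finite_measure_subalgebra.sqint_cond_exp[OF fsub], assumption)+

lemma E_adj: "sqint M u ==> sqint M v ==> v \<in> borel_measurable (A \<kappa>) ==>
    (\<integral>x. v x * E \<kappa> u x \<partial>M) = (\<integral>x. v x * u x \<partial>M)"
  unfolding E_def by (rule finite_measure_subalgebra.sqint_cond_exp(3)[OF fsub])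

lemma E_inner_mono:
  assumes "\<And>m. m \<in> K ==> \<kappa> m \<le> \<kappa>' m" "sqint M u"
  shows "(\<integral>x. E \<kappa>' u x * E \<kappa> u x \<partial>M) = (nrm2 M (E \<kappa>' u))^2"
proof -
  have "E \<kappa>' u \<in> borel_measurable (A \<kappa>)"
    by (rule measurable_from_subalg[OF A_mono[OF assms(1)] E_measurable_A])
  hence "(\<integral>x. E \<kappa>' u x * E \<kappa> u x \<partial>M) = (\<integral>x. E \<kappa>' u x * u x \<partial>M)"
    by (intro E_adj E_sqint assms)
  also have "\<dots> = (\<integral>x. E \<kappa>' u x * E \<kappa>' u x \<partial>M)" by (rule E_adj[symmetric]) (auto intro: assms E_sqint)
  finally show ?thesis unfolding nrm2_sq by (simp add: power2_eq_square)
qed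

text \<open>The projection on the smaller algebra is orthogonal to the difference of the two, by
  \<open>E_inner_mono\<close>.\<close>

lemma E_pythagoras:
  assumes "\<And>m. m \<in> K ==> \<kappa> m \<le> \<kappa>' m" and u: "sqint M u"
  shows "(nrm2 M (\<lambda>x. E \<kappa> u x - E \<kappa>' u x))^2 = (nrm2 M (E \<kappa> u))^2 - (nrm2 M (E \<kappa>' u))^2"
proof -
  note s = E_sqint(1)[OF u, of \<kappa>] E_sqint(1)[OF u, of \<kappa>']
  have "(nrm2 M (\<lambda>x. E \<kappa> u x - E \<kappa>' u x))^2 = (\<integral>x. (E \<kappa> u x)^2 + ((E \<kappa>' u x)^2 - 2 * (E \<kappa>' u x * E \<kappa> u x)) \<partial>M)"
    unfolding nrm2_sq by (rule Bochner_Integration.integral_cong) (auto simp: power2_diff)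
  also have "\<dots> = (nrm2 M (E \<kappa> u))^2 + ((nrm2 M (E \<kappa>' u))^2 - 2 * (\<integral>x. E \<kappa>' u x * E \<kappa> u x \<partial>M))"
    using s sqint_mult_integrable[OF s(2) s(1)] by (simp add: sqint_def nrm2_sq)
  finally show ?thesis by (simp add: E_inner_mono[OF assms])
qed

section \<open>Martingale increments over coordinates and scales\<close>

definition idx :: "'k => nat" where
  "idx = (SOME f. bij_betw f K {0..<card K})"

lemma idx: "bij_betw idx K {0..<card K}"
  unfolding idx_def using ex_bij_betw_finite_nat[OF finK] by (rule someI_ex)

text \<open>Stage r of the passage from level \<open>Suc k\<close> to level k: the first r
  coordinates are already refined. It interpolates between all coordinates at \<open>Suc k\<close>
  (r = 0) and all at k (r = \<open>card K\<close>).\<close>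

definition lvl :: "nat => nat => 'k => nat" where
  "lvl k r m = (if idx m < r then k else Suc k)"

definition D :: "nat => 'k => ('a => real) => 'a => real" where
  "D k m u x = E (lvl k (Suc (idx m))) u x - E (lvl k (idx m)) u x"

lemma D_sqint: "sqint M u ==> sqint M (D k m u)"
  unfolding D_def by (intro sqint_diff E_sqint)

text \<open>Consecutive stages are nested, so Pythagoras turns each square into a difference of
  squares, and the sum along the enumeration telescopes.\<close>

lemma D_sum_coords:
  assumes u: "sqint M u"
  shows "(\<Sum>m\<in>K. (nrm2 M (D k m u))^2) = (nrm2 M (E (\<lambda>_. k) u))^2 - (nrm2 M (E (\<lambda>_. Suc k) u))^2"
proof -
  define b where "b = (\<lambda>r. (nrm2 M (E (lvl k r) u))^2)"
  have "(\<Sum>m\<in>K. (nrm2 M (D k m u))^2) = (\<Sum>m\<in>K. b (Suc (idx m)) - b (idx m))"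
  proof (rule sum.cong[OF refl])
    fix m
    have "(nrm2 M (\<lambda>x. E (lvl k (Suc (idx m))) u x - E (lvl k (idx m)) u x))^2 = b (Suc (idx m)) - b (idx m)"
      unfolding b_def by (rule E_pythagoras[OF _ u]) (auto simp: lvl_def)
    thus "(nrm2 M (D k m u))^2 = b (Suc (idx m)) - b (idx m)" by (simp add: D_def[abs_def])
  qed
  also have "\<dots> = (\<Sum>r\<in>{0..<card K}. b (Suc r) - b r)"
    by (rule sum.reindex_bij_betw[OF idx])
  also have "\<dots> = b (card K) - b 0"
    by (simp add: sum_Suc_diff')
  also have "A (lvl k (card K)) = A (\<lambda>_. k)" "A (lvl k 0) = A (\<lambda>_. Suc k)"
    using bij_betwE[OF idx] by (auto intro!: A_cong simp: lvl_def)
  hence "b (card K) - b 0 = (nrm2 M (E (\<lambda>_. k) u))^2 - (nrm2 M (E (\<lambda>_. Suc k) u))^2"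
    by (simp add: b_def E_def)
  finally show ?thesis .
qed

text \<open>At level 0 the only admissible move is the trivial one, so every event is
  invariant.\<close>

lemma E_0: assumes u: "sqint M u" shows "AE x in M. E (\<lambda>_. 0) u x = u x"
proof -
  interpret F: finite_measure_subalgebra M "A (\<lambda>_. 0)" by (rule fsub)
  have "u \<in> borel_measurable (A (\<lambda>_. 0))"
    using u by (intro measurable_AI) (auto simp: upd_X sqint_def)
  thus ?thesis unfolding E_def by (intro F.real_cond_exp_F_meas sqint_integrable u)
qed

lemma D_sum_levels:
  assumes u: "sqint M u"
  shows "(\<Sum>k\<le>n. \<Sum>m\<in>K. (nrm2 M (D k m u))^2) = (nrm2 M u)^2 - (nrm2 M (E (\<lambda>_. Suc n) u))^2"
proof -
  have "nrm2 M (E (\<lambda>_. 0) u) = nrm2 M u"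
    by (rule sqint_AE_cong(2)[OF u]) (use E_0[OF u] in \<open>auto elim: eventually_mono\<close>)
  moreover have "(\<Sum>k\<le>n. (nrm2 M (E (\<lambda>_. k) u))^2 - (nrm2 M (E (\<lambda>_. Suc k) u))^2) =
      (nrm2 M (E (\<lambda>_. 0) u))^2 - (nrm2 M (E (\<lambda>_. Suc n) u))^2"
    by (rule sum_telescope)
  ultimately show ?thesis by (simp add: D_sum_coords[OF u])
qed

text \<open>One coordinate, all scales: this form applies to a family of functions depending on the
  coordinate, which is how it is used in \<open>multiscale_poincare\<close>.\<close>

lemma D_bessel:
  assumes u: "sqint M u" and m: "m \<in> K"
  shows "(\<Sum>k\<le>n. (nrm2 M (D k m u))^2) \<le> (nrm2 M u)^2"
proof -
  have "(\<Sum>k\<le>n. (nrm2 M (D k m u))^2) \<le> (\<Sum>k\<le>n. \<Sum>m\<in>K. (nrm2 M (D k m u))^2)"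
    using m finK by (intro sum_mono member_le_sum) auto
  also have "\<dots> \<le> (nrm2 M u)^2" unfolding D_sum_levels[OF u] by simp
  finally show ?thesis .
qed

text \<open>Weak form of the statement that G is the derivative of u in coordinate m, tested against
  functions with vanishing cell integrals; for these the cell mean of u drops out of the mean value
  formula. Unlike differentiability it is stable under L2 limits. The integrals must vanish at all
  points, which is the purpose of \<open>D_good_version\<close>.\<close>

definition ibp :: "('a => real) => 'k => ('a => real) => bool" where
  "ibp u m G \<longleftrightarrow> (\<forall>j\<le>n. \<forall>w. sqint M w --> (\<forall>\<xi>\<in>space M. Kop j (\<lambda>_ _. 1) m w \<xi> = 0) -->
     (\<integral>x. w x * u x \<partial>M) = (\<integral>x. Kop j (kap j) m w x * G x \<partial>M))"

section \<open>Increments whose slice integrals vanish everywhere\<close>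

lemma lvl_self: "lvl k (Suc (idx m)) m = k" "lvl k (idx m) m = Suc k"
  by (simp_all add: lvl_def)

lemma lvl_other: "m \<in> K ==> m' \<in> K ==> m' \<noteq> m ==> lvl k (Suc (idx m)) m' = lvl k (idx m) m'"
  using bij_betw_imp_inj_on[OF idx] by (auto simp: lvl_def inj_on_def less_Suc_eq)

text \<open>Integrating coordinate m over its cell forgets its position there, which raises its
  level by one. The other coordinates have equal levels in both algebras, and their updates commute
  with the integration.\<close>

lemma Kop_invariant:
  assumes m [simp]: "m \<in> K" and w [measurable]: "w \<in> borel_measurable (A (lvl k (Suc (idx m))))"
  shows "Kop k (\<lambda>_ _. 1) m w \<in> borel_measurable (A (lvl k (idx m)))"
    "\<xi> \<in> space M ==> sim (Suc k) (X m \<xi>) t ==>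
      (\<integral>\<^sup>+s. sind (Suc k) (X m (upd m \<xi> t)) s * ennreal ((w (upd m (upd m \<xi> t) s))^2) \<partial>lborel) =
      (\<integral>\<^sup>+s. sind (Suc k) (X m \<xi>) s * ennreal ((w (upd m \<xi> s))^2) \<partial>lborel)"
    "(\<lambda>\<xi>. \<integral>\<^sup>+s. sind (Suc k) (X m \<xi>) s * ennreal ((w (upd m \<xi> s))^2) \<partial>lborel) \<in> borel_measurable (A (lvl k (idx m)))"
proof -
  have wM [measurable]: "w \<in> borel_measurable M" using w by (rule measurable_A_M)
  have cell: "sim (Suc k) t s \<longleftrightarrow> sim (Suc k) (X m \<xi>) s" if "sim (Suc k) (X m \<xi>) t" for t s \<xi>
    using that sim_trans sim_sym by blast
  have other: "w (upd m (upd m' \<xi> t) s) = w (upd m \<xi> s)"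
    if "m' \<in> K" "m' \<noteq> m" "\<xi> \<in> space M" "sim (lvl k (idx m) m') (X m' \<xi>) t" for m' \<xi> t s
  proof -
    have "w (upd m' (upd m \<xi> s) t) = w (upd m \<xi> s)"
      by (rule measurable_A_D[OF w]) (use that lvl_other[OF m that(1,2)] in \<open>auto simp: upd_space X_upd_other\<close>)
    thus ?thesis using upd_comm[of m m' \<xi> s t] that by simp
  qed
  show "Kop k (\<lambda>_ _. 1) m w \<in> borel_measurable (A (lvl k (idx m)))"
  proof (rule measurable_AI)
    fix m' \<xi> t assume *: "m' \<in> K" "\<xi> \<in> space M" "sim (lvl k (idx m) m') (X m' \<xi>) t"
    show "Kop k (\<lambda>_ _. 1) m w (upd m' \<xi> t) = Kop k (\<lambda>_ _. 1) m w \<xi>"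
    proof (cases "m' = m")
      case True
      thus ?thesis using * cell[of \<xi> t] by (simp add: Kop_def X_upd upd_upd lvl_self)
    next
      case False
      hence "X m (upd m' \<xi> t) = X m \<xi>" using X_upd_other[OF *(1) m] * by auto
      thus ?thesis using * False by (simp add: Kop_def other)
    qed
  qed measurable
  show sl: "(\<integral>\<^sup>+s. sind (Suc k) (X m (upd m \<xi> t)) s * ennreal ((w (upd m (upd m \<xi> t) s))^2) \<partial>lborel) =
      (\<integral>\<^sup>+s. sind (Suc k) (X m \<xi>) s * ennreal ((w (upd m \<xi> s))^2) \<partial>lborel)"
    if "\<xi> \<in> space M" "sim (Suc k) (X m \<xi>) t" for \<xi> t
    using that cell[of \<xi> t] by (simp add: X_upd upd_upd)
  show "(\<lambda>\<xi>. \<integral>\<^sup>+s. sind (Suc k) (X m \<xi>) s * ennreal ((w (upd m \<xi> s))^2) \<partial>lborel) \<in> borel_measurable (A (lvl k (idx m)))"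
  proof (rule measurable_AI)
    fix m' \<xi> t assume *: "m' \<in> K" "\<xi> \<in> space M" "sim (lvl k (idx m) m') (X m' \<xi>) t"
    show "(\<integral>\<^sup>+s. sind (Suc k) (X m (upd m' \<xi> t)) s * ennreal ((w (upd m (upd m' \<xi> t) s))^2) \<partial>lborel) =
      (\<integral>\<^sup>+s. sind (Suc k) (X m \<xi>) s * ennreal ((w (upd m \<xi> s))^2) \<partial>lborel)"
    proof (cases "m' = m")
      case True
      thus ?thesis using * sl by (simp add: lvl_self)
    next
      case False
      hence "X m (upd m' \<xi> t) = X m \<xi>" using X_upd_other[OF *(1) m] * by auto
      thus ?thesis using * False by (simp add: other)
    qed
  qed measurable
qed

text \<open>The increment has conditional mean zero only almost surely, whereas \<open>ibp\<close>
  asks every slice integral to vanish. The exceptional slices form a null event of the coarser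
  algebra, so the increment can be set to zero on them as a whole and stays measurable for the finer
  one.\<close>

lemma D_good_version:
  assumes m [simp]: "m \<in> K" and k: "k \<le> n" and u: "sqint M u"
  obtains w where "w \<in> borel_measurable (A (lvl k (Suc (idx m))))" "sqint M w"
    "AE \<xi> in M. w \<xi> = D k m u \<xi>" "\<And>\<xi>. \<xi> \<in> space M ==> Kop k (\<lambda>_ _. 1) m w \<xi> = 0"
    "\<And>\<xi>. \<xi> \<in> space M ==> (\<integral>\<^sup>+s. sind (Suc k) (X m \<xi>) s * ennreal ((w (upd m \<xi> s))^2) \<partial>lborel) < \<infinity>"
    "AE \<xi> in M. E (lvl k (idx m)) w \<xi> = 0"
proof -
  define B1 B0 where "B1 = A (lvl k (Suc (idx m)))" and "B0 = A (lvl k (idx m))"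
  define w0 where "w0 = D k m u"
  have sub: "subalgebra B1 B0" unfolding B1_def B0_def by (rule A_mono) (auto simp: lvl_def)
  have sw0: "sqint M w0" unfolding w0_def by (rule D_sqint[OF u])
  have w0 [measurable]: "w0 \<in> borel_measurable B1"
    unfolding w0_def D_def[abs_def] B1_def
    by (intro borel_measurable_diff E_measurable_A measurable_from_subalg[OF sub[unfolded B1_def B0_def]])
  have [measurable]: "w0 \<in> borel_measurable M" using sw0 by (rule sqint_measurable)
  interpret F0: finite_measure_subalgebra M B0 unfolding B0_def by (rule fsub)
  interpret F1: finite_measure_subalgebra M B1 unfolding B1_def by (rule fsub)
  have iu: "integrable M u" by (rule sqint_integrable[OF u])
  have E0: "AE \<xi> in M. E (lvl k (idx m)) w0 \<xi> = 0"
  proof -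
    have e: "E (lvl k (idx m)) = real_cond_exp M B0" "E (lvl k (Suc (idx m))) = real_cond_exp M B1"
      by (simp_all add: E_def B0_def B1_def)
    have i1: "integrable M (real_cond_exp M B1 u)" "integrable M (real_cond_exp M B0 u)"
      using sqint_integrable[OF E_sqint(1)[OF u]] unfolding e[symmetric] by auto
    have "AE \<xi> in M. real_cond_exp M B0 w0 \<xi> = real_cond_exp M B0 (real_cond_exp M B1 u) \<xi> - real_cond_exp M B0 (real_cond_exp M B0 u) \<xi>"
      unfolding w0_def D_def[abs_def] e by (rule F0.real_cond_exp_diff[OF i1])
    moreover have "AE \<xi> in M. real_cond_exp M B0 (real_cond_exp M B1 u) \<xi> = real_cond_exp M B0 u \<xi>"
      by (rule F0.real_cond_exp_nested_subalg[OF F1.subalg sub iu])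
    moreover have "AE \<xi> in M. real_cond_exp M B0 (real_cond_exp M B0 u) \<xi> = real_cond_exp M B0 u \<xi>"
      by (rule F0.real_cond_exp_F_meas[OF i1(2)]) simp
    ultimately show ?thesis unfolding e by eventually_elim simp
  qed
  define Z where "Z = Kop k (\<lambda>_ _. 1) m w0"
  have ZA: "Z \<in> borel_measurable B0" unfolding Z_def B0_def by (rule Kop_invariant(1)[OF m w0[unfolded B1_def]])
  have sZ: "sqint M Z" unfolding Z_def by (rule Kop_bound(1)[OF m k _ _ sw0]) auto
  have [measurable]: "Z \<in> borel_measurable M" using sZ by (rule sqint_measurable)
  have Zupd: "Z (upd m \<xi> t) = Z \<xi>" if "\<xi> \<in> space M" "sim (Suc k) (X m \<xi>) t" for \<xi> t
    by (rule measurable_A_D[OF ZA[unfolded B0_def] m]) (use that in \<open>auto simp: lvl_self\<close>)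
  have KZ: "AE \<xi> in M. Kop k (\<lambda>_ _. 1) m Z \<xi> = 3 ^ k * Z \<xi>"
    using AE_X_generic[OF m, of k] AE_space
  proof eventually_elim
    case (elim \<xi>)
    have "Kop k (\<lambda>_ _. 1) m Z \<xi> = (\<integral>t. indicator {ctr k (X m \<xi>) - 3 ^ k / 2<..<ctr k (X m \<xi>) + 3 ^ k / 2} t * Z \<xi> \<partial>lborel)"
      unfolding Kop_def using elim sim_iff_cell[of "X m \<xi>" k] Zupd
      by (intro Bochner_Integration.integral_cong) (auto simp: indicator_def)
    also have "\<dots> = 3 ^ k * Z \<xi>" by simp
    finally show ?case .
  qed
  have [measurable]: "Kop k (\<lambda>_ _. 1) m Z \<in> borel_measurable M" by measurable
  \<comment> \<open>The slice integral \<open>Z\<close> is constant on the cell, so applying the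
    operator again gives \<open>3 ^ k * Z\<close>. After transposition its square integral is a
    multiple of the pairing of \<open>Z\<close> with the increment, and \<open>Z\<close> belongs to
    the algebra in which the increment has mean zero.\<close>
  have "(\<integral>\<xi>. (Z \<xi>)^2 \<partial>M) = (\<integral>\<xi>. Z \<xi> * Kop k (\<lambda>_ _. 1) m w0 \<xi> \<partial>M)"
    by (simp add: Z_def power2_eq_square)
  also have "\<dots> = (\<integral>\<xi>. w0 \<xi> * Kop k (\<lambda>_ _. 1) m Z \<xi> \<partial>M)"
    by (rule Kop_transpose[OF m k _ _ sZ sw0]) auto
  also have "\<dots> = (\<integral>\<xi>. 3 ^ k * (Z \<xi> * w0 \<xi>) \<partial>M)"
    by (rule integral_cong_AE) (use KZ in \<open>auto elim: eventually_mono\<close>)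
  also have "\<dots> = 3 ^ k * (\<integral>\<xi>. Z \<xi> * E (lvl k (idx m)) w0 \<xi> \<partial>M)"
    using E_adj[OF sw0 sZ ZA[unfolded B0_def]] by simp
  also have "(\<integral>\<xi>. Z \<xi> * E (lvl k (idx m)) w0 \<xi> \<partial>M) = (\<integral>\<xi>. 0 \<partial>M)"
    by (rule integral_cong_AE) (use E0 in \<open>auto elim: eventually_mono\<close>)
  finally have "(\<integral>\<xi>. (Z \<xi>)^2 \<partial>M) = 0" by simp
  hence Z0: "AE \<xi> in M. Z \<xi> = 0"
    using sZ by (subst (asm) integral_nonneg_eq_0_iff_AE) (auto simp: sqint_def)
  \<comment> \<open>\<open>Kop\<close> is a Bochner integral and hence 0 by default on a slice that
    is not integrable; finiteness of \<open>V\<close> separates the true zeros from such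
    defaults.\<close>
  define V where "V = (\<lambda>\<xi>. \<integral>\<^sup>+s. sind (Suc k) (X m \<xi>) s * ennreal ((w0 (upd m \<xi> s))^2) \<partial>lborel)"
  have VA: "V \<in> borel_measurable B0" unfolding V_def B0_def by (rule Kop_invariant(3)[OF m w0[unfolded B1_def]])
  have Vupd: "V (upd m \<xi> t) = V \<xi>" if "\<xi> \<in> space M" "sim (Suc k) (X m \<xi>) t" for \<xi> t
    unfolding V_def by (rule Kop_invariant(2)[OF m w0[unfolded B1_def] that])
  have V0: "AE \<xi> in M. V \<xi> < \<infinity>" unfolding V_def by (rule AE_slice_finite[OF m k sw0])
  \<comment> \<open>The condition depends only on the cell of coordinate m, so whole slices are kept
    or dropped.\<close>
  define w where "w = (\<lambda>\<xi>. if Z \<xi> = 0 \<and> V \<xi> < \<infinity> then w0 \<xi> else 0)"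
  have weq: "AE \<xi> in M. w \<xi> = w0 \<xi>" using Z0 V0 by eventually_elim (simp add: w_def)
  have wB1: "w \<in> borel_measurable B1"
  proof -
    have [measurable]: "Z \<in> borel_measurable B1" "V \<in> borel_measurable B1"
      using ZA VA measurable_from_subalg[OF sub] by auto
    show ?thesis unfolding w_def by measurable
  qed
  hence wM: "w \<in> borel_measurable M" unfolding B1_def by (rule measurable_A_M)
  have sw: "sqint M w" by (rule sqint_AE_cong(1)[OF sw0 wM]) (use weq in \<open>auto elim: eventually_mono\<close>)
  have wupd: "w (upd m \<xi> s) = (if Z \<xi> = 0 \<and> V \<xi> < \<infinity> then w0 (upd m \<xi> s) else 0)"
    if "\<xi> \<in> space M" "sim (Suc k) (X m \<xi>) s" for \<xi> s
    using that by (simp add: w_def Zupd Vupd)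
  show ?thesis
  proof (rule that)
    show "w \<in> borel_measurable (A (lvl k (Suc (idx m))))" using wB1 by (simp add: B1_def)
    show "sqint M w" by fact
    show "AE \<xi> in M. w \<xi> = D k m u \<xi>" using weq by (simp add: w0_def)
    show "Kop k (\<lambda>_ _. 1) m w \<xi> = 0" if \<xi>: "\<xi> \<in> space M" for \<xi>
    proof -
      have "Kop k (\<lambda>_ _. 1) m w \<xi> = (\<integral>t. (if Z \<xi> = 0 \<and> V \<xi> < \<infinity> then 1 else 0) * (sind (Suc k) (X m \<xi>) t * (1 * w0 (upd m \<xi> t))) \<partial>lborel)"
        unfolding Kop_def by (rule Bochner_Integration.integral_cong) (auto simp: wupd \<xi>)
      also have "\<dots> = (if Z \<xi> = 0 \<and> V \<xi> < \<infinity> then 1 else 0) * Z \<xi>"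
        by (simp add: Z_def Kop_def)
      also have "\<dots> = 0" by simp
      finally show ?thesis .
    qed
    show "(\<integral>\<^sup>+s. sind (Suc k) (X m \<xi>) s * ennreal ((w (upd m \<xi> s))^2) \<partial>lborel) < \<infinity>" if \<xi>: "\<xi> \<in> space M" for \<xi>
    proof -
      have "(\<integral>\<^sup>+s. sind (Suc k) (X m \<xi>) s * ennreal ((w (upd m \<xi> s))^2) \<partial>lborel) =
          (\<integral>\<^sup>+s. (if Z \<xi> = 0 \<and> V \<xi> < \<infinity> then sind (Suc k) (X m \<xi>) s * ennreal ((w0 (upd m \<xi> s))^2) else 0) \<partial>lborel)"
        by (rule nn_integral_cong) (auto simp: wupd \<xi>)
      thus ?thesis by (cases "Z \<xi> = 0 \<and> V \<xi> < \<infinity>") (auto simp: V_def)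
    qed
    have "AE \<xi> in M. real_cond_exp M B0 w \<xi> = real_cond_exp M B0 w0 \<xi>"
      by (rule F0.real_cond_exp_cong[OF weq wM]) measurable
    thus "AE \<xi> in M. E (lvl k (idx m)) w \<xi> = 0"
      using E0 unfolding E_def B0_def[symmetric] by eventually_elim simp
  qed
qed

text \<open>For r < t in one cell of length 3^i the kernels differ by (t - r)/3^(i+1) minus the
  indicator of [r, t). The constant part is killed by the vanishing integral of w over the larger
  cell; on [r, t) the function w is constant in its m-th coordinate, so the other part contributes
  (t - r) times its value.\<close>

lemma kap_slice_diff:
  assumes m [simp]: "m \<in> K" and w: "w \<in> borel_measurable (A (lvl (Suc i) (Suc (idx m))))"
    and \<xi>: "\<xi> \<in> space M" and K0: "Kop (Suc i) (\<lambda>_ _. 1) m w \<xi> = 0"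
    and fin: "(\<integral>\<^sup>+s. sind (Suc (Suc i)) (X m \<xi>) s * ennreal ((w (upd m \<xi> s))^2) \<partial>lborel) < \<infinity>"
    and r: "sim (Suc (Suc i)) (X m \<xi>) r" and rt: "sim (Suc i) r t" "r < t"
  shows "(\<integral>s. sind (Suc (Suc i)) (X m \<xi>) s * (kap (Suc i) t s * w (upd m \<xi> s)) \<partial>lborel) =
    (\<integral>s. sind (Suc (Suc i)) (X m \<xi>) s * (kap (Suc i) r s * w (upd m \<xi> s)) \<partial>lborel) - (t - r) * w (upd m \<xi> r)"
proof -
  have wM [measurable]: "w \<in> borel_measurable M" using w by (rule measurable_A_M)
  have [measurable]: "\<xi> \<in> space M" by fact
  have rt': "sim (Suc (Suc i)) r t" using rt(1) sim_Suc_mono by blast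
  \<comment> \<open>A class containing two distinct points r < t is not that of a wall.\<close>
  have nw: "X m \<xi> \<notin> range (wall (Suc i))"
  proof
    assume "X m \<xi> \<in> range (wall (Suc i))"
    then obtain l where l: "X m \<xi> = wall (Suc i) l" by auto
    have "sgn (X m \<xi> - wall (Suc i) l) = sgn (r - wall (Suc i) l)" "sgn (r - wall (Suc i) l) = sgn (t - wall (Suc i) l)"
      using r rt' by (auto simp: sim_Suc)
    thus False using l rt(2) by (simp add: sgn_if split: if_splits)
  qed
  define g where "g = (\<lambda>s. sind (Suc (Suc i)) (X m \<xi>) s * w (upd m \<xi> s))"
  have ig: "integrable lborel g" unfolding g_def by (rule slice_cell_integrable(1)[OF m \<xi> wM fin nw])
  have [measurable]: "g \<in> borel_measurable borel" using borel_measurable_integrable[OF ig] by simp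
  have g0: "(\<integral>s. g s \<partial>lborel) = 0" using K0 by (simp add: Kop_def g_def)
  have ik: "integrable lborel (\<lambda>s. kap (Suc i) t s * g s)" for t
  proof (rule Bochner_Integration.integrable_bound[OF ig])
    show "AE s in lborel. norm (kap (Suc i) t s * g s) \<le> norm (g s)"
    proof (rule AE_I2)
      fix s show "norm (kap (Suc i) t s * g s) \<le> norm (g s)"
        using kap_bound[of "Suc i" t s] by (auto simp: abs_mult intro!: mult_left_le_one_le split: if_splits)
    qed
  qed measurable
  have eq: "(\<integral>s. sind (Suc (Suc i)) (X m \<xi>) s * (kap (Suc i) t s * w (upd m \<xi> s)) \<partial>lborel) = (\<integral>s. kap (Suc i) t s * g s \<partial>lborel)" for t
    by (rule Bochner_Integration.integral_cong) (auto simp: g_def)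
  have "(\<integral>s. kap (Suc i) t s * g s \<partial>lborel) - (\<integral>s. kap (Suc i) r s * g s \<partial>lborel) = (\<integral>s. kap (Suc i) t s * g s - kap (Suc i) r s * g s \<partial>lborel)"
    by (rule Bochner_Integration.integral_diff[symmetric, OF ik ik])
  also have "\<dots> = (\<integral>s. (t - r) / 3 ^ Suc i * g s - indicator {r..<t} s * w (upd m \<xi> r) \<partial>lborel)"
  proof (rule Bochner_Integration.integral_cong[OF refl])
    fix s
    show "kap (Suc i) t s * g s - kap (Suc i) r s * g s = (t - r) / 3 ^ Suc i * g s - indicator {r..<t} s * w (upd m \<xi> r)"
    proof (cases "sim (Suc (Suc i)) (X m \<xi>) s")
      case True
      have s: "sim (Suc (Suc i)) r s" "sim (Suc (Suc i)) t s"
        using True r rt' sim_trans sim_sym by blast+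
      have c: "ctr (Suc i) t = ctr (Suc i) r" using sim_ctr[OF rt'] by simp
      \<comment> \<open>Where the indicator is nonzero, s lies in the cell of length 3^i around r,
        on which w does not depend on its own coordinate.\<close>
      have ind: "indicator {r..<t} s * w (upd m \<xi> r) = indicator {r..<t} s * g s"
      proof (cases "r \<le> s \<and> s < t")
        case in_rt: True
        have "sim (Suc i) r s" using sim_between[OF rt(1)] in_rt by auto
        hence "w (upd m (upd m \<xi> r) s) = w (upd m \<xi> r)"
          using \<xi> by (intro measurable_A_D[OF w m]) (auto simp: upd_space X_upd lvl_self)
        thus ?thesis using True \<xi> by (simp add: g_def upd_upd)
      qed auto
      have "kap (Suc i) t s - kap (Suc i) r s = (t - r) / 3 ^ Suc i - indicator {r..<t} s"
        using s rt(2) by (auto simp: kap_def c indicator_def diff_divide_distrib)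
      hence "(kap (Suc i) t s - kap (Suc i) r s) * g s = ((t - r) / 3 ^ Suc i - indicator {r..<t} s) * g s" by simp
      thus ?thesis unfolding ind by (simp add: left_diff_distrib)
    next
      case False
      have "\<not> (r \<le> s \<and> s < t)"
      proof
        assume "r \<le> s \<and> s < t"
        hence "sim (Suc (Suc i)) r s" using sim_between[OF rt'] by auto
        thus False using False r sim_trans by blast
      qed
      thus ?thesis using False by (simp add: g_def)
    qed
  qed
  also have "\<dots> = (t - r) / 3 ^ Suc i * (\<integral>s. g s \<partial>lborel) - (t - r) * w (upd m \<xi> r)"
    using ig rt(2) by (subst Bochner_Integration.integral_diff) auto
  finally show ?thesis unfolding eq g0 by simp
qed

lemma kap_le_1: "\<bar>kap j r s\<bar> \<le> 1"
  using kap_bound[of j r s] by (auto split: if_splits)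

lemma kap_pair_measurable [measurable]: "(\<lambda>(r, s). kap j r s) \<in> borel_measurable (borel \<Otimes>\<^sub>M borel)"
  by measurable

text \<open>By \<open>kap_slice_diff\<close> the kernel applied to w has slope -w within a cell of
  length 3^i, and w times the coordinate has slope w, so the sum is constant there. Subtracting the
  centre, itself constant on the cell, keeps the second term of size 3^i. In the remaining
  coordinates w is already invariant within cells of that length.\<close>

lemma coarse_invariant:
  assumes m [simp]: "m \<in> K" and w: "w \<in> borel_measurable (A (lvl (Suc i) (Suc (idx m))))"
    and K0: "\<And>\<xi>. \<xi> \<in> space M ==> Kop (Suc i) (\<lambda>_ _. 1) m w \<xi> = 0"
    and fin: "\<And>\<xi>. \<xi> \<in> space M ==> (\<integral>\<^sup>+s. sind (Suc (Suc i)) (X m \<xi>) s * ennreal ((w (upd m \<xi> s))^2) \<partial>lborel) < \<infinity>"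
  shows "(\<lambda>\<xi>. Kop (Suc i) (kap (Suc i)) m w \<xi> + w \<xi> * (X m \<xi> - ctr i (X m \<xi>))) \<in> borel_measurable (A (\<lambda>_. Suc i))"
proof (rule measurable_AI)
  have wM [measurable]: "w \<in> borel_measurable M" using w by (rule measurable_A_M)
  show "(\<lambda>\<xi>. Kop (Suc i) (kap (Suc i)) m w \<xi> + w \<xi> * (X m \<xi> - ctr i (X m \<xi>))) \<in> borel_measurable M" by measurable
  fix m' \<xi> t assume *: "m' \<in> K" "\<xi> \<in> space M" "sim (Suc i) (X m' \<xi>) t"
  \<comment> \<open>Every level of this stage is \<open>Suc i\<close> or \<open>Suc (Suc i)\<close>,
    so the move is admissible for w in any coordinate.\<close>
  have **: "sim (lvl (Suc i) (Suc (idx m)) m') (X m' \<xi>) t"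
    by (rule sim_mono[OF _ *(3)]) (simp add: lvl_def)
  have wt: "w (upd m' \<xi> t) = w \<xi>" by (rule measurable_A_D[OF w *(1,2) **])
  show "Kop (Suc i) (kap (Suc i)) m w (upd m' \<xi> t) + w (upd m' \<xi> t) * (X m (upd m' \<xi> t) - ctr i (X m (upd m' \<xi> t))) =
      Kop (Suc i) (kap (Suc i)) m w \<xi> + w \<xi> * (X m \<xi> - ctr i (X m \<xi>))"
  proof (cases "m' = m")
    case True
    have s: "sim (Suc i) (X m \<xi>) t" using * True by simp
    have s': "sim (Suc (Suc i)) (X m \<xi>) t" using s by (rule sim_Suc_mono)
    have c: "ctr i t = ctr i (X m \<xi>)" using sim_ctr[OF s] by simp
    have "sind (Suc (Suc i)) t x = (sind (Suc (Suc i)) (X m \<xi>) x :: real)" for x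
      using s' sim_trans sim_sym by (metis (full_types))
    hence Kt: "Kop (Suc i) (kap (Suc i)) m w (upd m \<xi> t) = (\<integral>s. sind (Suc (Suc i)) (X m \<xi>) s * (kap (Suc i) t s * w (upd m \<xi> s)) \<partial>lborel)"
      using *(2) by (simp add: Kop_def X_upd upd_upd)
    have Kx: "Kop (Suc i) (kap (Suc i)) m w \<xi> = (\<integral>s. sind (Suc (Suc i)) (X m \<xi>) s * (kap (Suc i) (X m \<xi>) s * w (upd m \<xi> s)) \<partial>lborel)"
      by (simp add: Kop_def)
    have "Kop (Suc i) (kap (Suc i)) m w (upd m \<xi> t) = Kop (Suc i) (kap (Suc i)) m w \<xi> - (t - X m \<xi>) * w \<xi>"
    proof (cases t "X m \<xi>" rule: linorder_cases)
      case less
      show ?thesis unfolding Kt Kx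
        using kap_slice_diff[OF m w *(2) K0[OF *(2)] fin[OF *(2)] s' s[THEN sim_sym[THEN iffD1]] less] wt True
        by (simp add: algebra_simps)
    next
      case equal
      thus ?thesis using *(2) by (simp add: upd_X)
    next
      case greater
      show ?thesis unfolding Kt Kx
        using kap_slice_diff[OF m w *(2) K0[OF *(2)] fin[OF *(2)] sim_refl s greater] *(2)
        by (simp add: upd_X)
    qed
    thus ?thesis using True wt *(2) by (simp add: X_upd c algebra_simps)
  next
    case False
    have x: "X m (upd m' \<xi> t) = X m \<xi>" using X_upd_other[OF *(1) m] *(2) False by auto
    have "w (upd m (upd m' \<xi> t) s) = w (upd m \<xi> s)" for s
    proof -
      have "w (upd m' (upd m \<xi> s) t) = w (upd m \<xi> s)"
        by (rule measurable_A_D[OF w]) (use * ** False in \<open>auto simp: upd_space X_upd_other\<close>)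
      thus ?thesis using upd_comm[of m m' \<xi> s t] * False by simp
    qed
    thus ?thesis using x wt by (simp add: Kop_def)
  qed
qed

text \<open>One link of the telescoping sum for the distance between a coordinate and the centre of
  its cell, with the derivative already averaged at the scale j of the link.\<close>

definition gap :: "nat => 'k => ('a => real) => 'a => real" where
  "gap j m G \<xi> = (ctr j (X m \<xi>) - ctr (Suc j) (X m \<xi>)) * E (\<lambda>_. Suc j) G \<xi>"

text \<open>What remains of the distance below scale 0, at most 1/2; here the derivative stays
  unaveraged.\<close>

definition fine_gap :: "'k => ('a => real) => 'a => real" where
  "fine_gap m G \<xi> = (X m \<xi> - ctr 0 (X m \<xi>)) * G \<xi>"

lemma gap_bound:
  assumes m [simp]: "m \<in> K" and G: "sqint M G"
  shows "sqint M (gap j m G)" "nrm2 M (gap j m G) \<le> 2 * 3 ^ j * nrm2 M (E (\<lambda>_. Suc j) G)"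
proof -
  have meas: "gap j m G \<in> borel_measurable M" unfolding gap_def by measurable
  have ae: "AE \<xi> in M. \<bar>gap j m G \<xi>\<bar> \<le> 2 * 3 ^ j * \<bar>E (\<lambda>_. Suc j) G \<xi>\<bar>"
    by (rule AE_I2) (auto simp: gap_def abs_mult intro!: mult_right_mono ctr_dist_Suc)
  show "sqint M (gap j m G)" "nrm2 M (gap j m G) \<le> 2 * 3 ^ j * nrm2 M (E (\<lambda>_. Suc j) G)"
    using nrm2_mono_scaled[OF E_sqint(1)[OF G] meas ae] by simp_all
qed

lemma fine_gap_bound:
  assumes m [simp]: "m \<in> K" and G: "sqint M G"
  shows "sqint M (fine_gap m G)" "nrm2 M (fine_gap m G) \<le> nrm2 M G / 2"
proof -
  have [measurable]: "G \<in> borel_measurable M" using G by (rule sqint_measurable)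
  have meas: "fine_gap m G \<in> borel_measurable M" unfolding fine_gap_def by measurable
  have ae: "AE \<xi> in M. \<bar>fine_gap m G \<xi>\<bar> \<le> 1 / 2 * \<bar>G \<xi>\<bar>"
  proof (rule AE_I2)
    fix \<xi>
    have "\<bar>X m \<xi> - ctr 0 (X m \<xi>)\<bar> * \<bar>G \<xi>\<bar> \<le> 1 / 2 * \<bar>G \<xi>\<bar>"
      using ctr_dist[of "X m \<xi>" 0] by (intro mult_right_mono) simp_all
    thus "\<bar>fine_gap m G \<xi>\<bar> \<le> 1 / 2 * \<bar>G \<xi>\<bar>" by (simp only: fine_gap_def abs_mult)
  qed
  show "sqint M (fine_gap m G)" "nrm2 M (fine_gap m G) \<le> nrm2 M G / 2"
    using nrm2_mono_scaled[OF G meas ae] by simp_all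
qed

text \<open>w is measurable at the finer stage and has mean zero given the coarser one, so only the
  increment of \<phi> between these two stages pairs with it. This puts increments on the right-hand
  side of \<open>D_bound\<close>, where Bessel's inequality can sum them.\<close>

lemma inner_D:
  assumes m: "m \<in> K" and w: "w \<in> borel_measurable (A (lvl k (Suc (idx m))))" and sw: "sqint M w"
    and E0: "AE \<xi> in M. E (lvl k (idx m)) w \<xi> = 0" and \<phi>: "sqint M \<phi>"
  shows "(\<integral>x. w x * \<phi> x \<partial>M) = (\<integral>x. w x * D k m \<phi> x \<partial>M)"
proof -
  have wM [measurable]: "w \<in> borel_measurable M" using w by (rule measurable_A_M)
  note sE = E_sqint(1)[OF \<phi>]
  have "(\<integral>x. w x * E (lvl k (idx m)) \<phi> x \<partial>M) = (\<integral>x. E (lvl k (idx m)) \<phi> x * w x \<partial>M)" by (simp add: mult.commute)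
  also have "\<dots> = (\<integral>x. E (lvl k (idx m)) \<phi> x * E (lvl k (idx m)) w x \<partial>M)"
    by (rule E_adj[symmetric, OF sw sE]) (rule E_measurable_A)
  also have "\<dots> = (\<integral>x. 0 \<partial>M)" by (rule integral_cong_AE) (use E0 in \<open>auto elim: eventually_mono\<close>)
  finally have z: "(\<integral>x. w x * E (lvl k (idx m)) \<phi> x \<partial>M) = 0" by simp
  have "(\<integral>x. w x * D k m \<phi> x \<partial>M) = (\<integral>x. w x * E (lvl k (Suc (idx m))) \<phi> x - w x * E (lvl k (idx m)) \<phi> x \<partial>M)"
    by (simp add: D_def right_diff_distrib)
  also have "\<dots> = (\<integral>x. w x * E (lvl k (Suc (idx m))) \<phi> x \<partial>M) - (\<integral>x. w x * E (lvl k (idx m)) \<phi> x \<partial>M)"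
    by (intro Bochner_Integration.integral_diff sqint_mult_integrable sw sE)
  also have "\<dots> = (\<integral>x. w x * \<phi> x \<partial>M)" using E_adj[OF \<phi> sw w] z by simp
  finally show ?thesis by simp
qed

text \<open>For k = 0 the kernel has size 1 and the derivative is taken as it is. For k =
  \<open>Suc i\<close> the kernel applied to the increment w is \<theta> minus w times the distance
  to the centre at scale i, with \<theta> invariant at that scale; the distance telescopes, and each
  link is measurable at its own scale.\<close>

lemma D_bound:
  assumes m [simp]: "m \<in> K" and k: "k \<le> n" and u: "sqint M u" and G: "sqint M G" and ibp: "ibp u m G"
  shows "nrm2 M (D k m u) \<le> (case k of 0 => nrm2 M G
    | Suc i => 7 / 2 * 3 ^ i * nrm2 M (E (\<lambda>_. Suc i) G) + (\<Sum>j<i. nrm2 M (D k m (gap j m G))) + nrm2 M (D k m (fine_gap m G)))"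
    (is "_ \<le> ?R")
proof -
  have [measurable]: "G \<in> borel_measurable M" using G by (rule sqint_measurable)
  have "\<exists>w. w \<in> borel_measurable (A (lvl k (Suc (idx m)))) \<and> sqint M w \<and>
    (AE \<xi> in M. w \<xi> = D k m u \<xi>) \<and> (\<forall>\<xi>\<in>space M. Kop k (\<lambda>_ _. 1) m w \<xi> = 0) \<and>
    (\<forall>\<xi>\<in>space M. (\<integral>\<^sup>+s. sind (Suc k) (X m \<xi>) s * ennreal ((w (upd m \<xi> s))^2) \<partial>lborel) < \<infinity>) \<and>
    (AE \<xi> in M. E (lvl k (idx m)) w \<xi> = 0)"
    by (rule D_good_version[OF m k u]) blast
  then obtain w where w: "w \<in> borel_measurable (A (lvl k (Suc (idx m))))" and sw: "sqint M w"
    and weq: "AE \<xi> in M. w \<xi> = D k m u \<xi>" and K0': "\<forall>\<xi>\<in>space M. Kop k (\<lambda>_ _. 1) m w \<xi> = 0"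
    and fin': "\<forall>\<xi>\<in>space M. (\<integral>\<^sup>+s. sind (Suc k) (X m \<xi>) s * ennreal ((w (upd m \<xi> s))^2) \<partial>lborel) < \<infinity>"
    and E0: "AE \<xi> in M. E (lvl k (idx m)) w \<xi> = 0"
    by blast
  note K0 = bspec[OF K0'] and fin = bspec[OF fin']
  have wM [measurable]: "w \<in> borel_measurable M" using w by (rule measurable_A_M)
  have sD: "sqint M (D k m u)" by (rule D_sqint[OF u])
  have [measurable]: "D k m u \<in> borel_measurable M" using sD by (rule sqint_measurable)
  have nw: "nrm2 M (D k m u) = nrm2 M w"
    by (rule sqint_AE_cong(2)[OF sw]) (use weq in auto)
  have sK: "sqint M (Kop k (kap k) m w)" "nrm2 M (Kop k (kap k) m w) \<le> 3 ^ k * nrm2 M w"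
    using Kop_bound[OF m k _ kap_le_1 sw] by (auto simp: split_def)
  have "(nrm2 M w)^2 = (\<integral>x. w x * D k m u x \<partial>M)"
    unfolding nrm2_sq by (rule integral_cong_AE) (use weq in \<open>auto elim!: eventually_mono simp: power2_eq_square\<close>)
  also have "\<dots> = (\<integral>x. w x * u x \<partial>M)" by (rule inner_D[symmetric, OF m w sw E0 u])
  also have "\<dots> = (\<integral>x. Kop k (kap k) m w x * G x \<partial>M)"
    using ibp k sw K0 unfolding ibp_def by blast
  finally have sq: "(nrm2 M w)^2 = (\<integral>x. Kop k (kap k) m w x * G x \<partial>M)" .
  have "(nrm2 M w)^2 \<le> nrm2 M w * ?R"
  proof (cases k)
    case 0
    have "(nrm2 M w)^2 \<le> nrm2 M (Kop k (kap k) m w) * nrm2 M G"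
      using integral_mult_le_nrm2[OF sK(1) G] sq by simp
    also have "\<dots> \<le> nrm2 M w * nrm2 M G" using sK(2) 0 by (intro mult_right_mono) auto
    finally show ?thesis using 0 by simp
  next
    case (Suc i)
    \<comment> \<open>Measurable at level \<open>Suc i\<close> in all coordinates, so its pairing
      with \<open>G\<close> involves only the conditional expectation of \<open>G\<close> at that
      level.\<close>
    define \<theta> where "\<theta> = (\<lambda>\<xi>. Kop k (kap k) m w \<xi> + w \<xi> * (X m \<xi> - ctr i (X m \<xi>)))"
    have \<theta>A: "\<theta> \<in> borel_measurable (A (\<lambda>_. Suc i))"
      unfolding \<theta>_def Suc by (rule coarse_invariant) (use m w K0 fin Suc in auto)
    have wx: "sqint M (\<lambda>\<xi>. w \<xi> * (X m \<xi> - ctr i (X m \<xi>)))" "nrm2 M (\<lambda>\<xi>. w \<xi> * (X m \<xi> - ctr i (X m \<xi>))) \<le> 3 ^ i / 2 * nrm2 M w"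
    proof -
      have meas: "(\<lambda>\<xi>. w \<xi> * (X m \<xi> - ctr i (X m \<xi>))) \<in> borel_measurable M" by measurable
      have ae: "AE \<xi> in M. \<bar>w \<xi> * (X m \<xi> - ctr i (X m \<xi>))\<bar> \<le> 3 ^ i / 2 * \<bar>w \<xi>\<bar>"
      proof (rule AE_I2)
        fix \<xi>
        have "\<bar>w \<xi>\<bar> * \<bar>X m \<xi> - ctr i (X m \<xi>)\<bar> \<le> \<bar>w \<xi>\<bar> * (3 ^ i / 2)" by (intro mult_left_mono ctr_dist) simp
        thus "\<bar>w \<xi> * (X m \<xi> - ctr i (X m \<xi>))\<bar> \<le> 3 ^ i / 2 * \<bar>w \<xi>\<bar>" by (simp add: abs_mult mult.commute)
      qed
      show "sqint M (\<lambda>\<xi>. w \<xi> * (X m \<xi> - ctr i (X m \<xi>)))" "nrm2 M (\<lambda>\<xi>. w \<xi> * (X m \<xi> - ctr i (X m \<xi>))) \<le> 3 ^ i / 2 * nrm2 M w"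
        using nrm2_mono_scaled[OF sw meas ae] by simp_all
    qed
    have s\<theta>: "sqint M \<theta>" unfolding \<theta>_def by (intro sqint_add sK wx)
    have "nrm2 M \<theta> \<le> nrm2 M (Kop k (kap k) m w) + nrm2 M (\<lambda>\<xi>. w \<xi> * (X m \<xi> - ctr i (X m \<xi>)))"
      unfolding \<theta>_def by (rule nrm2_triangle[OF sK(1) wx(1)])
    \<comment> \<open>7/2 = 3 + 1/2: the kernel has norm 3^k = 3 * 3^i, and the distance to the
      centre is at most half a cell.\<close>
    also have "\<dots> \<le> 7 / 2 * 3 ^ i * nrm2 M w" using sK(2) wx(2) Suc by simp
    finally have n\<theta>: "nrm2 M \<theta> \<le> 7 / 2 * 3 ^ i * nrm2 M w" .
    have sg: "sqint M (\<lambda>\<xi>. (ctr j (X m \<xi>) - ctr (Suc j) (X m \<xi>)) * G \<xi>)" for j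
      by (rule sqint_bounded_mult[OF G _ ctr_dist_Suc]) measurable
    have tel: "X m \<xi> - ctr i (X m \<xi>) = (X m \<xi> - ctr 0 (X m \<xi>)) + (\<Sum>j<i. ctr j (X m \<xi>) - ctr (Suc j) (X m \<xi>))" for \<xi>
      using sum_lessThan_telescope'[of "\<lambda>j. ctr j (X m \<xi>)" i] by simp
    have "(\<integral>x. Kop k (kap k) m w x * G x \<partial>M) =
        (\<integral>x. \<theta> x * G x - (w x * fine_gap m G x + (\<Sum>j<i. w x * ((ctr j (X m x) - ctr (Suc j) (X m x)) * G x))) \<partial>M)"
    proof (rule Bochner_Integration.integral_cong[OF refl])
      fix x
      have "w x * fine_gap m G x + (\<Sum>j<i. w x * ((ctr j (X m x) - ctr (Suc j) (X m x)) * G x)) = w x * (X m x - ctr i (X m x)) * G x"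
        unfolding tel fine_gap_def by (simp add: sum_distrib_left sum_distrib_right algebra_simps)
      thus "Kop k (kap k) m w x * G x = \<theta> x * G x - (w x * fine_gap m G x + (\<Sum>j<i. w x * ((ctr j (X m x) - ctr (Suc j) (X m x)) * G x)))"
        by (simp add: \<theta>_def algebra_simps)
    qed
    also have "\<dots> = (\<integral>x. \<theta> x * G x \<partial>M) - ((\<integral>x. w x * fine_gap m G x \<partial>M) +
        (\<Sum>j<i. \<integral>x. w x * ((ctr j (X m x) - ctr (Suc j) (X m x)) * G x) \<partial>M))"
      using sqint_mult_integrable[OF s\<theta> G] sqint_mult_integrable[OF sw fine_gap_bound(1)[OF m G]] sqint_mult_integrable[OF sw sg]
      by simp
    also have "(\<integral>x. \<theta> x * G x \<partial>M) = (\<integral>x. \<theta> x * E (\<lambda>_. Suc i) G x \<partial>M)" by (rule E_adj[symmetric, OF G s\<theta> \<theta>A])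
    also have "(\<integral>x. w x * fine_gap m G x \<partial>M) = (\<integral>x. w x * D k m (fine_gap m G) x \<partial>M)"
      by (rule inner_D[OF m w sw E0 fine_gap_bound(1)[OF m G]])
    also have "(\<Sum>j<i. \<integral>x. w x * ((ctr j (X m x) - ctr (Suc j) (X m x)) * G x) \<partial>M) = (\<Sum>j<i. \<integral>x. w x * D k m (gap j m G) x \<partial>M)"
    proof (rule sum.cong[OF refl])
      fix j assume j: "j \<in> {..<i}"
      \<comment> \<open>The two centres are constant on cells of scale j, and so is w in every
        coordinate because j < i; this is what permits averaging \<open>G\<close> at scale
        j.\<close>
      define v where "v = (\<lambda>x. (ctr j (X m x) - ctr (Suc j) (X m x)) * w x)"
      have sv: "sqint M v" unfolding v_def by (rule sqint_bounded_mult[OF sw _ ctr_dist_Suc]) measurable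
      have vA: "v \<in> borel_measurable (A (\<lambda>_. Suc j))"
      proof (rule measurable_AI)
        show "v \<in> borel_measurable M" using sv by (rule sqint_measurable)
        fix m' \<xi> t assume *: "m' \<in> K" "\<xi> \<in> space M" "sim (Suc j) (X m' \<xi>) t"
        have "sim (lvl k (Suc (idx m)) m') (X m' \<xi>) t"
          by (rule sim_mono[OF _ *(3)]) (use j Suc in \<open>auto simp: lvl_def\<close>)
        hence wt: "w (upd m' \<xi> t) = w \<xi>" by (rule measurable_A_D[OF w *(1,2)])
        have "ctr j (X m (upd m' \<xi> t)) = ctr j (X m \<xi>) \<and> ctr (Suc j) (X m (upd m' \<xi> t)) = ctr (Suc j) (X m \<xi>)"
        proof (cases "m' = m")
          case True
          thus ?thesis using * sim_ctr[OF *(3)] sim_ctr[OF sim_Suc_mono[OF *(3)]] by (simp add: X_upd)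
        next
          case False
          thus ?thesis using X_upd_other[OF *(1) m] *(2) by auto
        qed
        thus "v (upd m' \<xi> t) = v \<xi>" by (simp add: v_def wt)
      qed
      have "(\<integral>x. w x * ((ctr j (X m x) - ctr (Suc j) (X m x)) * G x) \<partial>M) = (\<integral>x. v x * G x \<partial>M)"
        by (simp add: v_def mult_ac)
      also have "\<dots> = (\<integral>x. v x * E (\<lambda>_. Suc j) G x \<partial>M)" by (rule E_adj[symmetric, OF G sv vA])
      also have "\<dots> = (\<integral>x. w x * gap j m G x \<partial>M)" by (simp add: v_def gap_def mult_ac)
      also have "\<dots> = (\<integral>x. w x * D k m (gap j m G) x \<partial>M)"
        by (rule inner_D[OF m w sw E0 gap_bound(1)[OF m G]])
      finally show "(\<integral>x. w x * ((ctr j (X m x) - ctr (Suc j) (X m x)) * G x) \<partial>M) = (\<integral>x. w x * D k m (gap j m G) x \<partial>M)" .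
    qed
    finally have eq: "(nrm2 M w)^2 = (\<integral>x. \<theta> x * E (\<lambda>_. Suc i) G x \<partial>M) -
        ((\<integral>x. w x * D k m (fine_gap m G) x \<partial>M) + (\<Sum>j<i. \<integral>x. w x * D k m (gap j m G) x \<partial>M))"
      unfolding sq .
    have b1: "\<bar>\<integral>x. \<theta> x * E (\<lambda>_. Suc i) G x \<partial>M\<bar> \<le> nrm2 M w * (7 / 2 * 3 ^ i * nrm2 M (E (\<lambda>_. Suc i) G))"
    proof -
      have "\<bar>\<integral>x. \<theta> x * E (\<lambda>_. Suc i) G x \<partial>M\<bar> \<le> nrm2 M \<theta> * nrm2 M (E (\<lambda>_. Suc i) G)"
        by (rule integral_mult_le_nrm2[OF s\<theta> E_sqint(1)[OF G]])
      also have "\<dots> \<le> (7 / 2 * 3 ^ i * nrm2 M w) * nrm2 M (E (\<lambda>_. Suc i) G)" by (rule mult_right_mono[OF n\<theta>]) simp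
      finally show ?thesis by (simp add: mult_ac)
    qed
    have b2: "\<bar>\<integral>x. w x * D k m \<phi> x \<partial>M\<bar> \<le> nrm2 M w * nrm2 M (D k m \<phi>)" if "sqint M \<phi>" for \<phi>
      by (rule integral_mult_le_nrm2[OF sw D_sqint[OF that]])
    have "\<bar>\<Sum>j<i. \<integral>x. w x * D k m (gap j m G) x \<partial>M\<bar> \<le> (\<Sum>j<i. \<bar>\<integral>x. w x * D k m (gap j m G) x \<partial>M\<bar>)" by (rule sum_abs)
    also have "\<dots> \<le> (\<Sum>j<i. nrm2 M w * nrm2 M (D k m (gap j m G)))" by (intro sum_mono b2 gap_bound(1)[OF m G])
    finally have b3: "\<bar>\<Sum>j<i. \<integral>x. w x * D k m (gap j m G) x \<partial>M\<bar> \<le> nrm2 M w * (\<Sum>j<i. nrm2 M (D k m (gap j m G)))"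
      by (simp add: sum_distrib_left)
    have "(nrm2 M w)^2 \<le> nrm2 M w * (7 / 2 * 3 ^ i * nrm2 M (E (\<lambda>_. Suc i) G)) +
        nrm2 M w * (\<Sum>j<i. nrm2 M (D k m (gap j m G))) + nrm2 M w * nrm2 M (D k m (fine_gap m G))"
      using eq b1 b2[OF fine_gap_bound(1)[OF m G]] b3 by linarith
    thus ?thesis unfolding Suc by (simp only: nat.case distrib_left)
  qed
  \<comment> \<open>Covers a vanishing increment, where the common factor \<open>nrm2 M w\<close>
    cannot be cancelled.\<close>
  moreover have "0 \<le> ?R" by (auto split: nat.split intro!: add_nonneg_nonneg sum_nonneg mult_nonneg_nonneg)
  ultimately show ?thesis unfolding nw power2_eq_square
    by (cases "nrm2 M w = 0") (auto simp: mult_le_cancel_left less_le)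
qed

text \<open>Bessel's inequality makes the sum over scales \<open>k\<close> of each \<open>D k m (gap j m (G m))\<close> cost a single
  \<open>gap j m (G m)\<close>, so that no logarithm of the scale ratio is lost.\<close>

theorem multiscale_poincare:
  assumes u: "sqint M u" and G: "\<And>m. m \<in> K ==> sqint M (G m)" and ibp: "\<And>m. m \<in> K ==> ibp u m (G m)"
    and top: "AE \<xi> in M. E (\<lambda>_. Suc n) u \<xi> = 0"
  shows "nrm2 M u \<le> 6 * L2_set (\<lambda>m. nrm2 M (G m)) K + 6 * (\<Sum>j\<le>n. 3 ^ j * L2_set (\<lambda>m. nrm2 M (E (\<lambda>_. Suc j) (G m))) K)"
proof -
  define I where "I = {..n} \<times> K"
  have finI: "finite I" by (simp add: I_def finK)
  have split: "(\<Sum>p\<in>I. f (fst p) (snd p)) = (\<Sum>m\<in>K. \<Sum>k\<le>n. f k m)" for f :: "nat => 'k => real"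
    unfolding I_def by (subst sum.swap) (simp add: sum.cartesian_product split_def)
  \<comment> \<open>\<open>H\<close> may depend on the coordinate: for each m the sum over the
    scales is bounded separately, and only then are the coordinates added.\<close>
  have bessel: "L2_set (\<lambda>p. nrm2 M (D (fst p) (snd p) (H (snd p)))) I \<le> B * L2_set (\<lambda>m. nrm2 M (H' m)) K"
    if H: "\<And>m. m \<in> K ==> sqint M (H m)" "\<And>m. m \<in> K ==> nrm2 M (H m) \<le> B * nrm2 M (H' m)" and B: "0 \<le> B" for H H' B
  proof -
    have "L2_set (\<lambda>p. nrm2 M (D (fst p) (snd p) (H (snd p)))) I = sqrt (\<Sum>m\<in>K. \<Sum>k\<le>n. (nrm2 M (D k m (H m)))^2)"
      unfolding L2_set_def split[of "\<lambda>k m. (nrm2 M (D k m (H m)))^2"] ..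
    also have "\<dots> \<le> sqrt (\<Sum>m\<in>K. (nrm2 M (H m))^2)"
      by (intro real_sqrt_le_mono sum_mono D_bessel H)
    also have "\<dots> \<le> L2_set (\<lambda>m. B * nrm2 M (H' m)) K"
      unfolding L2_set_def by (intro real_sqrt_le_mono sum_mono power_mono H) auto
    also have "\<dots> = B * L2_set (\<lambda>m. nrm2 M (H' m)) K" by (rule L2_set_right_distrib[symmetric, OF B])
    finally show ?thesis .
  qed
  define N where "N = L2_set (\<lambda>m. nrm2 M (G m)) K"
  define S where "S = (\<lambda>j. L2_set (\<lambda>m. nrm2 M (E (\<lambda>_. Suc j) (G m))) K)"
  define a0 where "a0 = (\<lambda>p::nat \<times> 'k. if fst p = 0 then nrm2 M (G (snd p)) else 0)"
  define a where "a = (\<lambda>i (p::nat \<times> 'k). if fst p = Suc i then 7 / 2 * 3 ^ i * nrm2 M (E (\<lambda>_. Suc i) (G (snd p))) else 0)"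
  define b where "b = (\<lambda>p. nrm2 M (D (fst p) (snd p) (fine_gap (snd p) (G (snd p)))))"
  define c where "c = (\<lambda>j p. nrm2 M (D (fst p) (snd p) (gap j (snd p) (G (snd p)))))"
  have "(nrm2 M u)^2 = (\<Sum>k\<le>n. \<Sum>m\<in>K. (nrm2 M (D k m u))^2)"
  proof -
    \<comment> \<open>With no mean left at the coarsest level, the increments account for all of
      u.\<close>
    have "nrm2 M (E (\<lambda>_. Suc n) u) = nrm2 M (\<lambda>_. 0)"
      by (rule sqint_AE_cong(2)) (use top in \<open>auto elim: eventually_mono\<close>)
    thus ?thesis using D_sum_levels[OF u] by (simp add: nrm2_def)
  qed
  also have "\<dots> = (\<Sum>p\<in>I. (nrm2 M (D (fst p) (snd p) u))^2)"
    unfolding I_def by (simp add: sum.cartesian_product split_def)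
  finally have "nrm2 M u = L2_set (\<lambda>p. nrm2 M (D (fst p) (snd p) u)) I"
    unfolding L2_set_def by (metis nrm2_nonneg real_sqrt_unique)
  also have "\<dots> \<le> L2_set (\<lambda>p. a0 p + b p + (\<Sum>j<n. a j p + c j p)) I"
  proof (rule L2_set_mono)
    fix p assume "p \<in> I"
    then obtain k m where p: "p = (k, m)" "k \<le> n" "m \<in> K" by (auto simp: I_def)
    note bd = D_bound[OF p(3,2) u G[OF p(3)] ibp[OF p(3)]]
    have nn: "0 \<le> a0 p" "0 \<le> b p" "\<And>j. 0 \<le> a j p" "\<And>j. 0 \<le> c j p" by (auto simp: a0_def b_def a_def c_def)
    show "nrm2 M (D (fst p) (snd p) u) \<le> a0 p + b p + (\<Sum>j<n. a j p + c j p)"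
    proof (cases k)
      case 0
      have "nrm2 M (D k m u) \<le> a0 p" using bd 0 by (simp add: a0_def p)
      moreover have "0 \<le> (\<Sum>j<n. a j p + c j p)" by (intro sum_nonneg add_nonneg_nonneg nn)
      ultimately show ?thesis using nn p by simp
    next
      case (Suc i)
      have "nrm2 M (D k m u) \<le> a i p + (\<Sum>j<i. c j p) + b p" using bd Suc by (simp add: a_def b_def c_def p)
      also have "(\<Sum>j<i. c j p) \<le> (\<Sum>j<n. c j p)" using Suc p(2) nn by (intro sum_mono2) auto
      also have "a i p \<le> (\<Sum>j<n. a j p)" using Suc p(2) nn by (intro member_le_sum) auto
      finally show ?thesis using nn p by (simp add: sum.distrib)
    qed
  qed simp
  also have "\<dots> \<le> L2_set a0 I + L2_set b I + (\<Sum>j<n. L2_set (a j) I + L2_set (c j) I)"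
  proof -
    have "L2_set (\<lambda>p. \<Sum>j<n. a j p + c j p) I \<le> (\<Sum>j<n. L2_set (\<lambda>p. a j p + c j p) I)" by (rule L2_set_sum_le) simp
    also have "\<dots> \<le> (\<Sum>j<n. L2_set (a j) I + L2_set (c j) I)" by (intro sum_mono L2_set_triangle_ineq)
    finally show ?thesis
      using L2_set_triangle_ineq[of "\<lambda>p. a0 p + b p" "\<lambda>p. \<Sum>j<n. a j p + c j p" I] L2_set_triangle_ineq[of a0 b I] by simp
  qed
  \<comment> \<open>1 comes from the scale k = 0 and 1/2 from \<open>fine_gap\<close>; at each scale
    j, 7/2 comes from \<theta> and 2 from \<open>gap\<close>. Both 3/2 and 11/2 are rounded up to
    6.\<close>
  also have "\<dots> \<le> N + 1 / 2 * N + (\<Sum>j<n. 7 / 2 * 3 ^ j * S j + 2 * 3 ^ j * S j)"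
  proof (intro add_mono sum_mono)
    \<comment> \<open>These terms live on a single scale each, so the sum over the scales adds
      nothing.\<close>
    have one: "(\<Sum>p\<in>I. (if fst p = k then f (snd p) else 0)^2) \<le> (\<Sum>m\<in>K. (f m)^2)" for k and f :: "'k => real"
    proof -
      have "(\<Sum>p\<in>I. (if fst p = k then f (snd p) else 0)^2) = (\<Sum>m\<in>K. \<Sum>l\<le>n. (if l = k then f m else 0)^2)"
        by (rule split[of "\<lambda>l m. (if l = k then f m else 0)^2"])
      also have "\<dots> = (\<Sum>m\<in>K. \<Sum>l\<le>n. if k = l then (f m)^2 else 0)"
        by (intro sum.cong refl) auto
      also have "\<dots> \<le> (\<Sum>m\<in>K. (f m)^2)" by (intro sum_mono) (simp add: sum.delta)
      finally show ?thesis .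
    qed
    show "L2_set a0 I \<le> N" unfolding L2_set_def N_def a0_def by (intro real_sqrt_le_mono one)
    show "L2_set b I \<le> 1 / 2 * N" unfolding b_def N_def
      by (rule bessel) (use fine_gap_bound G in auto)
    fix j
    show "L2_set (c j) I \<le> 2 * 3 ^ j * S j" unfolding c_def S_def
      by (rule bessel) (use gap_bound G in auto)
    have "L2_set (a j) I \<le> L2_set (\<lambda>m. 7 / 2 * 3 ^ j * nrm2 M (E (\<lambda>_. Suc j) (G m))) K"
      unfolding L2_set_def a_def by (intro real_sqrt_le_mono one)
    also have "\<dots> = 7 / 2 * 3 ^ j * S j" unfolding S_def by (rule L2_set_right_distrib[symmetric]) simp
    finally show "L2_set (a j) I \<le> 7 / 2 * 3 ^ j * S j" .
  qed
  also have "\<dots> \<le> 6 * N + 6 * (\<Sum>j\<le>n. 3 ^ j * S j)"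
  proof -
    have N0: "0 \<le> N" and S0: "\<And>j. 0 \<le> S j" by (auto simp: N_def S_def)
    have "(\<Sum>j<n. 7 / 2 * 3 ^ j * S j + 2 * 3 ^ j * S j) \<le> (\<Sum>j<n. 6 * (3 ^ j * S j))"
      using S0 by (intro sum_mono) (simp add: field_simps)
    also have "\<dots> \<le> (\<Sum>j\<le>n. 6 * (3 ^ j * S j))" using S0 by (intro sum_mono2) auto
    finally show ?thesis using N0 by (simp add: sum_distrib_left)
  qed
  finally show ?thesis by (simp add: N_def S_def)
qed

end

lemma AE_unif3_iff: "(AE t in unif3 n. P t) \<longleftrightarrow> (AE t in lborel. t \<in> interval3 n --> P t)"
  unfolding unif3_def by (subst AE_density) (auto simp: indicator_def intro!: AE_cong)

lemma integrable_unif3_iff: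
  fixes f :: "real => real"
  assumes [measurable]: "f \<in> borel_measurable borel"
  shows "integrable (unif3 n) f \<longleftrightarrow> set_integrable lborel (interval3 n) f"
proof -
  have "integrable (unif3 n) f \<longleftrightarrow> integrable lborel (\<lambda>t. (indicator (interval3 n) t / 3 ^ n) *\<^sub>R f t)"
    unfolding unif3_def by (rule integrable_density) auto
  also have "(\<lambda>t. (indicator (interval3 n) t / 3 ^ n) *\<^sub>R f t) = (\<lambda>t. (1 / 3 ^ n) * (indicator (interval3 n) t *\<^sub>R f t))"
    by auto
  also have "integrable lborel (\<lambda>t. (1 / 3 ^ n) * (indicator (interval3 n) t *\<^sub>R f t)) \<longleftrightarrow>
      integrable lborel (\<lambda>t. indicator (interval3 n) t *\<^sub>R f t)"
    using integrable_mult_left_iff[of lborel "1 / 3 ^ n" "\<lambda>t. indicator (interval3 n) t *\<^sub>R f t"] by simp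
  finally show ?thesis unfolding set_integrable_def .
qed

section \<open>Weak derivatives from smooth slices, and their limits\<close>

context resample_space
begin

text \<open>Converse of \<open>AE_resample\<close>: an almost sure statement is reduced to one along
  slices, where calculus in one variable applies.\<close>

lemma AE_resampleI:
  assumes m [simp]: "m \<in> K" and [measurable]: "Measurable.pred M Q"
    and ae: "AE \<xi> in M. AE t in unif3 n. Q (upd m \<xi> t)"
  shows "AE \<xi> in M. Q \<xi>"
proof -
  interpret U: prob_space "unif3 n" by (rule prob_space_unif3)
  define N where "N = {\<xi>\<in>space M. \<not> Q \<xi>}"
  have [measurable]: "N \<in> sets M" unfolding N_def by measurable
  have "AE \<xi> in M. (\<integral>\<^sup>+t. indicator N (upd m \<xi> t) \<partial>unif3 n) = (0::ennreal)"
    using ae AE_space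
  proof eventually_elim
    case (elim \<xi>)
    hence [measurable]: "\<xi> \<in> space M" by simp
    show ?case
    proof (subst nn_integral_0_iff_AE)
      show "AE t in unif3 n. indicator N (upd m \<xi> t) = (0::ennreal)"
        using elim(1) by eventually_elim (simp add: N_def indicator_def)
    qed measurable
  qed
  hence "(\<integral>\<^sup>+\<xi>. \<integral>\<^sup>+t. indicator N (upd m \<xi> t) \<partial>unif3 n \<partial>M) = (0::ennreal)"
    by (subst nn_integral_0_iff_AE) measurable
  hence "(\<integral>\<^sup>+\<xi>. indicator N \<xi> \<partial>M) = 0" using resample[OF m, of "indicator N"] by simp
  thus ?thesis by (intro AE_I[of _ _ N]) (auto simp: N_def)
qed

lemma AE_slice_integrable:
  assumes m [simp]: "m \<in> K" and u: "sqint M u"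
  shows "AE \<xi> in M. set_integrable lborel (interval3 n) (\<lambda>t. u (upd m \<xi> t))"
proof -
  interpret U: prob_space "unif3 n" by (rule prob_space_unif3)
  have [measurable]: "u \<in> borel_measurable M" using u by (rule sqint_measurable)
  have "integrable M u" by (rule sqint_integrable[OF u])
  hence "(\<integral>\<^sup>+\<xi>. ennreal \<bar>u \<xi>\<bar> \<partial>M) < \<infinity>" by (simp add: integrable_iff_bounded)
  also have "(\<integral>\<^sup>+\<xi>. ennreal \<bar>u \<xi>\<bar> \<partial>M) = (\<integral>\<^sup>+\<xi>. \<integral>\<^sup>+t. ennreal \<bar>u (upd m \<xi> t)\<bar> \<partial>unif3 n \<partial>M)"
    by (rule resample) simp_all
  finally have "AE \<xi> in M. (\<integral>\<^sup>+t. ennreal \<bar>u (upd m \<xi> t)\<bar> \<partial>unif3 n) \<noteq> \<infinity>"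
    by (intro nn_integral_PInf_AE) simp_all
  thus ?thesis using AE_space
  proof eventually_elim
    case (elim \<xi>)
    hence [measurable]: "\<xi> \<in> space M" by simp
    have "integrable (unif3 n) (\<lambda>t. u (upd m \<xi> t))"
      using elim(1) by (intro integrableI_bounded) (auto simp: less_top)
    thus ?case by (subst (asm) integrable_unif3_iff) measurable
  qed
qed

text \<open>On each slice the kernel formula holds for the smooth representatives, while u and G
  agree with them only almost everywhere. Resampling the coordinate makes its exceptional values
  negligible.\<close>

lemma mean_value_identity:
  assumes m [simp]: "m \<in> K" and j: "j \<le> n" and u: "sqint M u" and G: "sqint M G"
    and smooth: "AE \<xi> in M. \<exists>\<phi> \<psi>. (\<forall>t\<in>interval3 n. (\<phi> has_real_derivative \<psi> t) (at t)) \<and> continuous_on (interval3 n) \<psi> \<and>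
      (AE t in unif3 n. u (upd m \<xi> t) = \<phi> t \<and> G (upd m \<xi> t) = \<psi> t)"
  shows "AE \<xi> in M. u \<xi> - Kop j (\<lambda>_ _. 1) m u \<xi> / 3 ^ j = Kop j (\<lambda>s t. kap j t s) m G \<xi>"
proof (rule AE_resampleI[OF m])
  have [measurable]: "u \<in> borel_measurable M" "G \<in> borel_measurable M" using u G by (auto intro: sqint_measurable)
  show "Measurable.pred M (\<lambda>\<xi>. u \<xi> - Kop j (\<lambda>_ _. 1) m u \<xi> / 3 ^ j = Kop j (\<lambda>s t. kap j t s) m G \<xi>)" by measurable
  show "AE \<xi> in M. AE s in unif3 n. u (upd m \<xi> s) - Kop j (\<lambda>_ _. 1) m u (upd m \<xi> s) / 3 ^ j =
      Kop j (\<lambda>s t. kap j t s) m G (upd m \<xi> s)"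
    using smooth AE_slice_integrable[OF m u] AE_slice_integrable[OF m G] AE_space
  proof eventually_elim
    case (elim \<xi>)
    hence [measurable]: "\<xi> \<in> space M" by simp
    from elim(1) obtain \<phi> \<psi> where der: "\<And>t. t \<in> interval3 n ==> (\<phi> has_real_derivative \<psi> t) (at t)"
      and cont: "continuous_on (interval3 n) \<psi>" and ae: "AE t in unif3 n. u (upd m \<xi> t) = \<phi> t \<and> G (upd m \<xi> t) = \<psi> t"
      by auto
    have ae': "AE t in lborel. t \<in> interval3 n --> u (upd m \<xi> t) = \<phi> t \<and> G (upd m \<xi> t) = \<psi> t"
      using ae by (simp only: AE_unif3_iff)
    have \<phi>c: "continuous_on (interval3 n) \<phi>"
      using der by (intro continuous_at_imp_continuous_on) (auto intro: DERIV_isCont)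
    have op: "interval3 n \<in> sets lborel" by simp
    have si: "set_integrable lborel (interval3 n) \<phi>" "set_integrable lborel (interval3 n) \<psi>"
    proof -
      have mm: "(\<lambda>t. indicator (interval3 n) t *\<^sub>R \<phi> t) \<in> borel_measurable lborel"
        "(\<lambda>t. indicator (interval3 n) t *\<^sub>R \<psi> t) \<in> borel_measurable lborel"
        unfolding measurable_lborel2 by (rule borel_measurable_continuous_on_indicator; simp add: \<phi>c cont)+
      show "set_integrable lborel (interval3 n) \<phi>"
        using elim(2) unfolding set_integrable_def
        by (rule integrable_cong_AE_imp[OF _ mm(1)]) (use ae' in \<open>auto elim!: eventually_mono simp: indicator_def\<close>)
      show "set_integrable lborel (interval3 n) \<psi>"
        using elim(3) unfolding set_integrable_def
        by (rule integrable_cong_AE_imp[OF _ mm(2)]) (use ae' in \<open>auto elim!: eventually_mono simp: indicator_def\<close>)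
    qed
    show ?case
      using AE_unif3[OF AE_nonwall[of j], of n] ae
    proof eventually_elim
      case s: (elim s)
      define a b where "a = ctr j s - 3 ^ j / 2" and "b = ctr j s + 3 ^ j / 2"
      have cell: "sim (Suc j) s t \<longleftrightarrow> t \<in> {a<..<b}" for t using sim_iff_cell[of s j t] s by (simp add: a_def b_def)
      have sub: "{a<..<b} \<subseteq> interval3 n" using cell sim_interval3[of "Suc j" n s] j s by auto
      have sab: "s \<in> {a<..<b}" using cell[of s] by simp
      have ba: "b - a = 3 ^ j" by (simp add: a_def b_def)
      have [measurable]: "(\<lambda>t. indicator {a<..<b} t *\<^sub>R \<phi> t) \<in> borel_measurable borel"
        "(\<lambda>t. indicator {a<..<b} t *\<^sub>R \<psi> t) \<in> borel_measurable borel"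
        by (rule borel_measurable_continuous_on_indicator; simp add: continuous_on_subset[OF \<phi>c sub] continuous_on_subset[OF cont sub])+
      have k1: "Kop j (\<lambda>_ _. 1) m u (upd m \<xi> s) = (LBINT t:{a<..<b}. \<phi> t)"
        unfolding Kop_def set_lebesgue_integral_def
      proof (rule integral_cong_AE)
        show "AE t in lborel. sind (Suc j) (X m (upd m \<xi> s)) t * (1 * u (upd m (upd m \<xi> s) t)) = indicator {a<..<b} t *\<^sub>R \<phi> t"
          using ae' by eventually_elim (use sub elim(4) in \<open>auto simp: X_upd upd_upd cell indicator_def\<close>)
      qed measurable
      have k2: "Kop j (\<lambda>s t. kap j t s) m G (upd m \<xi> s) = (LBINT r:{a<..<b}. ((r - a) / (b - a) - (if s < r then 1 else 0)) * \<psi> r)"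
        unfolding Kop_def set_lebesgue_integral_def
      proof (rule integral_cong_AE)
        have "(\<lambda>r. indicator {a<..<b} r *\<^sub>R (((r - a) / (b - a) - (if s < r then 1 else 0)) * \<psi> r)) =
            (\<lambda>r. ((r - a) / (b - a) - (if s < r then 1 else 0)) * (indicator {a<..<b} r *\<^sub>R \<psi> r))" by auto
        also have "\<dots> \<in> borel_measurable lborel" by measurable
        finally show "(\<lambda>r. indicator {a<..<b} r *\<^sub>R (((r - a) / (b - a) - (if s < r then 1 else 0)) * \<psi> r)) \<in> borel_measurable lborel" .
        \<comment> \<open>\<open>kap\<close> takes the point of integration first, so the kernel of
          the mean value formula at s and t is \<open>kap j t s\<close>.\<close>
        have K: "kap j t s = (t - a) / (b - a) - (if s < t then 1 else 0)" if "t \<in> {a<..<b}" for t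
        proof -
          have st: "sim (Suc j) s t" using that cell by simp
          have "ctr j t = ctr j s" using sim_ctr[OF st] by simp
          moreover have "(t - a) / 3 ^ j = (t - ctr j s) / 3 ^ j + 1 / 2" by (simp add: a_def field_simps)
          ultimately show ?thesis using st by (simp add: kap_def sim_sym[of _ t s] ba)
        qed
        show "AE r in lborel. sind (Suc j) (X m (upd m \<xi> s)) r * (kap j r (X m (upd m \<xi> s)) * G (upd m (upd m \<xi> s) r)) =
            indicator {a<..<b} r *\<^sub>R (((r - a) / (b - a) - (if s < r then 1 else 0)) * \<psi> r)"
          using ae' by eventually_elim (use sub elim(4) in \<open>auto simp: X_upd upd_upd cell indicator_def K\<close>)
      qed measurable
      have "\<phi> s - (LBINT t:{a<..<b}. \<phi> t) / (b - a) = (LBINT r:{a<..<b}. ((r - a) / (b - a) - (if s < r then 1 else 0)) * \<psi> r)"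
        by (rule mean_value_kernel[OF _ sab])
          (use sab sub der in \<open>auto intro!: continuous_on_subset[OF cont sub] set_integrable_subset[OF si(1)] set_integrable_subset[OF si(2)]\<close>)
      thus ?case using s k1 k2 by (simp add: ba)
    qed
  qed
qed

text \<open>Pair \<open>mean_value_identity\<close> with w and transpose both operators: the cell
  mean disappears because w has vanishing cell integrals, and the kernel passes from G to w with its
  arguments exchanged.\<close>

lemma ibp_smooth:
  assumes m [simp]: "m \<in> K" and u: "sqint M u" and G: "sqint M G"
    and smooth: "AE \<xi> in M. \<exists>\<phi> \<psi>. (\<forall>t\<in>interval3 n. (\<phi> has_real_derivative \<psi> t) (at t)) \<and> continuous_on (interval3 n) \<psi> \<and>
      (AE t in unif3 n. u (upd m \<xi> t) = \<phi> t \<and> G (upd m \<xi> t) = \<psi> t)"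
  shows "ibp u m G"
  unfolding ibp_def
proof (intro allI impI)
  fix j w assume j: "j \<le> n" and w: "sqint M w" and K0: "\<forall>\<xi>\<in>space M. Kop j (\<lambda>_ _. 1) m w \<xi> = 0"
  have [measurable]: "u \<in> borel_measurable M" "G \<in> borel_measurable M" "w \<in> borel_measurable M"
    using u G w by (auto intro: sqint_measurable)
  have su: "sqint M (Kop j (\<lambda>_ _. 1) m u)" by (rule Kop_bound(1)[OF m j _ _ u]) auto
  have "(\<integral>x. w x * Kop j (\<lambda>_ _. 1) m u x \<partial>M) = (\<integral>x. u x * Kop j (\<lambda>_ _. 1) m w x \<partial>M)"
    by (rule Kop_transpose[OF m j _ _ w u]) auto
  also have "\<dots> = (\<integral>x. 0 \<partial>M)" using K0 by (intro Bochner_Integration.integral_cong) auto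
  finally have z: "(\<integral>x. w x * Kop j (\<lambda>_ _. 1) m u x \<partial>M) = 0" by simp
  have "(\<integral>x. w x * u x \<partial>M) = (\<integral>x. w x * u x \<partial>M) - (\<integral>x. w x * Kop j (\<lambda>_ _. 1) m u x \<partial>M) / 3 ^ j" using z by simp
  also have "\<dots> = (\<integral>x. w x * u x - w x * Kop j (\<lambda>_ _. 1) m u x / 3 ^ j \<partial>M)"
    using sqint_mult_integrable[OF w u] sqint_mult_integrable[OF w su] by simp
  also have "\<dots> = (\<integral>x. w x * Kop j (\<lambda>s t. kap j t s) m G x \<partial>M)"
  proof (rule integral_cong_AE)
    show "AE x in M. w x * u x - w x * Kop j (\<lambda>_ _. 1) m u x / 3 ^ j = w x * Kop j (\<lambda>s t. kap j t s) m G x"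
      using mean_value_identity[OF m j u G smooth]
    proof eventually_elim
      case (elim x)
      show ?case unfolding elim[symmetric] by (simp add: right_diff_distrib)
    qed
  qed measurable
  also have "\<dots> = (\<integral>x. G x * Kop j (kap j) m w x \<partial>M)"
    using Kop_transpose[OF m j, of "\<lambda>s t. kap j t s" w G] kap_le_1 w G by simp
  finally show "(\<integral>x. w x * u x \<partial>M) = (\<integral>x. Kop j (kap j) m w x * G x \<partial>M)" by (simp add: mult.commute)
qed

text \<open>Both sides are continuous in the square norm, the kernel operator sending w to a
  square-integrable function.\<close>

lemma ibp_limit:
  assumes m [simp]: "m \<in> K" and u: "sqint M u" and G: "sqint M G"
    and su: "\<And>i::nat. sqint M (v i)" and sG: "\<And>i. sqint M (H i)" and ibp: "\<And>i. ibp (v i) m (H i)"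
    and lu: "(\<lambda>i. nrm2 M (\<lambda>x. v i x - u x)) \<longlonglongrightarrow> 0" and lG: "(\<lambda>i. nrm2 M (\<lambda>x. H i x - G x)) \<longlonglongrightarrow> 0"
  shows "ibp u m G"
  unfolding ibp_def
proof (intro allI impI)
  fix j w assume j: "j \<le> n" and w: "sqint M w" and K0: "\<forall>\<xi>\<in>space M. Kop j (\<lambda>_ _. 1) m w \<xi> = 0"
  have sK: "sqint M (Kop j (kap j) m w)" by (rule Kop_bound(1)[OF m j _ kap_le_1 w]) simp
  have lim: "(\<lambda>i. \<integral>x. a x * f i x \<partial>M) \<longlonglongrightarrow> (\<integral>x. a x * g x \<partial>M)"
    if a: "sqint M a" and f: "\<And>i. sqint M (f i)" and g: "sqint M g" and l: "(\<lambda>i. nrm2 M (\<lambda>x. f i x - g x)) \<longlonglongrightarrow> 0" for a f g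
  proof (rule LIM_zero_cancel, rule Lim_null_comparison)
    show "(\<lambda>i. nrm2 M a * nrm2 M (\<lambda>x. f i x - g x)) \<longlonglongrightarrow> 0"
      using tendsto_mult_left[OF l, of "nrm2 M a"] by simp
    have "\<bar>(\<integral>x. a x * f i x \<partial>M) - (\<integral>x. a x * g x \<partial>M)\<bar> \<le> nrm2 M a * nrm2 M (\<lambda>x. f i x - g x)" for i
    proof -
      have "(\<integral>x. a x * f i x \<partial>M) - (\<integral>x. a x * g x \<partial>M) = (\<integral>x. a x * (f i x - g x) \<partial>M)"
        using sqint_mult_integrable[OF a f] sqint_mult_integrable[OF a g] by (simp add: right_diff_distrib)
      thus ?thesis using integral_mult_le_nrm2[OF a sqint_diff[OF f g]] by simp
    qed
    thus "\<forall>\<^sub>F i in sequentially. norm ((\<integral>x. a x * f i x \<partial>M) - (\<integral>x. a x * g x \<partial>M)) \<le> nrm2 M a * nrm2 M (\<lambda>x. f i x - g x)" by simp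
  qed
  have "(\<lambda>i. \<integral>x. w x * v i x \<partial>M) \<longlonglongrightarrow> (\<integral>x. w x * u x \<partial>M)" by (rule lim[OF w su u lu])
  moreover have "(\<lambda>i. \<integral>x. w x * v i x \<partial>M) = (\<lambda>i. \<integral>x. Kop j (kap j) m w x * H i x \<partial>M)"
    using ibp j w K0 unfolding ibp_def by blast
  moreover have "(\<lambda>i. \<integral>x. Kop j (kap j) m w x * H i x \<partial>M) \<longlonglongrightarrow> (\<integral>x. Kop j (kap j) m w x * G x \<partial>M)"
    by (rule lim[OF sK sG G lG])
  ultimately show "(\<integral>x. w x * u x \<partial>M) = (\<integral>x. Kop j (kap j) m w x * G x \<partial>M)"
    using LIMSEQ_unique by metis
qed

end

section \<open>Point configurations\<close>

lemma sets_dirac_sum [simp, measurable_cong]: "sets (dirac_sum I x) = sets borel"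
  unfolding dirac_sum_def by (metis sets.sigma_sets_eq sets_measure_of space_borel sets.space_closed)

lemma space_dirac_sum [simp]: "space (dirac_sum I x) = UNIV"
  using sets_eq_imp_space_eq[OF sets_dirac_sum[of I x]] by simp

lemma sets_configs: "\<mu> \<in> configs ==> sets \<mu> = sets borel"
  by (auto simp: configs_def)

lemma space_configs: "\<mu> \<in> configs ==> space \<mu> = UNIV"
  using sets_eq_imp_space_eq[OF sets_configs] by simp

lemma sets_restr [simp]: "sets (restr \<mu> A) = sets \<mu>"
  by (simp add: restr_def)

lemma sets_plus_measure [simp]: "sets (plus_measure M N) = sets M"
  by (simp add: plus_measure_def sets.sigma_sets_eq)

lemma emeasure_restr:
  assumes "\<mu> \<in> configs" and [measurable]: "A \<in> sets borel" "B \<in> sets borel"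
  shows "emeasure (restr \<mu> A) B = emeasure \<mu> (A \<inter> B)"
proof -
  have [measurable_cong]: "sets \<mu> = sets borel" by (rule sets_configs[OF assms(1)])
  show ?thesis unfolding restr_def by (subst emeasure_density)
    (auto simp: indicator_inter_arith[symmetric] simp flip: nn_integral_indicator)
qed

lemma emeasure_dirac_sum_count:
  assumes "A \<in> sets borel"
  shows "emeasure (dirac_sum I x) A = emeasure (count_space I) {i \<in> I. x i \<in> A}"
proof -
  have "emeasure (dirac_sum I x) A = (\<integral>\<^sup>+i. indicator {i \<in> I. x i \<in> A} i \<partial>count_space I)"
    unfolding emeasure_dirac_sum[OF assms]
    by (rule nn_integral_cong) (use assms in \<open>auto simp: emeasure_return indicator_def\<close>)
  thus ?thesis by simp
qed

lemma emeasure_dirac_sum_finite: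
  assumes "A \<in> sets borel"
  shows "emeasure (dirac_sum {..<N::nat} x) A = of_nat (card {i. i < N \<and> x i \<in> A})"
proof -
  have "{i \<in> {..<N}. x i \<in> A} = {i. i < N \<and> x i \<in> A}" by auto
  thus ?thesis unfolding emeasure_dirac_sum_count[OF assms] by (subst emeasure_count_space_finite) auto
qed

lemma configs_count:
  assumes "\<mu> \<in> configs" "A \<in> sets borel"
  shows "emeasure \<mu> A = \<infinity> \<or> (\<exists>k::nat. emeasure \<mu> A = of_nat k)"
proof -
  obtain I x where "\<mu> = dirac_sum I x" using assms(1) by (auto simp: configs_def)
  hence "emeasure \<mu> A = emeasure (count_space I) {i \<in> I. x i \<in> A}"
    using emeasure_dirac_sum_count[OF assms(2)] by simp
  thus ?thesis by (cases "finite {i \<in> I. x i \<in> A}") auto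
qed

text \<open>Finitely many extra atoms keep the mass finite on each set of a sequence exhausting the
  space for \<eta>.\<close>

lemma configsI_finite_cover:
  assumes "\<mu> = dirac_sum I x" "\<eta> \<in> configs" "\<And>A. A \<in> sets borel ==> emeasure \<mu> A \<le> of_nat N + emeasure \<eta> A"
  shows "\<mu> \<in> configs"
proof -
  interpret \<eta>: sigma_finite_measure \<eta> using assms(2) by (simp add: configs_def)
  obtain F :: "nat => _ set" where F: "range F \<subseteq> sets \<eta>" "(\<Union>i. F i) = space \<eta>" "\<And>i. emeasure \<eta> (F i) \<noteq> \<infinity>"
    using \<eta>.sigma_finite by metis
  have sb: "F i \<in> sets borel" for i using F(1) sets_configs[OF assms(2)] by auto
  have "sigma_finite_measure \<mu>"
  proof
    show "\<exists>A. countable A \<and> A \<subseteq> sets \<mu> \<and> \<Union>A = space \<mu> \<and> (\<forall>a\<in>A. emeasure \<mu> a \<noteq> \<infinity>)"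
    proof (intro exI[of _ "range F"] conjI ballI)
      show "range F \<subseteq> sets \<mu>" using sb assms(1) by auto
      show "\<Union> (range F) = space \<mu>" using F(2) assms(1) space_configs[OF assms(2)] by simp
      fix a assume "a \<in> range F"
      then obtain i where i: "a = F i" by auto
      have "emeasure \<mu> a \<le> of_nat N + emeasure \<eta> (F i)" using assms(3)[OF sb] i by simp
      also have "\<dots> < \<infinity>" using F(3)[of i] by (simp add: less_top of_nat_less_top)
      finally show "emeasure \<mu> a \<noteq> \<infinity>" by simp
    qed simp
  qed
  thus ?thesis using assms(1) by (auto simp: configs_def)
qed

text \<open>What \<eta> contains inside Q is discarded, so \<eta> may be any configuration with the
  desired exterior.\<close>

definition conf :: "(real^'d) set => nat => (nat => real^'d) => (real^'d) measure => (real^'d) measure" where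
  "conf Q N x \<eta> = plus_measure (dirac_sum {..<N} x) (restr \<eta> (- Q))"

lemma sets_conf [simp, measurable_cong]: "sets (conf Q N x \<eta>) = sets borel"
  by (simp add: conf_def)

lemma space_conf [simp]: "space (conf Q N x \<eta>) = UNIV"
  using sets_eq_imp_space_eq[OF sets_conf[of Q N x \<eta>]] by simp

lemma emeasure_conf:
  assumes "\<eta> \<in> configs" "Q \<in> sets borel" "A \<in> sets borel"
  shows "emeasure (conf Q N x \<eta>) A = of_nat (card {i. i < N \<and> x i \<in> A}) + emeasure \<eta> (A - Q)"
proof -
  have "emeasure (conf Q N x \<eta>) A = emeasure (dirac_sum {..<N} x) A + emeasure (restr \<eta> (- Q)) A"
    unfolding conf_def by (rule emeasure_plus_measure) (use assms sets_configs in auto)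
  moreover have "- Q \<inter> A = A - Q" by auto
  ultimately show ?thesis using assms by (simp add: emeasure_restr emeasure_dirac_sum_finite borel_comp)
qed

text \<open>Both families of atoms must share one index set in the natural numbers: the new points
  take the indices below N, those of \<eta> are shifted by N.\<close>

lemma conf_in_configs:
  assumes "\<eta> \<in> configs" "Q \<in> sets borel"
  shows "conf Q N x \<eta> \<in> configs"
proof -
  obtain I y where \<eta>: "\<eta> = dirac_sum I y" using assms(1) by (auto simp: configs_def)
  define J where "J = {..<N} \<union> (\<lambda>i. i + N) ` {i \<in> I. y i \<notin> Q}"
  define z where "z = (\<lambda>i. if i < N then x i else y (i - N))"
  have eq: "conf Q N x \<eta> = dirac_sum J z"
  proof (rule measure_eqI)
    fix A assume "A \<in> sets (conf Q N x \<eta>)"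
    hence A: "A \<in> sets borel" by simp
    have AQ: "A - Q \<in> sets borel" using A assms by auto
    have s: "{i \<in> J. z i \<in> A} = {i. i < N \<and> x i \<in> A} \<union> (\<lambda>i. i + N) ` {i \<in> I. y i \<in> A - Q}"
      by (auto simp: J_def z_def)
    have "emeasure (count_space J) {i \<in> J. z i \<in> A} = of_nat (card {i. i < N \<and> x i \<in> A}) + emeasure (count_space I) {i \<in> I. y i \<in> A - Q}"
    proof (cases "finite {i \<in> I. y i \<in> A - Q}")
      case True
      have "card {i \<in> J. z i \<in> A} = card {i. i < N \<and> x i \<in> A} + card ((\<lambda>i. i + N) ` {i \<in> I. y i \<in> A - Q})"
        unfolding s by (rule card_Un_disjoint) (use True in auto)
      also have "card ((\<lambda>i. i + N) ` {i \<in> I. y i \<in> A - Q}) = card {i \<in> I. y i \<in> A - Q}"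
        by (rule card_image) auto
      finally have c: "card {i \<in> J. z i \<in> A} = card {i. i < N \<and> x i \<in> A} + card {i \<in> I. y i \<in> A - Q}" .
      have fin: "finite {i \<in> J. z i \<in> A}" unfolding s using True by simp
      have "emeasure (count_space J) {i \<in> J. z i \<in> A} = of_nat (card {i \<in> J. z i \<in> A})"
        by (rule emeasure_count_space_finite) (use fin in auto)
      moreover have "emeasure (count_space I) {i \<in> I. y i \<in> A - Q} = of_nat (card {i \<in> I. y i \<in> A - Q})"
        by (rule emeasure_count_space_finite) (use True in auto)
      ultimately show ?thesis unfolding c by (simp only: of_nat_add)
    next
      case False
      have "infinite ((\<lambda>i. i + N) ` {i \<in> I. y i \<in> A - Q})"
        using False by (simp add: finite_image_iff)
      hence "infinite {i \<in> J. z i \<in> A}" unfolding s by simp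
      hence "emeasure (count_space J) {i \<in> J. z i \<in> A} = \<infinity>" by (intro emeasure_count_space_infinite) auto
      moreover have "emeasure (count_space I) {i \<in> I. y i \<in> A - Q} = \<infinity>"
        by (rule emeasure_count_space_infinite) (use False in auto)
      moreover have "of_nat c + (\<infinity>::ennreal) = \<infinity>" for c by simp
      ultimately show ?thesis by (simp only:)
    qed
    moreover have "emeasure \<eta> (A - Q) = emeasure (count_space I) {i \<in> I. y i \<in> A - Q}"
      unfolding \<eta> by (rule emeasure_dirac_sum_count[OF AQ])
    ultimately show "emeasure (conf Q N x \<eta>) A = emeasure (dirac_sum J z) A"
      by (simp only: emeasure_conf[OF assms A] emeasure_dirac_sum_count[OF A])
  qed simp
  show ?thesis
  proof (rule configsI_finite_cover[OF eq assms(1)])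
    fix A :: "(real^'a) set" assume A: "A \<in> sets borel"
    have "card {i. i < N \<and> x i \<in> A} \<le> card {..<N}" by (rule card_mono) auto
    hence "of_nat (card {i. i < N \<and> x i \<in> A}) \<le> (of_nat N :: ennreal)" by simp
    moreover have "emeasure \<eta> (A - Q) \<le> emeasure \<eta> A"
      by (rule emeasure_mono) (use A sets_configs[OF assms(1)] in auto)
    ultimately show "emeasure (conf Q N x \<eta>) A \<le> of_nat N + emeasure \<eta> A"
      unfolding emeasure_conf[OF assms A] by (rule add_mono)
  qed
qed

text \<open>Counted set by set. Splitting off the index i first makes the removal of one atom exact,
  subtraction in the extended nonnegative reals being truncated.\<close>

lemma move_point_conf:
  assumes "\<eta> \<in> configs" "Q \<in> sets borel" "i < N"
  shows "move_point (conf Q N x \<eta>) (x i) y = conf Q N (x(i := y)) \<eta>"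
proof (rule measure_eqI)
  have cnt: "card {j. j < N \<and> z j \<in> A} = card {j. j < N \<and> j \<noteq> i \<and> z j \<in> A} + (if z i \<in> A then 1 else 0)" for z :: "nat => real^'a" and A
  proof -
    have "{j. j < N \<and> z j \<in> A} = {j. j < N \<and> j \<noteq> i \<and> z j \<in> A} \<union> (if z i \<in> A then {i} else {})"
      using assms(3) by auto
    moreover have "card ({j. j < N \<and> j \<noteq> i \<and> z j \<in> A} \<union> (if z i \<in> A then {i} else {})) =
        card {j. j < N \<and> j \<noteq> i \<and> z j \<in> A} + card (if z i \<in> A then {i} else {})"
      by (rule card_Un_disjoint) auto
    ultimately show ?thesis by simp
  qed
  have le: "indicator A (x i) \<le> emeasure (conf Q N x \<eta>) A" if "A \<in> sets borel" for A
    unfolding emeasure_conf[OF assms(1,2) that] cnt[of x A] by (auto simp: indicator_def)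
  have s: "sets (move_point (conf Q N x \<eta>) (x i) y) = sets borel"
    using sets.sets_measure_of_eq[of borel] by (simp add: move_point_def diff_measure_def)
  thus "sets (move_point (conf Q N x \<eta>) (x i) y) = sets (conf Q N (x(i := y)) \<eta>)" by simp
  fix A assume "A \<in> sets (move_point (conf Q N x \<eta>) (x i) y)"
  hence A: "A \<in> sets borel" using s by simp
  have "{j. j < N \<and> j \<noteq> i \<and> (x(i := y)) j \<in> A} = {j. j < N \<and> j \<noteq> i \<and> x j \<in> A}" by auto
  hence c: "card {j. j < N \<and> (x(i := y)) j \<in> A} = card {j. j < N \<and> j \<noteq> i \<and> x j \<in> A} + (if y \<in> A then 1 else 0)"
    using cnt[of "x(i := y)" A] by simp
  have "emeasure (move_point (conf Q N x \<eta>) (x i) y) A = emeasure (conf Q N x \<eta>) A - indicator A (x i) + indicator A y"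
    by (rule emeasure_move_point[OF _ le A]) simp_all
  also have "\<dots> = of_nat (card {j. j < N \<and> j \<noteq> i \<and> x j \<in> A}) + indicator A y + emeasure \<eta> (A - Q)"
    unfolding emeasure_conf[OF assms(1,2) A] cnt[of x A] by (auto simp: indicator_def add_ac)
  also have "\<dots> = emeasure (conf Q N (x(i := y)) \<eta>) A"
    unfolding emeasure_conf[OF assms(1,2) A] c by (auto simp: indicator_def add_ac)
  finally show "emeasure (move_point (conf Q N x \<eta>) (x i) y) A = emeasure (conf Q N (x(i := y)) \<eta>) A" .
qed

lemma emeasure_conf_atom:
  assumes "\<eta> \<in> configs" "Q \<in> sets borel" "i < N"
  shows "emeasure (conf Q N x \<eta>) {x i} \<noteq> 0"
proof -
  have "card {j. j < N \<and> x j \<in> {x i}} > 0" using assms(3) by (subst card_gt_0_iff) auto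
  thus ?thesis using emeasure_conf[OF assms(1,2), of "{x i}" N x] assms(3) by auto
qed

lemma nn_integral_conf:
  assumes "\<eta> \<in> configs" "Q \<in> sets borel" "\<And>i. i < N ==> x i \<in> Q" "h \<in> borel_measurable borel"
  shows "(\<integral>\<^sup>+y\<in>Q. h y \<partial>conf Q N x \<eta>) = (\<Sum>i<N. h (x i))"
proof -
  have [measurable]: "Q \<in> sets borel" "h \<in> borel_measurable borel" by fact+
  have "(\<integral>\<^sup>+y. h y * indicator Q y \<partial>conf Q N x \<eta>) = (\<Sum>i<N. h (x i) * indicator Q (x i))" if "h \<in> borel_measurable borel" for h
    using that
  proof (induction h rule: borel_measurable_induct)
    case (cong f g)
    thus ?case by (simp cong: nn_integral_cong)
  next
    case (set A)
    have "(\<integral>\<^sup>+y. indicator A y * indicator Q y \<partial>conf Q N x \<eta>) = emeasure (conf Q N x \<eta>) (A \<inter> Q)"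
      using set assms(2) by (simp add: indicator_inter_arith[symmetric])
    also have "\<dots> = of_nat (card {i. i < N \<and> x i \<in> A \<inter> Q})"
      using emeasure_conf[OF assms(1,2), of "A \<inter> Q" N x] set assms(2) by (simp add: Diff_eq Int_assoc)
    also have "{i. i < N \<and> x i \<in> A \<inter> Q} = {..<N} \<inter> {i. x i \<in> A \<inter> Q}" by auto
    also have "of_nat (card ({..<N} \<inter> {i. x i \<in> A \<inter> Q})) = (\<Sum>i<N. if x i \<in> A \<inter> Q then 1 else 0 :: ennreal)"
      by (simp add: sum.If_cases)
    also have "\<dots> = (\<Sum>i<N. indicator A (x i) * indicator Q (x i))"
      by (rule sum.cong) (auto simp: indicator_def)
    finally show ?case .
  next
    case (mult u c)
    have [measurable]: "u \<in> borel_measurable borel" by fact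
    have "(\<integral>\<^sup>+y. c * u y * indicator Q y \<partial>conf Q N x \<eta>) = c * (\<integral>\<^sup>+y. u y * indicator Q y \<partial>conf Q N x \<eta>)"
      by (subst nn_integral_cmult[symmetric]) (auto simp only: mult.assoc, measurable)
    also have "(\<integral>\<^sup>+y. u y * indicator Q y \<partial>conf Q N x \<eta>) = (\<Sum>i<N. u (x i) * indicator Q (x i))" by fact
    finally show ?case by (simp only: sum_distrib_left mult.assoc)
  next
    case (add u v)
    thus ?case by (simp add: distrib_right nn_integral_add sum.distrib)
  next
    case (seq U)
    have inc: "incseq (\<lambda>j. U j y)" for y using seq(3) by (auto simp: incseq_def le_fun_def)
    have "(\<integral>\<^sup>+y. (SUP j. U j) y * indicator Q y \<partial>conf Q N x \<eta>) = (\<integral>\<^sup>+y. (SUP j. U j y * indicator Q y) \<partial>conf Q N x \<eta>)"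
      by (intro nn_integral_cong) (simp add: image_comp SUP_mult_right_ennreal)
    also have "\<dots> = (SUP j. \<integral>\<^sup>+y. U j y * indicator Q y \<partial>conf Q N x \<eta>)"
      by (rule nn_integral_monotone_convergence_SUP)
        (use seq inc in \<open>auto simp: incseq_def le_fun_def intro!: mult_right_mono\<close>)
    also have "\<dots> = (SUP j. \<Sum>i<N. U j (x i) * indicator Q (x i))" using seq by simp
    also have "\<dots> = (\<Sum>i<N. SUP j. U j (x i) * indicator Q (x i))"
      by (rule ennreal_SUP_sum) (use inc in \<open>auto simp: incseq_def intro!: mult_right_mono\<close>)
    also have "\<dots> = (\<Sum>i<N. (SUP j. U j) (x i) * indicator Q (x i))"
      by (simp add: image_comp SUP_mult_right_ennreal)
    finally show ?case .
  qed
  from this[OF assms(4)] show ?thesis using assms(3) by simp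
qed

section \<open>Counting \<open>\<sigma>\<close>-algebras\<close>

lemma space_count_algebra [simp]: "space (count_algebra \<V>) = configs"
  unfolding count_algebra_def by (rule space_measure_of) auto

lemma measurable_count [measurable]:
  assumes "V \<in> \<V>" shows "(\<lambda>\<mu>. emeasure \<mu> V) \<in> borel_measurable (count_algebra \<V>)"
proof (rule measurableI)
  fix B :: "ennreal set" assume "B \<in> sets borel"
  hence "{\<mu> \<in> configs. emeasure \<mu> V \<in> B} \<in> sets (count_algebra \<V>)"
    unfolding count_algebra_def using assms by (subst sets_measure_of) (auto intro!: sigma_sets.Basic)
  moreover have "(\<lambda>\<mu>. emeasure \<mu> V) -` B \<inter> space (count_algebra \<V>) = {\<mu> \<in> configs. emeasure \<mu> V \<in> B}" by auto
  ultimately show "(\<lambda>\<mu>. emeasure \<mu> V) -` B \<inter> space (count_algebra \<V>) \<in> sets (count_algebra \<V>)" by simp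
qed simp

lemma measurable_count_algebraI:
  assumes "\<And>\<xi>. \<xi> \<in> space M ==> f \<xi> \<in> configs" "\<And>V. V \<in> \<V> ==> (\<lambda>\<xi>. emeasure (f \<xi>) V) \<in> borel_measurable M"
  shows "f \<in> M \<rightarrow>\<^sub>M count_algebra \<V>"
  unfolding count_algebra_def
proof (rule measurable_measure_of)
  show "f \<in> space M \<rightarrow> configs" using assms(1) by auto
  fix S assume "S \<in> {{\<mu> \<in> configs. emeasure \<mu> V \<in> B} |V B. V \<in> \<V> \<and> B \<in> sets borel}"
  then obtain V B where S: "S = {\<mu> \<in> configs. emeasure \<mu> V \<in> B}" "V \<in> \<V>" "B \<in> sets borel" by auto
  have "f -` S \<inter> space M = (\<lambda>\<xi>. emeasure (f \<xi>) V) -` B \<inter> space M" using S(1) assms(1) by auto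
  also have "\<dots> \<in> sets M" by (rule measurable_sets[OF assms(2)[OF S(2)] S(3)])
  finally show "f -` S \<inter> space M \<in> sets M" .
qed auto

lemma count_algebra_mono: "\<V> \<subseteq> \<W> ==> subalgebra (count_algebra \<W>) (count_algebra \<V>)"
  unfolding subalgebra_def
proof (intro conjI subsetI)
  fix S assume *: "\<V> \<subseteq> \<W>" and S: "S \<in> sets (count_algebra \<V>)"
  have "(\<lambda>\<mu>. \<mu>) \<in> count_algebra \<W> \<rightarrow>\<^sub>M count_algebra \<V>"
    by (rule measurable_count_algebraI) (use * in auto)
  from measurable_sets[OF this S] show "S \<in> sets (count_algebra \<W>)"
    using sets.sets_into_space[OF S] by (simp add: Int_absorb2)
qed simp

lemma measurable_conf [measurable]:
  fixes Q :: "(real^'d) set"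
  assumes [measurable]: "Q \<in> sets borel"
  shows "(\<lambda>(\<eta>, x). conf Q N x \<eta>) \<in> count_algebra {V \<in> sets borel. V \<subseteq> - Q} \<Otimes>\<^sub>M (\<Pi>\<^sub>M i\<in>{..<N}. borel) \<rightarrow>\<^sub>M count_algebra (sets borel)"
proof (rule measurable_count_algebraI)
  let ?M = "count_algebra {V \<in> sets borel. V \<subseteq> - Q} \<Otimes>\<^sub>M (\<Pi>\<^sub>M i\<in>{..<N}. borel)"
  show "(case \<xi> of (\<eta>, x) => conf Q N x \<eta>) \<in> configs" if "\<xi> \<in> space ?M" for \<xi>
    using that conf_in_configs[OF _ assms] by (auto simp: space_pair_measure)
  fix V :: "(real^'d) set" assume V [measurable]: "V \<in> sets borel"
  have [measurable]: "(\<lambda>\<eta>. emeasure \<eta> (V - Q)) \<in> borel_measurable (count_algebra {V \<in> sets borel. V \<subseteq> - Q})"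
    by (rule measurable_count) (use V assms in auto)
  have "(\<lambda>\<xi>. (\<Sum>i<N. indicator V (snd \<xi> i)) + emeasure (fst \<xi>) (V - Q)) \<in> borel_measurable ?M"
    by (intro borel_measurable_add borel_measurable_sum) measurable
  moreover have "emeasure (case \<xi> of (\<eta>, x) => conf Q N x \<eta>) V = (\<Sum>i<N. indicator V (snd \<xi> i)) + emeasure (fst \<xi>) (V - Q)"
    if "\<xi> \<in> space ?M" for \<xi>
  proof -
    have \<eta>: "fst \<xi> \<in> configs" using that by (auto simp: space_pair_measure)
    have "of_nat (card {i. i < N \<and> snd \<xi> i \<in> V}) = (\<Sum>i<N. indicator V (snd \<xi> i) :: ennreal)"
    proof -
      have "{i. i < N \<and> snd \<xi> i \<in> V} = {..<N} \<inter> {i. snd \<xi> i \<in> V}" by auto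
      thus ?thesis by (simp add: indicator_def sum.If_cases)
    qed
    thus ?thesis using emeasure_conf[OF \<eta> assms V] by (simp add: split_def)
  qed
  ultimately show "(\<lambda>\<xi>. emeasure (case \<xi> of (\<eta>, x) => conf Q N x \<eta>) V) \<in> borel_measurable ?M"
    by (simp cong: measurable_cong)
qed

text \<open>Dividing by the mass of Q turns a random measure finite on Q into a subprobability
  kernel, against which jointly measurable functions have measurable integrals; the mass is then
  multiplied back. Configurations with infinite mass on Q receive the value 0.\<close>

lemma measurable_config_integral:
  assumes m [measurable]: "m \<in> A \<rightarrow>\<^sub>M count_algebra (sets borel)" and h [measurable]: "case_prod h \<in> borel_measurable (A \<Otimes>\<^sub>M borel)"
    and Q [measurable]: "Q \<in> sets borel"
  shows "(\<lambda>a. if emeasure (m a) Q < \<infinity> then \<integral>\<^sup>+y\<in>Q. h a y \<partial>m a else 0) \<in> borel_measurable A"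
proof -
  define L where "L = (\<lambda>a. density (m a) (\<lambda>y. inverse (emeasure (m a) Q) * indicator Q y))"
  have mc: "m a \<in> configs" if "a \<in> space A" for a using measurable_space[OF m that] by simp
  have em [measurable]: "(\<lambda>a. emeasure (m a) V) \<in> borel_measurable A" if "V \<in> sets borel" for V
    using measurable_compose[OF m measurable_count[OF that]] .
  have L_int: "(\<integral>\<^sup>+y. f y \<partial>L a) = inverse (emeasure (m a) Q) * (\<integral>\<^sup>+y\<in>Q. f y \<partial>m a)"
    if a: "a \<in> space A" and f [measurable]: "f \<in> borel_measurable borel" for a f
  proof -
    have [measurable_cong]: "sets (m a) = sets borel" by (rule sets_configs[OF mc[OF a]])
    have "(\<integral>\<^sup>+y. f y \<partial>L a) = (\<integral>\<^sup>+y. inverse (emeasure (m a) Q) * (f y * indicator Q y) \<partial>m a)"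
      unfolding L_def by (subst nn_integral_density) (auto simp: mult_ac)
    also have "\<dots> = inverse (emeasure (m a) Q) * (\<integral>\<^sup>+y. f y * indicator Q y \<partial>m a)"
      by (rule nn_integral_cmult) measurable
    finally show ?thesis .
  qed
  have L_em: "emeasure (L a) V = inverse (emeasure (m a) Q) * emeasure (m a) (V \<inter> Q)" if a: "a \<in> space A" and V: "V \<in> sets borel" for a V
  proof -
    have sm: "sets (m a) = sets borel" by (rule sets_configs[OF mc[OF a]])
    have "emeasure (L a) V = (\<integral>\<^sup>+y. indicator V y \<partial>L a)" using V sm by (simp add: L_def)
    also have "\<dots> = inverse (emeasure (m a) Q) * (\<integral>\<^sup>+y\<in>Q. indicator V y \<partial>m a)" by (rule L_int[OF a]) (use V in simp)
    also have "(\<integral>\<^sup>+y\<in>Q. indicator V y \<partial>m a) = (\<integral>\<^sup>+y. indicator (V \<inter> Q) y \<partial>m a)" by (rule nn_integral_cong) (simp add: indicator_inter_arith)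
    also have "\<dots> = emeasure (m a) (V \<inter> Q)" using V Q sm by simp
    finally show ?thesis .
  qed
  have "L \<in> A \<rightarrow>\<^sub>M subprob_algebra borel"
  proof (rule measurable_subprob_algebra)
    fix a assume a: "a \<in> space A"
    have sm: "sets (m a) = sets borel" by (rule sets_configs[OF mc[OF a]])
    show s: "sets (L a) = sets borel" by (simp add: L_def sm)
    have sp: "space (L a) = UNIV" using sets_eq_imp_space_eq[OF s] by simp
    show "subprob_space (L a)"
    proof
      have "emeasure (L a) UNIV = inverse (emeasure (m a) Q) * emeasure (m a) Q" using L_em[OF a, of UNIV] by simp
      \<comment> \<open>For mass 0 or infinity the inverse is infinity or 0 respectively, and the
        product is 0 in both cases.\<close>
      also have "\<dots> \<le> 1"
        by (cases "emeasure (m a) Q = 0 \<or> emeasure (m a) Q = \<infinity>") (auto simp: mult.commute ennreal_inverse_mult less_top divide_ennreal_def[symmetric] ennreal_divide_self)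
      finally show "emeasure (L a) (space (L a)) \<le> 1" by (simp add: sp)
      show "space (L a) \<noteq> {}" by (simp add: sp)
    qed
  next
    fix V :: "(real^'b) set" assume V: "V \<in> sets borel"
    have "(\<lambda>a. inverse (emeasure (m a) Q) * emeasure (m a) (V \<inter> Q)) \<in> borel_measurable A"
      using V by (intro borel_measurable_times_ennreal borel_measurable_inverse_ennreal em) auto
    thus "(\<lambda>a. emeasure (L a) V) \<in> borel_measurable A" by (simp add: L_em V cong: measurable_cong)
  qed
  hence "(\<lambda>a. integral\<^sup>N (L a) (h a)) \<in> borel_measurable A"
    by (intro nn_integral_measurable_subprob_algebra2) simp_all
  hence meas: "(\<lambda>a. if emeasure (m a) Q < \<infinity> then emeasure (m a) Q * integral\<^sup>N (L a) (h a) else 0) \<in> borel_measurable A"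
    using em[OF Q] by measurable
  show ?thesis
  proof (subst measurable_cong)
    fix a assume a: "a \<in> space A"
    have sm [measurable_cong]: "sets (m a) = sets borel" by (rule sets_configs[OF mc[OF a]])
    have ha [measurable]: "h a \<in> borel_measurable borel" using measurable_compose[OF measurable_Pair1'[OF a] h] by simp
    have "(\<integral>\<^sup>+y\<in>Q. h a y \<partial>m a) = emeasure (m a) Q * (inverse (emeasure (m a) Q) * (\<integral>\<^sup>+y\<in>Q. h a y \<partial>m a))"
      if fin: "emeasure (m a) Q < \<infinity>"
    proof (cases "emeasure (m a) Q = 0")
      case True
      hence "AE y in m a. h a y * indicator Q y = 0"
        using Q sm by (intro AE_I[of _ _ Q]) (auto simp: indicator_def)
      hence "(\<integral>\<^sup>+y\<in>Q. h a y \<partial>m a) = 0" by (subst nn_integral_0_iff_AE) auto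
      thus ?thesis by simp
    next
      case False
      hence "emeasure (m a) Q * inverse (emeasure (m a) Q) = 1"
        using fin by (simp add: divide_ennreal_def[symmetric] ennreal_divide_self)
      thus ?thesis by (simp add: mult.assoc[symmetric])
    qed
    thus "(if emeasure (m a) Q < \<infinity> then \<integral>\<^sup>+y\<in>Q. h a y \<partial>m a else 0) =
        (if emeasure (m a) Q < \<infinity> then emeasure (m a) Q * integral\<^sup>N (L a) (h a) else 0)"
      using L_int[OF a ha] by simp
  qed (rule meas)
qed

section \<open>The Poisson law given the number of points\<close>

definition pois :: "real => nat => real" where
  "pois l k = l ^ k / fact k * exp (- l)"

lemma pois_nonneg: "0 \<le> l ==> 0 \<le> pois l k"
  by (simp add: pois_def)

lemma pois_pos: "0 < l ==> 0 < pois l k"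
  by (simp add: pois_def)

lemma pois_sums: "pois l sums 1"
proof -
  have "(\<lambda>k. l ^ k /\<^sub>R fact k) sums exp l" by (rule exp_converges)
  hence "(\<lambda>k. exp (- l) * (l ^ k /\<^sub>R fact k)) sums (exp (- l) * exp l)" by (rule sums_mult)
  thus ?thesis by (simp add: pois_def[abs_def] exp_minus field_simps)
qed

text \<open>Words with prescribed letter counts are the arrangements of a multiset, and their number
  is the multinomial coefficient.\<close>

lemma card_functions_with_fibres:
  assumes S: "finite S" and k: "sum k S = N"
  shows "real (card {w \<in> {..<N} \<rightarrow>\<^sub>E S. \<forall>s\<in>S. card {i. i < N \<and> w i = s} = k s}) = fact N / (\<Prod>s\<in>S. fact (k s))"
proof -
  define A where "A = Abs_multiset (\<lambda>s. if s \<in> S then k s else 0)"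
  have cA: "count A s = (if s \<in> S then k s else 0)" for s
    unfolding A_def by (subst count_Abs_multiset) (auto intro: finite_subset[OF _ S])
  have setA: "set_mset A \<subseteq> S" using cA by (auto simp flip: count_greater_zero_iff split: if_splits)
  have sizeA: "size A = N"
  proof -
    have "size A = sum (count A) (set_mset A)" by (simp add: size_multiset_overloaded_eq)
    also have "\<dots> = sum (count A) S" by (rule sum.mono_neutral_left) (use S setA in \<open>auto simp: count_eq_zero_iff\<close>)
    finally show ?thesis using k by (simp add: cA)
  qed
  let ?W = "{w \<in> {..<N} \<rightarrow>\<^sub>E S. \<forall>s\<in>S. card {i. i < N \<and> w i = s} = k s}"
  have cm: "count (mset (map w [0..<N])) s = card {i. i < N \<and> w i = s}" for w :: "nat => 'a" and s
  proof -
    have "count (mset (map w [0..<N])) s = length (filter (\<lambda>i. s = w i) [0..<N])"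
      unfolding count_mset by (induction N) auto
    also have "\<dots> = length (filter (\<lambda>i. w i = s) [0..<N])" by (simp only: eq_commute[of s])
    also have "\<dots> = card {i. i < N \<and> w i = s}"
      by (subst distinct_length_filter) (auto intro!: arg_cong[of _ _ card])
    finally show ?thesis .
  qed
  have "bij_betw (\<lambda>w. map w [0..<N]) ?W (permutations_of_multiset A)"
  proof (rule bij_betwI[where g = "\<lambda>xs. \<lambda>i\<in>{..<N}. xs ! i"])
    show "(\<lambda>w. map w [0..<N]) \<in> ?W \<rightarrow> permutations_of_multiset A"
    proof
      fix w assume w: "w \<in> ?W"
      have "mset (map w [0..<N]) = A"
      proof (rule multiset_eqI)
        fix s
        show "count (mset (map w [0..<N])) s = count A s"
        proof (cases "s \<in> S")
          case True
          thus ?thesis using w unfolding cm cA by auto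
        next
          case False
          hence "{i. i < N \<and> w i = s} = {}" using w by (auto simp: PiE_iff)
          thus ?thesis using False unfolding cm cA by simp
        qed
      qed
      thus "map w [0..<N] \<in> permutations_of_multiset A" by (rule permutations_of_multisetI)
    qed
    show "(\<lambda>xs. \<lambda>i\<in>{..<N}. xs ! i) \<in> permutations_of_multiset A \<rightarrow> ?W"
    proof
      fix xs assume "xs \<in> permutations_of_multiset A"
      hence xs: "mset xs = A" by (rule permutations_of_multisetD)
      have len: "length xs = N" using xs sizeA by (metis size_mset)
      have mp: "map (\<lambda>i\<in>{..<N}. xs ! i) [0..<N] = xs" by (rule nth_equalityI) (auto simp: len)
      have "card {i. i < N \<and> (\<lambda>i\<in>{..<N}. xs ! i) i = s} = k s" if "s \<in> S" for s
        using cm[of "\<lambda>i\<in>{..<N}. xs ! i" s] that unfolding mp xs cA by simp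
      moreover have "xs ! i \<in> S" if "i < N" for i
        using that len xs setA by (metis nth_mem set_mset_mset subsetD)
      ultimately show "(\<lambda>i\<in>{..<N}. xs ! i) \<in> ?W" by auto
    qed
    show "(\<lambda>i\<in>{..<N}. map w [0..<N] ! i) = w" if "w \<in> ?W" for w
      using that by (auto simp: fun_eq_iff PiE_iff extensional_def)
    show "map (\<lambda>i\<in>{..<N}. xs ! i) [0..<N] = xs" if "xs \<in> permutations_of_multiset A" for xs
    proof -
      have "length xs = N" using permutations_of_multisetD[OF that] sizeA by (metis size_mset)
      thus ?thesis by (intro nth_equalityI) auto
    qed
  qed
  hence c: "card ?W = card (permutations_of_multiset A)" by (rule bij_betw_same_card)
  have "card (permutations_of_multiset A) * (\<Prod>x\<in>set_mset A. fact (count A x)) = (fact N :: nat)"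
    using card_permutations_of_multiset_aux[of A] sizeA by simp
  also have "(\<Prod>x\<in>set_mset A. fact (count A x)) = (\<Prod>x\<in>S. fact (count A x) :: nat)"
    by (rule prod.mono_neutral_left) (use S setA in \<open>auto simp: not_in_iff\<close>)
  also have "\<dots> = (\<Prod>s\<in>S. fact (k s))" by (rule prod.cong) (auto simp: cA)
  finally have "real (card ?W * (\<Prod>s\<in>S. fact (k s))) = real (fact N)" unfolding c by simp
  moreover have "(\<Prod>s\<in>S. fact (k s) :: real) \<noteq> 0" using S by (simp add: prod_zero_iff)
  ultimately show ?thesis by (simp add: field_simps)
qed

text \<open>The event is the disjoint union, over all words with the prescribed letter counts, of
  product boxes of equal probability.\<close>

lemma multinomial_measure:
  fixes U :: "'b measure" and W :: "'s => 'b set"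
  assumes U: "prob_space U" and S: "finite S" and k: "sum k S = N"
    and W: "\<And>s. s \<in> S ==> W s \<in> sets U" and disj: "disjoint_family_on W S"
  shows "{x \<in> space (\<Pi>\<^sub>M i\<in>{..<N}. U). \<forall>s\<in>S. card {i. i < N \<and> x i \<in> W s} = k s} \<in> sets (\<Pi>\<^sub>M i\<in>{..<N}. U)" (is "?X \<in> _")
    "measure (\<Pi>\<^sub>M i\<in>{..<N}. U) {x \<in> space (\<Pi>\<^sub>M i\<in>{..<N}. U). \<forall>s\<in>S. card {i. i < N \<and> x i \<in> W s} = k s} =
      fact N * (\<Prod>s\<in>S. measure U (W s) ^ k s / fact (k s))"
proof -
  interpret U: prob_space U by fact
  interpret P: product_prob_space "\<lambda>_. U" "{..<N}" ..
  interpret FP: finite_product_prob_space "\<lambda>_. U" "{..<N}" by standard simp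
  define F where "F = {w \<in> {..<N} \<rightarrow>\<^sub>E S. \<forall>s\<in>S. card {i. i < N \<and> w i = s} = k s}"
  have finF: "finite F" unfolding F_def by (rule finite_subset[OF _ finite_PiE[of "{..<N}" "\<lambda>_. S"]]) (use S in auto)
  define B where "B = (\<lambda>w. \<Pi>\<^sub>E i\<in>{..<N}. W (w i))"
  have Bm: "B w \<in> sets (\<Pi>\<^sub>M i\<in>{..<N}. U)" if "w \<in> F" for w
    unfolding B_def using that W by (intro sets_PiM_I_finite) (auto simp: F_def PiE_iff)
  have uniq: "s = s'" if "s \<in> S" "s' \<in> S" "p \<in> W s" "p \<in> W s'" for s s' p
    using disj that unfolding disjoint_family_on_def by blast
  have eq: "?X = (\<Union>w\<in>F. B w)"
  proof (intro equalityI subsetI)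
    fix x assume x: "x \<in> ?X"
    \<comment> \<open>The prescribed counts add up to N, so no point escapes all the sets
      \<open>W s\<close>.\<close>
    have tot: "(\<Sum>s\<in>S. card {i. i < N \<and> x i \<in> W s}) = N" using x k by simp
    have "card (\<Union>s\<in>S. {i. i < N \<and> x i \<in> W s}) = (\<Sum>s\<in>S. card {i. i < N \<and> x i \<in> W s})"
    proof (rule card_UN_disjoint)
      show "\<forall>s\<in>S. \<forall>s'\<in>S. s \<noteq> s' --> {i. i < N \<and> x i \<in> W s} \<inter> {i. i < N \<and> x i \<in> W s'} = {}"
        using uniq by blast
    qed (use S in simp_all)
    hence "(\<Union>s\<in>S. {i. i < N \<and> x i \<in> W s}) = {..<N}"
      using tot by (intro card_subset_eq) auto
    hence ex: "\<exists>s\<in>S. x i \<in> W s" if "i < N" for i using that by blast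
    define w where "w = (\<lambda>i\<in>{..<N}. SOME s. s \<in> S \<and> x i \<in> W s)"
    have w: "w i \<in> S" "x i \<in> W (w i)" if "i < N" for i
      using someI_ex[of "\<lambda>s. s \<in> S \<and> x i \<in> W s"] ex[OF that] that by (auto simp: w_def)
    have "{i. i < N \<and> w i = s} = {i. i < N \<and> x i \<in> W s}" if "s \<in> S" for s
      using w uniq that by blast
    hence "w \<in> F" using x w by (auto simp: F_def w_def)
    moreover have "x \<in> B w" using x w(2) by (auto simp: B_def space_PiM PiE_iff)
    ultimately show "x \<in> (\<Union>w\<in>F. B w)" by blast
  next
    fix x assume "x \<in> (\<Union>w\<in>F. B w)"
    then obtain w where w: "w \<in> F" "x \<in> B w" by blast
    have "{i. i < N \<and> x i \<in> W s} = {i. i < N \<and> w i = s}" if "s \<in> S" for s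
    proof -
      have "w i \<in> S" "x i \<in> W (w i)" if "i < N" for i using w that by (auto simp: F_def B_def PiE_iff)
      thus ?thesis using uniq that by blast
    qed
    moreover have "x \<in> space (\<Pi>\<^sub>M i\<in>{..<N}. U)" using w Bm sets.sets_into_space by blast
    ultimately show "x \<in> ?X" using w by (simp add: F_def)
  qed
  show "?X \<in> sets (\<Pi>\<^sub>M i\<in>{..<N}. U)" unfolding eq using finF Bm by blast
  have dj: "disjoint_family_on B F"
    unfolding disjoint_family_on_def
  proof (intro ballI impI)
    fix w w' assume *: "w \<in> F" "w' \<in> F" "w \<noteq> w'"
    have "w = w'" if x: "x \<in> B w" "x \<in> B w'" for x
    proof (rule PiE_ext)
      show "w \<in> {..<N} \<rightarrow>\<^sub>E S" "w' \<in> {..<N} \<rightarrow>\<^sub>E S" using * by (auto simp: F_def)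
      fix i assume i: "i \<in> {..<N}"
      have "x i \<in> W (w i)" "x i \<in> W (w' i)" "w i \<in> S" "w' i \<in> S" using x i * by (auto simp: B_def F_def PiE_iff)
      thus "w i = w' i" using uniq by blast
    qed
    thus "B w \<inter> B w' = {}" using * by blast
  qed
  have mB: "measure (\<Pi>\<^sub>M i\<in>{..<N}. U) (B w) = (\<Prod>s\<in>S. measure U (W s) ^ k s)" if w: "w \<in> F" for w
  proof -
    have "measure (\<Pi>\<^sub>M i\<in>{..<N}. U) (B w) = (\<Prod>i\<in>{..<N}. measure U (W (w i)))"
      unfolding B_def using w W by (intro FP.finite_measure_PiM_emb) (auto simp: F_def PiE_iff)
    also have "\<dots> = (\<Prod>s\<in>S. \<Prod>i\<in>{i\<in>{..<N}. w i = s}. measure U (W (w i)))"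
      by (rule prod.group[symmetric]) (use w S in \<open>auto simp: F_def PiE_iff\<close>)
    also have "\<dots> = (\<Prod>s\<in>S. measure U (W s) ^ k s)"
    proof (rule prod.cong[OF refl])
      fix s assume s: "s \<in> S"
      have "(\<Prod>i\<in>{i\<in>{..<N}. w i = s}. measure U (W (w i))) = (\<Prod>i\<in>{i\<in>{..<N}. w i = s}. measure U (W s))"
        by (rule prod.cong) auto
      also have "\<dots> = measure U (W s) ^ k s" using w s by (simp add: F_def)
      finally show "(\<Prod>i\<in>{i\<in>{..<N}. w i = s}. measure U (W (w i))) = measure U (W s) ^ k s" .
    qed
    finally show ?thesis .
  qed
  have "measure (\<Pi>\<^sub>M i\<in>{..<N}. U) ?X = (\<Sum>w\<in>F. measure (\<Pi>\<^sub>M i\<in>{..<N}. U) (B w))"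
    unfolding eq by (rule measure_finite_Union) (use finF Bm dj finite_measure.emeasure_finite[OF prob_space.finite_measure[OF prob_space_PiM[OF U]]] in auto)
  also have "\<dots> = real (card F) * (\<Prod>s\<in>S. measure U (W s) ^ k s)" by (simp add: mB)
  also have "\<dots> = fact N * (\<Prod>s\<in>S. measure U (W s) ^ k s / fact (k s))"
    unfolding F_def card_functions_with_fibres[OF S k] by (simp add: prod_dividef)
  finally show "measure (\<Pi>\<^sub>M i\<in>{..<N}. U) ?X = fact N * (\<Prod>s\<in>S. measure U (W s) ^ k s / fact (k s))" .
qed

section \<open>Joint law of the counts of a Poisson process\<close>

locale poisson =
  fixes \<rho> :: real and P :: "(real^'d::finite) measure measure"
  assumes rho: "0 < \<rho>" and law: "poisson_law \<rho> P"
begin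

sublocale prob_space P using law by (simp add: poisson_law_def)

lemma sets_P [measurable_cong]: "sets P = sets (count_algebra (sets borel))"
  using law by (simp add: poisson_law_def)

lemma space_P [simp]: "space P = configs"
  using sets_eq_imp_space_eq[OF sets_P] by simp

lemma count_meas [measurable]: "V \<in> sets borel ==> (\<lambda>\<mu>. emeasure \<mu> V) \<in> borel_measurable P"
  by (simp add: measurable_count cong: measurable_cong_sets)

lemma count_event [measurable]: "V \<in> sets borel ==> {\<mu> \<in> configs. emeasure \<mu> V = c} \<in> sets P"
  using measurable_sets[OF count_meas, of V "{c}"] by (simp add: vimage_def Int_def conj_commute)

lemma count_prob:
  assumes "V \<in> sets borel" "emeasure lborel V < \<infinity>"
  shows "measure P {\<mu> \<in> configs. emeasure \<mu> V = of_nat k} = pois (\<rho> * measure lborel V) k"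
  using law assms by (auto simp: poisson_law_def pois_def)

text \<open>The probabilities prescribed for the finite counts sum to 1, which leaves no mass for an
  infinite count.\<close>

lemma AE_count:
  assumes V: "V \<in> sets borel" "emeasure lborel V < \<infinity>"
  shows "AE \<mu> in P. \<exists>k::nat. emeasure \<mu> V = of_nat k"
proof -
  define F where "F = (\<lambda>k::nat. {\<mu> \<in> configs. emeasure \<mu> V = of_nat k})"
  have "(\<lambda>k. measure P (F k)) sums measure P (\<Union>k. F k)"
    by (rule finite_measure_UNION) (use V in \<open>auto simp: F_def disjoint_family_on_def\<close>)
  moreover have "(\<lambda>k. measure P (F k)) sums 1"
    unfolding F_def count_prob[OF V] by (rule pois_sums)
  ultimately have "measure P (\<Union>k. F k) = 1" by (rule sums_unique2)
  hence "AE \<mu> in P. \<mu> \<in> (\<Union>k. F k)" using V by (subst AE_in_set_eq_1) (auto simp: F_def)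
  thus ?thesis by eventually_elim (auto simp: F_def)
qed

lemma AE_count_null:
  assumes V: "V \<in> null_sets lborel"
  shows "AE \<mu> in P. emeasure \<mu> V = 0"
proof -
  have V': "V \<in> sets borel" "emeasure lborel V < \<infinity>" using V by auto
  have "measure lborel V = 0" using V by (simp add: measure_def null_setsD1)
  hence "measure P {\<mu> \<in> configs. emeasure \<mu> V = 0} = 1"
    using count_prob[OF V', of 0] by (simp add: pois_def)
  hence "AE \<mu> in P. \<mu> \<in> {\<mu> \<in> configs. emeasure \<mu> V = 0}" using V' by (subst AE_in_set_eq_1) auto
  thus ?thesis by eventually_elim simp
qed

lemma joint_count_prob:
  assumes S: "finite S" and W: "\<And>s. s \<in> S ==> W s \<in> sets borel" "\<And>s. s \<in> S ==> emeasure lborel (W s) < \<infinity>"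
    and disj: "disjoint_family_on W S"
  shows "measure P {\<mu> \<in> configs. \<forall>s\<in>S. emeasure \<mu> (W s) = of_nat (k s)} = (\<Prod>s\<in>S. pois (\<rho> * measure lborel (W s)) (k s))"
proof (cases "S = {}")
  case True
  thus ?thesis using prob_space by simp
next
  case False
  define m where "m = card S"
  obtain h where h: "bij_betw h {..<m} S" using ex_bij_betw_nat_finite[OF S] by (auto simp: m_def atLeast0LessThan)
  have m0: "m \<noteq> 0" using False S by (simp add: m_def)
  have hS: "h i \<in> S" if "i < m" for i using h that by (auto simp: bij_betw_def)
  have dj: "disjoint_family_on (\<lambda>i. W (h i)) {..<m}"
    using disj hS bij_betw_imp_inj_on[OF h] unfolding disjoint_family_on_def inj_on_def by (metis lessThan_iff)
  have "indep_vars (\<lambda>_. borel) (\<lambda>i \<mu>. emeasure \<mu> (W (h i))) {..<m}"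
    using law dj W(1) hS by (auto simp: poisson_law_def)
  hence "prob (\<Inter>j\<in>{..<m}. (\<lambda>\<mu>. emeasure \<mu> (W (h j))) -` {of_nat (k (h j))} \<inter> space P) =
      (\<Prod>j\<in>{..<m}. prob ((\<lambda>\<mu>. emeasure \<mu> (W (h j))) -` {of_nat (k (h j))} \<inter> space P))"
    by (rule indep_varsD) (use m0 in auto)
  also have "(\<Inter>j\<in>{..<m}. (\<lambda>\<mu>. emeasure \<mu> (W (h j))) -` {of_nat (k (h j))} \<inter> space P) =
      {\<mu> \<in> configs. \<forall>s\<in>S. emeasure \<mu> (W s) = of_nat (k s)}"
    using m0 h by (auto simp: bij_betw_def)
  also have "(\<Prod>j\<in>{..<m}. prob ((\<lambda>\<mu>. emeasure \<mu> (W (h j))) -` {of_nat (k (h j))} \<inter> space P)) =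
      (\<Prod>j\<in>{..<m}. pois (\<rho> * measure lborel (W (h j))) (k (h j)))"
  proof (rule prod.cong[OF refl])
    fix j assume "j \<in> {..<m}"
    hence "h j \<in> S" using hS by auto
    moreover have "(\<lambda>\<mu>. emeasure \<mu> (W (h j))) -` {of_nat (k (h j))} \<inter> space P = {\<mu> \<in> configs. emeasure \<mu> (W (h j)) = of_nat (k (h j))}"
      by auto
    ultimately show "prob ((\<lambda>\<mu>. emeasure \<mu> (W (h j))) -` {of_nat (k (h j))} \<inter> space P) = pois (\<rho> * measure lborel (W (h j))) (k (h j))"
      using count_prob W by simp
  qed
  also have "\<dots> = (\<Prod>s\<in>S. pois (\<rho> * measure lborel (W s)) (k s))"
    by (rule prod.reindex_bij_betw[OF h])
  finally show ?thesis .
qed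

end

section \<open>Cylinder events\<close>

definition cylinder :: "nat => (nat => (real^'d) set) => (nat => ennreal set) => (real^'d) measure set" where
  "cylinder m V B = {\<mu> \<in> configs. \<forall>i<m. emeasure \<mu> (V i) \<in> B i}"

text \<open>Restricted to sets of finite volume, for which the Poisson law gives the distribution of
  the counts explicitly.\<close>

definition cylinders :: "(real^'d) measure set set" where
  "cylinders = {cylinder m V B | m V B. (\<forall>i<m. V i \<in> sets borel \<and> emeasure lborel (V i) < \<infinity>) \<and> (\<forall>i<m. B i \<in> sets borel)}"

lemma Int_stable_cylinders: "Int_stable (cylinders :: (real^'d) measure set set)"
  unfolding Int_stable_def
proof (intro ballI)
  fix a b :: "(real^'d) measure set" assume "a \<in> cylinders" "b \<in> cylinders"
  then obtain m V B m' V' B' where *: "a = cylinder m V B" "b = cylinder m' V' B'"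
    "\<forall>i<m. V i \<in> sets borel \<and> emeasure lborel (V i) < \<infinity>" "\<forall>i<m. B i \<in> sets borel"
    "\<forall>i<m'. V' i \<in> sets borel \<and> emeasure lborel (V' i) < \<infinity>" "\<forall>i<m'. B' i \<in> sets borel"
    unfolding cylinders_def by blast
  define V2 where "V2 = (\<lambda>i. if i < m then V i else V' (i - m))"
  define B2 where "B2 = (\<lambda>i. if i < m then B i else B' (i - m))"
  have "a \<inter> b = cylinder (m + m') V2 B2"
  proof (intro set_eqI iffI)
    fix \<mu> assume \<mu>: "\<mu> \<in> a \<inter> b"
    have "emeasure \<mu> (V2 i) \<in> B2 i" if "i < m + m'" for i
      using \<mu> that by (cases "i < m") (auto simp: * cylinder_def V2_def B2_def)
    thus "\<mu> \<in> cylinder (m + m') V2 B2" using \<mu> by (auto simp: * cylinder_def)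
  next
    fix \<mu> assume \<mu>: "\<mu> \<in> cylinder (m + m') V2 B2"
    have "emeasure \<mu> (V i) \<in> B i" if "i < m" for i
      using \<mu> that by (auto simp: cylinder_def V2_def B2_def dest!: spec[of _ i])
    moreover have "emeasure \<mu> (V' i) \<in> B' i" if "i < m'" for i
      using \<mu> that by (auto simp: cylinder_def V2_def B2_def dest!: spec[of _ "i + m"])
    ultimately show "\<mu> \<in> a \<inter> b" using \<mu> by (auto simp: * cylinder_def)
  qed
  moreover have "cylinder (m + m') V2 B2 \<in> cylinders"
    unfolding cylinders_def
    by (intro CollectI exI[of _ "m + m'"] exI[of _ V2] exI[of _ B2] conjI refl) (use * in \<open>auto simp: V2_def B2_def\<close>)
  ultimately show "a \<inter> b \<in> cylinders" by simp
qed

lemma cylinder_measurable: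
  assumes "\<And>i. i < m ==> V i \<in> sets borel" "\<And>i. i < m ==> B i \<in> sets borel"
  shows "cylinder m V B \<in> sets (count_algebra (sets borel))"
proof -
  have "cylinder m V B = {\<mu> \<in> space (count_algebra (sets borel)). \<forall>i\<in>{..<m}. emeasure \<mu> (V i) \<in> B i}"
    by (auto simp: cylinder_def)
  also have "\<dots> \<in> sets (count_algebra (sets borel))"
  proof (rule sets.sets_Collect_finite_All)
    fix i assume i: "i \<in> {..<m}"
    have "(\<lambda>\<mu>. emeasure \<mu> (V i)) -` B i \<inter> space (count_algebra (sets borel)) \<in> sets (count_algebra (sets borel))"
      by (rule measurable_sets[OF measurable_count]) (use assms i in auto)
    also have "(\<lambda>\<mu>. emeasure \<mu> (V i)) -` B i \<inter> space (count_algebra (sets borel)) = {\<mu> \<in> space (count_algebra (sets borel)). emeasure \<mu> (V i) \<in> B i}" by auto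
    finally show "{\<mu> \<in> space (count_algebra (sets borel)). emeasure \<mu> (V i) \<in> B i} \<in> sets (count_algebra (sets borel))" .
  qed simp
  finally show ?thesis .
qed

text \<open>The count of a set of infinite volume is the sum of the counts of its bounded annular
  pieces.\<close>

lemma sets_count_algebra_cylinders:
  "sets (count_algebra (sets borel :: (real^'d) set set)) = sigma_sets configs cylinders"
proof
  let ?M = "sigma configs (cylinders :: (real^'d) measure set set)"
  have sp: "(cylinders :: (real^'d) measure set set) \<subseteq> Pow configs" by (auto simp: cylinders_def cylinder_def)
  have sM: "space ?M = configs" "sets ?M = sigma_sets configs cylinders" using sp by simp_all
  have fin: "(\<lambda>\<mu>. emeasure \<mu> V) \<in> borel_measurable ?M" if "V \<in> sets borel" "emeasure lborel V < \<infinity>" for V :: "(real^'d) set"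
  proof (rule measurableI)
    fix B :: "ennreal set" assume "B \<in> sets borel"
    hence "cylinder 1 (\<lambda>_. V) (\<lambda>_. B) \<in> cylinders" unfolding cylinders_def using that by blast
    moreover have "(\<lambda>\<mu>. emeasure \<mu> V) -` B \<inter> space ?M = cylinder 1 (\<lambda>_. V) (\<lambda>_. B)" unfolding sM by (auto simp: cylinder_def)
    ultimately show "(\<lambda>\<mu>. emeasure \<mu> V) -` B \<inter> space ?M \<in> sets ?M" unfolding sM by (simp add: sigma_sets.Basic)
  qed simp
  have all: "(\<lambda>\<mu>. emeasure \<mu> V) \<in> borel_measurable ?M" if V: "V \<in> sets borel" for V :: "(real^'d) set"
  proof -
    define R where "R = (\<lambda>j::nat. V \<inter> {x. real j \<le> norm x \<and> norm x < real j + 1})"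
    have R: "R j \<in> sets borel" for j unfolding R_def using V by measurable
    have Rf: "emeasure lborel (R j) < \<infinity>" for j
    proof -
      have "R j \<subseteq> ball 0 (real j + 1)" by (auto simp: R_def)
      hence "emeasure lborel (R j) \<le> emeasure lborel (ball (0::real^'d) (real j + 1))" by (intro emeasure_mono) auto
      also have "\<dots> < \<infinity>" by (rule emeasure_bounded_finite) simp
      finally show ?thesis .
    qed
    have dj: "disjoint_family R" unfolding disjoint_family_on_def R_def
    proof (intro ballI impI)
      fix i j :: nat assume "i \<noteq> j"
      thus "V \<inter> {x. real i \<le> norm x \<and> norm x < real i + 1} \<inter> (V \<inter> {x. real j \<le> norm x \<and> norm x < real j + 1}) = {}"
        by (cases "i < j") (auto simp: not_less)
    qed
    have un: "(\<Union>j. R j) = V"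
    proof -
      have "\<exists>j::nat. real j \<le> norm x \<and> norm x < real j + 1" for x :: "real^'d"
        by (rule exI[of _ "nat \<lfloor>norm x\<rfloor>"]) (simp add: of_nat_nat)
      thus ?thesis by (auto simp: R_def)
    qed
    have "(\<lambda>\<mu>. \<Sum>j. emeasure \<mu> (R j)) \<in> borel_measurable ?M"
    proof -
      have [measurable]: "(\<lambda>\<mu>. emeasure \<mu> (R j)) \<in> borel_measurable ?M" for j by (intro fin R Rf)
      show ?thesis by measurable
    qed
    moreover have "(\<Sum>j. emeasure \<mu> (R j)) = emeasure \<mu> V" if "\<mu> \<in> space ?M" for \<mu>
    proof -
      have "sets \<mu> = sets borel" using that unfolding sM by (rule sets_configs)
      thus ?thesis using R dj unfolding un[symmetric] by (intro suminf_emeasure) auto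
    qed
    ultimately show ?thesis by (simp cong: measurable_cong)
  qed
  have "(\<lambda>\<mu>. \<mu>) \<in> ?M \<rightarrow>\<^sub>M count_algebra (sets borel)"
    by (rule measurable_count_algebraI) (use all sM in auto)
  thus "sets (count_algebra (sets borel)) \<subseteq> sigma_sets configs (cylinders :: (real^'d) measure set set)"
  proof (intro subsetI)
    fix S assume S: "S \<in> sets (count_algebra (sets borel :: (real^'d) set set))" and id: "(\<lambda>\<mu>. \<mu>) \<in> ?M \<rightarrow>\<^sub>M count_algebra (sets borel)"
    have "(\<lambda>\<mu>. \<mu>) -` S \<inter> space ?M \<in> sets ?M" by (rule measurable_sets[OF id S])
    thus "S \<in> sigma_sets configs cylinders" using sets.sets_into_space[OF S] unfolding sM by (simp add: Int_absorb2)
  qed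
  have "(cylinders :: (real^'d) measure set set) \<subseteq> sets (count_algebra (sets borel))"
  proof
    fix c :: "(real^'d) measure set" assume "c \<in> cylinders"
    then obtain m V B where "c = cylinder m V B" "\<forall>i<m. V i \<in> sets borel \<and> emeasure lborel (V i) < \<infinity>" "\<forall>i<m. B i \<in> sets borel"
      unfolding cylinders_def by blast
    thus "c \<in> sets (count_algebra (sets borel))" using cylinder_measurable[of m V B] by simp
  qed
  from sets.sigma_sets_subset[OF this]
  show "sigma_sets configs cylinders \<subseteq> sets (count_algebra (sets borel :: (real^'d) set set))" by simp
qed

section \<open>A window: labelled uniform points and an independent exterior\<close>

locale poisson_window = poisson \<rho> P for \<rho> and P :: "(real^'d::finite) measure measure" +
  fixes Q :: "(real^'d) set"
  assumes Q_borel [measurable]: "Q \<in> sets borel"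
    and Q_pos: "emeasure lborel Q \<noteq> 0" and Q_fin: "emeasure lborel Q < \<infinity>"
begin

definition Ext :: "(real^'d) measure measure" where
  "Ext = count_algebra {V \<in> sets borel. V \<subseteq> - Q}"

text \<open>Its points are still whole configurations; only the events visible outside Q are
  kept.\<close>

definition PE :: "(real^'d) measure measure" where
  "PE = restr_to_subalg P Ext"

definition UQ :: "(real^'d) measure" where
  "UQ = uniform_measure lborel Q"

text \<open>The labelled space: an exterior and N independent uniform points. The map
  \<open>T\<close> assembles them into a configuration and forgets the labels.\<close>

definition Om :: "nat => ((real^'d) measure \<times> (nat => real^'d)) measure" where
  "Om N = PE \<Otimes>\<^sub>M (\<Pi>\<^sub>M i\<in>{..<N}. UQ)"

definition T :: "nat => (real^'d) measure \<times> (nat => real^'d) => (real^'d) measure" where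
  "T N = (\<lambda>(\<eta>, x). conf Q N x \<eta>)"

definition pN :: "nat => real" where
  "pN = pois (\<rho> * measure lborel Q)"

lemma measure_Q_pos: "0 < measure lborel Q"
  using Q_pos Q_fin by (simp add: measure_def enn2real_positive_iff less_top zero_less_iff_neq_zero)

lemma pN_pos: "0 < pN N"
  unfolding pN_def by (rule pois_pos) (use rho measure_Q_pos in simp)

lemma subalg_Ext: "subalgebra P Ext"
proof -
  have "subalgebra (count_algebra (sets borel)) Ext" unfolding Ext_def by (rule count_algebra_mono) auto
  thus ?thesis by (simp add: subalgebra_def sets_P)
qed

lemma space_Ext [simp]: "space Ext = configs" by (simp add: Ext_def)

lemma sets_PE [measurable_cong]: "sets PE = sets Ext"
  unfolding PE_def by (rule sets_restr_to_subalg[OF subalg_Ext])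

lemma space_PE [simp]: "space PE = configs"
  unfolding PE_def by (simp add: space_restr_to_subalg)

lemma prob_PE: "prob_space PE"
  unfolding PE_def by (rule prob_space_restr_to_subalg[OF subalg_Ext]) (rule prob_space_axioms)

lemma emeasure_PE: "A \<in> sets Ext ==> emeasure PE A = emeasure P A"
  unfolding PE_def by (rule emeasure_restr_to_subalg[OF subalg_Ext])

lemma prob_UQ: "prob_space UQ"
  unfolding UQ_def by (rule prob_space_uniform_measure) (use Q_pos Q_fin in auto)

lemma sets_UQ [measurable_cong, simp]: "sets UQ = sets borel"
  by (simp add: UQ_def)

lemma space_UQ [simp]: "space UQ = UNIV"
  by (simp add: UQ_def)

lemma prob_PiUQ: "prob_space (\<Pi>\<^sub>M i\<in>{..<N::nat}. UQ)"
  by (rule prob_space_PiM) (rule prob_UQ)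

lemma prob_Om: "prob_space (Om N)"
proof -
  interpret A: prob_space PE by (rule prob_PE)
  interpret B: prob_space "\<Pi>\<^sub>M i\<in>{..<N}. UQ" by (rule prob_PiUQ)
  interpret pair_prob_space PE "\<Pi>\<^sub>M i\<in>{..<N}. UQ" ..
  show ?thesis unfolding Om_def by (rule prob_space_axioms)
qed

lemma space_Om: "space (Om N) = configs \<times> ({..<N} \<rightarrow>\<^sub>E UNIV)"
  by (simp add: Om_def space_pair_measure space_PiM)

lemma sets_Om [measurable_cong]: "sets (Om N) = sets (Ext \<Otimes>\<^sub>M (\<Pi>\<^sub>M i\<in>{..<N}. borel))"
  unfolding Om_def by (intro sets_pair_measure_cong sets_PE sets_PiM_cong) auto

lemma T_measurable [measurable]: "T N \<in> Om N \<rightarrow>\<^sub>M P"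
  unfolding T_def measurable_cong_sets[OF sets_Om sets_P] Ext_def by (rule measurable_conf) simp

lemma T_configs: "\<xi> \<in> space (Om N) ==> T N \<xi> \<in> configs"
  using measurable_space[OF T_measurable[of N]] by simp

lemma AE_UQ: "AE x in UQ. x \<in> Q"
  unfolding UQ_def by (rule AE_uniform_measureI) auto

lemma AE_in_Q: "AE \<xi> in Om N. \<forall>i<N. snd \<xi> i \<in> Q"
proof -
  interpret A: prob_space PE by (rule prob_PE)
  interpret B: prob_space "\<Pi>\<^sub>M i\<in>{..<N}. UQ" by (rule prob_PiUQ)
  interpret pair_prob_space PE "\<Pi>\<^sub>M i\<in>{..<N}. UQ" ..
  have "AE x in (\<Pi>\<^sub>M i\<in>{..<N}. UQ). \<forall>i\<in>{..<N}. x i \<in> Q"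
  proof (rule AE_finite_allI)
    fix i assume i: "i \<in> {..<N}"
    show "AE x in (\<Pi>\<^sub>M i\<in>{..<N}. UQ). x i \<in> Q"
      by (rule AE_PiM_component[of "{..<N}" "\<lambda>_. UQ", OF prob_UQ i AE_UQ])
  qed simp
  hence ae: "AE \<eta> in PE. AE x in (\<Pi>\<^sub>M i\<in>{..<N}. UQ). \<forall>i\<in>{..<N}. snd (\<eta>, x) i \<in> Q" by simp
  have "AE \<xi> in PE \<Otimes>\<^sub>M (\<Pi>\<^sub>M i\<in>{..<N}. UQ). \<forall>i\<in>{..<N}. snd \<xi> i \<in> Q"
  proof (rule AE_pair_measure[OF _ ae])
    show "{\<xi> \<in> space (PE \<Otimes>\<^sub>M (\<Pi>\<^sub>M i\<in>{..<N}. UQ)). \<forall>i\<in>{..<N}. snd \<xi> i \<in> Q} \<in> sets (PE \<Otimes>\<^sub>M (\<Pi>\<^sub>M i\<in>{..<N}. UQ))"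
    proof (rule sets.sets_Collect_finite_All)
      fix i assume i: "i \<in> {..<N}"
      have "(\<lambda>\<xi>. snd \<xi> i) \<in> PE \<Otimes>\<^sub>M (\<Pi>\<^sub>M i\<in>{..<N}. UQ) \<rightarrow>\<^sub>M UQ"
        by (rule measurable_compose[OF measurable_snd measurable_component_singleton[OF i]])
      from measurable_sets[OF this, of Q]
      show "{\<xi> \<in> space (PE \<Otimes>\<^sub>M (\<Pi>\<^sub>M i\<in>{..<N}. UQ)). snd \<xi> i \<in> Q} \<in> sets (PE \<Otimes>\<^sub>M (\<Pi>\<^sub>M i\<in>{..<N}. UQ))"
        by (simp add: vimage_def Int_def conj_commute)
    qed simp
  qed
  thus ?thesis unfolding Om_def by (simp add: lessThan_def)
qed

lemma ext_event [measurable]: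
  assumes "finite S" "\<And>s. s \<in> S ==> W s \<in> sets borel" "\<And>s. s \<in> S ==> W s \<subseteq> - Q"
  shows "{\<eta> \<in> configs. \<forall>s\<in>S. emeasure \<eta> (W s) = c s} \<in> sets Ext"
proof -
  have "{\<eta> \<in> space Ext. \<forall>s\<in>S. emeasure \<eta> (W s) = c s} \<in> sets Ext"
  proof (rule sets.sets_Collect_finite_All)
    fix s assume s: "s \<in> S"
    have "(\<lambda>\<eta>. emeasure \<eta> (W s)) \<in> borel_measurable Ext"
      unfolding Ext_def by (rule measurable_count) (use assms s in auto)
    from measurable_sets[OF this, of "{c s}"] show "{\<eta> \<in> space Ext. emeasure \<eta> (W s) = c s} \<in> sets Ext"
      by (simp add: vimage_def Int_def conj_commute)
  qed (use assms in simp)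
  thus ?thesis by simp
qed

text \<open>Inside \<open>Q\<close> the Poisson weight of \<open>N\<close> and the multinomial law
  recombine into independent Poisson laws.\<close>

lemma window_counts:
  assumes S: "finite S" and W: "\<And>s. s \<in> S ==> W s \<in> sets borel" "\<And>s. s \<in> S ==> emeasure lborel (W s) < \<infinity>"
    and disj: "disjoint_family_on W S" and R: "R \<subseteq> S" "(\<Union>s\<in>R. W s) = Q" "\<And>s. s \<in> S - R ==> W s \<subseteq> - Q"
  shows "emeasure P ({\<mu> \<in> configs. \<forall>s\<in>S. emeasure \<mu> (W s) = of_nat (k s)} \<inter> {\<mu> \<in> configs. emeasure \<mu> Q = of_nat N}) =
    ennreal (pN N) * emeasure (Om N) (T N -` {\<mu> \<in> configs. \<forall>s\<in>S. emeasure \<mu> (W s) = of_nat (k s)} \<inter> space (Om N))"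
    (is "emeasure P (?C \<inter> ?QN) = _ * emeasure _ (T N -` ?C \<inter> _)")
proof -
  have finR: "finite R" using S R(1) by (rule finite_subset[rotated])
  have djR: "disjoint_family_on W R" using disj R(1) by (rule disjoint_family_on_mono[rotated])
  \<comment> \<open>The sets indexed by \<open>R\<close> partition Q, so the prescribed counts fix
    the number of points in Q; if it is not N, both sides vanish.\<close>
  have muQ: "emeasure \<mu> Q = of_nat (sum k R)" if "\<mu> \<in> ?C" for \<mu>
  proof -
    have "sets \<mu> = sets borel" using that sets_configs by auto
    hence "(\<Sum>s\<in>R. emeasure \<mu> (W s)) = emeasure \<mu> (\<Union>s\<in>R. W s)"
      using W(1) R(1) by (intro sum_emeasure djR finR) auto
    moreover have "(\<Sum>s\<in>R. emeasure \<mu> (W s)) = (\<Sum>s\<in>R. of_nat (k s))"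
      using that R(1) by (intro sum.cong) auto
    ultimately show ?thesis using R(2) by simp
  qed
  have Cm: "?C \<in> sets P"
  proof -
    have "{\<mu> \<in> space P. \<forall>s\<in>S. emeasure \<mu> (W s) = of_nat (k s)} \<in> sets P"
      by (rule sets.sets_Collect_finite_All) (use S W(1) count_event in simp_all)
    thus ?thesis by simp
  qed
  show ?thesis
  proof (cases "sum k R = N")
    case False
    hence ne: "(of_nat (sum k R) :: ennreal) \<noteq> of_nat N" by (simp only: of_nat_eq_iff not_False_eq_True)
    have "?C \<inter> ?QN = {}"
    proof (intro equals0I)
      fix \<mu> assume "\<mu> \<in> ?C \<inter> ?QN"
      hence "\<mu> \<in> ?C" "emeasure \<mu> Q = of_nat N" by auto
      with trans[OF sym[OF muQ]] have "of_nat (sum k R) = (of_nat N :: ennreal)" by blast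
      with ne show False by contradiction
    qed
    moreover have "AE \<xi> in Om N. \<xi> \<notin> T N -` ?C \<inter> space (Om N)"
      using AE_in_Q[of N] AE_space
    proof eventually_elim
      case (elim \<xi>)
      obtain \<eta> x where \<xi>: "\<xi> = (\<eta>, x)" "\<eta> \<in> configs" using elim(2) by (auto simp: space_Om)
      have "{i. i < N \<and> x i \<in> Q} = {..<N}" using elim(1) \<xi> by auto
      hence "emeasure (T N \<xi>) Q = of_nat N" using \<xi> by (simp add: T_def emeasure_conf)
      hence "T N \<xi> \<notin> ?C" using ne muQ[of "T N \<xi>"] by (metis (no_types, lifting))
      thus ?case by blast
    qed
    hence "emeasure (Om N) (T N -` ?C \<inter> space (Om N)) = 0"
      using measurable_sets[OF T_measurable Cm] by (subst (asm) AE_iff_measurable[of "T N -` ?C \<inter> space (Om N)"]) auto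
    ultimately show ?thesis by simp
  next
    case True
    have "?C \<inter> ?QN = ?C" using muQ True by auto
    hence lhs: "emeasure P (?C \<inter> ?QN) = ennreal (\<Prod>s\<in>S. pois (\<rho> * measure lborel (W s)) (k s))"
      using joint_count_prob[OF S W disj, of k] by (simp add: emeasure_eq_measure)
    define Ce where "Ce = {\<eta> \<in> configs. \<forall>s\<in>S - R. emeasure \<eta> (W s) = of_nat (k s)}"
    define Ci where "Ci = {x \<in> space (\<Pi>\<^sub>M i\<in>{..<N}. UQ). \<forall>s\<in>R. card {i. i < N \<and> x i \<in> W s} = k s}"
    have Ce: "Ce \<in> sets Ext" unfolding Ce_def by (rule ext_event) (use S W R in auto)
    have WR: "W s \<subseteq> Q" if "s \<in> R" for s using R(2) that by auto
    have mi: "Ci \<in> sets (\<Pi>\<^sub>M i\<in>{..<N}. UQ)" "measure (\<Pi>\<^sub>M i\<in>{..<N}. UQ) Ci = fact N * (\<Prod>s\<in>R. measure UQ (W s) ^ k s / fact (k s))"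
      using multinomial_measure[OF prob_UQ finR True _ djR] W(1) R(1) unfolding Ci_def by auto
    \<comment> \<open>Almost surely the event is a product: the sets outside Q see the exterior
      only, those inside only the labelled points.\<close>
    have pre: "AE \<xi> in Om N. \<xi> \<in> T N -` ?C \<inter> space (Om N) \<longleftrightarrow> \<xi> \<in> Ce \<times> Ci"
      using AE_in_Q[of N] AE_space
    proof eventually_elim
      case (elim \<xi>)
      obtain \<eta> x where \<xi>: "\<xi> = (\<eta>, x)" "\<eta> \<in> configs" "x \<in> {..<N} \<rightarrow>\<^sub>E UNIV" using elim(2) by (auto simp: space_Om)
      have xQ: "\<And>i. i < N ==> x i \<in> Q" using elim(1) \<xi> by simp
      have tin: "T N \<xi> \<in> configs" using T_configs elim(2) by blast
      have c1: "emeasure (T N \<xi>) (W s) = of_nat (card {i. i < N \<and> x i \<in> W s})" if s: "s \<in> R" for s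
      proof -
        have e: "W s - Q = {}" using WR[OF s] by auto
        have wb: "W s \<in> sets borel" using W(1) s R(1) by auto
        have "emeasure (T N \<xi>) (W s) = of_nat (card {i. i < N \<and> x i \<in> W s}) + emeasure \<eta> (W s - Q)"
          using emeasure_conf[OF \<xi>(2) Q_borel wb] \<xi>(1) by (simp add: T_def)
        thus ?thesis unfolding e by simp
      qed
      have c2: "emeasure (T N \<xi>) (W s) = emeasure \<eta> (W s)" if s: "s \<in> S - R" for s
      proof -
        have "{i. i < N \<and> x i \<in> W s} = {}" "W s - Q = W s" using R(3)[OF s] xQ by auto
        thus ?thesis using emeasure_conf[OF \<xi>(2) Q_borel, of "W s" N x] W(1) s \<xi>(1) by (simp add: T_def)
      qed
      have "\<xi> \<in> T N -` ?C \<inter> space (Om N) \<longleftrightarrow> (\<forall>s\<in>R. emeasure (T N \<xi>) (W s) = of_nat (k s)) \<and> (\<forall>s\<in>S - R. emeasure (T N \<xi>) (W s) = of_nat (k s))"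
        using tin elim(2) R(1) by auto
      also have "\<dots> \<longleftrightarrow> \<xi> \<in> Ce \<times> Ci"
        using c1 c2 \<xi> by (auto simp: Ce_def Ci_def space_PiM)
      finally show ?case .
    qed
    interpret B: prob_space "\<Pi>\<^sub>M i\<in>{..<N}. UQ" by (rule prob_PiUQ)
    have "emeasure (Om N) (T N -` ?C \<inter> space (Om N)) = emeasure (Om N) (Ce \<times> Ci)"
      by (rule emeasure_eq_AE[OF pre])
        (use measurable_sets[OF T_measurable Cm] Ce mi(1) in \<open>auto simp: Om_def sets_PE\<close>)
    also have "\<dots> = emeasure PE Ce * emeasure (\<Pi>\<^sub>M i\<in>{..<N}. UQ) Ci"
      unfolding Om_def by (rule B.emeasure_pair_measure_Times) (use Ce mi(1) in \<open>auto simp: sets_PE\<close>)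
    also have "emeasure PE Ce = ennreal (\<Prod>s\<in>S - R. pois (\<rho> * measure lborel (W s)) (k s))"
      unfolding emeasure_PE[OF Ce] unfolding Ce_def
      using joint_count_prob[of "S - R" W k] S W disjoint_family_on_mono[OF _ disj, of "S - R"]
      by (simp add: emeasure_eq_measure)
    also have "emeasure (\<Pi>\<^sub>M i\<in>{..<N}. UQ) Ci = ennreal (fact N * (\<Prod>s\<in>R. measure UQ (W s) ^ k s / fact (k s)))"
      using mi by (simp add: B.emeasure_eq_measure)
    finally have rhs: "emeasure (Om N) (T N -` ?C \<inter> space (Om N)) = ennreal (\<Prod>s\<in>S - R. pois (\<rho> * measure lborel (W s)) (k s)) *
      ennreal (fact N * (\<Prod>s\<in>R. measure UQ (W s) ^ k s / fact (k s)))" .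
    define q where "q = measure lborel Q"
    have q0: "q > 0" unfolding q_def by (rule measure_Q_pos)
    have mU: "measure UQ (W s) = measure lborel (W s) / q" if "s \<in> R" for s
    proof -
      have "Q \<inter> W s = W s" using WR[OF that] by auto
      thus ?thesis unfolding UQ_def q_def using measure_uniform_measure[of lborel Q "W s"] Q_pos Q_fin W(1) R(1) that by auto
    qed
    have tot: "(\<Sum>s\<in>R. measure lborel (W s)) = q"
    proof -
      have "measure lborel (\<Union>s\<in>R. W s) = (\<Sum>s\<in>R. measure lborel (W s))"
        by (rule measure_finite_Union[OF finR _ djR]) (use W R(1) in \<open>auto simp: less_top\<close>)
      thus ?thesis using R(2) by (simp add: q_def)
    qed
    \<comment> \<open>The factorial of N and the powers of the volume of Q cancel, and the
      exponential splits because the volumes over \<open>R\<close> add up to that of Q.\<close>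
    have "pN N * (fact N * (\<Prod>s\<in>R. measure UQ (W s) ^ k s / fact (k s))) =
        exp (- (\<rho> * q)) * ((\<rho> * q) ^ N * (\<Prod>s\<in>R. (measure lborel (W s) / q) ^ k s / fact (k s)))"
      by (simp add: pN_def pois_def q_def[symmetric] mU)
    also have "(\<rho> * q) ^ N = (\<Prod>s\<in>R. (\<rho> * q) ^ k s)" unfolding True[symmetric] by (rule power_sum)
    also have "(\<Prod>s\<in>R. (\<rho> * q) ^ k s) * (\<Prod>s\<in>R. (measure lborel (W s) / q) ^ k s / fact (k s)) =
        (\<Prod>s\<in>R. (\<rho> * measure lborel (W s)) ^ k s / fact (k s))"
      unfolding prod.distrib[symmetric] using q0 by (intro prod.cong) (auto simp: power_mult_distrib power_divide)
    also have "exp (- (\<rho> * q)) = (\<Prod>s\<in>R. exp (- (\<rho> * measure lborel (W s))))"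
      using finR by (simp add: exp_sum[symmetric] sum_negf sum_distrib_left[symmetric] tot)
    also have "(\<Prod>s\<in>R. exp (- (\<rho> * measure lborel (W s)))) * (\<Prod>s\<in>R. (\<rho> * measure lborel (W s)) ^ k s / fact (k s)) =
        (\<Prod>s\<in>R. pois (\<rho> * measure lborel (W s)) (k s))"
      unfolding prod.distrib[symmetric] by (intro prod.cong) (auto simp: pois_def)
    finally have key: "pN N * (fact N * (\<Prod>s\<in>R. measure UQ (W s) ^ k s / fact (k s))) = (\<Prod>s\<in>R. pois (\<rho> * measure lborel (W s)) (k s))" .
    have "ennreal (pN N) * emeasure (Om N) (T N -` ?C \<inter> space (Om N)) =
        ennreal (\<Prod>s\<in>S - R. pois (\<rho> * measure lborel (W s)) (k s)) * (ennreal (pN N) * ennreal (fact N * (\<Prod>s\<in>R. measure UQ (W s) ^ k s / fact (k s))))"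
      unfolding rhs by (simp add: mult_ac)
    also have "ennreal (pN N) * ennreal (fact N * (\<Prod>s\<in>R. measure UQ (W s) ^ k s / fact (k s))) = ennreal (\<Prod>s\<in>R. pois (\<rho> * measure lborel (W s)) (k s))"
      unfolding key[symmetric] using pN_pos[of N] by (intro ennreal_mult[symmetric]) (auto intro!: mult_nonneg_nonneg prod_nonneg)
    also have "ennreal (\<Prod>s\<in>S - R. pois (\<rho> * measure lborel (W s)) (k s)) * \<dots> =
        ennreal ((\<Prod>s\<in>S - R. pois (\<rho> * measure lborel (W s)) (k s)) * (\<Prod>s\<in>R. pois (\<rho> * measure lborel (W s)) (k s)))"
      using rho by (intro ennreal_mult[symmetric] prod_nonneg ballI pois_nonneg) auto
    also have "(\<Prod>s\<in>S - R. pois (\<rho> * measure lborel (W s)) (k s)) * (\<Prod>s\<in>R. pois (\<rho> * measure lborel (W s)) (k s)) =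
        (\<Prod>s\<in>S. pois (\<rho> * measure lborel (W s)) (k s))"
      by (rule prod.subset_diff[symmetric, OF R(1) S])
    finally show ?thesis unfolding lhs by simp
  qed
qed

text \<open>The region of the Venn diagram of \<open>V 0\<close>, ..., \<open>V m\<close> selected
  by \<open>s\<close>.\<close>

definition atom :: "nat => (nat => (real^'d) set) => nat set => (real^'d) set" where
  "atom m V s = (\<Inter>i\<in>s. V i) - (\<Union>i\<in>{..m} - s. V i)"

text \<open>The empty pattern is left out: its region is the complement of all the sets and would
  have infinite volume.\<close>

definition patterns :: "nat => nat set set" where
  "patterns m = Pow {..m} - {{}}"

lemma finite_patterns: "finite (patterns m)"
  by (simp add: patterns_def)

lemma atom_facts:
  assumes V: "\<And>i. i \<le> m ==> V i \<in> sets borel" "\<And>i. i \<le> m ==> emeasure lborel (V i) < \<infinity>"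
  shows "s \<in> patterns m ==> atom m V s \<in> sets borel"
    "s \<in> patterns m ==> emeasure lborel (atom m V s) < \<infinity>"
    "disjoint_family_on (atom m V) (patterns m)"
    "i \<le> m ==> (\<Union>s\<in>{s \<in> patterns m. i \<in> s}. atom m V s) = V i"
    "s \<in> patterns m ==> i \<le> m ==> i \<notin> s ==> atom m V s \<subseteq> - V i"
proof -
  have b: "atom m V s \<in> sets borel" if s: "s \<in> patterns m" for s
  proof -
    have "finite s" "s \<noteq> {}" "s \<subseteq> {..m}" using s by (auto simp: patterns_def intro: finite_subset)
    thus ?thesis unfolding atom_def by (intro sets.Diff sets.finite_INT sets.finite_UN) (use V in auto)
  qed
  show "s \<in> patterns m ==> atom m V s \<in> sets borel" by (rule b)
  show "emeasure lborel (atom m V s) < \<infinity>" if s: "s \<in> patterns m"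
  proof -
    obtain i where i: "i \<in> s" "i \<le> m" using s by (auto simp: patterns_def)
    have "emeasure lborel (atom m V s) \<le> emeasure lborel (V i)"
      by (rule emeasure_mono) (use i V in \<open>auto simp: atom_def\<close>)
    also have "\<dots> < \<infinity>" using V(2) i by simp
    finally show ?thesis .
  qed
  have in_atom: "s = {i. i \<le> m \<and> p \<in> V i}" if "s \<in> patterns m" "p \<in> atom m V s" for s p
    using that by (auto simp: patterns_def atom_def)
  show "disjoint_family_on (atom m V) (patterns m)"
    unfolding disjoint_family_on_def using in_atom by blast
  show "(\<Union>s\<in>{s \<in> patterns m. i \<in> s}. atom m V s) = V i" if i: "i \<le> m"
  proof (intro equalityI subsetI)
    fix p assume "p \<in> V i"
    hence "{i. i \<le> m \<and> p \<in> V i} \<in> {s \<in> patterns m. i \<in> s}" "p \<in> atom m V {i. i \<le> m \<and> p \<in> V i}"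
      using i by (auto simp: patterns_def atom_def)
    thus "p \<in> (\<Union>s\<in>{s \<in> patterns m. i \<in> s}. atom m V s)" by blast
  qed (auto simp: atom_def)
  show "s \<in> patterns m ==> i \<le> m ==> i \<notin> s ==> atom m V s \<subseteq> - V i"
    by (auto simp: atom_def)
qed

section \<open>Identification of the conditional law\<close>

definition QN :: "nat => (real^'d) measure set" where
  "QN N = {\<mu> \<in> configs. emeasure \<mu> Q = of_nat N}"

lemma QN_sets [measurable]: "QN N \<in> sets P"
  by (simp add: QN_def count_event)

lemma emeasure_QN: "emeasure P (QN N) = ennreal (pN N)"
  unfolding QN_def pN_def using count_prob[OF Q_borel Q_fin, of N] by (simp add: emeasure_eq_measure)

definition M1 :: "nat => (real^'d) measure measure" where
  "M1 N = density P (indicator (QN N))"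

definition M2 :: "nat => (real^'d) measure measure" where
  "M2 N = scale_measure (ennreal (pN N)) (distr (Om N) P (T N))"

lemma sets_M12 [simp, measurable_cong]: "sets (M1 N) = sets P" "sets (M2 N) = sets P"
  by (simp_all add: M1_def M2_def)

lemma space_M12 [simp]: "space (M1 N) = configs" "space (M2 N) = configs"
  using sets_eq_imp_space_eq[OF sets_M12(1)] sets_eq_imp_space_eq[OF sets_M12(2)] by auto

lemma emeasure_M1: assumes "A \<in> sets P" shows "emeasure (M1 N) A = emeasure P (A \<inter> QN N)"
proof -
  have "(\<lambda>\<mu>. indicator (QN N) \<mu> * indicator A \<mu> :: ennreal) = indicator (A \<inter> QN N)"
    by (auto simp: indicator_def)
  moreover have "emeasure (M1 N) A = (\<integral>\<^sup>+\<mu>. indicator (QN N) \<mu> * indicator A \<mu> \<partial>P)"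
    unfolding M1_def using assms by (subst emeasure_density) auto
  ultimately show ?thesis using assms by simp
qed

lemma emeasure_M2: assumes "A \<in> sets P"
  shows "emeasure (M2 N) A = ennreal (pN N) * emeasure (Om N) (T N -` A \<inter> space (Om N))"
  unfolding M2_def using assms by (simp add: emeasure_distr)

lemma emeasure_M_space: "emeasure (M1 N) configs = ennreal (pN N)" "emeasure (M2 N) configs = ennreal (pN N)"
proof -
  have c: "configs \<in> sets P" using sets.top[of P] by simp
  have i: "configs \<inter> QN N = QN N" by (auto simp: QN_def)
  show "emeasure (M1 N) configs = ennreal (pN N)" by (simp add: emeasure_M1[OF c] i emeasure_QN)
  have "T N -` configs \<inter> space (Om N) = space (Om N)" using T_configs by auto
  thus "emeasure (M2 N) configs = ennreal (pN N)"
    by (simp add: emeasure_M2[OF c] prob_space.emeasure_space_1[OF prob_Om])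
qed

text \<open>Membership in a cylinder is decided by the counts of the Venn regions of its sets
  together with Q. On each vector of such counts the two measures agree by
  \<open>window_counts\<close>, and there are countably many finite vectors.\<close>

lemma M12_cylinder:
  assumes V: "\<forall>i<m. V i \<in> sets borel \<and> emeasure lborel (V i) < \<infinity>" and B: "\<forall>i<m. B i \<in> sets borel"
  shows "emeasure (M1 N) (cylinder m V B) = emeasure (M2 N) (cylinder m V B)"
proof -
  \<comment> \<open>Q is adjoined as the last set, which makes it a union of Venn regions.\<close>
  define V' where "V' = (\<lambda>i. if i < m then V i else Q)"
  have V': "V' i \<in> sets borel" "emeasure lborel (V' i) < \<infinity>" if "i \<le> m" for i
    using V Q_fin by (auto simp: V'_def)
  define S where "S = patterns m"
  define W where "W = atom m V'"
  note af = atom_facts[of m V', OF V', folded S_def W_def]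
  have finS: "finite S" by (simp add: S_def finite_patterns)
  define R where "R = {s \<in> S. m \<in> s}"
  have R: "R \<subseteq> S" "(\<Union>s\<in>R. W s) = Q" "\<And>s. s \<in> S - R ==> W s \<subseteq> - Q"
    using af(4)[of m] af(5)[of _ m] by (auto simp: R_def V'_def)
  define C where "C = (\<lambda>k::nat set => nat. {\<mu> \<in> configs. \<forall>s\<in>S. emeasure \<mu> (W s) = of_nat (k s)})"
  define I where "I = S \<rightarrow>\<^sub>E (UNIV :: nat set)"
  have cI: "countable I" unfolding I_def by (rule countable_PiE) (use finS in auto)
  have Cm: "C k \<in> sets P" for k
  proof -
    have "{\<mu> \<in> space P. \<forall>s\<in>S. emeasure \<mu> (W s) = of_nat (k s)} \<in> sets P"
      by (rule sets.sets_Collect_finite_All) (use finS af(1) count_event in simp_all)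
    thus ?thesis by (simp add: C_def)
  qed
  have C_eq: "emeasure (M1 N) (C k) = emeasure (M2 N) (C k)" for k
    unfolding emeasure_M1[OF Cm] emeasure_M2[OF Cm] unfolding C_def QN_def
    by (rule window_counts[OF finS af(1,2,3) R])
  have dj: "disjoint_family_on C J" if "J \<subseteq> I" for J
    unfolding disjoint_family_on_def
  proof (intro ballI impI equals0I)
    fix k l \<mu> assume kl: "k \<in> J" "l \<in> J" "k \<noteq> l" and \<mu>: "\<mu> \<in> C k \<inter> C l"
    have "k = l"
    proof (rule PiE_ext)
      show "k \<in> S \<rightarrow>\<^sub>E UNIV" "l \<in> S \<rightarrow>\<^sub>E UNIV" using kl that by (auto simp: I_def)
      fix s assume "s \<in> S"
      hence "(of_nat (k s) :: ennreal) = of_nat (l s)" using \<mu> by (auto simp: C_def)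
      thus "k s = l s" by (simp only: of_nat_eq_iff)
    qed
    thus False using kl by simp
  qed
  have UN_eq: "emeasure (M1 N) (\<Union>k\<in>J. C k) = emeasure (M2 N) (\<Union>k\<in>J. C k)" if J: "J \<subseteq> I" for J
  proof -
    have cJ: "countable J" using J cI by (rule countable_subset)
    have "emeasure (M1 N) (\<Union>k\<in>J. C k) = (\<integral>\<^sup>+k. emeasure (M1 N) (C k) \<partial>count_space J)"
      by (rule emeasure_UN_countable) (use cJ Cm dj[OF J] in auto)
    moreover have "emeasure (M2 N) (\<Union>k\<in>J. C k) = (\<integral>\<^sup>+k. emeasure (M2 N) (C k) \<partial>count_space J)"
      by (rule emeasure_UN_countable) (use cJ Cm dj[OF J] in auto)
    ultimately show ?thesis by (simp add: C_eq)
  qed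
  define Fin where "Fin = (\<Union>k\<in>I. C k)"
  have Fm: "Fin \<in> sets P" unfolding Fin_def by (intro sets.countable_UN'[OF cI]) (use Cm in auto)
  have cm: "configs - Fin \<in> sets P" using Fm sets.top[of P] by auto
  have n1: "emeasure (M1 N) (configs - Fin) = 0"
  proof -
    have "AE \<mu> in P. \<forall>s\<in>S. \<exists>k::nat. emeasure \<mu> (W s) = of_nat k"
      by (rule AE_finite_allI[OF finS]) (use AE_count af in blast)
    hence "AE \<mu> in P. \<mu> \<notin> configs - Fin" using AE_space
    proof eventually_elim
      case (elim \<mu>)
      then obtain k :: "nat set => nat" where "\<forall>s\<in>S. emeasure \<mu> (W s) = of_nat (k s)" by metis
      hence "\<mu> \<in> C (restrict k S)" using elim(2) by (auto simp: C_def)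
      thus ?case by (auto simp: Fin_def I_def)
    qed
    hence "emeasure P (configs - Fin) = 0" using cm by (subst (asm) AE_iff_measurable[of "configs - Fin"]) (auto dest: sets.sets_into_space)
    moreover have "emeasure P ((configs - Fin) \<inter> QN N) \<le> emeasure P (configs - Fin)" by (rule emeasure_mono) (use cm in auto)
    ultimately show ?thesis unfolding emeasure_M1[OF cm] by simp
  qed
  have spl: "emeasure (Mx :: (real^'d) measure measure) configs = emeasure Mx Fin + emeasure Mx (configs - Fin)" if "sets Mx = sets P" for Mx
  proof -
    have "Fin \<union> (configs - Fin) = configs" using sets.sets_into_space[OF Fm] by auto
    thus ?thesis using plus_emeasure[of Fin Mx "configs - Fin"] Fm cm that by simp
  qed
  \<comment> \<open>That the counts are finite under the second measure follows from the equality of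
    the total masses.\<close>
  have n2: "emeasure (M2 N) (configs - Fin) = 0"
  proof -
    have "emeasure (M1 N) Fin = ennreal (pN N)" using spl[of "M1 N"] n1 emeasure_M_space(1)[of N] by simp
    hence "emeasure (M2 N) Fin = ennreal (pN N)" using UN_eq[of I] by (simp add: Fin_def)
    hence "ennreal (pN N) + emeasure (M2 N) (configs - Fin) = ennreal (pN N) + 0"
      using spl[of "M2 N"] emeasure_M_space(2)[of N] by simp
    thus ?thesis by (subst (asm) ennreal_add_left_cancel) auto
  qed
  define c where "c = cylinder m V B"
  have cP: "c \<in> sets P" unfolding c_def sets_P by (rule cylinder_measurable) (use V B in auto)
  define J where "J = {k \<in> I. C k \<subseteq> c}"
  \<comment> \<open>The count of \<open>V i\<close> is a sum of prescribed counts, so each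
    \<open>C k\<close> lies either inside the cylinder or outside it.\<close>
  have inV: "emeasure \<mu> (V i) = (\<Sum>s\<in>{s \<in> S. i \<in> s}. of_nat (k s))" if "\<mu> \<in> C k" "i < m" for \<mu> k i
  proof -
    have sm: "sets \<mu> = sets borel" using that sets_configs by (auto simp: C_def)
    have "emeasure \<mu> (V i) = emeasure \<mu> (\<Union>s\<in>{s \<in> S. i \<in> s}. W s)" using af(4)[of i] that(2) by (simp add: V'_def)
    also have "\<dots> = (\<Sum>s\<in>{s \<in> S. i \<in> s}. emeasure \<mu> (W s))"
      by (rule sum_emeasure[symmetric]) (use af finS sm in \<open>auto intro: disjoint_family_on_mono[OF _ af(3)]\<close>)
    also have "\<dots> = (\<Sum>s\<in>{s \<in> S. i \<in> s}. of_nat (k s))" by (rule sum.cong) (use that in \<open>auto simp: C_def\<close>)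
    finally show ?thesis .
  qed
  have cF: "c \<inter> Fin = (\<Union>k\<in>J. C k)"
  proof (intro equalityI subsetI)
    fix \<mu> assume \<mu>: "\<mu> \<in> c \<inter> Fin"
    then obtain k where k: "k \<in> I" "\<mu> \<in> C k" by (auto simp: Fin_def)
    have "C k \<subseteq> c"
    proof
      fix \<nu> assume \<nu>: "\<nu> \<in> C k"
      have "emeasure \<nu> (V i) \<in> B i" if "i < m" for i
        using inV[OF \<nu> that] inV[OF k(2) that] \<mu> that by (auto simp: c_def cylinder_def)
      thus "\<nu> \<in> c" using \<nu> by (auto simp: c_def cylinder_def C_def)
    qed
    thus "\<mu> \<in> (\<Union>k\<in>J. C k)" using k by (auto simp: J_def)
  qed (auto simp: J_def Fin_def)
  have red: "emeasure Mx c = emeasure Mx (\<Union>k\<in>J. C k)"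
    if "sets Mx = sets P" "emeasure Mx (configs - Fin) = 0" for Mx :: "(real^'d) measure measure"
  proof -
    have cc: "c \<subseteq> configs" by (auto simp: c_def cylinder_def)
    have "emeasure Mx c = emeasure Mx (c \<inter> Fin) + emeasure Mx (c - Fin)"
      using plus_emeasure[of "c \<inter> Fin" Mx "c - Fin"] cP Fm that(1) by (simp add: Int_Diff_Un Int_Diff_disjoint)
    moreover have "emeasure Mx (c - Fin) \<le> emeasure Mx (configs - Fin)" by (rule emeasure_mono) (use cm cc that(1) in auto)
    ultimately show ?thesis using that(2) cF by simp
  qed
  have "emeasure (M1 N) c = emeasure (M1 N) (\<Union>k\<in>J. C k)" by (rule red[OF _ n1]) simp
  also have "\<dots> = emeasure (M2 N) (\<Union>k\<in>J. C k)" by (rule UN_eq) (auto simp: J_def)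
  also have "\<dots> = emeasure (M2 N) c" by (rule red[OF _ n2, symmetric]) simp
  finally show ?thesis by (simp add: c_def)
qed

text \<open>Both measures are finite with the same mass and agree on an intersection-stable
  generator. In words: given N points in Q, these are independent and uniform, and independent of
  the exterior.\<close>

theorem conf_law: "density P (indicator (QN N)) = scale_measure (ennreal (pN N)) (distr (Om N) P (T N))"
proof -
  have "M1 N = M2 N"
  proof (rule measure_eqI_generator_eq[where A = "\<lambda>_. configs"])
    show "Int_stable (cylinders :: (real^'d) measure set set)" by (rule Int_stable_cylinders)
    show "cylinders \<subseteq> Pow (configs :: (real^'d) measure set)" by (auto simp: cylinders_def cylinder_def)
    show "emeasure (M1 N) c = emeasure (M2 N) c" if "c \<in> cylinders" for c
      using that unfolding cylinders_def using M12_cylinder by blast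
    show "sets (M1 N) = sigma_sets configs cylinders" "sets (M2 N) = sigma_sets configs cylinders"
      by (simp_all add: sets_P sets_count_algebra_cylinders)
    have "cylinder 0 (\<lambda>_. {}) (\<lambda>_. {}) \<in> (cylinders :: (real^'d) measure set set)" unfolding cylinders_def by blast
    thus "range (\<lambda>_::nat. configs) \<subseteq> (cylinders :: (real^'d) measure set set)" by (auto simp: cylinder_def)
    show "emeasure (M1 N) configs \<noteq> \<infinity>" by (simp add: emeasure_M_space)
  qed simp
  thus ?thesis by (simp add: M1_def M2_def)
qed

section \<open>Integrals, null events and measurability on the labelled space\<close>

lemma nn_integral_QN:
  assumes [measurable]: "h \<in> borel_measurable P"
  shows "(\<integral>\<^sup>+\<mu>. indicator (QN N) \<mu> * h \<mu> \<partial>P) = ennreal (pN N) * (\<integral>\<^sup>+\<xi>. h (T N \<xi>) \<partial>Om N)"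
proof -
  have "(\<integral>\<^sup>+\<mu>. indicator (QN N) \<mu> * h \<mu> \<partial>P) = (\<integral>\<^sup>+\<mu>. h \<mu> \<partial>density P (indicator (QN N)))"
    by (rule nn_integral_density[symmetric]) measurable
  also have "\<dots> = ennreal (pN N) * (\<integral>\<^sup>+\<mu>. h \<mu> \<partial>distr (Om N) P (T N))"
    unfolding conf_law by (rule nn_integral_scale_measure) simp
  also have "(\<integral>\<^sup>+\<mu>. h \<mu> \<partial>distr (Om N) P (T N)) = (\<integral>\<^sup>+\<xi>. h (T N \<xi>) \<partial>Om N)"
    by (rule nn_integral_distr) measurable
  finally show ?thesis .
qed

lemma AE_QN: "AE \<mu> in P. \<exists>N. \<mu> \<in> QN N"
  using AE_count[OF Q_borel Q_fin] AE_space by eventually_elim (auto simp: QN_def)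

lemma disjoint_QN: "disjoint_family QN"
  unfolding disjoint_family_on_def
proof (intro ballI impI equals0I)
  fix N M \<mu> assume "N \<noteq> M" "\<mu> \<in> QN N \<inter> QN M"
  hence "(of_nat N :: ennreal) = of_nat M" by (auto simp: QN_def)
  with \<open>N \<noteq> M\<close> show False by (simp only: of_nat_eq_iff)
qed

lemma suminf_QN:
  fixes h :: "(real^'d) measure => ennreal"
  assumes "\<mu> \<in> QN N" shows "(\<Sum>M. indicator (QN M) \<mu> * h \<mu>) = h \<mu>"
proof -
  have "(\<Sum>M. indicator (QN M) \<mu> * h \<mu>) = (\<Sum>M. indicator (QN M) \<mu>) * h \<mu>" by simp
  also have "(\<Sum>M. indicator (QN M) \<mu> :: ennreal) = indicator (\<Union>M. QN M) \<mu>"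
    by (rule suminf_indicator[OF disjoint_QN])
  finally show ?thesis using assms by (auto simp: indicator_def)
qed

text \<open>Almost every configuration has finitely many points in Q, so the events
  \<open>QN N\<close> split the integral.\<close>

lemma nn_integral_P:
  assumes [measurable]: "h \<in> borel_measurable P"
  shows "(\<integral>\<^sup>+\<mu>. h \<mu> \<partial>P) = (\<Sum>N. ennreal (pN N) * (\<integral>\<^sup>+\<xi>. h (T N \<xi>) \<partial>Om N))"
proof -
  have "(\<integral>\<^sup>+\<mu>. h \<mu> \<partial>P) = (\<integral>\<^sup>+\<mu>. (\<Sum>N. indicator (QN N) \<mu> * h \<mu>) \<partial>P)"
    by (rule nn_integral_cong_AE) (use AE_QN in \<open>auto elim!: eventually_mono simp: suminf_QN simp del: ennreal_suminf_multc\<close>)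
  also have "\<dots> = (\<Sum>N. \<integral>\<^sup>+\<mu>. indicator (QN N) \<mu> * h \<mu> \<partial>P)" by (rule nn_integral_suminf) measurable
  finally show ?thesis by (simp add: nn_integral_QN)
qed

text \<open>A null event meets \<open>QN N\<close> in a null event, and the weight
  \<open>pN N\<close> by which the labelled law is multiplied is positive.\<close>

lemma AE_T:
  assumes "AE \<mu> in P. R \<mu>" shows "AE \<xi> in Om N. R (T N \<xi>)"
proof -
  obtain Z where Z: "Z \<in> null_sets P" "{\<mu> \<in> space P. \<not> R \<mu>} \<subseteq> Z" using assms by (auto simp: eventually_ae_filter)
  have [measurable]: "Z \<in> sets P" using Z by auto
  have "ennreal (pN N) * (\<integral>\<^sup>+\<xi>. indicator Z (T N \<xi>) \<partial>Om N) = (\<integral>\<^sup>+\<mu>. indicator (QN N) \<mu> * indicator Z \<mu> \<partial>P)"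
    by (rule nn_integral_QN[symmetric]) measurable
  also have "\<dots> \<le> (\<integral>\<^sup>+\<mu>. indicator Z \<mu> \<partial>P)" by (rule nn_integral_mono) (auto simp: indicator_def)
  also have "\<dots> = 0" using Z by auto
  finally have "(\<integral>\<^sup>+\<xi>. indicator Z (T N \<xi>) \<partial>Om N) = 0" using pN_pos[of N] by (simp add: ennreal_eq_0_iff)
  hence "AE \<xi> in Om N. indicator Z (T N \<xi>) = (0::ennreal)" by (subst (asm) nn_integral_0_iff_AE) measurable
  thus ?thesis using AE_space
    by eventually_elim (use Z(2) T_configs in \<open>auto simp: indicator_def split: if_splits\<close>)
qed

text \<open>Null events have null preimages by \<open>AE_T\<close>. This lets functions measurable
  only for the completion of P be read on the labelled space.\<close>

lemma T_completion [measurable]: "T N \<in> completion (Om N) \<rightarrow>\<^sub>M completion P"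
proof -
  have C: "complete_measure (completion (Om N))" by unfold_locales
  show ?thesis
  proof (rule complete_measure.measurable_completion2[OF C])
    show T: "T N \<in> completion (Om N) \<rightarrow>\<^sub>M P" by (rule measurable_completion) (rule T_measurable)
    show "null_sets P \<subseteq> null_sets (distr (completion (Om N)) P (T N))"
    proof
      fix Z assume Z: "Z \<in> null_sets P"
      hence "AE \<mu> in P. \<mu> \<notin> Z" by (rule AE_not_in)
      hence "AE \<xi> in Om N. T N \<xi> \<notin> Z" by (rule AE_T)
      hence "AE \<mu> in distr (completion (Om N)) P (T N). \<mu> \<notin> Z"
      proof (subst AE_distr_iff[OF T])
        have "{\<mu> \<in> space P. \<mu> \<notin> Z} = space P - Z" by auto
        thus "{\<mu> \<in> space P. \<mu> \<notin> Z} \<in> sets P" using sets.compl_sets[OF null_setsD2[OF Z]] by simp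
        assume "AE \<xi> in Om N. T N \<xi> \<notin> Z"
        thus "AE \<xi> in completion (Om N). T N \<xi> \<notin> Z" by (rule AE_completion)
      qed
      thus "Z \<in> null_sets (distr (completion (Om N)) P (T N))" using Z by (subst AE_iff_null_sets) auto
    qed
  qed
qed

lemma nn_integral_P_completion:
  assumes "h \<in> borel_measurable (completion P)"
  shows "(\<integral>\<^sup>+\<mu>. h \<mu> \<partial>completion P) = (\<Sum>N. ennreal (pN N) * (\<integral>\<^sup>+\<xi>. h (T N \<xi>) \<partial>Om N))"
proof -
  obtain h' where h' [measurable]: "h' \<in> borel_measurable P" and ae: "AE \<mu> in P. h \<mu> = h' \<mu>"
    using completion_ex_borel_measurable[OF assms] by blast
  have "(\<integral>\<^sup>+\<mu>. h \<mu> \<partial>completion P) = (\<integral>\<^sup>+\<mu>. h' \<mu> \<partial>P)"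
    unfolding nn_integral_completion by (rule nn_integral_cong_AE[OF ae])
  also have "\<dots> = (\<Sum>N. ennreal (pN N) * (\<integral>\<^sup>+\<xi>. h' (T N \<xi>) \<partial>Om N))" by (rule nn_integral_P) measurable
  finally have "(\<integral>\<^sup>+\<mu>. h \<mu> \<partial>completion P) = (\<Sum>N. ennreal (pN N) * (\<integral>\<^sup>+\<xi>. h' (T N \<xi>) \<partial>Om N))" .
  moreover have "(\<integral>\<^sup>+\<xi>. h' (T N \<xi>) \<partial>Om N) = (\<integral>\<^sup>+\<xi>. h (T N \<xi>) \<partial>Om N)" for N
    by (rule nn_integral_cong_AE) (use AE_T[OF ae, of N] in \<open>auto elim: eventually_mono\<close>)
  ultimately show ?thesis by simp
qed

lemma point_measurable [measurable]: "i < N ==> (\<lambda>\<xi>. snd \<xi> i) \<in> borel_measurable (Om N)"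
proof -
  assume "i < N"
  hence "(\<lambda>\<xi>. snd \<xi> i) \<in> Om N \<rightarrow>\<^sub>M UQ"
    unfolding Om_def by (intro measurable_compose[OF measurable_snd measurable_component_singleton]) auto
  thus ?thesis by (simp cong: measurable_cong_sets)
qed

lemma at_points_measurable:
  assumes g: "case_prod g \<in> borel_measurable (completion P \<Otimes>\<^sub>M borel)" and i: "i < N"
  shows "(\<lambda>\<xi>. g (T N \<xi>) (snd \<xi> i)) \<in> borel_measurable (completion (Om N))"
proof -
  have "(\<lambda>\<xi>. (T N \<xi>, snd \<xi> i)) \<in> completion (Om N) \<rightarrow>\<^sub>M completion P \<Otimes>\<^sub>M borel"
    by (intro measurable_Pair T_completion measurable_completion point_measurable i)
  from measurable_compose[OF this g] show ?thesis by simp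
qed

lemma nn_integral_T:
  "AE \<xi> in Om N. \<forall>h\<in>borel_measurable borel. (\<integral>\<^sup>+y\<in>Q. h y \<partial>T N \<xi>) = (\<Sum>i<N. h (snd \<xi> i))"
  using AE_in_Q[of N] AE_space
proof eventually_elim
  case (elim \<xi>)
  thus ?case by (auto simp: T_def space_Om split_def intro!: nn_integral_conf)
qed

lemma energy_formula:
  assumes g: "case_prod g \<in> borel_measurable (completion P \<Otimes>\<^sub>M borel)"
  shows "energy P Q g = (\<Sum>N. ennreal (pN N) * (\<integral>\<^sup>+\<xi>. (\<Sum>i<N. ennreal ((norm (g (T N \<xi>) (snd \<xi> i)))^2)) \<partial>Om N))"
proof -
  have id: "(\<lambda>\<mu>. \<mu>) \<in> completion P \<rightarrow>\<^sub>M count_algebra (sets borel)"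
    using measurable_completion[OF measurable_ident_sets[OF sets_P]] by simp
  \<comment> \<open>Almost surely equal to the inner integral, and measurable on all configurations
    thanks to the default 0.\<close>
  define \<Phi> where "\<Phi> = (\<lambda>\<mu>. if emeasure \<mu> Q < \<infinity> then \<integral>\<^sup>+x\<in>Q. ennreal ((norm (g \<mu> x))^2) \<partial>\<mu> else 0)"
  have gm: "(\<lambda>(\<mu>, x). ennreal ((norm (g \<mu> x))^2)) \<in> borel_measurable (completion P \<Otimes>\<^sub>M borel)"
  proof -
    have "(\<lambda>v::real^'d. ennreal ((norm v)^2)) \<in> borel_measurable borel" by measurable
    from measurable_compose[OF g this] show ?thesis by (simp only: split_def)
  qed
  have \<Phi>: "\<Phi> \<in> borel_measurable (completion P)"
    unfolding \<Phi>_def by (rule measurable_config_integral[OF id gm Q_borel])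
  have "energy P Q g = (\<integral>\<^sup>+\<mu>. \<Phi> \<mu> \<partial>completion P)"
    unfolding energy_def
  proof (rule nn_integral_cong_AE)
    show "AE \<mu> in completion P. (\<integral>\<^sup>+x\<in>Q. ennreal ((norm (g \<mu> x))^2) \<partial>\<mu>) = \<Phi> \<mu>"
      using AE_completion[OF AE_QN] by eventually_elim (auto simp: \<Phi>_def QN_def of_nat_less_top)
  qed
  also have "\<dots> = (\<Sum>N. ennreal (pN N) * (\<integral>\<^sup>+\<xi>. \<Phi> (T N \<xi>) \<partial>Om N))" by (rule nn_integral_P_completion[OF \<Phi>])
  finally have "energy P Q g = (\<Sum>N. ennreal (pN N) * (\<integral>\<^sup>+\<xi>. \<Phi> (T N \<xi>) \<partial>Om N))" .
  moreover have "(\<integral>\<^sup>+\<xi>. \<Phi> (T N \<xi>) \<partial>Om N) = (\<integral>\<^sup>+\<xi>. (\<Sum>i<N. ennreal ((norm (g (T N \<xi>) (snd \<xi> i)))^2)) \<partial>Om N)" for N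
  proof (rule nn_integral_cong_AE)
    from nn_integral_T[of N] AE_T[OF AE_QN, of N] AE_space
    show "AE \<xi> in Om N. \<Phi> (T N \<xi>) = (\<Sum>i<N. ennreal ((norm (g (T N \<xi>) (snd \<xi> i)))^2))"
    proof eventually_elim
      case (elim \<xi>)
      have "(\<lambda>x. ennreal ((norm (g (T N \<xi>) x))^2)) \<in> borel_measurable borel"
        using measurable_compose[OF measurable_Pair1' gm, of "T N \<xi>"] T_configs[OF elim(3)] by simp
      thus ?case using elim(1,2) by (auto simp: \<Phi>_def QN_def of_nat_less_top)
    qed
  qed
  ultimately show ?thesis by simp
qed

lemma L2_sq_formula:
  assumes "u \<in> borel_measurable (completion P)"
  shows "L2_sq P u = (\<Sum>N. ennreal (pN N) * (\<integral>\<^sup>+\<xi>. ennreal ((u (T N \<xi>))^2) \<partial>Om N))"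
  unfolding L2_sq_def by (rule nn_integral_P_completion) (use assms in measurable)

end

section \<open>Resampling a coordinate of a uniform point of the cube\<close>

lemma cube_iff: "p \<in> cube n \<longleftrightarrow> (\<forall>i. p $ i \<in> interval3 n)"
  by (auto simp: cube_def interval3_def mem_box_cart)

lemma open_cube: "open (cube n)"
  by (simp add: cube_def open_box)

lemma cube_borel [measurable]: "cube n \<in> sets borel"
  using open_cube by (rule borel_open)

lemma cube_window: "emeasure lborel (cube n :: (real^'d::finite) set) \<noteq> 0" "emeasure lborel (cube n :: (real^'d) set) < \<infinity>"
proof -
  have "(0 :: real^'d) \<in> cube n" by (simp add: cube_iff interval3_def)
  thus "emeasure lborel (cube n :: (real^'d) set) \<noteq> 0"
    using open_cube[of n] open_not_negligible[of "cube n :: (real^'d) set"]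
    by (metis cube_borel empty_iff negligible_iff_null_sets null_setsI null_sets_completionI sets_lborel)
next
  show "emeasure lborel (cube n :: (real^'d) set) < \<infinity>" unfolding cube_def by (rule emeasure_lborel_box_finite)
qed

text \<open>Write the new value as the old one plus h and translate p by h along the axis. The two
  constraints, p in the cube and the new value in the interval, are exchanged by this translation;
  integrating over h then produces 3^n, which the normalisation of the uniform law removes.\<close>

lemma uniform_cube_resample:
  fixes f :: "real^'d::finite => ennreal"
  assumes [measurable]: "f \<in> borel_measurable borel"
  shows "(\<integral>\<^sup>+p. f p \<partial>uniform_measure lborel (cube n)) =
    (\<integral>\<^sup>+p. \<integral>\<^sup>+t. f (p + (t - p $ k) *\<^sub>R axis k 1) \<partial>unif3 n \<partial>uniform_measure lborel (cube n))"
proof -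
  let ?I = "interval3 n" and ?Q = "cube n :: (real^'d) set"
  have nth [measurable]: "(\<lambda>p::real^'d. p $ k) \<in> borel_measurable borel"
    by (intro borel_measurable_continuous_onI continuous_intros)
  \<comment> \<open>The other coordinates are untouched, and in the k-th one both sides test the
    same two values against the same interval.\<close>
  have Q_eq: "indicator ?Q (p - h *\<^sub>R axis k 1) * indicator ?I (p $ k) = (indicator ?Q p * indicator ?I (p $ k - h) :: ennreal)" for p h
  proof -
    have "(p - h *\<^sub>R axis k 1) $ i = (if i = k then p $ k - h else p $ i)" for i by (simp add: axis_def)
    hence "p - h *\<^sub>R axis k 1 \<in> ?Q \<and> p $ k \<in> ?I \<longleftrightarrow> p \<in> ?Q \<and> p $ k - h \<in> ?I"
      unfolding cube_iff by (metis (full_types))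
    thus ?thesis by (auto simp: indicator_def)
  qed
  have unit: "(\<integral>\<^sup>+h. indicator ?I (s - h) \<partial>lborel) = (3 ^ n :: ennreal)" for s
  proof -
    have "(\<integral>\<^sup>+t. indicator ?I t \<partial>lborel) = ennreal \<bar>-1\<bar> * (\<integral>\<^sup>+h. indicator ?I (s + (-1) * h) \<partial>lborel)"
      by (rule nn_integral_real_affine) simp_all
    thus ?thesis by (simp add: emeasure_interval3)
  qed
  have "(\<integral>\<^sup>+p. indicator ?Q p * (\<integral>\<^sup>+t. indicator ?I t * f (p + (t - p $ k) *\<^sub>R axis k 1) \<partial>lborel) \<partial>lborel) =
      (\<integral>\<^sup>+p. \<integral>\<^sup>+h. indicator ?Q p * (indicator ?I (p $ k + h) * f (p + h *\<^sub>R axis k 1)) \<partial>lborel \<partial>lborel)"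
  proof (rule nn_integral_cong)
    fix p :: "real^'d"
    have "(\<integral>\<^sup>+t. indicator ?I t * f (p + (t - p $ k) *\<^sub>R axis k 1) \<partial>lborel) =
        ennreal \<bar>1\<bar> * (\<integral>\<^sup>+h. indicator ?I (p $ k + 1 * h) * f (p + (p $ k + 1 * h - p $ k) *\<^sub>R axis k 1) \<partial>lborel)"
      by (rule nn_integral_real_affine) simp_all
    thus "indicator ?Q p * (\<integral>\<^sup>+t. indicator ?I t * f (p + (t - p $ k) *\<^sub>R axis k 1) \<partial>lborel) =
        (\<integral>\<^sup>+h. indicator ?Q p * (indicator ?I (p $ k + h) * f (p + h *\<^sub>R axis k 1)) \<partial>lborel)"
      by (simp add: nn_integral_cmult)
  qed
  also have "\<dots> = (\<integral>\<^sup>+h. \<integral>\<^sup>+p. indicator ?Q p * (indicator ?I (p $ k + h) * f (p + h *\<^sub>R axis k 1)) \<partial>lborel \<partial>lborel)"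
    by (rule lborel_pair.Fubini'[symmetric]) measurable
  also have "\<dots> = (\<integral>\<^sup>+h. \<integral>\<^sup>+p. indicator ?Q p * indicator ?I (p $ k - h) * f p \<partial>lborel \<partial>lborel)"
  proof (rule nn_integral_cong)
    fix h :: real
    have "(\<integral>\<^sup>+p. indicator ?Q p * indicator ?I (p $ k - h) * f p \<partial>lborel) =
        (\<integral>\<^sup>+p. indicator ?Q (p - h *\<^sub>R axis k 1) * indicator ?I (p $ k) * f p \<partial>distr lborel borel ((+) (h *\<^sub>R axis k 1)))"
      unfolding lborel_distr_plus by (simp add: Q_eq)
    also have "\<dots> = (\<integral>\<^sup>+p. indicator ?Q p * (indicator ?I (p $ k + h) * f (p + h *\<^sub>R axis k 1)) \<partial>lborel)"
      by (subst nn_integral_distr) (simp_all add: mult.assoc axis_def add.commute)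
    finally show "(\<integral>\<^sup>+p. indicator ?Q p * (indicator ?I (p $ k + h) * f (p + h *\<^sub>R axis k 1)) \<partial>lborel) =
      (\<integral>\<^sup>+p. indicator ?Q p * indicator ?I (p $ k - h) * f p \<partial>lborel)" by simp
  qed
  also have "\<dots> = (\<integral>\<^sup>+p. \<integral>\<^sup>+h. (indicator ?Q p * f p) * indicator ?I (p $ k - h) \<partial>lborel \<partial>lborel)"
    by (subst lborel_pair.Fubini') (auto simp: mult_ac)
  also have "\<dots> = (\<integral>\<^sup>+p. (indicator ?Q p * f p) * 3 ^ n \<partial>lborel)"
    by (intro nn_integral_cong) (simp add: nn_integral_cmult unit)
  also have "\<dots> = (\<integral>\<^sup>+p. indicator ?Q p * f p \<partial>lborel) * 3 ^ n"
    by (rule nn_integral_multc) measurable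
  finally have main: "(\<integral>\<^sup>+p. indicator ?Q p * (\<integral>\<^sup>+t. indicator ?I t * f (p + (t - p $ k) *\<^sub>R axis k 1) \<partial>lborel) \<partial>lborel) =
      (\<integral>\<^sup>+p. indicator ?Q p * f p \<partial>lborel) * 3 ^ n" .
  have um: "(\<integral>\<^sup>+p. g p \<partial>uniform_measure lborel ?Q) = (\<integral>\<^sup>+p. g p * indicator ?Q p \<partial>lborel) / emeasure lborel ?Q"
    if "g \<in> borel_measurable borel" for g
    by (rule nn_integral_uniform_measure) (use that in auto)
  have inner: "(\<integral>\<^sup>+t. f (p + (t - p $ k) *\<^sub>R axis k 1) \<partial>unif3 n) =
      ennreal (1 / 3 ^ n) * (\<integral>\<^sup>+t. indicator ?I t * f (p + (t - p $ k) *\<^sub>R axis k 1) \<partial>lborel)" for p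
    by (rule nn_integral_unif3) measurable
  have one: "ennreal (1 / 3 ^ n) * 3 ^ n = 1"
  proof -
    have "ennreal (1 / 3 ^ n) * ennreal (3 ^ n) = 1" by (subst ennreal_mult[symmetric]) auto
    thus ?thesis by (simp add: ennreal_power[symmetric] del: ennreal_power)
  qed
  have "(\<integral>\<^sup>+p. (\<integral>\<^sup>+t. f (p + (t - p $ k) *\<^sub>R axis k 1) \<partial>unif3 n) * indicator ?Q p \<partial>lborel) =
      (\<integral>\<^sup>+p. ennreal (1 / 3 ^ n) * (indicator ?Q p * (\<integral>\<^sup>+t. indicator ?I t * f (p + (t - p $ k) *\<^sub>R axis k 1) \<partial>lborel)) \<partial>lborel)"
    unfolding inner by (simp add: mult_ac)
  also have "\<dots> = ennreal (1 / 3 ^ n) * ((\<integral>\<^sup>+p. indicator ?Q p * f p \<partial>lborel) * 3 ^ n)"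
    by (subst nn_integral_cmult) (simp_all add: main)
  also have "\<dots> = (ennreal (1 / 3 ^ n) * 3 ^ n) * (\<integral>\<^sup>+p. indicator ?Q p * f p \<partial>lborel)"
    by (simp only: mult_ac)
  also have "\<dots> = (\<integral>\<^sup>+p. f p * indicator ?Q p \<partial>lborel)" unfolding one by (simp add: mult.commute)
  finally have e: "(\<integral>\<^sup>+p. (\<integral>\<^sup>+t. f (p + (t - p $ k) *\<^sub>R axis k 1) \<partial>unif3 n) * indicator ?Q p \<partial>lborel) =
      (\<integral>\<^sup>+p. f p * indicator ?Q p \<partial>lborel)" .
  have [measurable]: "(\<lambda>p. \<integral>\<^sup>+t. f (p + (t - p $ k) *\<^sub>R axis k 1) \<partial>unif3 n) \<in> borel_measurable borel"
  proof -
    interpret U: prob_space "unif3 n" by (rule prob_space_unif3)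
    show ?thesis by measurable
  qed
  show ?thesis by (simp add: um e)
qed

context poisson_window
begin

text \<open>Only N indices of the sum of Dirac masses have their point in Q; enumerating them
  supplies the labels, and \<mu> serves as its own exterior.\<close>

lemma config_decomp:
  assumes "\<mu> \<in> QN N"
  obtains x where "x \<in> {..<N} \<rightarrow>\<^sub>E Q" "\<mu> = conf Q N x \<mu>"
proof -
  have \<mu>: "\<mu> \<in> configs" "emeasure \<mu> Q = of_nat N" using assms by (auto simp: QN_def)
  obtain I z where Iz: "\<mu> = dirac_sum I z" using \<mu>(1) by (auto simp: configs_def)
  define D where "D = {i \<in> I. z i \<in> Q}"
  have cD: "emeasure (count_space I) D = of_nat N" using \<mu>(2) emeasure_dirac_sum_count[OF Q_borel, of I z] by (simp add: Iz D_def)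
  have finD: "finite D"
  proof (rule ccontr)
    assume "infinite D"
    hence "emeasure (count_space I) D = \<infinity>" by (intro emeasure_count_space_infinite) (auto simp: D_def)
    thus False using cD by simp
  qed
  have "emeasure (count_space I) D = of_nat (card D)" by (rule emeasure_count_space_finite) (use finD in \<open>auto simp: D_def\<close>)
  hence "(of_nat (card D) :: ennreal) = of_nat N" using cD by simp
  hence card: "card D = N" by (simp only: of_nat_eq_iff)
  obtain h where h: "bij_betw h {..<N} D" using ex_bij_betw_nat_finite[OF finD] card by (auto simp: atLeast0LessThan)
  define x where "x = (\<lambda>i\<in>{..<N}. z (h i))"
  have hD: "h i \<in> I" "z (h i) \<in> Q" if "i < N" for i using h that by (auto simp: bij_betw_def D_def)
  show ?thesis
  proof (rule that)
    show "x \<in> {..<N} \<rightarrow>\<^sub>E Q" using hD by (auto simp: x_def)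
    show "\<mu> = conf Q N x \<mu>"
    proof (rule measure_eqI)
      show "sets \<mu> = sets (conf Q N x \<mu>)" using \<mu>(1) by (simp add: sets_configs)
      fix A assume "A \<in> sets \<mu>"
      hence A: "A \<in> sets borel" using \<mu>(1) by (simp add: sets_configs)
      hence AQ: "A \<inter> Q \<in> sets borel" "A - Q \<in> sets borel" by auto
      have bij: "bij_betw h {i. i < N \<and> x i \<in> A} {i \<in> I. z i \<in> A \<inter> Q}"
        unfolding bij_betw_def
      proof
        show "inj_on h {i. i < N \<and> x i \<in> A}" by (rule inj_on_subset[OF bij_betw_imp_inj_on[OF h]]) auto
        show "h ` {i. i < N \<and> x i \<in> A} = {i \<in> I. z i \<in> A \<inter> Q}"
        proof (intro equalityI subsetI)
          fix i assume i: "i \<in> {i \<in> I. z i \<in> A \<inter> Q}"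
          hence "i \<in> h ` {..<N}" using h by (auto simp: bij_betw_def D_def)
          thus "i \<in> h ` {i. i < N \<and> x i \<in> A}" using i by (auto simp: x_def)
        qed (use hD in \<open>auto simp: x_def\<close>)
      qed
      have "finite {i \<in> I. z i \<in> A \<inter> Q}" by (rule finite_subset[OF _ finD]) (auto simp: D_def)
      hence "emeasure \<mu> (A \<inter> Q) = of_nat (card {i \<in> I. z i \<in> A \<inter> Q})"
        unfolding Iz emeasure_dirac_sum_count[OF AQ(1)] by (intro emeasure_count_space_finite) auto
      also have "card {i \<in> I. z i \<in> A \<inter> Q} = card {i. i < N \<and> x i \<in> A}" using bij_betw_same_card[OF bij] by simp
      finally have "emeasure \<mu> (A \<inter> Q) = of_nat (card {i. i < N \<and> x i \<in> A})" .
      moreover have "emeasure \<mu> A = emeasure \<mu> (A \<inter> Q) + emeasure \<mu> (A - Q)"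
        using plus_emeasure[of "A \<inter> Q" \<mu> "A - Q"] AQ \<mu>(1) by (simp add: sets_configs Int_Diff_Un Int_Diff_disjoint)
      ultimately show "emeasure \<mu> A = emeasure (conf Q N x \<mu>) A"
        by (simp add: emeasure_conf[OF \<mu>(1) Q_borel A])
    qed
  qed
qed

end

section \<open>The labelled coordinates of a cube as a resampling space\<close>

locale poisson_cube = poisson \<rho> P for \<rho> and P :: "(real^'d::finite) measure measure" +
  fixes n :: nat

sublocale poisson_cube \<subseteq> poisson_window \<rho> P "cube n"
  by unfold_locales (use cube_window in auto)

context poisson_cube
begin

definition coords :: "nat => (nat \<times> 'd) set" where
  "coords N = {..<N} \<times> UNIV"

definition shift :: "'d => real^'d => real => real^'d" where
  "shift k p t = p + (t - p $ k) *\<^sub>R axis k 1"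

definition Xc :: "nat \<times> 'd => (real^'d) measure \<times> (nat => real^'d) => real" where
  "Xc m \<xi> = snd \<xi> (fst m) $ snd m"

definition upc :: "nat \<times> 'd => (real^'d) measure \<times> (nat => real^'d) => real => (real^'d) measure \<times> (nat => real^'d)" where
  "upc m \<xi> t = (fst \<xi>, (snd \<xi>)(fst m := shift (snd m) (snd \<xi> (fst m)) t))"

lemma shift_nth: "shift k p t $ l = (if l = k then t else p $ l)"
  by (simp add: shift_def axis_def)

lemma shift_self [simp]: "shift k p (p $ k) = p"
  by (simp add: shift_def)

lemma shift_shift [simp]: "shift k (shift k p s) t = shift k p t"
  by (simp add: vec_eq_iff shift_nth)

lemma shift_comm: "k \<noteq> l ==> shift k (shift l p s) t = shift l (shift k p t) s"
  by (simp add: vec_eq_iff shift_nth)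

lemma vec_nth_measurable [measurable]: "(\<lambda>p::real^'d. p $ k) \<in> borel_measurable borel"
  by (intro borel_measurable_continuous_onI continuous_intros)

lemma shift_measurable [measurable]:
  assumes [measurable]: "f \<in> borel_measurable A" "g \<in> borel_measurable A"
  shows "(\<lambda>a. shift k (f a) (g a)) \<in> borel_measurable A"
  unfolding shift_def by measurable

text \<open>The substantial clause is \<open>resample\<close>: by Fubini the labelled point carrying
  the coordinate is integrated separately from the exterior and the other points, and for it
  \<open>uniform_cube_resample\<close> applies.\<close>

lemma resample_space_Om: "resample_space (Om N) (coords N) Xc upc n"
proof (rule resample_space.intro)
  show "prob_space (Om N)" by (rule prob_Om)
  show "finite (coords N)" by (simp add: coords_def)
  fix m assume m: "m \<in> coords N"
  then obtain i k where ik: "m = (i, k)" "i < N" by (auto simp: coords_def)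
  have p [measurable]: "(\<lambda>\<xi>. snd \<xi> i) \<in> borel_measurable (Om N)" by (rule point_measurable[OF ik(2)])
  show "Xc m \<in> borel_measurable (Om N)" unfolding Xc_def ik by simp
  show um: "(\<lambda>(\<xi>, t). upc m \<xi> t) \<in> Om N \<Otimes>\<^sub>M borel \<rightarrow>\<^sub>M Om N"
  proof -
    have f: "(\<lambda>p. fst (fst p)) \<in> Om N \<Otimes>\<^sub>M (borel :: real measure) \<rightarrow>\<^sub>M PE"
      unfolding Om_def by measurable
    have s: "(\<lambda>p. snd (fst p)) \<in> Om N \<Otimes>\<^sub>M (borel :: real measure) \<rightarrow>\<^sub>M (\<Pi>\<^sub>M i\<in>{..<N}. UQ)"
      unfolding Om_def by measurable
    have q: "(\<lambda>p. shift k (snd (fst p) i) (snd p)) \<in> Om N \<Otimes>\<^sub>M (borel :: real measure) \<rightarrow>\<^sub>M UQ"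
      unfolding measurable_cong_sets[OF refl sets_UQ] by measurable
    have "(\<lambda>p. (snd (fst p))(i := shift k (snd (fst p) i) (snd p))) \<in> Om N \<Otimes>\<^sub>M (borel :: real measure) \<rightarrow>\<^sub>M (\<Pi>\<^sub>M i\<in>{..<N}. UQ)"
      by (rule measurable_fun_upd[OF _ s q]) (use ik in auto)
    from measurable_Pair[OF f this] show ?thesis
      by (simp add: upc_def[abs_def] ik split_def Om_def)
  qed
  show "Xc m (upc m \<xi> t) = t" for \<xi> t by (simp add: Xc_def upc_def shift_nth)
  show "upc m \<xi> (Xc m \<xi>) = \<xi>" for \<xi> by (simp add: Xc_def upc_def)
  show "upc m (upc m \<xi> s) t = upc m \<xi> t" for \<xi> s t by (simp add: upc_def)
  show "Xc m' (upc m \<xi> t) = Xc m' \<xi>" if "m' \<noteq> m" for m' \<xi> t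
    using that by (cases m', cases m) (auto simp: Xc_def upc_def shift_nth)
  show "upc m' (upc m \<xi> s) t = upc m (upc m' \<xi> t) s" if "m' \<noteq> m" for m' \<xi> s t
    using that by (cases m', cases m) (auto simp: upc_def shift_comm fun_upd_twist)
  fix h :: "_ => ennreal" assume h [measurable]: "h \<in> borel_measurable (Om N)"
  define J where "J = {..<N} - {i}"
  have J: "finite J" "i \<notin> J" "{..<N} = insert i J" using ik by (auto simp: J_def)
  interpret U: prob_space "unif3 n" by (rule prob_space_unif3)
  interpret Q: prob_space UQ by (rule prob_UQ)
  interpret B: prob_space "\<Pi>\<^sub>M i\<in>{..<N}. UQ" by (rule prob_PiUQ)
  interpret PP: product_sigma_finite "\<lambda>_::nat. UQ" by unfold_locales
  have hm: "h \<in> borel_measurable (PE \<Otimes>\<^sub>M (\<Pi>\<^sub>M i\<in>{..<N}. UQ))" using h by (simp add: Om_def)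
  have hu: "(\<lambda>\<xi>. \<integral>\<^sup>+t. h (upc m \<xi> t) \<partial>unif3 n) \<in> borel_measurable (PE \<Otimes>\<^sub>M (\<Pi>\<^sub>M i\<in>{..<N}. UQ))"
  proof -
    have "(\<lambda>p. h (case p of (\<xi>, t) => upc m \<xi> t)) \<in> borel_measurable (Om N \<Otimes>\<^sub>M borel)"
      by (rule measurable_compose[OF um h])
    hence "(\<lambda>(\<xi>, t). h (upc m \<xi> t)) \<in> borel_measurable (Om N \<Otimes>\<^sub>M unif3 n)"
      by (simp add: split_def cong: measurable_cong_sets)
    from U.borel_measurable_nn_integral_fst[OF this] show ?thesis by (simp add: Om_def)
  qed
  have "(\<integral>\<^sup>+\<xi>. h \<xi> \<partial>Om N) = (\<integral>\<^sup>+\<eta>. \<integral>\<^sup>+x. h (\<eta>, x) \<partial>(\<Pi>\<^sub>M i\<in>{..<N}. UQ) \<partial>PE)"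
    unfolding Om_def by (rule B.nn_integral_fst[OF hm, symmetric])
  also have "\<dots> = (\<integral>\<^sup>+\<eta>. \<integral>\<^sup>+x. \<integral>\<^sup>+t. h (upc m (\<eta>, x) t) \<partial>unif3 n \<partial>(\<Pi>\<^sub>M i\<in>{..<N}. UQ) \<partial>PE)"
  proof (rule nn_integral_cong)
    fix \<eta> assume \<eta>: "\<eta> \<in> space PE"
    have h1: "(\<lambda>x. h (\<eta>, x)) \<in> borel_measurable (\<Pi>\<^sub>M i\<in>insert i J. UQ)"
      using measurable_compose[OF measurable_Pair1'[OF \<eta>] hm] J(3) by simp
    have h2: "(\<lambda>x. \<integral>\<^sup>+t. h (upc m (\<eta>, x) t) \<partial>unif3 n) \<in> borel_measurable (\<Pi>\<^sub>M i\<in>insert i J. UQ)"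
      using measurable_compose[OF measurable_Pair1'[OF \<eta>] hu] J(3) by simp
    have "(\<integral>\<^sup>+x. h (\<eta>, x) \<partial>(\<Pi>\<^sub>M i\<in>insert i J. UQ)) = (\<integral>\<^sup>+x. \<integral>\<^sup>+p. h (\<eta>, x(i := p)) \<partial>UQ \<partial>(\<Pi>\<^sub>M i\<in>J. UQ))"
      by (rule PP.product_nn_integral_insert[OF J(1,2) h1])
    also have "\<dots> = (\<integral>\<^sup>+x. \<integral>\<^sup>+p. \<integral>\<^sup>+t. h (\<eta>, x(i := shift k p t)) \<partial>unif3 n \<partial>UQ \<partial>(\<Pi>\<^sub>M i\<in>J. UQ))"
    proof (rule nn_integral_cong)
      fix x assume x: "x \<in> space (\<Pi>\<^sub>M i\<in>J. UQ)"
      have "(\<lambda>p. x(i := p)) \<in> borel \<rightarrow>\<^sub>M (\<Pi>\<^sub>M i\<in>insert i J. UQ)"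
        using measurable_fun_upd[where I = J and J = "insert i J" and f = "\<lambda>_. x" and h = "\<lambda>p. p" and N = borel and M = "\<lambda>_. UQ" and i = i] x
        by (simp cong: measurable_cong_sets)
      from measurable_compose[OF this h1]
      have "(\<lambda>p. h (\<eta>, x(i := p))) \<in> borel_measurable borel" .
      from uniform_cube_resample[OF this, of n k]
      show "(\<integral>\<^sup>+p. h (\<eta>, x(i := p)) \<partial>UQ) = (\<integral>\<^sup>+p. \<integral>\<^sup>+t. h (\<eta>, x(i := shift k p t)) \<partial>unif3 n \<partial>UQ)"
        by (simp add: UQ_def shift_def)
    qed
    also have "\<dots> = (\<integral>\<^sup>+x. \<integral>\<^sup>+p. \<integral>\<^sup>+t. h (upc m (\<eta>, x(i := p)) t) \<partial>unif3 n \<partial>UQ \<partial>(\<Pi>\<^sub>M i\<in>J. UQ))"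
      by (simp add: upc_def ik)
    also have "\<dots> = (\<integral>\<^sup>+x. \<integral>\<^sup>+t. h (upc m (\<eta>, x) t) \<partial>unif3 n \<partial>(\<Pi>\<^sub>M i\<in>insert i J. UQ))"
      by (rule PP.product_nn_integral_insert[OF J(1,2) h2, symmetric])
    finally show "(\<integral>\<^sup>+x. h (\<eta>, x) \<partial>(\<Pi>\<^sub>M i\<in>{..<N}. UQ)) = (\<integral>\<^sup>+x. \<integral>\<^sup>+t. h (upc m (\<eta>, x) t) \<partial>unif3 n \<partial>(\<Pi>\<^sub>M i\<in>{..<N}. UQ))"
      unfolding J(3) .
  qed
  also have "\<dots> = (\<integral>\<^sup>+\<xi>. \<integral>\<^sup>+t. h (upc m \<xi> t) \<partial>unif3 n \<partial>Om N)"
    unfolding Om_def by (rule B.nn_integral_fst[OF hu])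
  finally show "(\<integral>\<^sup>+\<xi>. h \<xi> \<partial>Om N) = (\<integral>\<^sup>+\<xi>. \<integral>\<^sup>+t. h (upc m \<xi> t) \<partial>unif3 n \<partial>Om N)" .
qed

end

section \<open>Atoms of a configuration and displaced points\<close>

context poisson_window
begin

lemma atom_is_point:
  assumes "\<eta> \<in> configs" "y \<in> Q" "emeasure (conf Q N x \<eta>) {y} \<noteq> 0"
  shows "\<exists>i<N. y = x i"
proof (rule ccontr)
  assume "\<not> (\<exists>i<N. y = x i)"
  hence e: "{i. i < N \<and> x i \<in> {y}} = {}" "{y} - Q = {}" using assms(2) by auto
  have "emeasure (conf Q N x \<eta>) {y} = 0"
    using emeasure_conf[OF assms(1) Q_borel, of "{y}" N x] unfolding e by simp
  thus False using assms(3) by simp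
qed

text \<open>Almost every configuration has finitely many points in Q and is carried there by its
  atoms, so the inner integral is determined by the values at the atoms.\<close>

lemma energy_cong_atoms:
  assumes ae: "AE \<mu> in P. \<forall>y\<in>Q. emeasure \<mu> {y} \<noteq> 0 --> v \<mu> y = w \<mu> y"
  shows "energy P Q v = energy P Q w"
  unfolding energy_def nn_integral_completion
proof (rule nn_integral_cong_AE)
  show "AE \<mu> in P. (\<integral>\<^sup>+x\<in>Q. ennreal ((norm (v \<mu> x))^2) \<partial>\<mu>) = (\<integral>\<^sup>+x\<in>Q. ennreal ((norm (w \<mu> x))^2) \<partial>\<mu>)"
    using ae AE_QN
  proof eventually_elim
    case (elim \<mu>)
    then obtain N where N: "\<mu> \<in> QN N" by auto
    hence \<mu>: "\<mu> \<in> configs" by (simp add: QN_def)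
    obtain x where x: "x \<in> {..<N} \<rightarrow>\<^sub>E Q" "\<mu> = conf Q N x \<mu>" by (rule config_decomp[OF N])
    have Z: "Q - x ` {..<N} \<in> sets borel" by (intro sets.Diff Q_borel) (auto intro: finite_imp_closed borel_closed)
    have e: "{i. i < N \<and> x i \<in> Q - x ` {..<N}} = {}" "Q - x ` {..<N} - Q = {}" by auto
    have "emeasure \<mu> (Q - x ` {..<N}) = emeasure (conf Q N x \<mu>) (Q - x ` {..<N})" using x(2) by simp
    also have "\<dots> = 0" using emeasure_conf[OF \<mu> Q_borel Z, of N x] unfolding e by simp
    finally have z: "emeasure \<mu> (Q - x ` {..<N}) = 0" .
    show ?case
    proof (rule nn_integral_cong_AE)
      show "AE y in \<mu>. ennreal ((norm (v \<mu> y))^2) * indicator Q y = ennreal ((norm (w \<mu> y))^2) * indicator Q y"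
      proof (rule AE_I[OF _ z])
        show "Q - x ` {..<N} \<in> sets \<mu>" using Z sets_configs[OF \<mu>] by simp
        show "{y \<in> space \<mu>. ennreal ((norm (v \<mu> y))^2) * indicator Q y \<noteq> ennreal ((norm (w \<mu> y))^2) * indicator Q y} \<subseteq> Q - x ` {..<N}"
        proof
          fix y assume y: "y \<in> {y \<in> space \<mu>. ennreal ((norm (v \<mu> y))^2) * indicator Q y \<noteq> ennreal ((norm (w \<mu> y))^2) * indicator Q y}"
          hence ne0: "ennreal ((norm (v \<mu> y))^2) * indicator Q y \<noteq> ennreal ((norm (w \<mu> y))^2) * indicator Q y" by blast
          have yQ: "y \<in> Q" by (rule ccontr) (use ne0 in simp)
          have ne: "v \<mu> y \<noteq> w \<mu> y" using ne0 by auto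
          have "y \<notin> x ` {..<N}"
          proof
            assume "y \<in> x ` {..<N}"
            then obtain i where "i < N" "y = x i" by auto
            hence "emeasure (conf Q N x \<mu>) {y} \<noteq> 0" using emeasure_conf_atom[OF \<mu> Q_borel] by auto
            hence "emeasure \<mu> {y} \<noteq> 0" using x(2) by simp
            thus False using elim(1) yQ ne by auto
          qed
          thus "y \<in> Q - x ` {..<N}" using yQ by simp
        qed
      qed
    qed
  qed
qed

text \<open>The mass of the atom at x, for x in Q, written as an integral of the diagonal so that
  \<open>measurable_config_integral\<close> yields measurability jointly in \<mu> and x.\<close>

definition atm :: "(real^'d) measure => real^'d => ennreal" where
  "atm \<mu> x = (if emeasure \<mu> Q < \<infinity> then \<integral>\<^sup>+y\<in>Q. indicator {y. y = x} y \<partial>\<mu> else 0)"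

text \<open>\<open>move_point\<close> guarded by the presence of an atom to be removed; the guard
  makes the result a configuration in all cases.\<close>

definition mv :: "(real^'d) measure => real^'d => real^'d => (real^'d) measure" where
  "mv \<mu> x y = (if atm \<mu> x \<noteq> 0 then move_point \<mu> x y else \<mu>)"

lemma atm_eq:
  assumes "\<mu> \<in> configs" "emeasure \<mu> Q < \<infinity>" shows "atm \<mu> x = (if x \<in> Q then emeasure \<mu> {x} else 0)"
proof -
  have "(\<lambda>y. indicator {y. y = x} y * indicator Q y :: ennreal) = indicator (if x \<in> Q then {x} else {})"
    by (auto simp: indicator_def fun_eq_iff)
  thus ?thesis using assms by (simp add: atm_def sets_configs)
qed

lemma finite_window_QN:
  assumes "\<mu> \<in> configs" "emeasure \<mu> Q < \<infinity>" obtains N where "\<mu> \<in> QN N"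
  using configs_count[OF assms(1) Q_borel] assms by (auto simp: QN_def)

lemma mv_facts:
  assumes \<mu>: "\<mu> \<in> configs"
  shows "mv \<mu> x y \<in> configs"
    "V \<in> sets borel ==> emeasure (mv \<mu> x y) V = (if atm \<mu> x \<noteq> 0 then emeasure \<mu> V - indicator V x + indicator V y else emeasure \<mu> V)"
proof -
  have *: "move_point \<mu> x y \<in> configs" "\<And>A. A \<in> sets borel ==> indicator A x \<le> emeasure \<mu> A" if a: "atm \<mu> x \<noteq> 0"
  proof -
    have fin: "emeasure \<mu> Q < \<infinity>" using a by (auto simp: atm_def split: if_splits)
    have xQ: "x \<in> Q" and at: "emeasure \<mu> {x} \<noteq> 0" using a atm_eq[OF \<mu> fin] by (auto split: if_splits)
    obtain N where N: "\<mu> \<in> QN N" by (rule finite_window_QN[OF \<mu> fin])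
    obtain z where z: "z \<in> {..<N} \<rightarrow>\<^sub>E Q" "\<mu> = conf Q N z \<mu>" by (rule config_decomp[OF N])
    obtain i where i: "i < N" "x = z i" using atom_is_point[OF \<mu> xQ, of N z] z(2) at by auto
    have "move_point \<mu> x y = conf Q N (z(i := y)) \<mu>"
      using move_point_conf[OF \<mu> Q_borel i(1), of z y] z(2) i(2) by simp
    thus "move_point \<mu> x y \<in> configs" using conf_in_configs[OF \<mu> Q_borel] by simp
    fix A :: "(real^'d) set" assume A: "A \<in> sets borel"
    \<comment> \<open>Counts are integers or infinite, so a nonzero atom has mass at least 1 and a
      Dirac mass can be subtracted.\<close>
    have one: "1 \<le> emeasure \<mu> {x}"
    proof -
      have "{x} \<in> sets borel" by simp
      from configs_count[OF \<mu> this] show ?thesis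
      proof
        assume "\<exists>k::nat. emeasure \<mu> {x} = of_nat k"
        then obtain k :: nat where k: "emeasure \<mu> {x} = of_nat k" by auto
        hence "1 \<le> k" using at by (cases k) auto
        thus ?thesis unfolding k by (metis of_nat_1 of_nat_mono)
      qed simp
    qed
    show "indicator A x \<le> emeasure \<mu> A"
    proof (cases "x \<in> A")
      case True
      have "emeasure \<mu> {x} \<le> emeasure \<mu> A" by (rule emeasure_mono) (use True A sets_configs[OF \<mu>] in auto)
      thus ?thesis using one True by simp
    qed simp
  qed
  show "mv \<mu> x y \<in> configs" using * \<mu> by (simp add: mv_def)
  show "emeasure (mv \<mu> x y) V = (if atm \<mu> x \<noteq> 0 then emeasure \<mu> V - indicator V x + indicator V y else emeasure \<mu> V)"
    if V: "V \<in> sets borel"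
  proof (cases "atm \<mu> x = 0")
    case False
    have "emeasure (move_point \<mu> x y) V = emeasure \<mu> V - indicator V x + indicator V y"
      by (rule emeasure_move_point[OF sets_configs[OF \<mu>] *(2)[OF False] V])
    thus ?thesis using False by (simp add: mv_def)
  qed (simp add: mv_def)
qed

lemma atm_measurable [measurable]: "(\<lambda>p. atm (fst p) (snd p)) \<in> borel_measurable (P \<Otimes>\<^sub>M borel)"
proof -
  have m: "fst \<in> P \<Otimes>\<^sub>M (borel :: (real^'d) measure) \<rightarrow>\<^sub>M count_algebra (sets borel)"
    using measurable_fst by (simp cong: measurable_cong_sets add: sets_P)
  have h: "(\<lambda>(p, y). indicator {y. y = snd p} y :: ennreal) \<in> borel_measurable ((P \<Otimes>\<^sub>M (borel :: (real^'d) measure)) \<Otimes>\<^sub>M borel)"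
  proof -
    have "(\<lambda>q. if snd q = snd (fst q) then 1 else 0 :: ennreal) \<in> borel_measurable ((P \<Otimes>\<^sub>M (borel :: (real^'d) measure)) \<Otimes>\<^sub>M borel)"
      by measurable
    moreover have "(\<lambda>(p :: (real^'d) measure \<times> (real^'d), y). indicator {y. y = snd p} y :: ennreal) = (\<lambda>q. if snd q = snd (fst q) then 1 else 0)"
      by (auto simp: fun_eq_iff indicator_def)
    ultimately show ?thesis by (simp only:)
  qed
  from measurable_config_integral[OF m h Q_borel] show ?thesis
    unfolding atm_def[abs_def] .
qed

lemma mv_measurable [measurable]: "(\<lambda>p. mv (fst p) (snd p) (snd p + c)) \<in> P \<Otimes>\<^sub>M borel \<rightarrow>\<^sub>M P"
  unfolding measurable_cong_sets[OF refl sets_P]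
proof (rule measurable_count_algebraI)
  show "mv (fst p) (snd p) (snd p + c) \<in> configs" if "p \<in> space (P \<Otimes>\<^sub>M borel)" for p
    using that by (intro mv_facts) (auto simp: space_pair_measure)
  fix V :: "(real^'d) set" assume V [measurable]: "V \<in> sets borel"
  have [measurable]: "(\<lambda>p. emeasure (fst p) V) \<in> borel_measurable (P \<Otimes>\<^sub>M (borel :: (real^'d) measure))"
    by (rule measurable_compose[OF measurable_fst count_meas[OF V]])
  have "(\<lambda>p. if atm (fst p) (snd p) \<noteq> 0 then emeasure (fst p) V - indicator V (snd p) + indicator V (snd p + c) else emeasure (fst p) V)
      \<in> borel_measurable (P \<Otimes>\<^sub>M (borel :: (real^'d) measure))"
    by measurable
  thus "(\<lambda>p. emeasure (mv (fst p) (snd p) (snd p + c)) V) \<in> borel_measurable (P \<Otimes>\<^sub>M borel)"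
    by (subst measurable_cong[of _ _ "\<lambda>p. if atm (fst p) (snd p) \<noteq> 0 then emeasure (fst p) V - indicator V (snd p) + indicator V (snd p + c) else emeasure (fst p) V"])
      (auto simp: mv_facts(2) V space_pair_measure)
qed

end

section \<open>Derivatives of smooth functions along slices\<close>

context poisson_cube
begin

text \<open>Displacing the atom at \<open>x i\<close> is the same as changing the i-th label
  (\<open>move_point_conf\<close>), so the limit that defines \<open>grad\<close> is the partial
  derivative supplied by smoothness in the labels.\<close>

lemma Cinf_derivative:
  assumes f: "f \<in> Cinf P (cube n)" and \<eta>: "\<eta> \<in> configs" and i: "i < N"
  shows "\<And>x. x \<in> {..<N} \<rightarrow>\<^sub>E cube n ==>
      ((\<lambda>h. f (conf (cube n) N (x(i := x i + h *\<^sub>R axis k 1)) \<eta>)) has_real_derivative grad f (conf (cube n) N x \<eta>) (x i) $ k) (at 0)"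
    "continuous_on ({..<N} \<rightarrow>\<^sub>E cube n) (\<lambda>x. grad f (conf (cube n) N x \<eta>) (x i) $ k)"
proof -
  define F where "F = (\<lambda>x. f (conf (cube n) N x \<eta>))"
  have "bounded (cube n :: (real^'d) set)" unfolding cube_def by (rule bounded_box)
  hence "smooth_power N (cube n) F"
    using f \<eta> open_cube[of n] unfolding Cinf_def F_def conf_def by blast
  hence "Ck_power (Suc 0) N (cube n) F" by (simp add: smooth_power_def)
  then obtain G where G': "\<forall>i<N. \<forall>k. (\<forall>x\<in>{..<N} \<rightarrow>\<^sub>E cube n.
      ((\<lambda>h. F (x(i := x i + h *\<^sub>R axis k 1))) has_real_derivative G i k x) (at 0)) \<and> continuous_on ({..<N} \<rightarrow>\<^sub>E cube n) (G i k)"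
    by auto
  have G: "(\<forall>x\<in>{..<N} \<rightarrow>\<^sub>E cube n. ((\<lambda>h. F (x(i := x i + h *\<^sub>R axis k 1))) has_real_derivative G i k x) (at 0)) \<and>
      continuous_on ({..<N} \<rightarrow>\<^sub>E cube n) (G i k)" if "i < N" for i k
    using G' that by blast
  have gr: "grad f (conf (cube n) N x \<eta>) (x i) $ l = G i l x" if x: "x \<in> {..<N} \<rightarrow>\<^sub>E cube n" for x l
  proof -
    have "((\<lambda>h. (F (x(i := x i + h *\<^sub>R axis l 1)) - F (x(i := x i + 0 *\<^sub>R axis l 1))) / h) \<longlongrightarrow> G i l x) (at 0)"
      using G[OF i, of l] x by (auto simp: DERIV_def)
    hence "((\<lambda>h. (f (move_point (conf (cube n) N x \<eta>) (x i) (x i + h *\<^sub>R axis l 1)) - f (conf (cube n) N x \<eta>)) / h) \<longlongrightarrow> G i l x) (at 0)"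
      by (simp add: F_def move_point_conf[OF \<eta> cube_borel i])
    hence "Lim (at 0) (\<lambda>h. (f (move_point (conf (cube n) N x \<eta>) (x i) (x i + h *\<^sub>R axis l 1)) - f (conf (cube n) N x \<eta>)) / h) = G i l x"
      by (intro tendsto_Lim) simp
    thus ?thesis using emeasure_conf_atom[OF \<eta> cube_borel i] by (simp add: grad_def)
  qed
  show "((\<lambda>h. f (conf (cube n) N (x(i := x i + h *\<^sub>R axis k 1)) \<eta>)) has_real_derivative grad f (conf (cube n) N x \<eta>) (x i) $ k) (at 0)"
    if x: "x \<in> {..<N} \<rightarrow>\<^sub>E cube n" for x
    using G[OF i, of k] x unfolding gr[OF x] F_def by blast
  have "continuous_on ({..<N} \<rightarrow>\<^sub>E cube n) (G i k)" using G[OF i, of k] by blast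
  thus "continuous_on ({..<N} \<rightarrow>\<^sub>E cube n) (\<lambda>x. grad f (conf (cube n) N x \<eta>) (x i) $ k)"
    by (rule continuous_on_eq) (simp add: gr)
qed

lemma shift_in_cube: "p \<in> cube n ==> t \<in> interval3 n ==> shift k p t \<in> cube n"
  by (auto simp: cube_iff shift_nth)

lemma Cinf_slices:
  assumes f: "f \<in> Cinf P (cube n)" and \<xi>: "\<xi> \<in> space (Om N)" "\<And>i. i < N ==> snd \<xi> i \<in> cube n" and i: "i < N"
  shows "\<And>t. t \<in> interval3 n ==> ((\<lambda>t. f (T N (upc (i, k) \<xi> t))) has_real_derivative
      grad f (T N (upc (i, k) \<xi> t)) (snd (upc (i, k) \<xi> t) i) $ k) (at t)"
    "continuous_on (interval3 n) (\<lambda>t. grad f (T N (upc (i, k) \<xi> t)) (snd (upc (i, k) \<xi> t) i) $ k)"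
proof -
  obtain \<eta> x where e: "\<xi> = (\<eta>, x)" "\<eta> \<in> configs" "x \<in> {..<N} \<rightarrow>\<^sub>E UNIV" using \<xi>(1) by (auto simp: space_Om)
  define y where "y = (\<lambda>t. x(i := shift k (x i) t))"
  have yQ: "y t \<in> {..<N} \<rightarrow>\<^sub>E cube n" if "t \<in> interval3 n" for t
    using e \<xi>(2) i shift_in_cube[OF _ that] by (auto simp: y_def PiE_iff extensional_def)
  have T_eq: "T N (upc (i, k) \<xi> t) = conf (cube n) N (y t) \<eta>" "snd (upc (i, k) \<xi> t) i = y t i" for t
    by (simp_all add: T_def upc_def e y_def)
  show "((\<lambda>t. f (T N (upc (i, k) \<xi> t))) has_real_derivative
      grad f (T N (upc (i, k) \<xi> t)) (snd (upc (i, k) \<xi> t) i) $ k) (at t)" if t: "t \<in> interval3 n" for t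
  proof -
    \<comment> \<open>A displacement by h from the value t evaluates the slice at h + t, which turns
      a derivative at 0 into one at t.\<close>
    have "(y t)(i := y t i + h *\<^sub>R axis k 1) = y (h + t)" for h
      by (auto simp: y_def fun_eq_iff vec_eq_iff shift_def algebra_simps)
    hence "((\<lambda>h. f (conf (cube n) N (y (h + t)) \<eta>)) has_real_derivative grad f (conf (cube n) N (y t) \<eta>) (y t i) $ k) (at 0)"
      using Cinf_derivative(1)[OF f e(2) i yQ[OF t], of k] by simp
    thus ?thesis unfolding T_eq using DERIV_shift[of "\<lambda>t. f (conf (cube n) N (y t) \<eta>)" _ 0 t] by simp
  qed
  have "continuous_on (interval3 n) y"
  proof (rule continuous_on_coordinatewise_then_product)
    fix j show "continuous_on (interval3 n) (\<lambda>t. y t j)"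
      unfolding y_def shift_def by (cases "j = i") (auto intro!: continuous_intros)
  qed
  from continuous_on_compose2[OF Cinf_derivative(2)[OF f e(2) i, of k] this]
  show "continuous_on (interval3 n) (\<lambda>t. grad f (T N (upc (i, k) \<xi> t)) (snd (upc (i, k) \<xi> t) i) $ k)"
    unfolding T_eq using yQ by auto
qed

end

lemma vec_lambda_measurable:
  assumes "\<And>k. f k \<in> borel_measurable M"
  shows "(\<lambda>x. (\<chi> k. f k x) :: real^'d::finite) \<in> borel_measurable M"
proof -
  have "(\<lambda>x. (\<chi> k. f k x) :: real^'d) = (\<lambda>x. \<Sum>k\<in>UNIV. f k x *\<^sub>R axis k 1)"
    by (auto simp: fun_eq_iff vec_eq_iff axis_def if_distrib cong: if_cong)
  also have "\<dots> \<in> borel_measurable M" using assms by measurable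
  finally show ?thesis .
qed

lemma norm_vec_sq: "(norm (v :: real^'d::finite))^2 = (\<Sum>k\<in>UNIV. (v $ k)^2)"
  by (simp add: norm_vec_def L2_set_def sum_nonneg)

section \<open>A jointly measurable version of the gradient\<close>

context poisson_cube
begin

text \<open>Once the coordinate is resampled, the shift is a translation of the real line, which
  preserves Lebesgue null sets; inside the interval these are the null sets of the uniform
  law.\<close>

lemma AE_shifted:
  assumes m: "m \<in> coords N" and Z: "Z \<in> null_sets P"
  shows "AE \<xi> in Om N. Xc m \<xi> + h \<in> interval3 n --> T N (upc m \<xi> (Xc m \<xi> + h)) \<notin> Z"
proof -
  interpret R: resample_space "Om N" "coords N" Xc upc n by (rule resample_space_Om)
  have [measurable]: "Z \<in> sets P" using Z by auto
  have [simp]: "m \<in> coords N" by fact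
  show ?thesis
  proof (rule R.AE_resampleI[OF m])
    show "Measurable.pred (Om N) (\<lambda>\<xi>. Xc m \<xi> + h \<in> interval3 n --> T N (upc m \<xi> (Xc m \<xi> + h)) \<notin> Z)" by measurable
    have "AE \<xi> in Om N. T N \<xi> \<notin> Z" by (rule AE_T[OF AE_not_in[OF Z]])
    from R.AE_resample[OF m this] AE_space
    show "AE \<xi> in Om N. AE t in unif3 n. Xc m (upc m \<xi> t) + h \<in> interval3 n -->
        T N (upc m (upc m \<xi> t) (Xc m (upc m \<xi> t) + h)) \<notin> Z"
    proof eventually_elim
      case (elim \<xi>)
      hence [measurable]: "\<xi> \<in> space (Om N)" by simp
      have "AE t in lborel. t \<in> interval3 n --> T N (upc m \<xi> t) \<notin> Z"
        using elim(1) by (simp only: AE_unif3_iff)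
      hence "AE t in lborel. h + 1 * t \<in> interval3 n --> T N (upc m \<xi> (h + 1 * t)) \<notin> Z"
        by (intro AE_borel_affine) (simp_all, measurable)
      from AE_unif3[OF this, of n] show ?case
        by eventually_elim (use elim(2) in \<open>simp add: R.X_upd R.upd_upd add.commute\<close>)
    qed
  qed
qed

lemma measurable_lift_completion:
  assumes "h \<in> borel_measurable (P \<Otimes>\<^sub>M borel)" shows "h \<in> borel_measurable (completion P \<Otimes>\<^sub>M borel)"
proof -
  have "(\<lambda>p. (fst p, snd p)) \<in> completion P \<Otimes>\<^sub>M borel \<rightarrow>\<^sub>M P \<Otimes>\<^sub>M borel"
    by (intro measurable_Pair measurable_snd measurable_compose[OF measurable_fst] measurable_completion measurable_ident_sets refl)
  from measurable_compose[OF this assms] show ?thesis by simp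
qed

text \<open>The gradient is recovered as a limit along this one sequence, so that only countably
  many null events have to be avoided.\<close>

definition stp :: "nat => real" where
  "stp j = 1 / (real j + 1)"

lemma stp_pos: "0 < stp j" by (simp add: stp_def)

lemma stp_lim: "filterlim stp (at 0) sequentially"
proof -
  have "stp \<longlonglongrightarrow> 0" unfolding stp_def[abs_def] using LIMSEQ_inverse_real_of_nat by (simp add: inverse_eq_divide add.commute)
  moreover have "\<forall>\<^sub>F j in sequentially. stp j \<noteq> 0" using stp_pos by (simp add: less_le)
  ultimately show ?thesis by (simp add: filterlim_at)
qed

text \<open>The number of atoms, with multiplicity, whose displacement stays in the cube and leads
  into Z is a measurable function of the configuration. On the labelled space it vanishes almost
  surely by \<open>AE_shifted\<close>.\<close>

lemma AE_moved_points:
  assumes Z: "Z \<in> null_sets P"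
  shows "AE \<mu> in P. \<forall>y\<in>cube n. emeasure \<mu> {y} \<noteq> 0 --> y + c *\<^sub>R axis k 1 \<in> cube n --> mv \<mu> y (y + c *\<^sub>R axis k 1) \<notin> Z"
proof -
  let ?Q = "cube n :: (real^'d) set"
  have Zm [measurable]: "Z \<in> sets P" using Z by auto
  define h where "h = (\<lambda>\<mu> y. if y + c *\<^sub>R axis k 1 \<in> ?Q \<and> mv \<mu> y (y + c *\<^sub>R axis k 1) \<in> Z then 1 else 0 :: ennreal)"
  have hm [measurable]: "case_prod h \<in> borel_measurable (P \<Otimes>\<^sub>M borel)"
  proof -
    have "(\<lambda>p. if snd p + c *\<^sub>R axis k 1 \<in> ?Q \<and> mv (fst p) (snd p) (snd p + c *\<^sub>R axis k 1) \<in> Z then 1 else 0 :: ennreal) \<in> borel_measurable (P \<Otimes>\<^sub>M borel)"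
      by measurable
    thus ?thesis by (simp add: h_def split_def)
  qed
  define b where "b = (\<lambda>\<mu>. if emeasure \<mu> ?Q < \<infinity> then \<integral>\<^sup>+y\<in>?Q. h \<mu> y \<partial>\<mu> else 0)"
  have id: "(\<lambda>\<mu>. \<mu>) \<in> P \<rightarrow>\<^sub>M count_algebra (sets borel)" by (rule measurable_ident_sets[OF sets_P])
  have b [measurable]: "b \<in> borel_measurable P" unfolding b_def by (rule measurable_config_integral[OF id hm cube_borel])
  have hs: "h \<mu> \<in> borel_measurable borel" if "\<mu> \<in> configs" for \<mu>
    using measurable_compose[OF measurable_Pair1' hm, of \<mu>] that by simp
  have b_conf: "b \<mu> = (\<Sum>i<N. h \<mu> (x i))" if \<mu>: "\<mu> \<in> QN N" and x: "x \<in> {..<N} \<rightarrow>\<^sub>E ?Q" "\<mu> = conf ?Q N x \<mu>" for \<mu> N x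
  proof -
    have \<mu>c: "\<mu> \<in> configs" using \<mu> by (simp add: QN_def)
    have "(\<integral>\<^sup>+y\<in>?Q. h \<mu> y \<partial>\<mu>) = (\<integral>\<^sup>+y\<in>?Q. h \<mu> y \<partial>conf ?Q N x \<mu>)" using x(2) by simp
    also have "\<dots> = (\<Sum>i<N. h \<mu> (x i))" by (rule nn_integral_conf[OF \<mu>c cube_borel _ hs[OF \<mu>c]]) (use x in auto)
    finally show ?thesis using \<mu> by (simp add: b_def QN_def of_nat_less_top)
  qed
  have "(\<integral>\<^sup>+\<xi>. b (T N \<xi>) \<partial>Om N) = 0" for N
  proof (subst nn_integral_0_iff_AE)
    have "AE \<xi> in Om N. \<forall>i\<in>{..<N}. Xc (i, k) \<xi> + c \<in> interval3 n --> T N (upc (i, k) \<xi> (Xc (i, k) \<xi> + c)) \<notin> Z"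
      by (intro AE_finite_allI AE_shifted Z) (auto simp: coords_def)
    from this AE_in_Q[of N] AE_space nn_integral_T[of N] show "AE \<xi> in Om N. b (T N \<xi>) = 0"
    proof eventually_elim
      case (elim \<xi>)
      obtain \<eta> x where e: "\<xi> = (\<eta>, x)" "\<eta> \<in> configs" "x \<in> {..<N} \<rightarrow>\<^sub>E UNIV" using elim(3) by (auto simp: space_Om)
      have Te: "T N \<xi> = conf ?Q N x \<eta>" by (simp add: T_def e)
      have Tc: "T N \<xi> \<in> configs" using T_configs elim(3) by blast
      have "h (T N \<xi>) (x i) = 0" if i: "i < N" for i
      proof (cases "x i + c *\<^sub>R axis k 1 \<in> ?Q")
        case True
        have u: "T N (upc (i, k) \<xi> (Xc (i, k) \<xi> + c)) = conf ?Q N (x(i := x i + c *\<^sub>R axis k 1)) \<eta>"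
          by (simp add: T_def upc_def Xc_def e shift_def)
        have "(x i + c *\<^sub>R axis k 1) $ k \<in> interval3 n" using True unfolding cube_iff by blast
        moreover have "(x i + c *\<^sub>R axis k 1) $ k = x i $ k + c" by (simp add: axis_def)
        ultimately have "Xc (i, k) \<xi> + c \<in> interval3 n" by (simp only: Xc_def e fst_conv snd_conv prod.case)
        hence nz: "conf ?Q N (x(i := x i + c *\<^sub>R axis k 1)) \<eta> \<notin> Z" using elim(1) i u by auto
        have "emeasure (T N \<xi>) ?Q < \<infinity>"
        proof -
          have "?Q - ?Q = {}" by simp
          thus ?thesis unfolding Te emeasure_conf[OF e(2) cube_borel cube_borel] by (simp add: of_nat_less_top)
        qed
        moreover have "x i \<in> ?Q" using elim(2) i e by auto
        ultimately have "atm (T N \<xi>) (x i) \<noteq> 0"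
          using atm_eq[OF Tc, of "x i"] emeasure_conf_atom[OF e(2) cube_borel i] by (simp add: Te)
        hence "mv (T N \<xi>) (x i) (x i + c *\<^sub>R axis k 1) = conf ?Q N (x(i := x i + c *\<^sub>R axis k 1)) \<eta>"
          by (simp add: mv_def Te move_point_conf[OF e(2) cube_borel i])
        thus ?thesis using nz by (simp add: h_def)
      qed (simp add: h_def)
      moreover have "(\<integral>\<^sup>+y\<in>?Q. h (T N \<xi>) y \<partial>T N \<xi>) = (\<Sum>i<N. h (T N \<xi>) (x i))" using elim(4) hs[OF Tc] e by auto
      ultimately show ?case by (simp add: b_def)
    qed
  qed measurable
  hence "(\<integral>\<^sup>+\<mu>. b \<mu> \<partial>P) = 0" by (simp add: nn_integral_P)
  hence "AE \<mu> in P. b \<mu> = 0" by (subst (asm) nn_integral_0_iff_AE) measurable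
  thus ?thesis using AE_QN
  proof eventually_elim
    case (elim \<mu>)
    then obtain N where N: "\<mu> \<in> QN N" by auto
    hence \<mu>: "\<mu> \<in> configs" by (simp add: QN_def)
    obtain x where x: "x \<in> {..<N} \<rightarrow>\<^sub>E ?Q" "\<mu> = conf ?Q N x \<mu>" by (rule config_decomp[OF N])
    show ?case
    proof (intro ballI impI)
      fix y assume y: "y \<in> ?Q" "emeasure \<mu> {y} \<noteq> 0" "y + c *\<^sub>R axis k 1 \<in> ?Q"
      obtain i where i: "i < N" "y = x i" using atom_is_point[OF \<mu> y(1), of N x] x(2) y(2) by auto
      have "h \<mu> (x i) = 0" using elim(1) b_conf[OF N x] i by simp
      thus "mv \<mu> y (y + c *\<^sub>R axis k 1) \<notin> Z" using y i by (auto simp: h_def)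
    qed
  qed
qed

text \<open>\<open>f\<close> coincides with a measurable \<open>f'\<close> only off a null event,
  and displacing a point might lead into that event. By \<open>AE_moved_points\<close> this almost
  surely never happens for the steps \<open>stp j\<close>, so the difference quotients of
  \<open>f'\<close> converge to the gradient of \<open>f\<close> at every atom.\<close>

lemma grad_version:
  assumes f: "f \<in> Cinf P (cube n)"
  obtains f' gf where "f' \<in> borel_measurable P" "AE \<mu> in P. f \<mu> = f' \<mu>"
    "\<And>k. (\<lambda>p. gf k (fst p) (snd p)) \<in> borel_measurable (P \<Otimes>\<^sub>M borel)"
    "AE \<mu> in P. \<forall>y\<in>cube n. emeasure \<mu> {y} \<noteq> 0 --> grad f \<mu> y = (\<chi> k. gf k \<mu> y)"
proof -
  let ?Q = "cube n :: (real^'d) set"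
  have "f \<in> borel_measurable (completion P)" using f by (simp add: Cinf_def)
  then obtain f' where f' [measurable]: "f' \<in> borel_measurable P" and ae: "AE \<mu> in P. f \<mu> = f' \<mu>"
    using completion_ex_borel_measurable_real by blast
  then obtain Z where Z: "Z \<in> null_sets P" "{\<mu> \<in> space P. f \<mu> \<noteq> f' \<mu>} \<subseteq> Z" by (auto simp: eventually_ae_filter)
  have ff: "f \<mu> = f' \<mu>" if "\<mu> \<in> configs" "\<mu> \<notin> Z" for \<mu> using Z(2) that by auto
  \<comment> \<open>The default 0 occurs when the step leaves the cube; the cube being open, this
    concerns finitely many j at each of its points.\<close>
  define dq where "dq = (\<lambda>j k \<mu> y. if y + stp j *\<^sub>R axis k 1 \<in> ?Q then (f' (mv \<mu> y (y + stp j *\<^sub>R axis k 1)) - f' \<mu>) / stp j else 0)"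
  define gf where "gf = (\<lambda>k \<mu> y. lim (\<lambda>j. dq j k \<mu> y))"
  have f1 [measurable]: "(\<lambda>p. f' (fst p)) \<in> borel_measurable (P \<Otimes>\<^sub>M (borel :: (real^'d) measure))"
    by (rule measurable_compose[OF measurable_fst f'])
  have f2 [measurable]: "(\<lambda>p. f' (mv (fst p) (snd p) (snd p + c))) \<in> borel_measurable (P \<Otimes>\<^sub>M (borel :: (real^'d) measure))" for c
    by (rule measurable_compose[OF mv_measurable f'])
  have dqm [measurable]: "(\<lambda>p. dq j k (fst p) (snd p)) \<in> borel_measurable (P \<Otimes>\<^sub>M (borel :: (real^'d) measure))" for j k
    unfolding dq_def by measurable
  have "AE \<mu> in P. \<forall>j k. \<forall>y\<in>?Q. emeasure \<mu> {y} \<noteq> 0 --> y + stp j *\<^sub>R axis k 1 \<in> ?Q --> mv \<mu> y (y + stp j *\<^sub>R axis k 1) \<notin> Z"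
  proof (rule AE_all_countable[THEN iffD2], rule allI)
    fix j
    have "AE \<mu> in P. \<forall>k\<in>UNIV. \<forall>y\<in>?Q. emeasure \<mu> {y} \<noteq> 0 --> y + stp j *\<^sub>R axis k 1 \<in> ?Q --> mv \<mu> y (y + stp j *\<^sub>R axis k 1) \<notin> Z"
      by (rule AE_finite_allI) (auto intro: AE_moved_points[OF Z(1)])
    thus "AE \<mu> in P. \<forall>k. \<forall>y\<in>?Q. emeasure \<mu> {y} \<noteq> 0 --> y + stp j *\<^sub>R axis k 1 \<in> ?Q --> mv \<mu> y (y + stp j *\<^sub>R axis k 1) \<notin> Z" by simp
  qed
  hence G: "AE \<mu> in P. \<forall>y\<in>?Q. emeasure \<mu> {y} \<noteq> 0 --> grad f \<mu> y = (\<chi> k. gf k \<mu> y)"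
    using AE_QN AE_not_in[OF Z(1)]
  proof eventually_elim
    case outer: (elim \<mu>)
    then obtain N where N: "\<mu> \<in> QN N" by auto
    hence \<mu>: "\<mu> \<in> configs" and fin: "emeasure \<mu> ?Q < \<infinity>" by (auto simp: QN_def of_nat_less_top)
    obtain x where x: "x \<in> {..<N} \<rightarrow>\<^sub>E ?Q" "\<mu> = conf ?Q N x \<mu>" by (rule config_decomp[OF N])
    show ?case
    proof (intro ballI impI)
      fix y assume y: "y \<in> ?Q" "emeasure \<mu> {y} \<noteq> 0"
      obtain i where i: "i < N" "y = x i" using atom_is_point[OF \<mu> y(1), of N x] x(2) y(2) by auto
      have at: "atm \<mu> y \<noteq> 0" using atm_eq[OF \<mu> fin, of y] y by simp
      have mp: "mv \<mu> y z = conf ?Q N (x(i := z)) \<mu>" for z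
        using move_point_conf[OF \<mu> cube_borel[of n] i(1), where x = x and y = z] x(2) i(2) at by (simp add: mv_def)
      have "grad f \<mu> y $ k = gf k \<mu> y" for k
      proof -
        have "((\<lambda>h. f (conf ?Q N (x(i := x i + h *\<^sub>R axis k 1)) \<mu>)) has_real_derivative grad f (conf ?Q N x \<mu>) (x i) $ k) (at 0)"
          by (rule Cinf_derivative(1)[OF f \<mu> i(1) x(1)])
        hence "((\<lambda>h. f (mv \<mu> y (y + h *\<^sub>R axis k 1))) has_real_derivative grad f \<mu> y $ k) (at 0)"
          unfolding mp i(2)[symmetric] x(2)[symmetric] .
        hence "((\<lambda>h. (f (mv \<mu> y (y + h *\<^sub>R axis k 1)) - f (mv \<mu> y (y + 0 *\<^sub>R axis k 1))) / h) \<longlongrightarrow> grad f \<mu> y $ k) (at 0)"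
          by (simp add: DERIV_def)
        moreover have "mv \<mu> y (y + 0 *\<^sub>R axis k 1) = \<mu>" using mp[of y] x(2) i(2) by simp
        ultimately have "((\<lambda>h. (f (mv \<mu> y (y + h *\<^sub>R axis k 1)) - f \<mu>) / h) \<longlongrightarrow> grad f \<mu> y $ k) (at 0)" by simp
        from filterlim_compose[OF this stp_lim]
        have l: "(\<lambda>j. (f (mv \<mu> y (y + stp j *\<^sub>R axis k 1)) - f \<mu>) / stp j) \<longlonglongrightarrow> grad f \<mu> y $ k" .
        have "(\<lambda>j. y + stp j *\<^sub>R axis k 1) \<longlonglongrightarrow> y + 0 *\<^sub>R axis k 1"
          using stp_lim by (intro tendsto_intros) (simp add: filterlim_at)
        hence "\<forall>\<^sub>F j in sequentially. y + stp j *\<^sub>R axis k 1 \<in> ?Q"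
          by (rule topological_tendstoD[OF _ open_cube]) (use y in simp)
        hence "\<forall>\<^sub>F j in sequentially. (f (mv \<mu> y (y + stp j *\<^sub>R axis k 1)) - f \<mu>) / stp j = dq j k \<mu> y"
        proof eventually_elim
          case (elim j)
          have "mv \<mu> y (y + stp j *\<^sub>R axis k 1) \<notin> Z" using outer(1) y elim by blast
          hence "f (mv \<mu> y (y + stp j *\<^sub>R axis k 1)) = f' (mv \<mu> y (y + stp j *\<^sub>R axis k 1))" by (intro ff mv_facts \<mu>)
          moreover have "f \<mu> = f' \<mu>" using ff \<mu> outer(3) by blast
          ultimately show ?case using elim by (simp add: dq_def)
        qed
        from Lim_transform_eventually[OF l this] have "(\<lambda>j. dq j k \<mu> y) \<longlonglongrightarrow> grad f \<mu> y $ k" .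
        thus ?thesis unfolding gf_def by (rule limI[symmetric])
      qed
      thus "grad f \<mu> y = (\<chi> k. gf k \<mu> y)" by (simp add: vec_eq_iff)
    qed
  qed
  have gfm: "(\<lambda>p. gf k (fst p) (snd p)) \<in> borel_measurable (P \<Otimes>\<^sub>M borel)" for k
    unfolding gf_def by (rule borel_measurable_lim_metric) (rule dqm)
  show ?thesis by (rule that[OF f' ae gfm G])
qed

end

lemma sqintI_nn:
  assumes "f \<in> borel_measurable M" "(\<integral>\<^sup>+x. ennreal ((f x)^2) \<partial>M) < \<infinity>"
  shows "sqint M f"
proof -
  have "(\<lambda>x. (f x)^2) \<in> borel_measurable M" using assms(1) by measurable
  from integrableI_nonneg[OF this] assms show ?thesis by (simp add: sqint_def)
qed

lemma nn_integral_sq: "sqint M f ==> (\<integral>\<^sup>+x. ennreal ((f x)^2) \<partial>M) = ennreal ((nrm2 M f)^2)"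
  unfolding nrm2_sq sqint_def by (intro nn_integral_eq_integral) auto

section \<open>Integration by parts on the labelled space\<close>

context poisson_cube
begin

text \<open>The theory of resampling works with the uncompleted algebra, so functions arriving
  through the completion are replaced by a measurable version.\<close>

definition lft :: "nat => ((real^'d) measure \<times> (nat => real^'d) => real) => (real^'d) measure \<times> (nat => real^'d) => real" where
  "lft N \<phi> = (SOME v. v \<in> borel_measurable (Om N) \<and> (AE \<xi> in Om N. v \<xi> = \<phi> \<xi>))"

lemma lft:
  assumes "\<phi> \<in> borel_measurable (completion (Om N))"
  shows "lft N \<phi> \<in> borel_measurable (Om N)" "AE \<xi> in Om N. lft N \<phi> \<xi> = \<phi> \<xi>"
proof -
  obtain v where "v \<in> borel_measurable (Om N)" "AE \<xi> in Om N. \<phi> \<xi> = v \<xi>"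
    using completion_ex_borel_measurable_real[OF assms] by blast
  hence "\<exists>v. v \<in> borel_measurable (Om N) \<and> (AE \<xi> in Om N. v \<xi> = \<phi> \<xi>)" by (auto simp: eq_commute)
  from someI_ex[OF this] show "lft N \<phi> \<in> borel_measurable (Om N)" "AE \<xi> in Om N. lft N \<phi> \<xi> = \<phi> \<xi>"
    unfolding lft_def by blast+
qed

definition up :: "((real^'d) measure => real) => nat => (real^'d) measure \<times> (nat => real^'d) => real" where
  "up u N = lft N (\<lambda>\<xi>. u (T N \<xi>))"

definition gp :: "((real^'d) measure => real^'d => real^'d) => nat => nat \<times> 'd => (real^'d) measure \<times> (nat => real^'d) => real" where
  "gp g N m = lft N (\<lambda>\<xi>. g (T N \<xi>) (snd \<xi> (fst m)) $ snd m)"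

lemma up:
  assumes "u \<in> borel_measurable (completion P)"
  shows "up u N \<in> borel_measurable (Om N)" "AE \<xi> in Om N. up u N \<xi> = u (T N \<xi>)"
  unfolding up_def by (intro lft measurable_compose[OF T_completion assms])+

lemma gp:
  assumes "case_prod g \<in> borel_measurable (completion P \<Otimes>\<^sub>M borel)" "m \<in> coords N"
  shows "gp g N m \<in> borel_measurable (Om N)" "AE \<xi> in Om N. gp g N m \<xi> = g (T N \<xi>) (snd \<xi> (fst m)) $ snd m"
proof -
  have i: "fst m < N" using assms(2) by (auto simp: coords_def)
  have "(\<lambda>\<xi>. g (T N \<xi>) (snd \<xi> (fst m)) $ snd m) \<in> borel_measurable (completion (Om N))"
    using at_points_measurable[OF assms(1) i] by measurable
  thus "gp g N m \<in> borel_measurable (Om N)" "AE \<xi> in Om N. gp g N m \<xi> = g (T N \<xi>) (snd \<xi> (fst m)) $ snd m"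
    unfolding gp_def by (rule lft)+
qed

lemma L2_up:
  assumes "u \<in> borel_measurable (completion P)"
  shows "L2_sq P u = (\<Sum>N. ennreal (pN N) * (\<integral>\<^sup>+\<xi>. ennreal ((up u N \<xi>)^2) \<partial>Om N))"
  unfolding L2_sq_formula[OF assms]
proof (intro suminf_cong arg_cong2[where f = "(*)"] refl nn_integral_cong_AE)
  fix N show "AE \<xi> in Om N. ennreal ((u (T N \<xi>))^2) = ennreal ((up u N \<xi>)^2)"
    using up(2)[OF assms, of N] by eventually_elim simp
qed

lemma energy_gp:
  assumes g: "case_prod g \<in> borel_measurable (completion P \<Otimes>\<^sub>M borel)"
  shows "energy P (cube n) g = (\<Sum>N. ennreal (pN N) * (\<Sum>m\<in>coords N. \<integral>\<^sup>+\<xi>. ennreal ((gp g N m \<xi>)^2) \<partial>Om N))"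
  unfolding energy_formula[OF g]
proof (intro suminf_cong arg_cong2[where f = "(*)"] refl)
  fix N
  have fin: "finite (coords N)" by (simp add: coords_def)
  have ae: "AE \<xi> in Om N. \<forall>m\<in>coords N. gp g N m \<xi> = g (T N \<xi>) (snd \<xi> (fst m)) $ snd m"
    by (rule AE_finite_allI[OF fin gp(2)[OF g]])
  have "(\<integral>\<^sup>+\<xi>. (\<Sum>i<N. ennreal ((norm (g (T N \<xi>) (snd \<xi> i)))^2)) \<partial>Om N) = (\<integral>\<^sup>+\<xi>. (\<Sum>m\<in>coords N. ennreal ((gp g N m \<xi>)^2)) \<partial>Om N)"
  proof (rule nn_integral_cong_AE)
    show "AE \<xi> in Om N. (\<Sum>i<N. ennreal ((norm (g (T N \<xi>) (snd \<xi> i)))^2)) = (\<Sum>m\<in>coords N. ennreal ((gp g N m \<xi>)^2))"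
      using ae
    proof eventually_elim
      case (elim \<xi>)
      have "(\<Sum>i<N. ennreal ((norm (g (T N \<xi>) (snd \<xi> i)))^2)) = (\<Sum>i<N. \<Sum>k\<in>UNIV. ennreal ((g (T N \<xi>) (snd \<xi> i) $ k)^2))"
        by (simp add: norm_vec_sq sum_ennreal)
      also have "\<dots> = (\<Sum>m\<in>coords N. ennreal ((g (T N \<xi>) (snd \<xi> (fst m)) $ snd m)^2))"
        unfolding coords_def by (simp add: sum.cartesian_product split_def del: sum_ennreal)
      also have "\<dots> = (\<Sum>m\<in>coords N. ennreal ((gp g N m \<xi>)^2))"
        using elim by (intro sum.cong) auto
      finally show ?case .
    qed
  qed
  also have "\<dots> = (\<Sum>m\<in>coords N. \<integral>\<^sup>+\<xi>. ennreal ((gp g N m \<xi>)^2) \<partial>Om N)"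
  proof (rule nn_integral_sum)
    fix m assume "m \<in> coords N"
    note [measurable] = gp(1)[OF g this]
    show "(\<lambda>\<xi>. ennreal ((gp g N m \<xi>)^2)) \<in> borel_measurable (Om N)" by measurable
  qed
  finally show "(\<integral>\<^sup>+\<xi>. (\<Sum>i<N. ennreal ((norm (g (T N \<xi>) (snd \<xi> i)))^2)) \<partial>Om N) = (\<Sum>m\<in>coords N. \<integral>\<^sup>+\<xi>. ennreal ((gp g N m \<xi>)^2) \<partial>Om N)" .
qed

lemma sqint_term:
  assumes v: "v \<in> borel_measurable (Om N)" and le: "ennreal (pN N) * (\<integral>\<^sup>+\<xi>. ennreal ((v \<xi>)^2) \<partial>Om N) \<le> b" and b: "b < \<infinity>"
  shows "sqint (Om N) v" "pN N * (nrm2 (Om N) v)^2 \<le> enn2real b"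
proof -
  have "(\<integral>\<^sup>+\<xi>. ennreal ((v \<xi>)^2) \<partial>Om N) < \<infinity>"
  proof (rule ccontr)
    assume "\<not> ?thesis"
    hence "(\<integral>\<^sup>+\<xi>. ennreal ((v \<xi>)^2) \<partial>Om N) = \<infinity>" by (simp only: less_top[symmetric] not_not infinity_ennreal_def)
    thus False using le b pN_pos[of N] by (simp add: ennreal_mult_top)
  qed
  thus s: "sqint (Om N) v" by (rule sqintI_nn[OF v])
  have "ennreal (pN N * (nrm2 (Om N) v)^2) \<le> b" using le pN_pos[of N] by (simp add: nn_integral_sq[OF s] ennreal_mult)
  from enn2real_mono[OF this] b show "pN N * (nrm2 (Om N) v)^2 \<le> enn2real b"
    using pN_pos[of N] by simp
qed

lemma suminf_term_le: "f N \<le> (\<Sum>N. f N)" for f :: "nat => ennreal"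
  using sum_le_suminf[of f "{N}"] by simp

lemma L2_bound:
  assumes "u \<in> borel_measurable (completion P)" "L2_sq P u < \<infinity>"
  shows "sqint (Om N) (up u N)" "pN N * (nrm2 (Om N) (up u N))^2 \<le> enn2real (L2_sq P u)"
proof -
  have "ennreal (pN N) * (\<integral>\<^sup>+\<xi>. ennreal ((up u N \<xi>)^2) \<partial>Om N) \<le> L2_sq P u"
    unfolding L2_up[OF assms(1)] by (rule suminf_term_le)
  from sqint_term[OF up(1)[OF assms(1)] this assms(2)]
  show "sqint (Om N) (up u N)" "pN N * (nrm2 (Om N) (up u N))^2 \<le> enn2real (L2_sq P u)" .
qed

lemma energy_bound:
  assumes g: "case_prod g \<in> borel_measurable (completion P \<Otimes>\<^sub>M borel)" "energy P (cube n) g < \<infinity>" and m: "m \<in> coords N"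
  shows "sqint (Om N) (gp g N m)" "pN N * (nrm2 (Om N) (gp g N m))^2 \<le> enn2real (energy P (cube n) g)"
proof -
  have "(\<integral>\<^sup>+\<xi>. ennreal ((gp g N m \<xi>)^2) \<partial>Om N) \<le> (\<Sum>m\<in>coords N. \<integral>\<^sup>+\<xi>. ennreal ((gp g N m \<xi>)^2) \<partial>Om N)"
    by (rule member_le_sum[OF m]) (auto simp: coords_def)
  hence "ennreal (pN N) * (\<integral>\<^sup>+\<xi>. ennreal ((gp g N m \<xi>)^2) \<partial>Om N) \<le> ennreal (pN N) * (\<Sum>m\<in>coords N. \<integral>\<^sup>+\<xi>. ennreal ((gp g N m \<xi>)^2) \<partial>Om N)"
    by (rule mult_left_mono) simp
  also have "\<dots> \<le> energy P (cube n) g" unfolding energy_gp[OF g(1)] by (rule suminf_term_le)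
  finally have "ennreal (pN N) * (\<integral>\<^sup>+\<xi>. ennreal ((gp g N m \<xi>)^2) \<partial>Om N) \<le> energy P (cube n) g" .
  from sqint_term[OF gp(1)[OF g(1) m] this g(2)]
  show "sqint (Om N) (gp g N m)" "pN N * (nrm2 (Om N) (gp g N m))^2 \<le> enn2real (energy P (cube n) g)" .
qed

lemma energy_nrm:
  assumes "case_prod g \<in> borel_measurable (completion P \<Otimes>\<^sub>M borel)" "\<And>N m. m \<in> coords N ==> sqint (Om N) (gp g N m)"
  shows "energy P (cube n) g = (\<Sum>N. ennreal (pN N * (\<Sum>m\<in>coords N. (nrm2 (Om N) (gp g N m))^2)))"
  unfolding energy_gp[OF assms(1)]
  using pN_pos by (intro suminf_cong) (simp add: nn_integral_sq assms(2) sum_ennreal ennreal_mult less_imp_le sum_nonneg)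

text \<open>The weak derivative is stated for a jointly measurable w that agrees with
  \<open>grad f\<close> at the atoms. On the labelled space the points are atoms, so almost every
  slice of w is a slice of the true derivative.\<close>

lemma smooth_ibp:
  assumes f: "f \<in> Cinf P (cube n)" "L2_sq P f + energy P (cube n) (grad f) < \<infinity>"
  obtains w where "case_prod w \<in> borel_measurable (completion P \<Otimes>\<^sub>M borel)"
    "AE \<mu> in P. \<forall>y\<in>cube n. emeasure \<mu> {y} \<noteq> 0 --> grad f \<mu> y = w \<mu> y"
    "\<And>N m. m \<in> coords N ==> resample_space.ibp (Om N) Xc upc n (up f N) m (gp w N m)"
proof -
  obtain f' gf where "f' \<in> borel_measurable P" "AE \<mu> in P. f \<mu> = f' \<mu>"
    and gfm: "\<And>k. (\<lambda>p. gf k (fst p) (snd p)) \<in> borel_measurable (P \<Otimes>\<^sub>M borel)"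
    and gf: "AE \<mu> in P. \<forall>y\<in>cube n. emeasure \<mu> {y} \<noteq> 0 --> grad f \<mu> y = (\<chi> k. gf k \<mu> y)"
    by (rule grad_version[OF f(1)]) blast
  define w where "w = (\<lambda>\<mu> y. (\<chi> k. gf k \<mu> y) :: real^'d)"
  have "(\<lambda>p. (\<chi> k. gf k (fst p) (snd p)) :: real^'d) \<in> borel_measurable (P \<Otimes>\<^sub>M borel)"
    by (rule vec_lambda_measurable) (rule gfm)
  hence wm: "case_prod w \<in> borel_measurable (completion P \<Otimes>\<^sub>M borel)"
    by (intro measurable_lift_completion) (simp add: w_def split_def)
  have fm: "f \<in> borel_measurable (completion P)" using f(1) by (simp add: Cinf_def)
  have ae: "AE \<mu> in P. \<forall>y\<in>cube n. emeasure \<mu> {y} \<noteq> 0 --> grad f \<mu> y = w \<mu> y" using gf by (simp add: w_def)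
  have fin: "L2_sq P f < \<infinity>" "energy P (cube n) w < \<infinity>"
    using f(2) energy_cong_atoms[OF ae] by (auto simp: less_top)
  show ?thesis
  proof (rule that[OF wm ae])
    fix N m assume m: "m \<in> coords N"
    obtain i k where mi: "m = (i, k)" "i < N" using m by (auto simp: coords_def)
    interpret R: resample_space "Om N" "coords N" Xc upc n by (rule resample_space_Om)
    have aeG: "AE \<xi> in Om N. gp w N m \<xi> = grad f (T N \<xi>) (snd \<xi> i) $ k"
      using AE_T[OF ae, of N] gp(2)[OF wm m] AE_in_Q[of N] AE_space[of "Om N"]
    proof eventually_elim
      case (elim \<xi>)
      have c: "fst \<xi> \<in> configs" using elim(4) unfolding space_Om by (simp add: mem_Times_iff)
      have Te: "T N \<xi> = conf (cube n) N (snd \<xi>) (fst \<xi>)" by (simp add: T_def split_def)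
      have "emeasure (T N \<xi>) {snd \<xi> i} \<noteq> 0"
        unfolding Te by (rule emeasure_conf_atom[OF c cube_borel mi(2)])
      moreover have "snd \<xi> i \<in> cube n" using elim(3) mi(2) by blast
      ultimately have "grad f (T N \<xi>) (snd \<xi> i) = w (T N \<xi>) (snd \<xi> i)" using elim(1) by blast
      thus ?case using elim(2) mi(1) by simp
    qed
    show "R.ibp (up f N) m (gp w N m)"
    proof (rule R.ibp_smooth[OF m L2_bound(1)[OF fm fin(1)] energy_bound(1)[OF wm fin(2) m]])
      show "AE \<xi> in Om N. \<exists>\<phi> \<psi>. (\<forall>t\<in>interval3 n. (\<phi> has_real_derivative \<psi> t) (at t)) \<and> continuous_on (interval3 n) \<psi> \<and>
        (AE t in unif3 n. up f N (upc m \<xi> t) = \<phi> t \<and> gp w N m (upc m \<xi> t) = \<psi> t)"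
        using R.AE_resample[OF m up(2)[OF fm]] R.AE_resample[OF m aeG] AE_in_Q[of N] AE_space[of "Om N"]
      proof eventually_elim
        case (elim \<xi>)
        let ?\<phi> = "\<lambda>t. f (T N (upc m \<xi> t))" and ?\<psi> = "\<lambda>t. grad f (T N (upc m \<xi> t)) (snd (upc m \<xi> t) i) $ k"
        have "\<forall>t\<in>interval3 n. (?\<phi> has_real_derivative ?\<psi> t) (at t)" "continuous_on (interval3 n) ?\<psi>"
          unfolding mi(1) using Cinf_slices[OF f(1) elim(4) _ mi(2), where k = k] elim(3) by auto
        moreover have "AE t in unif3 n. up f N (upc m \<xi> t) = ?\<phi> t \<and> gp w N m (upc m \<xi> t) = ?\<psi> t"
          using elim(1,2) by eventually_elim simp
        ultimately show ?case by (intro exI[of _ ?\<phi>] exI[of _ ?\<psi>] conjI)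
      qed
    qed
  qed
qed

lemma nrm2_tendsto_0:
  assumes "b \<longlonglongrightarrow> (0 :: ennreal)" "\<forall>\<^sub>F j in sequentially. pN N * (a j)^2 \<le> enn2real (b j)" "\<And>j. 0 \<le> a j"
  shows "a \<longlonglongrightarrow> 0"
proof -
  have "(\<lambda>j. enn2real (b j)) \<longlonglongrightarrow> enn2real 0" using assms(1) by (intro tendsto_enn2real) auto
  hence "(\<lambda>j. sqrt (enn2real (b j) / pN N)) \<longlonglongrightarrow> sqrt (enn2real 0 / pN N)"
    using pN_pos[of N] by (intro tendsto_real_sqrt tendsto_divide[OF _ tendsto_const]) auto
  hence l: "(\<lambda>j. sqrt (enn2real (b j) / pN N)) \<longlonglongrightarrow> 0" by simp
  show ?thesis
  proof (rule Lim_null_comparison[OF _ l])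
    show "\<forall>\<^sub>F j in sequentially. norm (a j) \<le> sqrt (enn2real (b j) / pN N)"
      using assms(2)
    proof eventually_elim
      case (elim j)
      hence "(a j)^2 \<le> enn2real (b j) / pN N" using pN_pos[of N] by (simp add: field_simps)
      thus ?case using assms(3)[of j] by (simp add: real_le_rsqrt)
    qed
  qed
qed

text \<open>Convergence of functions and gradients on configurations implies, for each N separately,
  convergence on the labelled space, because \<open>pN N\<close> is positive; weak derivatives then
  pass to the limit by \<open>ibp_limit\<close>.\<close>

lemma H1_ibp:
  assumes H: "(u, g) \<in> H1 P (cube n)"
  shows "sqint (Om N) (up u N)"
    "m \<in> coords N ==> sqint (Om N) (gp g N m)"
    "m \<in> coords N ==> resample_space.ibp (Om N) Xc upc n (up u N) m (gp g N m)"
    "L2_sq P u < \<infinity>" "energy P (cube n) g < \<infinity>"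
proof -
  have um: "u \<in> borel_measurable (completion P)" and gm: "case_prod g \<in> borel_measurable (completion P \<Otimes>\<^sub>M borel)"
    using H by (auto simp: H1_def)
  obtain f where f: "\<And>j. f j \<in> Cinf P (cube n)" "\<And>j. L2_sq P (f j) + energy P (cube n) (grad (f j)) < \<infinity>"
    and lim: "(\<lambda>j. L2_sq P (\<lambda>\<mu>. f j \<mu> - u \<mu>) + energy P (cube n) (\<lambda>\<mu> x. grad (f j) \<mu> x - g \<mu> x)) \<longlonglongrightarrow> 0"
    using H by (auto simp: H1_def)
  have fm: "f j \<in> borel_measurable (completion P)" for j using f(1)[of j] by (simp add: Cinf_def)
  have "\<exists>w. case_prod w \<in> borel_measurable (completion P \<Otimes>\<^sub>M borel) \<and>
    (AE \<mu> in P. \<forall>y\<in>cube n. emeasure \<mu> {y} \<noteq> 0 --> grad (f j) \<mu> y = w \<mu> y) \<and>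
    (\<forall>N. \<forall>m\<in>coords N. resample_space.ibp (Om N) Xc upc n (up (f j) N) m (gp w N m))" for j
  proof (rule smooth_ibp[OF f(1,2)[of j]])
    fix w assume w: "case_prod w \<in> borel_measurable (completion P \<Otimes>\<^sub>M borel)"
      "AE \<mu> in P. \<forall>y\<in>cube n. emeasure \<mu> {y} \<noteq> 0 --> grad (f j) \<mu> y = w \<mu> y"
      "\<And>N m. m \<in> coords N ==> resample_space.ibp (Om N) Xc upc n (up (f j) N) m (gp w N m)"
    show ?thesis by (intro exI[of _ w] conjI allI ballI w)
  qed
  hence "\<exists>w. \<forall>j. case_prod (w j) \<in> borel_measurable (completion P \<Otimes>\<^sub>M borel) \<and>
    (AE \<mu> in P. \<forall>y\<in>cube n. emeasure \<mu> {y} \<noteq> 0 --> grad (f j) \<mu> y = w j \<mu> y) \<and>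
    (\<forall>N. \<forall>m\<in>coords N. resample_space.ibp (Om N) Xc upc n (up (f j) N) m (gp (w j) N m))"
    by (intro choice allI)
  then obtain w where W: "\<forall>j. case_prod (w j) \<in> borel_measurable (completion P \<Otimes>\<^sub>M borel) \<and>
    (AE \<mu> in P. \<forall>y\<in>cube n. emeasure \<mu> {y} \<noteq> 0 --> grad (f j) \<mu> y = w j \<mu> y) \<and>
    (\<forall>N. \<forall>m\<in>coords N. resample_space.ibp (Om N) Xc upc n (up (f j) N) m (gp (w j) N m))" ..
  have wm: "case_prod (w j) \<in> borel_measurable (completion P \<Otimes>\<^sub>M borel)"
    and wae: "AE \<mu> in P. \<forall>y\<in>cube n. emeasure \<mu> {y} \<noteq> 0 --> grad (f j) \<mu> y = w j \<mu> y" for j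
    using W[rule_format, of j] by auto
  have ibp: "resample_space.ibp (Om N) Xc upc n (up (f j) N) m (gp (w j) N m)" if "m \<in> coords N" for j N m
    using W that by blast
  have fin: "L2_sq P (f j) < \<infinity>" "energy P (cube n) (w j) < \<infinity>" for j
    using f(2)[of j] energy_cong_atoms[OF wae[of j]] by (auto simp: less_top)
  define eu where "eu = (\<lambda>j. L2_sq P (\<lambda>\<mu>. f j \<mu> - u \<mu>))"
  \<comment> \<open>Formed with the measurable versions \<open>w j\<close>, which have the same
    energy as the gradients they replace.\<close>
  define eg where "eg = (\<lambda>j. energy P (cube n) (\<lambda>\<mu> x. w j \<mu> x - g \<mu> x))"
  have eg_eq: "energy P (cube n) (\<lambda>\<mu> x. grad (f j) \<mu> x - g \<mu> x) = eg j" for j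
    unfolding eg_def
  proof (rule energy_cong_atoms)
    show "AE \<mu> in P. \<forall>y\<in>cube n. emeasure \<mu> {y} \<noteq> 0 --> grad (f j) \<mu> y - g \<mu> y = w j \<mu> y - g \<mu> y"
      using wae[of j] by eventually_elim simp
  qed
  have lim': "(\<lambda>j. eu j + eg j) \<longlonglongrightarrow> 0" using lim by (simp only: eg_eq eu_def)
  have dum: "(\<lambda>\<mu>. f j \<mu> - u \<mu>) \<in> borel_measurable (completion P)" for j using fm um by measurable
  have dgm: "case_prod (\<lambda>\<mu> x. w j \<mu> x - g \<mu> x) \<in> borel_measurable (completion P \<Otimes>\<^sub>M borel)" for j
    using borel_measurable_diff[OF wm[of j] gm] by (simp add: split_def)
  have small: "\<forall>\<^sub>F j in sequentially. eu j < \<infinity> \<and> eg j < \<infinity>"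
  proof -
    have "\<forall>\<^sub>F j in sequentially. eu j + eg j < \<infinity>" by (rule order_tendstoD(2)[OF lim']) simp
    thus ?thesis by eventually_elim (auto simp: less_top)
  qed
  have du: "AE \<xi> in Om N. up (\<lambda>\<mu>. f j \<mu> - u \<mu>) N \<xi> = up (f j) N \<xi> - up u N \<xi>" for j N
    using up(2)[OF fm[of j], of N] up(2)[OF um, of N] up(2)[OF dum[of j], of N] by eventually_elim simp
  have dg: "AE \<xi> in Om N. gp (\<lambda>\<mu> x. w j \<mu> x - g \<mu> x) N m \<xi> = gp (w j) N m \<xi> - gp g N m \<xi>" if "m \<in> coords N" for j N m
    using gp(2)[OF wm[of j] that] gp(2)[OF gm that] gp(2)[OF dgm[of j] that] by eventually_elim simp
  have bu: "sqint (Om N) (\<lambda>\<xi>. up (f j) N \<xi> - up u N \<xi>)"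
      "pN N * (nrm2 (Om N) (\<lambda>\<xi>. up (f j) N \<xi> - up u N \<xi>))^2 \<le> enn2real (eu j)" if j: "eu j < \<infinity>" for j N
  proof -
    have m: "(\<lambda>\<xi>. up (f j) N \<xi> - up u N \<xi>) \<in> borel_measurable (Om N)" by (intro borel_measurable_diff up fm um)
    note b = L2_bound[OF dum j[unfolded eu_def]]
    show "sqint (Om N) (\<lambda>\<xi>. up (f j) N \<xi> - up u N \<xi>)" by (rule sqint_AE_cong(1)[OF b(1) m du])
    show "pN N * (nrm2 (Om N) (\<lambda>\<xi>. up (f j) N \<xi> - up u N \<xi>))^2 \<le> enn2real (eu j)"
      using b(2)[of N] by (simp only: sqint_AE_cong(2)[OF b(1) m du] eu_def)
  qed
  have bg: "sqint (Om N) (\<lambda>\<xi>. gp (w j) N m \<xi> - gp g N m \<xi>)"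
      "pN N * (nrm2 (Om N) (\<lambda>\<xi>. gp (w j) N m \<xi> - gp g N m \<xi>))^2 \<le> enn2real (eg j)" if j: "eg j < \<infinity>" and mc: "m \<in> coords N" for j N m
  proof -
    have m: "(\<lambda>\<xi>. gp (w j) N m \<xi> - gp g N m \<xi>) \<in> borel_measurable (Om N)" by (intro borel_measurable_diff gp wm gm mc)
    note b = energy_bound[OF dgm j[unfolded eg_def] mc]
    show "sqint (Om N) (\<lambda>\<xi>. gp (w j) N m \<xi> - gp g N m \<xi>)" by (rule sqint_AE_cong(1)[OF b(1) m dg[OF mc]])
    show "pN N * (nrm2 (Om N) (\<lambda>\<xi>. gp (w j) N m \<xi> - gp g N m \<xi>))^2 \<le> enn2real (eg j)"
      using b(2) by (simp only: sqint_AE_cong(2)[OF b(1) m dg[OF mc]] eg_def)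
  qed
  \<comment> \<open>The approximation errors tend to 0 and so are finite from some index on; the
    sequence is started there.\<close>
  obtain j0 where j0: "\<And>j. j0 \<le> j ==> eu j < \<infinity>" "\<And>j. j0 \<le> j ==> eg j < \<infinity>"
    using small by (auto simp: eventually_sequentially)
  have su: "sqint (Om N) (up u N)" for N
    using sqint_diff[OF L2_bound(1)[OF fm[of j0] fin(1)] bu(1)[OF j0(1)[OF order.refl]], of N] by simp
  have sg: "sqint (Om N) (gp g N m)" if "m \<in> coords N" for N m
    using sqint_diff[OF energy_bound(1)[OF wm[of j0] fin(2) that] bg(1)[OF j0(2)[OF order.refl] that]] by simp
  show "sqint (Om N) (up u N)" by (rule su)
  show "sqint (Om N) (gp g N m)" if "m \<in> coords N" by (rule sg[OF that])
  have eu0: "(\<lambda>j. eu (j + j0)) \<longlonglongrightarrow> 0" and eg0: "(\<lambda>j. eg (j + j0)) \<longlonglongrightarrow> 0"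
    by (rule tendsto_sandwich[OF _ _ tendsto_const LIMSEQ_ignore_initial_segment[OF lim', of j0]]; simp)+
  show "resample_space.ibp (Om N) Xc upc n (up u N) m (gp g N m)" if m: "m \<in> coords N"
  proof -
    interpret R: resample_space "Om N" "coords N" Xc upc n by (rule resample_space_Om)
    show ?thesis
    proof (rule R.ibp_limit[OF m su sg[OF m]])
      fix j
      show "sqint (Om N) (up (f (j + j0)) N)" by (rule L2_bound(1)[OF fm fin(1)])
      show "sqint (Om N) (gp (w (j + j0)) N m)" by (rule energy_bound(1)[OF wm fin(2) m])
      show "R.ibp (up (f (j + j0)) N) m (gp (w (j + j0)) N m)" by (rule ibp[OF m])
    next
      show "(\<lambda>i. nrm2 (Om N) (\<lambda>x. up (f (i + j0)) N x - up u N x)) \<longlonglongrightarrow> 0"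
        by (rule nrm2_tendsto_0[OF eu0, of N]) (use bu(2)[OF j0(1)] in auto)
      show "(\<lambda>i. nrm2 (Om N) (\<lambda>x. gp (w (i + j0)) N m x - gp g N m x)) \<longlonglongrightarrow> 0"
        by (rule nrm2_tendsto_0[OF eg0, of N]) (use bg(2)[OF j0(2) m] in auto)
    qed
  qed
  \<comment> \<open>The triangle inequality followed by (s + t)^2 \<le> 2 s^2 + 2 t^2.\<close>
  have sq: "(nrm2 M a)^2 \<le> 2 * (nrm2 M b)^2 + 2 * (nrm2 M (\<lambda>x. b x - a x))^2" if "sqint M a" "sqint M b" for M a and b :: "'z => real"
  proof -
    have "nrm2 M a \<le> nrm2 M b + nrm2 M (\<lambda>x. b x - a x)"
      using nrm2_diff_le[OF that(2) sqint_diff[OF that(2,1)]] by simp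
    hence "(nrm2 M a)^2 \<le> (nrm2 M b + nrm2 M (\<lambda>x. b x - a x))^2" by (intro power_mono) auto
    also have "\<dots> \<le> 2 * (nrm2 M b)^2 + 2 * (nrm2 M (\<lambda>x. b x - a x))^2"
      using sum_squares_bound[of "nrm2 M b" "nrm2 M (\<lambda>x. b x - a x)"] by (simp add: power2_sum)
    finally show ?thesis .
  qed
  show "L2_sq P u < \<infinity>"
  proof -
    have "ennreal ((u \<mu>)^2) \<le> 2 * ennreal ((f j0 \<mu>)^2) + 2 * ennreal ((f j0 \<mu> - u \<mu>)^2)" for \<mu>
    proof -
      have "(u \<mu>)^2 \<le> 2 * (f j0 \<mu>)^2 + 2 * (f j0 \<mu> - u \<mu>)^2"
        using zero_le_power2[of "2 * f j0 \<mu> - u \<mu>"] by (simp add: power2_eq_square algebra_simps)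
      hence "ennreal ((u \<mu>)^2) \<le> ennreal (2 * (f j0 \<mu>)^2 + 2 * (f j0 \<mu> - u \<mu>)^2)" by (rule ennreal_leI)
      thus ?thesis by (simp add: ennreal_mult)
    qed
    hence "L2_sq P u \<le> (\<integral>\<^sup>+\<mu>. 2 * ennreal ((f j0 \<mu>)^2) + 2 * ennreal ((f j0 \<mu> - u \<mu>)^2) \<partial>completion P)"
      unfolding L2_sq_def by (rule nn_integral_mono)
    also have "\<dots> = 2 * L2_sq P (f j0) + 2 * eu j0"
    proof -
      note [measurable] = fm um
      show ?thesis unfolding L2_sq_def eu_def by (subst nn_integral_add) (auto simp: nn_integral_cmult)
    qed
    also have "\<dots> < \<infinity>" using fin(1)[of j0] j0(1)[OF order.refl] by (simp add: ennreal_mult_less_top less_top)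
    finally show ?thesis .
  qed
  show "energy P (cube n) g < \<infinity>"
  proof -
    have ewg: "energy P (cube n) g = (\<Sum>N. ennreal (pN N * (\<Sum>m\<in>coords N. (nrm2 (Om N) (gp g N m))^2)))"
      by (rule energy_nrm[OF gm sg])
    have ew: "energy P (cube n) (w j0) = (\<Sum>N. ennreal (pN N * (\<Sum>m\<in>coords N. (nrm2 (Om N) (gp (w j0) N m))^2)))"
      by (rule energy_nrm[OF wm energy_bound(1)[OF wm fin(2)]])
    have ed: "energy P (cube n) (\<lambda>\<mu> x. w j0 \<mu> x - g \<mu> x) = (\<Sum>N. ennreal (pN N * (\<Sum>m\<in>coords N. (nrm2 (Om N) (gp (\<lambda>\<mu> x. w j0 \<mu> x - g \<mu> x) N m))^2)))"
      by (rule energy_nrm[OF dgm energy_bound(1)[OF dgm j0(2)[OF order.refl, unfolded eg_def]]])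
    have "energy P (cube n) g \<le> (\<Sum>N. 2 * ennreal (pN N * (\<Sum>m\<in>coords N. (nrm2 (Om N) (gp (w j0) N m))^2)) +
        2 * ennreal (pN N * (\<Sum>m\<in>coords N. (nrm2 (Om N) (gp (\<lambda>\<mu> x. w j0 \<mu> x - g \<mu> x) N m))^2)))"
      unfolding ewg
    proof (intro suminf_le summableI)
      fix N
      have "(nrm2 (Om N) (gp g N m))^2 \<le> 2 * (nrm2 (Om N) (gp (w j0) N m))^2 + 2 * (nrm2 (Om N) (gp (\<lambda>\<mu> x. w j0 \<mu> x - g \<mu> x) N m))^2"
        if m: "m \<in> coords N" for m
      proof -
        have mm: "(\<lambda>\<xi>. gp (w j0) N m \<xi> - gp g N m \<xi>) \<in> borel_measurable (Om N)" by (intro borel_measurable_diff gp wm gm m)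
        have "nrm2 (Om N) (\<lambda>\<xi>. gp (w j0) N m \<xi> - gp g N m \<xi>) = nrm2 (Om N) (gp (\<lambda>\<mu> x. w j0 \<mu> x - g \<mu> x) N m)"
          by (rule sqint_AE_cong(2)[OF energy_bound(1)[OF dgm j0(2)[OF order.refl, unfolded eg_def] m] mm dg[OF m]])
        thus ?thesis using sq[OF sg[OF m] energy_bound(1)[OF wm fin(2) m, of j0]] by simp
      qed
      hence "(\<Sum>m\<in>coords N. (nrm2 (Om N) (gp g N m))^2) \<le> 2 * (\<Sum>m\<in>coords N. (nrm2 (Om N) (gp (w j0) N m))^2) +
          2 * (\<Sum>m\<in>coords N. (nrm2 (Om N) (gp (\<lambda>\<mu> x. w j0 \<mu> x - g \<mu> x) N m))^2)"
        unfolding sum_distrib_left sum.distrib[symmetric] by (rule sum_mono)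
      hence "pN N * (\<Sum>m\<in>coords N. (nrm2 (Om N) (gp g N m))^2) \<le> pN N * (2 * (\<Sum>m\<in>coords N. (nrm2 (Om N) (gp (w j0) N m))^2) +
          2 * (\<Sum>m\<in>coords N. (nrm2 (Om N) (gp (\<lambda>\<mu> x. w j0 \<mu> x - g \<mu> x) N m))^2))"
        using pN_pos[of N] by (intro mult_left_mono) auto
      hence "ennreal (pN N * (\<Sum>m\<in>coords N. (nrm2 (Om N) (gp g N m))^2)) \<le>
          ennreal (2 * (pN N * (\<Sum>m\<in>coords N. (nrm2 (Om N) (gp (w j0) N m))^2)) +
          2 * (pN N * (\<Sum>m\<in>coords N. (nrm2 (Om N) (gp (\<lambda>\<mu> x. w j0 \<mu> x - g \<mu> x) N m))^2)))"
        by (intro ennreal_leI) (simp add: algebra_simps)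
      also have "\<dots> = 2 * ennreal (pN N * (\<Sum>m\<in>coords N. (nrm2 (Om N) (gp (w j0) N m))^2)) +
        2 * ennreal (pN N * (\<Sum>m\<in>coords N. (nrm2 (Om N) (gp (\<lambda>\<mu> x. w j0 \<mu> x - g \<mu> x) N m))^2))"
        using pN_pos[of N] by (subst ennreal_plus) (auto simp: ennreal_mult sum_nonneg less_imp_le)
      finally show "ennreal (pN N * (\<Sum>m\<in>coords N. (nrm2 (Om N) (gp g N m))^2)) \<le> 2 * ennreal (pN N * (\<Sum>m\<in>coords N. (nrm2 (Om N) (gp (w j0) N m))^2)) +
        2 * ennreal (pN N * (\<Sum>m\<in>coords N. (nrm2 (Om N) (gp (\<lambda>\<mu> x. w j0 \<mu> x - g \<mu> x) N m))^2))" .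
    qed
    also have "\<dots> = 2 * energy P (cube n) (w j0) + 2 * eg j0"
      unfolding eg_def ew ed
      by (subst suminf_add[symmetric]) (auto simp: ennreal_suminf_cmult)
    also have "\<dots> < \<infinity>" using fin(2)[of j0] j0(2)[OF order.refl] by (simp add: ennreal_mult_less_top less_top)
    finally show ?thesis .
  qed
qed

end

section \<open>Conditioning on the counts of the cells\<close>

abbreviation cell :: "nat => real^'d => (real^'d) set" where
  "cell k z \<equiv> (+) z ` cube k"

lemma mem_cell: "p \<in> cell k z \<longleftrightarrow> (\<forall>l. p $ l - z $ l \<in> interval3 k)"
proof
  assume "\<forall>l. p $ l - z $ l \<in> interval3 k"
  hence "p - z \<in> cube k" by (simp add: cube_iff)
  thus "p \<in> cell k z" by (intro image_eqI[of _ _ "p - z"]) auto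
qed (auto simp: cube_iff)

lemma cell_borel [measurable]: "cell k z \<in> sets borel"
  using open_translation[OF open_cube, of z k] by (rule borel_open)

lemma mem_interval3_lattice: "s - 3 ^ k * of_int m \<in> interval3 k \<longleftrightarrow> wall k (m - 1) < s \<and> s < wall k m"
  unfolding interval3_def wall_def by (auto simp: distrib_left right_diff_distrib)

lemma lattice_nth: assumes "z \<in> lattice k" obtains m where "z $ l = 3 ^ k * of_int m"
  using assms by (auto simp: lattice_def)

lemma wall_le_iff: "wall j m \<le> wall j m' \<longleftrightarrow> m \<le> m'"
  by (simp add: wall_def)

lemma sim_in_cell:
  assumes z: "z \<in> lattice k" and s: "s - z $ l \<in> interval3 k" and t: "t - z $ l \<in> interval3 k"
  shows "sim (Suc k) s t"
  unfolding sim_Suc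
proof
  fix j
  obtain m where m: "z $ l = 3 ^ k * of_int m" by (rule lattice_nth[OF z])
  have b: "wall k (m - 1) < s" "s < wall k m" "wall k (m - 1) < t" "t < wall k m"
    using s t by (auto simp: m mem_interval3_lattice)
  show "sgn (s - wall k j) = sgn (t - wall k j)"
  proof (cases "j \<le> m - 1")
    case True
    hence "wall k j \<le> wall k (m - 1)" by (simp only: wall_le_iff)
    thus ?thesis using b by simp
  next
    case False
    hence "wall k m \<le> wall k j" by (simp only: wall_le_iff)
    thus ?thesis using b by simp
  qed
qed

lemma sim_cell_iff:
  assumes z: "z \<in> lattice k" and st: "sim (Suc k) s t"
  shows "s - z $ l \<in> interval3 k \<longleftrightarrow> t - z $ l \<in> interval3 k"
proof -
  obtain m where m: "z $ l = 3 ^ k * of_int m" by (rule lattice_nth[OF z])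
  have "sgn (s - wall k j) = sgn (t - wall k j)" for j using st by (simp add: sim_Suc)
  from this[of "m - 1"] this[of m] show ?thesis
    unfolding m mem_interval3_lattice by (auto simp: sgn_if split: if_splits)
qed

lemma center_in_cell: "z $ l - z $ l \<in> interval3 k"
  by (simp add: interval3_def)

lemma cell_sim_center: "z \<in> lattice k ==> p \<in> cell k z ==> sim (Suc k) (p $ l) (z $ l)"
  by (rule sim_in_cell[OF _ _ center_in_cell]) (auto simp: mem_cell)

lemma grid_lattice: "z \<in> grid n k ==> z \<in> lattice k"
  by (simp add: grid_def)

lemma cell_subset_cube:
  assumes z: "z \<in> grid n k" and k: "k \<le> n" shows "cell k z \<subseteq> cube n"
proof
  fix p assume p: "p \<in> cell k z"
  show "p \<in> cube n" unfolding cube_iff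
  proof
    fix l
    have "z $ l \<in> interval3 n" using z by (simp add: grid_def cube_iff)
    thus "p $ l \<in> interval3 n"
      using sim_interval3[OF _ cell_sim_center[OF grid_lattice[OF z] p], of n l] k by simp
  qed
qed

lemma cell_unique:
  assumes z: "z \<in> lattice k" "z' \<in> lattice k" and p: "p \<in> cell k z" "p \<in> cell k z'" shows "z = z'"
proof -
  have "z $ l = z' $ l" for l
  proof -
    obtain m m' where m: "z $ l = 3 ^ k * of_int m" "z' $ l = 3 ^ k * of_int m'"
      using lattice_nth[OF z(1)] lattice_nth[OF z(2)] by metis
    have "wall k (m - 1) < p $ l" "p $ l < wall k m" "wall k (m' - 1) < p $ l" "p $ l < wall k m'"
      using p unfolding mem_cell by (metis m mem_interval3_lattice)+
    hence "wall k (m - 1) < wall k m'" "wall k (m' - 1) < wall k m" by auto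
    hence "m = m'" by (simp add: wall_less_iff)
    thus ?thesis using m by simp
  qed
  thus ?thesis by (simp add: vec_eq_iff)
qed

text \<open>The centres of the one-dimensional cells of the coordinates assemble to the lattice
  point; it lies in the cube because p does and cells do not cross its boundary.\<close>

lemma cell_exists:
  fixes p :: "real^'d::finite"
  assumes p: "p \<in> cube n" "\<And>l. p $ l \<notin> range (wall k)" and k: "k \<le> n"
  obtains z where "z \<in> grid n k" "p \<in> cell k z"
proof
  define z :: "real^'d" where "z = (\<chi> l. ctr k (p $ l))"
  have zl: "z \<in> lattice k" by (auto simp: z_def lattice_def ctr_def)
  show pz: "p \<in> cell k z" unfolding mem_cell
  proof
    fix l
    have "p $ l \<in> {ctr k (p $ l) - 3 ^ k / 2<..<ctr k (p $ l) + 3 ^ k / 2}"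
      using sim_iff_cell[OF p(2), of l "p $ l"] by simp
    thus "p $ l - z $ l \<in> interval3 k" by (simp add: z_def interval3_def)
  qed
  have "z $ l \<in> interval3 n" for l
    using sim_interval3[OF _ cell_sim_center[OF zl pz], of n l] p(1) k by (simp add: cube_iff)
  thus "z \<in> grid n k" using zl by (simp add: grid_def cube_iff)
qed

lemma cube_at_eq:
  assumes "z \<in> lattice k" "p \<in> cell k z" shows "cube_at k p = cell k z"
proof -
  have "{Q. \<exists>z\<in>lattice k. Q = cell k z \<and> p \<in> Q} = {cell k z}"
  proof (intro equalityI subsetI)
    fix Q assume "Q \<in> {Q. \<exists>z\<in>lattice k. Q = cell k z \<and> p \<in> Q}"
    then obtain z' where z': "z' \<in> lattice k" "Q = cell k z'" "p \<in> cell k z'" by blast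
    show "Q \<in> {cell k z}" unfolding z'(2) cell_unique[OF z'(1) assms(1) z'(3) assms(2)] by simp
  next
    fix Q assume "Q \<in> {cell k z}"
    thus "Q \<in> {Q. \<exists>z\<in>lattice k. Q = cell k z \<and> p \<in> Q}" using assms by blast
  qed
  thus ?thesis unfolding cube_at_def by simp
qed

lemma finite_grid: "finite (grid n k :: (real^'d::finite) set)"
proof -
  let ?F = "PiE (UNIV :: 'd set) (\<lambda>_. {- (3 ^ n)..(3 ^ n :: int)})"
  have "grid n k \<subseteq> (\<lambda>f. (\<chi> l. 3 ^ k * of_int (f l)) :: real^'d) ` ?F"
  proof
    fix z :: "real^'d" assume z: "z \<in> grid n k"
    have "\<forall>l. \<exists>m::int. z $ l = 3 ^ k * of_int m" using z by (simp add: grid_def lattice_def)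
    then obtain f where f: "\<And>l. z $ l = 3 ^ k * of_int (f l)" by metis
    have "f l \<in> {- (3 ^ n)..3 ^ n}" for l
    proof -
      have "\<bar>3 ^ k * real_of_int (f l)\<bar> < 3 ^ n / 2"
      proof -
        have "z $ l \<in> interval3 n" using z unfolding grid_def Int_iff cube_iff by blast
        thus ?thesis unfolding f[of l] interval3_def abs_less_iff greaterThanLessThan_iff by linarith
      qed
      moreover have "\<bar>real_of_int (f l)\<bar> \<le> \<bar>3 ^ k * real_of_int (f l)\<bar>"
        using mult_right_mono[of 1 "3 ^ k" "\<bar>real_of_int (f l)\<bar>"] by (simp add: abs_mult)
      moreover have "0 \<le> (3::real) ^ n" by simp
      ultimately have "\<bar>real_of_int (f l)\<bar> \<le> 3 ^ n" by linarith
      hence "real_of_int \<bar>f l\<bar> \<le> real_of_int (3 ^ n)" by simp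
      hence "\<bar>f l\<bar> \<le> 3 ^ n" by (simp only: of_int_le_iff)
      thus ?thesis by (simp add: abs_le_iff)
    qed
    hence "f \<in> ?F" by auto
    thus "z \<in> (\<lambda>f. (\<chi> l. 3 ^ k * of_int (f l)) :: real^'d) ` ?F"
      by (rule rev_image_eqI) (simp add: vec_eq_iff f)
  qed
  thus ?thesis by (rule finite_subset) (intro finite_imageI finite_PiE, auto)
qed

lemma wall_null: "{p :: real^'d::finite. \<exists>l. p $ l \<in> range (wall k)} \<in> null_sets lborel"
proof -
  have e: "{p :: real^'d. \<exists>l. p $ l \<in> range (wall k)} = (\<Union>(l, m)\<in>UNIV. {p. p $ l = wall k m})" by auto
  have "{p :: real^'d. p $ l = a} \<in> null_sets lborel" for l and a :: real
  proof -
    have "negligible {p :: real^'d. p $ l = a}"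
      using negligible_hyperplane[of "axis l 1 :: real^'d" a] by (simp add: inner_axis' axis_eq_0_iff)
    hence "{p :: real^'d. p $ l = a} \<in> null_sets lebesgue" by (simp add: negligible_iff_null_sets)
    moreover have "closed {p :: real^'d. p $ l = a}"
      using closed_Collect_eq[of "\<lambda>p :: real^'d. p $ l" "\<lambda>_. a"] by (simp add: continuous_intros)
    hence "{p :: real^'d. p $ l = a} \<in> sets lborel" by (simp add: borel_closed)
    ultimately show ?thesis by (simp only: null_sets_completion_iff)
  qed
  thus ?thesis unfolding e by (intro null_sets_UN') (auto simp: split_def)
qed

text \<open>The events that do not separate \<mu> from \<nu> contain the generators and are stable
  under the operations of a \<sigma>-algebra.\<close>

lemma count_algebra_determined:
  assumes S: "S \<in> sets (count_algebra \<V>)" and \<mu>: "\<mu> \<in> configs" "\<nu> \<in> configs" "\<And>W. W \<in> \<V> ==> emeasure \<mu> W = emeasure \<nu> W"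
  shows "\<mu> \<in> S \<longleftrightarrow> \<nu> \<in> S"
proof -
  have "S \<in> sigma_sets configs {{\<mu> \<in> configs. emeasure \<mu> V \<in> B} | V B. V \<in> \<V> \<and> B \<in> sets borel}"
    using S unfolding count_algebra_def by (subst (asm) sets_measure_of) auto
  thus ?thesis by (induction) (use \<mu> in auto)
qed

lemma count_algebra_determined_fun:
  fixes c :: "(real^'d) measure => real"
  assumes c: "c \<in> borel_measurable (count_algebra \<V>)" and \<mu>: "\<mu> \<in> configs" "\<nu> \<in> configs" "\<And>W. W \<in> \<V> ==> emeasure \<mu> W = emeasure \<nu> W"
  shows "c \<mu> = c \<nu>"
proof -
  have "c -` {c \<mu>} \<inter> space (count_algebra \<V>) \<in> sets (count_algebra \<V>)" by (rule measurable_sets[OF c]) simp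
  from count_algebra_determined[OF this \<mu>] \<mu> show ?thesis by auto
qed

section \<open>Relabelling of the points and occupancy of the cells\<close>

context poisson_cube
begin

lemma nonwall: "AE \<xi> in Om N. \<forall>i<N. \<forall>l. snd \<xi> i $ l \<notin> range (wall k)"
proof -
  interpret R: resample_space "Om N" "coords N" Xc upc n by (rule resample_space_Om)
  have "AE \<xi> in Om N. \<forall>m\<in>coords N. Xc m \<xi> \<notin> range (wall k)"
  proof (rule AE_finite_allI)
    show "finite (coords N)" by (simp add: coords_def)
    show "AE \<xi> in Om N. Xc m \<xi> \<notin> range (wall k)" if "m \<in> coords N" for m
      using R.AE_X_generic[OF that, of k] by eventually_elim simp
  qed
  thus ?thesis by eventually_elim (auto simp: coords_def Xc_def)
qed

lemma AE_grid_cell: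
  assumes "k \<le> n" shows "AE \<xi> in Om N. \<exists>w\<in>{..<N} \<rightarrow>\<^sub>E grid n k. \<forall>i<N. snd \<xi> i \<in> cell k (w i)"
  using nonwall[of N k] AE_in_Q[of N]
proof eventually_elim
  case (elim \<xi>)
  have "\<exists>z\<in>grid n k. snd \<xi> i \<in> cell k z" if "i < N" for i
    by (rule cell_exists[OF _ _ assms, of "snd \<xi> i"]) (use elim that in auto)
  then obtain w where w: "\<And>i. i < N ==> w i \<in> grid n k" "\<And>i. i < N ==> snd \<xi> i \<in> cell k (w i)" by metis
  show ?case by (rule bexI[of _ "restrict w {..<N}"]) (use w in auto)
qed

definition Sg :: "nat => (nat => nat) => (real^'d) measure \<times> (nat => real^'d) => (real^'d) measure \<times> (nat => real^'d)" where
  "Sg N \<sigma> \<xi> = (fst \<xi>, \<lambda>i\<in>{..<N}. snd \<xi> (\<sigma> i))"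

lemma Sg_measurable [measurable]:
  assumes \<sigma>: "\<sigma> permutes {..<N}" shows "Sg N \<sigma> \<in> Om N \<rightarrow>\<^sub>M Om N"
proof -
  have "(\<lambda>\<xi>. (fst \<xi>, \<lambda>i\<in>{..<N}. snd \<xi> (\<sigma> i))) \<in> Om N \<rightarrow>\<^sub>M PE \<Otimes>\<^sub>M (\<Pi>\<^sub>M i\<in>{..<N}. UQ)"
  proof (rule measurable_Pair)
    show "fst \<in> Om N \<rightarrow>\<^sub>M PE" unfolding Om_def by (rule measurable_fst)
    show "(\<lambda>\<xi>. \<lambda>i\<in>{..<N}. snd \<xi> (\<sigma> i)) \<in> Om N \<rightarrow>\<^sub>M (\<Pi>\<^sub>M i\<in>{..<N}. UQ)"
    proof (rule measurable_restrict)
      fix i assume "i \<in> {..<N}"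
      hence "\<sigma> i < N" using permutes_in_image[OF \<sigma>, of i] by simp
      from point_measurable[OF this] show "(\<lambda>\<xi>. snd \<xi> (\<sigma> i)) \<in> Om N \<rightarrow>\<^sub>M UQ" by (simp cong: measurable_cong_sets)
    qed
  qed
  thus ?thesis by (simp add: Om_def Sg_def[abs_def])
qed

text \<open>The labelled points are independent with a common law, hence exchangeable, and the
  exterior is left fixed.\<close>

lemma nn_integral_Sg:
  assumes \<sigma>: "\<sigma> permutes {..<N}" and h [measurable]: "h \<in> borel_measurable (Om N)"
  shows "(\<integral>\<^sup>+\<xi>. h (Sg N \<sigma> \<xi>) \<partial>Om N) = (\<integral>\<^sup>+\<xi>. h \<xi> \<partial>Om N)"
proof -
  let ?Pi = "\<Pi>\<^sub>M i\<in>{..<N}. UQ" and ?r = "\<lambda>x. \<lambda>i\<in>{..<N}. x (\<sigma> i)"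
  interpret B: prob_space ?Pi by (rule prob_PiUQ)
  have h': "h \<in> borel_measurable (PE \<Otimes>\<^sub>M ?Pi)" using h by (simp add: Om_def)
  have hs: "(\<lambda>\<xi>. h (Sg N \<sigma> \<xi>)) \<in> borel_measurable (PE \<Otimes>\<^sub>M ?Pi)"
    using measurable_compose[OF Sg_measurable[OF \<sigma>] h] by (simp add: Om_def)
  have d: "distr ?Pi ?Pi ?r = ?Pi"
    using distr_PiM_reindex[of "{..<N}" "\<lambda>_. UQ" \<sigma> "{..<N}"] prob_UQ permutes_inj_on[OF \<sigma>] permutes_in_image[OF \<sigma>] by auto
  have r: "?r \<in> ?Pi \<rightarrow>\<^sub>M ?Pi"
    by (rule measurable_restrict) (use permutes_in_image[OF \<sigma>] in \<open>auto intro!: measurable_component_singleton\<close>)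
  have "(\<integral>\<^sup>+\<xi>. h (Sg N \<sigma> \<xi>) \<partial>Om N) = (\<integral>\<^sup>+\<eta>. \<integral>\<^sup>+x. h (Sg N \<sigma> (\<eta>, x)) \<partial>?Pi \<partial>PE)"
    unfolding Om_def by (rule B.nn_integral_fst[OF hs, symmetric])
  also have "\<dots> = (\<integral>\<^sup>+\<eta>. \<integral>\<^sup>+x. h (\<eta>, x) \<partial>?Pi \<partial>PE)"
  proof (rule nn_integral_cong)
    fix \<eta> assume "\<eta> \<in> space PE"
    hence "(\<lambda>x. h (\<eta>, x)) \<in> borel_measurable ?Pi" using measurable_compose[OF measurable_Pair1' h'] by blast
    hence "(\<integral>\<^sup>+x. h (\<eta>, x) \<partial>distr ?Pi ?Pi ?r) = (\<integral>\<^sup>+x. h (\<eta>, ?r x) \<partial>?Pi)" by (intro nn_integral_distr r) simp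
    thus "(\<integral>\<^sup>+x. h (Sg N \<sigma> (\<eta>, x)) \<partial>?Pi) = (\<integral>\<^sup>+x. h (\<eta>, x) \<partial>?Pi)" unfolding d Sg_def by simp
  qed
  also have "\<dots> = (\<integral>\<^sup>+\<xi>. h \<xi> \<partial>Om N)" unfolding Om_def by (rule B.nn_integral_fst[OF h'])
  finally show ?thesis .
qed

lemma distr_Sg:
  assumes \<sigma>: "\<sigma> permutes {..<N}" shows "distr (Om N) (Om N) (Sg N \<sigma>) = Om N"
proof (rule measure_eqI)
  fix A assume "A \<in> sets (distr (Om N) (Om N) (Sg N \<sigma>))"
  hence A [measurable]: "A \<in> sets (Om N)" by simp
  have "emeasure (distr (Om N) (Om N) (Sg N \<sigma>)) A = (\<integral>\<^sup>+\<xi>. indicator A \<xi> \<partial>distr (Om N) (Om N) (Sg N \<sigma>))" by simp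
  also have "\<dots> = (\<integral>\<^sup>+\<xi>. indicator A (Sg N \<sigma> \<xi>) \<partial>Om N)"
    by (rule nn_integral_distr[OF Sg_measurable[OF \<sigma>]]) simp
  also have "\<dots> = emeasure (Om N) A" by (subst nn_integral_Sg[OF \<sigma>]) auto
  finally show "emeasure (distr (Om N) (Om N) (Sg N \<sigma>)) A = emeasure (Om N) A" .
qed simp

lemma integral_Sg:
  fixes f :: "_ => real"
  assumes \<sigma>: "\<sigma> permutes {..<N}" and f: "f \<in> borel_measurable (Om N)"
  shows "(\<integral>\<xi>. f (Sg N \<sigma> \<xi>) \<partial>Om N) = (\<integral>\<xi>. f \<xi> \<partial>Om N)"
  using integral_distr[OF Sg_measurable[OF \<sigma>] f] unfolding distr_Sg[OF \<sigma>] by simp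

lemma AE_Sg:
  assumes \<sigma>: "\<sigma> permutes {..<N}" and ae: "AE \<xi> in Om N. R \<xi>" shows "AE \<xi> in Om N. R (Sg N \<sigma> \<xi>)"
proof -
  have "AE \<xi> in distr (Om N) (Om N) (Sg N \<sigma>). R \<xi>" unfolding distr_Sg[OF \<sigma>] by (rule ae)
  from AE_distrD[OF Sg_measurable[OF \<sigma>] this] show ?thesis .
qed

lemma T_Sg:
  assumes \<sigma>: "\<sigma> permutes {..<N}" and \<xi>: "\<xi> \<in> space (Om N)" shows "T N (Sg N \<sigma> \<xi>) = T N \<xi>"
proof -
  obtain \<eta> x where e: "\<xi> = (\<eta>, x)" "\<eta> \<in> configs" using \<xi> by (auto simp: space_Om)
  have "conf (cube n) N (\<lambda>i\<in>{..<N}. x (\<sigma> i)) \<eta> = conf (cube n) N x \<eta>"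
  proof (rule measure_eqI)
    fix A assume "A \<in> sets (conf (cube n) N (\<lambda>i\<in>{..<N}. x (\<sigma> i)) \<eta>)"
    hence A: "A \<in> sets borel" by simp
    have "\<sigma> ` {i. i < N \<and> x (\<sigma> i) \<in> A} = {i. i < N \<and> x i \<in> A}"
    proof (intro equalityI subsetI)
      fix i assume i: "i \<in> {i. i < N \<and> x i \<in> A}"
      hence "i \<in> \<sigma> ` {..<N}" using permutes_image[OF \<sigma>] by simp
      thus "i \<in> \<sigma> ` {i. i < N \<and> x (\<sigma> i) \<in> A}" using i by auto
    qed (use permutes_in_image[OF \<sigma>] in auto)
    hence "card {i. i < N \<and> x (\<sigma> i) \<in> A} = card {i. i < N \<and> x i \<in> A}"
      using card_image[OF inj_on_subset[OF permutes_inj[OF \<sigma>]], of "{i. i < N \<and> x (\<sigma> i) \<in> A}"] by simp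
    moreover have "{i. i < N \<and> (\<lambda>i\<in>{..<N}. x (\<sigma> i)) i \<in> A} = {i. i < N \<and> x (\<sigma> i) \<in> A}" by auto
    ultimately show "emeasure (conf (cube n) N (\<lambda>i\<in>{..<N}. x (\<sigma> i)) \<eta>) A = emeasure (conf (cube n) N x \<eta>) A"
      by (simp only: emeasure_conf[OF e(2) cube_borel A])
  qed simp
  thus ?thesis by (simp add: T_def Sg_def e)
qed

text \<open>Invariance concerns one coordinate at a time, so x is carried to y coordinate by
  coordinate; J holds those still to be treated.\<close>

lemma A_move:
  assumes S: "S \<in> sets (resample_space.A (Om N) (coords N) Xc upc (\<lambda>_. k))" and \<eta>: "\<eta> \<in> configs"
    and xy: "x \<in> {..<N} \<rightarrow>\<^sub>E UNIV" "y \<in> {..<N} \<rightarrow>\<^sub>E UNIV" "\<And>i l. i < N ==> sim k (x i $ l) (y i $ l)"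
  shows "(\<eta>, x) \<in> S \<longleftrightarrow> (\<eta>, y) \<in> S"
proof -
  interpret R: resample_space "Om N" "coords N" Xc upc n by (rule resample_space_Om)
  have S': "S \<in> R.invar (\<lambda>_. k)" using S by (simp add: R.sets_A)
  have "(\<eta>, x) \<in> S \<longleftrightarrow> (\<eta>, y) \<in> S"
    if "finite J" "J \<subseteq> coords N" "x \<in> {..<N} \<rightarrow>\<^sub>E UNIV" "\<And>i l. i < N ==> sim k (x i $ l) (y i $ l)"
      "\<And>i l. i < N ==> (i, l) \<notin> J ==> x i $ l = y i $ l" for J x
    using that
  proof (induction J arbitrary: x rule: finite_induct)
    case empty
    have "x = y" by (rule PiE_ext[OF empty(2) xy(2)]) (use empty(4) in \<open>auto simp: vec_eq_iff\<close>)
    thus ?case by simp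
  next
    case (insert m J)
    obtain i l where m: "m = (i, l)" "i < N" using insert.prems(1) by (auto simp: coords_def)
    define x' where "x' = x(i := shift l (x i) (y i $ l))"
    have x'nth: "x' j $ l' = (if (j, l') = m then y j $ l' else x j $ l')" for j l'
      by (auto simp: x'_def shift_nth m)
    have "(\<eta>, x) \<in> S \<longleftrightarrow> upc m (\<eta>, x) (y i $ l) \<in> S"
    proof -
      have "(\<eta>, x) \<in> space (Om N)" using insert.prems(2) \<eta> by (simp add: space_Om)
      moreover have "m \<in> coords N" using insert.prems(1) by blast
      moreover have "sim k (Xc m (\<eta>, x)) (y i $ l)" using insert.prems(3) m by (simp add: Xc_def)
      ultimately show ?thesis using S' unfolding R.invar_def by blast
    qed
    also have "upc m (\<eta>, x) (y i $ l) = (\<eta>, x')" by (simp add: upc_def x'_def m)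
    also have "(\<eta>, x') \<in> S \<longleftrightarrow> (\<eta>, y) \<in> S"
    proof (rule insert.IH)
      show "J \<subseteq> coords N" using insert.prems(1) by blast
      show "x' \<in> {..<N} \<rightarrow>\<^sub>E UNIV" using insert.prems(2) m(2) by (auto simp: x'_def PiE_iff extensional_def)
      show "sim k (x' j $ l') (y j $ l')" if "j < N" for j l' using insert.prems(3)[OF that] by (simp add: x'nth)
      show "x' j $ l' = y j $ l'" if "j < N" "(j, l') \<notin> J" for j l' using insert.prems(4)[OF that(1)] that(2) by (simp add: x'nth)
    qed
    finally show ?case .
  qed
  from this[of "coords N" x] xy show ?thesis by (auto simp: coords_def)
qed

lemma integrable_T:
  fixes Y :: "(real^'d) measure => real"
  assumes Y: "integrable P Y"
  shows "integrable (Om N) (\<lambda>\<xi>. Y (T N \<xi>))" "(\<integral>\<mu>. indicator (QN N) \<mu> * Y \<mu> \<partial>P) = pN N * (\<integral>\<xi>. Y (T N \<xi>) \<partial>Om N)"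
proof -
  have Ym [measurable]: "Y \<in> borel_measurable P" using Y by (rule borel_measurable_integrable)
  have m [measurable]: "(\<lambda>\<xi>. Y (T N \<xi>)) \<in> borel_measurable (Om N)" by (rule measurable_compose[OF T_measurable Ym])
  have e: "ennreal (indicator (QN N) \<mu> * f) = indicator (QN N) \<mu> * ennreal f" for \<mu> f by (simp split: split_indicator)
  have nn: "(\<integral>\<^sup>+\<mu>. ennreal (indicator (QN N) \<mu> * f (Y \<mu>)) \<partial>P) = ennreal (pN N) * (\<integral>\<^sup>+\<xi>. ennreal (f (Y (T N \<xi>))) \<partial>Om N)"
    if f [measurable]: "f \<in> borel_measurable borel" for f :: "real => real"
  proof -
    have "(\<lambda>\<mu>. ennreal (f (Y \<mu>))) \<in> borel_measurable P" by measurable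
    from nn_integral_QN[OF this] show ?thesis by (simp only: e)
  qed
  have iQ: "integrable P (\<lambda>\<mu>. indicator (QN N) \<mu> * Y \<mu>)" using integrable_mult_indicator[OF QN_sets Y, of N] by simp
  show iT: "integrable (Om N) (\<lambda>\<xi>. Y (T N \<xi>))"
  proof (rule integrableI_bounded)
    have "ennreal (pN N) * (\<integral>\<^sup>+\<xi>. ennreal \<bar>Y (T N \<xi>)\<bar> \<partial>Om N) = (\<integral>\<^sup>+\<mu>. ennreal (indicator (QN N) \<mu> * \<bar>Y \<mu>\<bar>) \<partial>P)"
      using nn[of abs] by simp
    also have "\<dots> \<le> (\<integral>\<^sup>+\<mu>. ennreal \<bar>Y \<mu>\<bar> \<partial>P)" by (intro nn_integral_mono) (simp split: split_indicator)
    also have "\<dots> < \<infinity>" using Y by (simp add: integrable_iff_bounded)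
    finally have "ennreal (pN N) * (\<integral>\<^sup>+\<xi>. ennreal \<bar>Y (T N \<xi>)\<bar> \<partial>Om N) < \<infinity>" .
    thus "(\<integral>\<^sup>+\<xi>. ennreal (norm (Y (T N \<xi>))) \<partial>Om N) < \<infinity>"
      using pN_pos[of N] by (auto simp: ennreal_mult_less_top ennreal_eq_0_iff)
  qed measurable
  have "(\<integral>\<mu>. indicator (QN N) \<mu> * Y \<mu> \<partial>P) = enn2real (\<integral>\<^sup>+\<mu>. ennreal (indicator (QN N) \<mu> * Y \<mu>) \<partial>P) - enn2real (\<integral>\<^sup>+\<mu>. ennreal (indicator (QN N) \<mu> * - Y \<mu>) \<partial>P)"
    using real_lebesgue_integral_def[OF iQ] by simp
  also have "\<dots> = pN N * (enn2real (\<integral>\<^sup>+\<xi>. ennreal (Y (T N \<xi>)) \<partial>Om N) - enn2real (\<integral>\<^sup>+\<xi>. ennreal (- Y (T N \<xi>)) \<partial>Om N))"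
    using nn[of "\<lambda>y. y"] nn[of uminus] pN_pos[of N] by (simp add: enn2real_mult right_diff_distrib)
  also have "\<dots> = pN N * (\<integral>\<xi>. Y (T N \<xi>) \<partial>Om N)"
    using real_lebesgue_integral_def[OF iT] by simp
  finally show "(\<integral>\<mu>. indicator (QN N) \<mu> * Y \<mu> \<partial>P) = pN N * (\<integral>\<xi>. Y (T N \<xi>) \<partial>Om N)" .
qed

lemma Ext_subset_scale: "subalgebra (scale_alg n k) Ext"
  unfolding scale_alg_def Ext_def by (rule count_algebra_mono) auto

lemma scale_subset_P: "subalgebra P (scale_alg n k)"
proof -
  have "subalgebra (count_algebra (sets borel)) (scale_alg n k)"
    unfolding scale_alg_def by (rule count_algebra_mono) auto
  thus ?thesis by (simp add: subalgebra_def sets_P)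
qed

lemma space_scale_alg [simp]: "space (scale_alg n k) = configs"
  by (simp add: scale_alg_def)

definition occ :: "nat => (nat => real^'d) => real^'d => nat" where
  "occ N w z = card {i. i < N \<and> w i = z}"

lemma occ_outside:
  assumes "w \<in> {..<N} \<rightarrow>\<^sub>E G" "z \<notin> G" shows "occ N w z = 0"
proof -
  have "{i. i < N \<and> w i = z} = {}" using assms by auto
  thus ?thesis unfolding occ_def by (simp only: card.empty)
qed

definition occ_event :: "nat => (real^'d => nat) => (real^'d) measure set" where
  "occ_event k m = {\<mu> \<in> configs. \<forall>z\<in>grid n k. emeasure \<mu> (cell k z) = of_nat (m z)}"

lemma occ_event_sets: "occ_event k m \<in> sets (scale_alg n k)"
proof -
  have "{\<mu> \<in> space (scale_alg n k). \<forall>z\<in>grid n k. emeasure \<mu> (cell k z) = of_nat (m z)} \<in> sets (scale_alg n k)"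
  proof (rule sets.sets_Collect_finite_All)
    fix z :: "real^'d" assume z: "z \<in> grid n k"
    have [measurable]: "(\<lambda>\<mu>. emeasure \<mu> (cell k z)) \<in> borel_measurable (scale_alg n k)"
      unfolding scale_alg_def by (rule measurable_count) (use z in auto)
    show "{\<mu> \<in> space (scale_alg n k). emeasure \<mu> (cell k z) = of_nat (m z)} \<in> sets (scale_alg n k)" by measurable
  qed (rule finite_grid)
  thus ?thesis by (simp add: occ_event_def)
qed

text \<open>Almost surely no point sits on a wall, so the counts of the cells of the grid add up to
  the count of the cube.\<close>

lemma occ_event_QN:
  assumes k: "k \<le> n" and w: "w \<in> {..<N} \<rightarrow>\<^sub>E grid n k"
  shows "AE \<mu> in P. \<mu> \<in> occ_event k (occ N w) --> \<mu> \<in> QN N"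
  using AE_count_null[OF wall_null[of k]]
proof eventually_elim
  case (elim \<mu>)
  show ?case
  proof
    assume "\<mu> \<in> occ_event k (occ N w)"
    hence \<mu>: "\<mu> \<in> configs" and c: "\<And>z. z \<in> grid n k ==> emeasure \<mu> (cell k z) = of_nat (occ N w z)"
      by (auto simp: occ_event_def)
    have s: "sets \<mu> = sets borel" by (rule sets_configs[OF \<mu>])
    let ?U = "\<Union>z\<in>grid n k. cell k z :: (real^'d) set" and ?W = "{p :: real^'d. \<exists>l. p $ l \<in> range (wall k)}"
    have W: "?W \<in> sets borel" using wall_null[of k] by auto
    have U: "?U \<in> sets borel" by (intro sets.finite_UN finite_grid cell_borel)
    have UQ: "?U \<subseteq> cube n" using cell_subset_cube[OF _ k] by blast
    have "cube n \<subseteq> ?U \<union> ?W"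
    proof
      fix p :: "real^'d" assume p: "p \<in> cube n"
      show "p \<in> ?U \<union> ?W"
      proof (cases "p \<in> ?W")
        case False
        obtain z where "z \<in> grid n k" "p \<in> cell k z" by (rule cell_exists[OF p _ k]) (use False in auto)
        thus ?thesis by blast
      qed simp
    qed
    hence "emeasure \<mu> (cube n) \<le> emeasure \<mu> (?U \<union> ?W)" by (rule emeasure_mono) (use U W s in auto)
    also have "\<dots> \<le> emeasure \<mu> ?U + emeasure \<mu> ?W" by (rule emeasure_subadditive) (use U W s in auto)
    finally have "emeasure \<mu> (cube n) \<le> emeasure \<mu> ?U" using elim by simp
    moreover have "emeasure \<mu> ?U \<le> emeasure \<mu> (cube n)" by (rule emeasure_mono[OF UQ]) (simp add: s)
    ultimately have "emeasure \<mu> (cube n) = emeasure \<mu> ?U" by simp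
    also have "\<dots> = (\<Sum>z\<in>grid n k. emeasure \<mu> (cell k z))"
    proof (rule sum_emeasure[symmetric])
      show "(\<lambda>z. cell k z) ` grid n k \<subseteq> sets \<mu>" unfolding s by (rule image_subsetI) (rule cell_borel)
      show "disjoint_family_on (\<lambda>z. cell k z :: (real^'d) set) (grid n k)"
        unfolding disjoint_family_on_def
      proof (intro ballI impI equals0I)
        fix z z' p :: "real^'d" assume "z \<in> grid n k" "z' \<in> grid n k" "z \<noteq> z'" "p \<in> cell k z \<inter> cell k z'"
        thus False using cell_unique[OF grid_lattice grid_lattice] by (metis IntE)
      qed
    qed (rule finite_grid)
    also have "\<dots> = of_nat (\<Sum>z\<in>grid n k. occ N w z)" using c by simp
    also have "(\<Sum>z\<in>grid n k. occ N w z) = card (\<Union>z\<in>grid n k. {i. i < N \<and> w i = z})"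
      unfolding occ_def by (rule card_UN_disjoint[symmetric]) (auto simp: finite_grid)
    also have "(\<Union>z\<in>grid n k. {i. i < N \<and> w i = z}) = {..<N}" using w by auto
    finally show "\<mu> \<in> QN N" using \<mu> by (simp add: QN_def)
  qed
qed

lemma T_occ:
  assumes k: "k \<le> n" and \<xi>: "\<xi> \<in> space (Om N)" and w: "w \<in> {..<N} \<rightarrow>\<^sub>E grid n k" "\<And>i. i < N ==> snd \<xi> i \<in> cell k (w i)"
    and z: "z \<in> grid n k"
  shows "emeasure (T N \<xi>) (cell k z) = of_nat (occ N w z)"
proof -
  obtain \<eta> x where e: "\<xi> = (\<eta>, x)" "\<eta> \<in> configs" using \<xi> by (auto simp: space_Om)
  have "cell k z - cube n = {}" using cell_subset_cube[OF z k] by blast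
  hence "emeasure \<eta> (cell k z - cube n) = 0" by (simp only: emeasure_empty)
  moreover have "{i. i < N \<and> x i \<in> cell k z} = {i. i < N \<and> w i = z}"
  proof (intro equalityI subsetI)
    fix i assume i: "i \<in> {i. i < N \<and> x i \<in> cell k z}"
    hence "x i \<in> cell k (w i)" "w i \<in> grid n k" using w e by auto
    hence "w i = z" using cell_unique[OF grid_lattice grid_lattice[OF z]] i by blast
    thus "i \<in> {i. i < N \<and> w i = z}" using i by simp
  qed (use w e in auto)
  ultimately show ?thesis
    using emeasure_conf[OF e(2) cube_borel[of n] cell_borel[where z = z and k = k], where N = N and x = x] by (simp add: T_def e occ_def)
qed

text \<open>An event that is invariant inside the cells becomes a function of the configuration,
  measurable at scale \<open>k\<close>, once it is symmetrised over all labellings of the points.\<close>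

lemma orth_lift:
  assumes k: "k \<le> n" and Y: "integrable P Y" and orth: "\<And>D. D \<in> sets (scale_alg n k) ==> (\<integral>\<mu>. indicator D \<mu> * Y \<mu> \<partial>P) = 0"
    and S: "S \<in> sets (resample_space.A (Om N) (coords N) Xc upc (\<lambda>_. Suc k))"
  shows "(\<integral>\<xi>. indicator S \<xi> * Y (T N \<xi>) \<partial>Om N) = (0::real)"
proof -
  interpret R: resample_space "Om N" "coords N" Xc upc n by (rule resample_space_Om)
  define perms where "perms = {\<sigma>. \<sigma> permutes {..<N}}"
  have finp: "finite perms" unfolding perms_def by (rule finite_permutations) simp
  have Sm [measurable]: "S \<in> sets (Om N)" using S R.subalg_A unfolding subalgebra_def by blast
  have Ym [measurable]: "(\<lambda>\<xi>. Y (T N \<xi>)) \<in> borel_measurable (Om N)"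
    using integrable_T(1)[OF Y] by (rule borel_measurable_integrable)
  let ?F = "scale_alg n k"
  have FP: "D \<in> sets P" if "D \<in> sets ?F" for D using that scale_subset_P[of k] unfolding subalgebra_def by blast
  define B where "B = (\<lambda>m. T N -` occ_event k m \<inter> space (Om N))"
  have Bm [measurable]: "B m \<in> sets (Om N)" for m
    unfolding B_def by (rule measurable_sets[OF T_measurable FP[OF occ_event_sets]])
  define C where "C = occ N ` ({..<N} \<rightarrow>\<^sub>E (grid n k :: (real^'d) set))"
  have finC: "finite C" unfolding C_def by (intro finite_imageI finite_PiE finite_grid) auto
  have one: "(\<integral>\<xi>. indicator (B m) \<xi> * (indicator S \<xi> * Y (T N \<xi>)) \<partial>Om N) = 0" if m: "m \<in> C" for m
  proof -
    obtain w where w: "w \<in> {..<N} \<rightarrow>\<^sub>E grid n k" "m = occ N w" using m by (auto simp: C_def)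
    \<comment> \<open>The cell centres \<open>w\<close> stand for the points: membership in the
      invariant S depends only on the exterior and on the cell of each label. With the counts
      prescribed, this gives an event measurable at scale k.\<close>
    define D where "D = (\<lambda>\<sigma>. occ_event k m \<inter> {\<eta> \<in> configs. (\<eta>, \<lambda>i\<in>{..<N}. w (\<sigma> i)) \<in> S})"
    have ext: "{\<eta> \<in> configs. (\<eta>, y) \<in> S} \<in> sets Ext" for y
    proof -
      have "S \<in> sets (Ext \<Otimes>\<^sub>M (\<Pi>\<^sub>M i\<in>{..<N}. borel))" using Sm by (simp only: sets_Om)
      from sets_Pair2[OF this, of y] have "(\<lambda>\<eta>. (\<eta>, y)) -` S \<in> sets Ext" .
      moreover have "(\<lambda>\<eta>. (\<eta>, y)) -` S = {\<eta> \<in> configs. (\<eta>, y) \<in> S}"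
        using sets.sets_into_space[OF Sm] by (auto simp: space_Om)
      ultimately show ?thesis by simp
    qed
    have Dm: "D \<sigma> \<in> sets ?F" for \<sigma>
      unfolding D_def using ext Ext_subset_scale[of k] unfolding subalgebra_def by (intro sets.Int occ_event_sets) blast
    have z: "(\<integral>\<xi>. indicator (D \<sigma>) (T N \<xi>) * Y (T N \<xi>) \<partial>Om N) = 0" for \<sigma>
    proof -
      have iD: "integrable P (\<lambda>\<mu>. indicator (D \<sigma>) \<mu> * Y \<mu>)"
        using integrable_mult_indicator[OF FP[OF Dm] Y] by simp
      have Yp: "Y \<in> borel_measurable P" using Y by (rule borel_measurable_integrable)
      have Dp: "D \<sigma> \<in> sets P" by (rule FP[OF Dm])
      have "0 = (\<integral>\<mu>. indicator (D \<sigma>) \<mu> * Y \<mu> \<partial>P)" using orth[OF Dm] by simp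
      also have "\<dots> = (\<integral>\<mu>. indicator (QN N) \<mu> * (indicator (D \<sigma>) \<mu> * Y \<mu>) \<partial>P)"
      proof (rule integral_cong_AE)
        show "AE \<mu> in P. indicator (D \<sigma>) \<mu> * Y \<mu> = indicator (QN N) \<mu> * (indicator (D \<sigma>) \<mu> * Y \<mu>)"
          using occ_event_QN[OF k w(1)] by eventually_elim (auto simp: D_def w(2) split: split_indicator)
      qed (use Yp Dp in measurable)
      also have "\<dots> = pN N * (\<integral>\<xi>. indicator (D \<sigma>) (T N \<xi>) * Y (T N \<xi>) \<partial>Om N)" by (rule integrable_T(2)[OF iD])
      finally show ?thesis using pN_pos[of N] by simp
    qed
    \<comment> \<open>The sum over all relabellings no longer depends on which label sits in which
      cell.\<close>
    have ae: "AE \<xi> in Om N. (\<Sum>\<sigma>\<in>perms. indicator (D \<sigma>) (T N \<xi>)) = (\<Sum>\<sigma>\<in>perms. indicator (B m) \<xi> * indicator S (Sg N \<sigma> \<xi>) :: real)"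
      using AE_grid_cell[OF k, of N] AE_in_Q[of N] AE_space[of "Om N"]
    proof eventually_elim
      case (elim \<xi>)
      obtain \<eta> x where e: "\<xi> = (\<eta>, x)" "\<eta> \<in> configs" "x \<in> {..<N} \<rightarrow>\<^sub>E UNIV" using elim(3) by (auto simp: space_Om)
      have Tc: "T N \<xi> \<in> configs" by (rule T_configs[OF elim(3)])
      obtain v where v: "v \<in> {..<N} \<rightarrow>\<^sub>E grid n k" "\<And>i. i < N ==> x i \<in> cell k (v i)" using elim(1) e by auto
      \<comment> \<open>The section of S is an exterior event, and the assembled configuration has
        the same counts outside the cube as \<eta>.\<close>
      have sec: "T N \<xi> \<in> {\<eta> \<in> configs. (\<eta>, y) \<in> S} \<longleftrightarrow> (\<eta>, y) \<in> S" for y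
      proof -
        have "T N \<xi> \<in> {\<eta> \<in> configs. (\<eta>, y) \<in> S} \<longleftrightarrow> \<eta> \<in> {\<eta> \<in> configs. (\<eta>, y) \<in> S}"
        proof (rule count_algebra_determined[OF ext[unfolded Ext_def] Tc e(2)])
          fix V :: "(real^'d) set" assume V: "V \<in> {V \<in> sets borel. V \<subseteq> - cube n}"
          hence "{i. i < N \<and> x i \<in> V} = {}" "V - cube n = V" using elim(2) e by auto
          thus "emeasure (T N \<xi>) V = emeasure \<eta> V"
            using emeasure_conf[OF e(2) cube_borel[of n], of V N x] V by (simp add: T_def e)
        qed
        thus ?thesis using e(2) by simp
      qed
      show ?case
      proof (cases "\<xi> \<in> B m")
        case False
        hence "T N \<xi> \<notin> occ_event k m" using elim(3) by (simp add: B_def)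
        thus ?thesis using False by (simp add: D_def)
      next
        case True
        hence To: "T N \<xi> \<in> occ_event k m" by (simp add: B_def)
        have "occ N v z = occ N w z" if z: "z \<in> grid n k" for z
        proof -
          have "emeasure (T N \<xi>) (cell k z) = of_nat (occ N v z)" by (rule T_occ[OF k elim(3) v(1) _ z]) (use v(2) e in auto)
          moreover have "emeasure (T N \<xi>) (cell k z) = of_nat (occ N w z)" using To z by (simp add: occ_event_def w(2))
          ultimately have "(of_nat (occ N v z) :: ennreal) = of_nat (occ N w z)" by simp
          thus ?thesis by (simp only: of_nat_eq_iff)
        qed
        moreover have "occ N v z = occ N w z" if z: "z \<notin> grid n k" for z
          using occ_outside[OF v(1) z] occ_outside[OF w(1) z] by simp
        ultimately have oe: "occ N v z = occ N w z" for z by blast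
        \<comment> \<open>Equal occupancies mean equal multisets of cells, so the true assignment v
          of cells to labels is w after a permutation \<tau>.\<close>
        have "image_mset v (mset_set {..<N}) = image_mset w (mset_set {..<N})"
        proof (rule multiset_eqI)
          fix z
          have *: "count (image_mset f (mset_set {..<N})) z = occ N f z" for f :: "nat => real^'d"
          proof -
            have "{a \<in> {..<N}. f a = z} = {i. i < N \<and> f i = z}" by auto
            thus ?thesis by (simp add: count_image_mset' occ_def Collect_conj_eq lessThan_def eq_commute[of z])
          qed
          show "count (image_mset v (mset_set {..<N})) z = count (image_mset w (mset_set {..<N})) z"
            unfolding * by (rule oe)
        qed
        then obtain \<tau> where \<tau>: "\<tau> permutes {..<N}" "\<forall>i\<in>{..<N}. v i = w (\<tau> i)"
          by (rule image_mset_eq_implies_permutes[rotated]) auto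
        have "(\<Sum>\<sigma>\<in>perms. indicator (D \<sigma>) (T N \<xi>)) = (\<Sum>\<sigma>\<in>perms. indicator S (\<eta>, \<lambda>i\<in>{..<N}. w (\<sigma> i)) :: real)"
          using To sec by (intro sum.cong) (auto simp: D_def indicator_def)
        \<comment> \<open>Composition with \<tau> runs through the same set of relabellings.\<close>
        also have "\<dots> = (\<Sum>\<sigma>\<in>perms. indicator S (\<eta>, \<lambda>i\<in>{..<N}. w ((\<tau> \<circ> \<sigma>) i)))"
          unfolding perms_def by (rule setum_permutations_compose_left[OF \<tau>(1)])
        also have "\<dots> = (\<Sum>\<sigma>\<in>perms. indicator S (Sg N \<sigma> \<xi>))"
        proof (rule sum.cong[OF refl])
          fix \<sigma> assume "\<sigma> \<in> perms"
          hence \<sigma>: "\<sigma> i < N" if "i < N" for i using permutes_in_image[of \<sigma> "{..<N}" i] that by (simp add: perms_def)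
          have "(\<eta>, \<lambda>i\<in>{..<N}. x (\<sigma> i)) \<in> S \<longleftrightarrow> (\<eta>, \<lambda>i\<in>{..<N}. w ((\<tau> \<circ> \<sigma>) i)) \<in> S"
          proof (rule A_move[OF S e(2)])
            fix i l assume i: "i < N"
            have "v (\<sigma> i) = w (\<tau> (\<sigma> i))" using \<tau>(2) \<sigma>[OF i] by simp
            moreover have "sim (Suc k) (x (\<sigma> i) $ l) (v (\<sigma> i) $ l)"
              using v \<sigma>[OF i] by (intro cell_sim_center grid_lattice) auto
            ultimately show "sim (Suc k) ((\<lambda>i\<in>{..<N}. x (\<sigma> i)) i $ l) ((\<lambda>i\<in>{..<N}. w ((\<tau> \<circ> \<sigma>) i)) i $ l)" using i by simp
          qed auto
          thus "indicator S (\<eta>, \<lambda>i\<in>{..<N}. w ((\<tau> \<circ> \<sigma>) i)) = (indicator S (Sg N \<sigma> \<xi>) :: real)"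
            by (simp add: Sg_def e indicator_def)
        qed
        finally show ?thesis using True by simp
      qed
    qed
    have iS: "integrable (Om N) (\<lambda>\<xi>. indicator (B m) \<xi> * (indicator S \<xi> * Y (T N \<xi>)))"
      using integrable_mult_indicator[OF Bm integrable_mult_indicator[OF Sm integrable_T(1)[OF Y]]] by simp
    have perm: "(\<integral>\<xi>. indicator (B m) \<xi> * indicator S (Sg N \<sigma> \<xi>) * Y (T N \<xi>) \<partial>Om N) = (\<integral>\<xi>. indicator (B m) \<xi> * (indicator S \<xi> * Y (T N \<xi>)) \<partial>Om N)"
      "integrable (Om N) (\<lambda>\<xi>. indicator (B m) \<xi> * indicator S (Sg N \<sigma> \<xi>) * Y (T N \<xi>))"
      if \<sigma>: "\<sigma> \<in> perms" for \<sigma>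
    proof -
      have p: "\<sigma> permutes {..<N}" using \<sigma> by (simp add: perms_def)
      have cong: "indicator (B m) (Sg N \<sigma> \<xi>) * (indicator S (Sg N \<sigma> \<xi>) * Y (T N (Sg N \<sigma> \<xi>))) = indicator (B m) \<xi> * indicator S (Sg N \<sigma> \<xi>) * Y (T N \<xi>)"
        if \<xi>: "\<xi> \<in> space (Om N)" for \<xi>
        using \<xi> measurable_space[OF Sg_measurable[OF p] \<xi>] T_Sg[OF p \<xi>] by (simp add: B_def indicator_def)
      let ?f = "\<lambda>\<xi>. indicator (B m) \<xi> * (indicator S \<xi> * Y (T N \<xi>))"
      have fm: "?f \<in> borel_measurable (Om N)" by measurable
      show "(\<integral>\<xi>. indicator (B m) \<xi> * indicator S (Sg N \<sigma> \<xi>) * Y (T N \<xi>) \<partial>Om N) = (\<integral>\<xi>. ?f \<xi> \<partial>Om N)"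
        unfolding integral_Sg[OF p fm, symmetric] by (rule Bochner_Integration.integral_cong[OF refl cong[symmetric]])
      have "integrable (distr (Om N) (Om N) (Sg N \<sigma>)) ?f" unfolding distr_Sg[OF p] by (rule iS)
      hence "integrable (Om N) (\<lambda>\<xi>. ?f (Sg N \<sigma> \<xi>))" by (rule integrable_distr[OF Sg_measurable[OF p]])
      thus "integrable (Om N) (\<lambda>\<xi>. indicator (B m) \<xi> * indicator S (Sg N \<sigma> \<xi>) * Y (T N \<xi>))"
        by (subst (asm) Bochner_Integration.integrable_cong[OF refl cong]) auto
    qed
    have iDT: "integrable (Om N) (\<lambda>\<xi>. indicator (D \<sigma>) (T N \<xi>) * Y (T N \<xi>))" for \<sigma>
      using integrable_T(1)[OF integrable_mult_indicator[OF FP[OF Dm] Y]] by simp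
    have "0 = (\<Sum>\<sigma>\<in>perms. \<integral>\<xi>. indicator (D \<sigma>) (T N \<xi>) * Y (T N \<xi>) \<partial>Om N)" using z by simp
    also have "\<dots> = (\<integral>\<xi>. (\<Sum>\<sigma>\<in>perms. indicator (D \<sigma>) (T N \<xi>) * Y (T N \<xi>)) \<partial>Om N)"
      by (rule Bochner_Integration.integral_sum[symmetric]) (rule iDT)
    also have "\<dots> = (\<integral>\<xi>. (\<Sum>\<sigma>\<in>perms. indicator (B m) \<xi> * indicator S (Sg N \<sigma> \<xi>) * Y (T N \<xi>)) \<partial>Om N)"
    proof (rule integral_cong_AE)
      show "(\<lambda>\<xi>. \<Sum>\<sigma>\<in>perms. indicator (D \<sigma>) (T N \<xi>) * Y (T N \<xi>)) \<in> borel_measurable (Om N)"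
        by (intro borel_measurable_sum borel_measurable_integrable iDT)
      show "(\<lambda>\<xi>. \<Sum>\<sigma>\<in>perms. indicator (B m) \<xi> * indicator S (Sg N \<sigma> \<xi>) * Y (T N \<xi>)) \<in> borel_measurable (Om N)"
        by (intro borel_measurable_sum borel_measurable_integrable perm)
      show "AE \<xi> in Om N. (\<Sum>\<sigma>\<in>perms. indicator (D \<sigma>) (T N \<xi>) * Y (T N \<xi>)) = (\<Sum>\<sigma>\<in>perms. indicator (B m) \<xi> * indicator S (Sg N \<sigma> \<xi>) * Y (T N \<xi>))"
        using ae by eventually_elim (simp only: sum_distrib_right[symmetric])
    qed
    also have "\<dots> = (\<Sum>\<sigma>\<in>perms. \<integral>\<xi>. indicator (B m) \<xi> * indicator S (Sg N \<sigma> \<xi>) * Y (T N \<xi>) \<partial>Om N)"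
      by (rule Bochner_Integration.integral_sum) (rule perm)
    \<comment> \<open>By exchangeability all relabellings contribute the same integral.\<close>
    also have "\<dots> = real (card perms) * (\<integral>\<xi>. indicator (B m) \<xi> * (indicator S \<xi> * Y (T N \<xi>)) \<partial>Om N)"
      by (simp add: perm(1))
    finally have "real (card perms) * (\<integral>\<xi>. indicator (B m) \<xi> * (indicator S \<xi> * Y (T N \<xi>)) \<partial>Om N) = 0" by simp
    moreover have "card perms \<noteq> 0"
    using card_permutations[OF refl, of "{..<N}"] by (simp add: perms_def)
    ultimately show ?thesis by simp
  qed
  have iS: "integrable (Om N) (\<lambda>\<xi>. indicator S \<xi> * Y (T N \<xi>))"
    using integrable_mult_indicator[OF Sm integrable_T(1)[OF Y]] by simp
  have iB: "integrable (Om N) (\<lambda>\<xi>. indicator (B m) \<xi> * (indicator S \<xi> * Y (T N \<xi>)))" for m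
    using integrable_mult_indicator[OF Bm iS] by simp
  \<comment> \<open>The occupancy vector has finitely many possible values, and the corresponding
    events cover the labelled space up to a null event.\<close>
  have "(\<integral>\<xi>. indicator S \<xi> * Y (T N \<xi>) \<partial>Om N) = (\<integral>\<xi>. (\<Sum>m\<in>C. indicator (B m) \<xi> * (indicator S \<xi> * Y (T N \<xi>))) \<partial>Om N)"
  proof (rule integral_cong_AE)
    show "AE \<xi> in Om N. indicator S \<xi> * Y (T N \<xi>) = (\<Sum>m\<in>C. indicator (B m) \<xi> * (indicator S \<xi> * Y (T N \<xi>)))"
      using AE_grid_cell[OF k, of N] AE_space[of "Om N"]
    proof eventually_elim
      case (elim \<xi>)
      obtain v where v: "v \<in> {..<N} \<rightarrow>\<^sub>E grid n k" "\<And>i. i < N ==> snd \<xi> i \<in> cell k (v i)" using elim(1) by auto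
      have "\<xi> \<in> B m \<longleftrightarrow> m = occ N v" if m: "m \<in> C" for m
      proof -
        have "\<xi> \<in> B m \<longleftrightarrow> (\<forall>z\<in>grid n k. (of_nat (occ N v z) :: ennreal) = of_nat (m z))"
          using T_configs[OF elim(2)] elim(2) T_occ[OF k elim(2) v] by (simp add: B_def occ_event_def del: of_nat_eq_iff)
        also have "\<dots> \<longleftrightarrow> (\<forall>z\<in>grid n k. occ N v z = m z)" by (simp only: of_nat_eq_iff)
        also have "\<dots> \<longleftrightarrow> (\<forall>z. occ N v z = m z)"
        proof -
          obtain w where w: "w \<in> {..<N} \<rightarrow>\<^sub>E grid n k" "m = occ N w" using m by (auto simp: C_def)
          have "occ N v z = m z" if z: "z \<notin> grid n k" for z
            using occ_outside[OF v(1) z] occ_outside[OF w(1) z] w(2) by simp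
          thus ?thesis by blast
        qed
        also have "\<dots> \<longleftrightarrow> m = occ N v" by (auto simp: fun_eq_iff)
        finally show ?thesis .
      qed
      hence "(\<Sum>m\<in>C. indicator (B m) \<xi> * (indicator S \<xi> * Y (T N \<xi>))) = (\<Sum>m\<in>C. if m = occ N v then indicator S \<xi> * Y (T N \<xi>) else 0)"
        by (intro sum.cong) (auto simp: indicator_def)
      also have "\<dots> = indicator S \<xi> * Y (T N \<xi>)"
      proof -
        have "occ N v \<in> C" using v(1) by (auto simp: C_def)
        thus ?thesis by (simp add: finC)
      qed
      finally show ?case by simp
    qed
  qed (intro borel_measurable_sum borel_measurable_integrable iB iS)+
  also have "\<dots> = (\<Sum>m\<in>C. \<integral>\<xi>. indicator (B m) \<xi> * (indicator S \<xi> * Y (T N \<xi>)) \<partial>Om N)"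
    by (rule Bochner_Integration.integral_sum) (rule iB)
  also have "\<dots> = 0" using one by simp
  finally show ?thesis .
qed

lemma fsub_scale: "finite_measure_subalgebra (completion P) (scale_alg n k)"
proof -
  interpret C: prob_space "completion P" by (rule prob_space_completion)
  have "subalgebra (completion P) (scale_alg n k)"
    using scale_subset_P[of k] sets_completion[of P] unfolding subalgebra_def by (auto intro: sets_completionI_sets)
  thus ?thesis by (intro finite_measure_subalgebra.intro finite_measure_subalgebra_axioms.intro) unfold_locales
qed

lemma up_integrable:
  assumes iX: "integrable (completion P) X" shows "integrable (Om N) (up X N)"
proof -
  have Xm: "X \<in> borel_measurable (completion P)" using iX by (rule borel_measurable_integrable)
  obtain X0 where X0: "X0 \<in> borel_measurable P" and ae0: "AE \<mu> in P. X \<mu> = X0 \<mu>"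
    using completion_ex_borel_measurable_real[OF Xm] by blast
  have "integrable (completion P) X0"
    using iX integrable_cong_AE[OF Xm measurable_completion[OF X0] AE_completion[OF ae0]] by simp
  hence i0: "integrable (Om N) (\<lambda>\<xi>. X0 (T N \<xi>))" using integrable_completion[OF X0] by (intro integrable_T(1)) simp
  have "AE \<xi> in Om N. X0 (T N \<xi>) = up X N \<xi>"
    using up(2)[OF Xm, of N] AE_T[OF ae0, of N] by eventually_elim simp
  thus ?thesis using i0 integrable_cong_AE[OF borel_measurable_integrable[OF i0] up(1)[OF Xm]] by simp
qed

text \<open>Read on the labelled space, the conditional expectation given the counts is almost
  surely invariant within cells, and its difference from X is orthogonal to every invariant event by
  \<open>orth_lift\<close>; these properties characterise the other side. Scale k corresponds to
  level \<open>Suc k\<close>, level 0 being that of exact positions.\<close>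

lemma cond_exp_lift:
  assumes k: "k \<le> n" and iX: "integrable (completion P) X"
  shows "AE \<xi> in Om N. resample_space.E (Om N) (coords N) Xc upc (\<lambda>_. Suc k) (up X N) \<xi> =
    real_cond_exp (completion P) (scale_alg n k) X (T N \<xi>)"
proof -
  interpret R: resample_space "Om N" "coords N" Xc upc n by (rule resample_space_Om)
  interpret FS: finite_measure_subalgebra "completion P" "scale_alg n k" by (rule fsub_scale)
  interpret FA: finite_measure_subalgebra "Om N" "R.A (\<lambda>_. Suc k)" by (rule R.fsub)
  let ?F = "scale_alg n k"
  define c where "c = real_cond_exp (completion P) ?F X"
  have cF: "c \<in> borel_measurable ?F" unfolding c_def by (rule borel_measurable_cond_exp)
  have cP: "c \<in> borel_measurable P" by (rule measurable_from_subalg[OF scale_subset_P cF])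
  have Xm: "X \<in> borel_measurable (completion P)" using iX by (rule borel_measurable_integrable)
  obtain X0 where X0: "X0 \<in> borel_measurable P" and ae0: "AE \<mu> in P. X \<mu> = X0 \<mu>"
    using completion_ex_borel_measurable_real[OF Xm] by blast
  have X0c: "X0 \<in> borel_measurable (completion P)" by (rule measurable_completion[OF X0])
  have ae0c: "AE \<mu> in completion P. X \<mu> = X0 \<mu>" using ae0 by (rule AE_completion)
  have iX0c: "integrable (completion P) X0" using iX integrable_cong_AE[OF Xm X0c ae0c] by simp
  have iX0: "integrable P X0" using iX0c integrable_completion[OF X0] by simp
  have icc: "integrable (completion P) c" unfolding c_def by (rule FS.real_cond_exp_int(1)[OF iX])
  have ic: "integrable P c" using icc integrable_completion[OF cP] by simp
  have iY: "integrable P (\<lambda>\<mu>. X0 \<mu> - c \<mu>)" using iX0 ic by simp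
  have orth: "(\<integral>\<mu>. indicator D \<mu> * (X0 \<mu> - c \<mu>) \<partial>P) = 0" if D: "D \<in> sets ?F" for D
  proof -
    have DP: "D \<in> sets P" using D scale_subset_P[of k] unfolding subalgebra_def by blast
    hence DC: "D \<in> sets (completion P)" by (rule sets_completionI_sets)
    have "(\<integral>\<mu>. indicator D \<mu> * (X0 \<mu> - c \<mu>) \<partial>P) = (\<integral>\<mu>. indicator D \<mu> * (X0 \<mu> - c \<mu>) \<partial>completion P)"
      by (rule integral_completion[symmetric]) (use DP X0 cP in measurable)
    also have "\<dots> = (\<integral>\<mu>. indicator D \<mu> * X0 \<mu> \<partial>completion P) - (\<integral>\<mu>. indicator D \<mu> * c \<mu> \<partial>completion P)"
      using integrable_mult_indicator[OF DC iX0c] integrable_mult_indicator[OF DC icc] by (simp add: right_diff_distrib)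
    also have "(\<integral>\<mu>. indicator D \<mu> * X0 \<mu> \<partial>completion P) = (\<integral>\<mu>. indicator D \<mu> * X \<mu> \<partial>completion P)"
    proof (rule integral_cong_AE)
      show "AE \<mu> in completion P. indicator D \<mu> * X0 \<mu> = indicator D \<mu> * X \<mu>" using ae0c by eventually_elim simp
    qed (use DC X0c Xm in measurable)
    also have "\<dots> = (\<integral>\<mu>. indicator D \<mu> * c \<mu> \<partial>completion P)"
      using FS.real_cond_exp_intA[OF iX D] by (simp add: set_lebesgue_integral_def c_def)
    finally show ?thesis by simp
  qed
  \<comment> \<open>Invariance must hold at every point of the labelled space. If some labelled
    point lies outside the cube, moving it can change the counts of exterior sets, so the function
    is put to 0 there; the event is null.\<close>
  define c' where "c' = (\<lambda>\<xi>. if \<forall>i\<in>{..<N}. snd \<xi> i \<in> cube n then c (T N \<xi>) else 0)"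
  have cT: "(\<lambda>\<xi>. c (T N \<xi>)) \<in> borel_measurable (Om N)" by (rule measurable_compose[OF T_measurable cP])
  have Qi: "Measurable.pred (Om N) (\<lambda>\<xi>. \<forall>i\<in>{..<N}. snd \<xi> i \<in> cube n)"
  proof (rule pred_intros_finite(3))
    fix i assume "i \<in> {..<N}"
    hence [measurable]: "(\<lambda>\<xi>. snd \<xi> i) \<in> borel_measurable (Om N)" by (intro point_measurable) simp
    show "Measurable.pred (Om N) (\<lambda>\<xi>. snd \<xi> i \<in> cube n)" by measurable
  qed simp
  have c'A: "c' \<in> borel_measurable (R.A (\<lambda>_. Suc k))"
  proof (rule R.measurable_AI)
    note [measurable] = cT Qi
    show "c' \<in> borel_measurable (Om N)" unfolding c'_def by measurable
    fix m \<xi> t assume m: "m \<in> coords N" and \<xi>: "\<xi> \<in> space (Om N)" and st: "sim (Suc k) (Xc m \<xi>) t"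
    obtain i l where mi: "m = (i, l)" "i < N" using m by (auto simp: coords_def)
    obtain \<eta> x where e: "\<xi> = (\<eta>, x)" "\<eta> \<in> configs" using \<xi> by (auto simp: space_Om)
    define y where "y = x(i := shift l (x i) t)"
    have u: "upc m \<xi> t = (\<eta>, y)" by (simp add: upc_def mi e y_def)
    have sm: "sim (Suc k) (x j $ l') (y j $ l')" for j l' using st by (auto simp: y_def shift_nth Xc_def mi e)
    have inQ: "y j \<in> cube n \<longleftrightarrow> x j \<in> cube n" for j
      unfolding cube_iff using sim_interval3[OF _ sm, of n] k by auto
    have inV: "y j \<in> cell k z \<longleftrightarrow> x j \<in> cell k z" if "z \<in> lattice k" for j z
      unfolding mem_cell using sim_cell_iff[OF that sm] by blast
    show "c' (upc m \<xi> t) = c' \<xi>"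
    proof (cases "\<forall>i\<in>{..<N}. x i \<in> cube n")
      case False
      thus ?thesis unfolding c'_def u unfolding e using inQ by auto
    next
      case True
      have "c (conf (cube n) N y \<eta>) = c (conf (cube n) N x \<eta>)"
      proof (rule count_algebra_determined_fun[OF cF[unfolded scale_alg_def]])
        show "conf (cube n) N y \<eta> \<in> configs" "conf (cube n) N x \<eta> \<in> configs" by (intro conf_in_configs e cube_borel)+
        fix V :: "(real^'d) set" assume V: "V \<in> (\<lambda>z. cell k z) ` grid n k \<union> {V \<in> sets borel. V \<subseteq> - cube n}"
        have "V \<in> sets borel" using V cell_borel by blast
        moreover have "{i. i < N \<and> y i \<in> V} = {i. i < N \<and> x i \<in> V}"
        proof (cases "V \<in> (\<lambda>z. cell k z) ` grid n k")
          case True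
          then obtain z where z: "z \<in> grid n k" "V = cell k z" by blast
          show ?thesis unfolding z(2) using inV[OF grid_lattice[OF z(1)]] by simp
        next
          case False
          hence Vs: "V \<subseteq> - cube n" using V by blast
          have "\<And>j. j < N ==> x j \<notin> V" "\<And>j. j < N ==> y j \<notin> V" using inQ True Vs by auto
          thus ?thesis by blast
        qed
        ultimately show "emeasure (conf (cube n) N y \<eta>) V = emeasure (conf (cube n) N x \<eta>) V"
          by (simp only: emeasure_conf[OF e(2) cube_borel])
      qed
      thus ?thesis unfolding c'_def u unfolding e T_def using inQ by simp
    qed
  qed
  have aec: "AE \<xi> in Om N. c' \<xi> = c (T N \<xi>)" using AE_in_Q[of N] by eventually_elim (auto simp: c'_def)
  have c'm: "c' \<in> borel_measurable (Om N)" by (rule R.measurable_A_M[OF c'A])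
  have aeu: "AE \<xi> in Om N. up X N \<xi> = X0 (T N \<xi>)"
    using up(2)[OF Xm, of N] AE_T[OF ae0, of N] by eventually_elim simp
  have um: "up X N \<in> borel_measurable (Om N)" by (rule up(1)[OF Xm])
  have X0T: "(\<lambda>\<xi>. X0 (T N \<xi>)) \<in> borel_measurable (Om N)" by (rule measurable_compose[OF T_measurable X0])
  have "AE \<xi> in Om N. real_cond_exp (Om N) (R.A (\<lambda>_. Suc k)) (up X N) \<xi> = c' \<xi>"
  proof (rule FA.real_cond_exp_charact)
    show iu: "integrable (Om N) (up X N)" by (rule up_integrable[OF iX])
    show ic': "integrable (Om N) c'" using integrable_T(1)[OF ic, of N] integrable_cong_AE[OF c'm cT aec] by simp
    show "c' \<in> borel_measurable (R.A (\<lambda>_. Suc k))" by (rule c'A)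
    fix S assume S: "S \<in> sets (R.A (\<lambda>_. Suc k))"
    have Sm: "S \<in> sets (Om N)" using S R.subalg_A unfolding subalgebra_def by blast
    have "0 = (\<integral>\<xi>. indicator S \<xi> * (X0 (T N \<xi>) - c (T N \<xi>)) \<partial>Om N)" using orth_lift[OF k iY orth S] by simp
    also have "\<dots> = (\<integral>\<xi>. indicator S \<xi> * (up X N \<xi> - c' \<xi>) \<partial>Om N)"
    proof (rule integral_cong_AE)
      show "AE \<xi> in Om N. indicator S \<xi> * (X0 (T N \<xi>) - c (T N \<xi>)) = indicator S \<xi> * (up X N \<xi> - c' \<xi>)"
        using aec aeu by eventually_elim simp
    qed (use Sm X0T cT um c'm in measurable)
    also have "\<dots> = (\<integral>\<xi>. indicator S \<xi> * up X N \<xi> \<partial>Om N) - (\<integral>\<xi>. indicator S \<xi> * c' \<xi> \<partial>Om N)"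
      using integrable_mult_indicator[OF Sm iu] integrable_mult_indicator[OF Sm ic'] by (simp add: right_diff_distrib)
    finally show "(\<integral>\<xi>\<in>S. up X N \<xi> \<partial>Om N) = (\<integral>\<xi>\<in>S. c' \<xi> \<partial>Om N)" by (simp add: set_lebesgue_integral_def)
  qed
  thus ?thesis using aec unfolding R.E_def c_def by eventually_elim simp
qed

end

section \<open>Averages over cells\<close>

lemma integral_conf:
  fixes f :: "real^'d::finite => real"
  assumes \<eta>: "\<eta> \<in> configs" and Q: "Q \<in> sets borel" and x: "\<And>i. i < N ==> x i \<in> Q" and f: "f \<in> borel_measurable borel"
  shows "integrable (conf Q N x \<eta>) (\<lambda>y. indicator Q y * f y)" "(\<integral>y. indicator Q y * f y \<partial>conf Q N x \<eta>) = (\<Sum>i<N. f (x i))"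
proof -
  have nn: "(\<integral>\<^sup>+y. ennreal (indicator Q y * h (f y)) \<partial>conf Q N x \<eta>) = ennreal (\<Sum>i<N. h (f (x i)))"
    if h: "h \<in> borel_measurable borel" "\<And>y. 0 \<le> h y" for h :: "real => real"
  proof -
    have "(\<integral>\<^sup>+y. ennreal (indicator Q y * h (f y)) \<partial>conf Q N x \<eta>) = (\<integral>\<^sup>+y\<in>Q. ennreal (h (f y)) \<partial>conf Q N x \<eta>)"
      by (rule nn_integral_cong) (simp split: split_indicator)
    also have "\<dots> = (\<Sum>i<N. ennreal (h (f (x i))))"
      by (rule nn_integral_conf[OF \<eta> Q x]) (use f h in measurable)
    finally show ?thesis using h(2) by (simp add: sum_ennreal)
  qed
  have m: "(\<lambda>y. indicator Q y * f y) \<in> borel_measurable (conf Q N x \<eta>)" using f Q by measurable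
  show i: "integrable (conf Q N x \<eta>) (\<lambda>y. indicator Q y * f y)"
  proof (rule integrableI_bounded[OF m])
    have "(\<integral>\<^sup>+y. ennreal (norm (indicator Q y * f y)) \<partial>conf Q N x \<eta>) = (\<integral>\<^sup>+y. ennreal (indicator Q y * \<bar>f y\<bar>) \<partial>conf Q N x \<eta>)"
      by (simp add: abs_mult)
    also have "\<dots> < \<infinity>" using nn[of abs] by simp
    finally show "(\<integral>\<^sup>+y. ennreal (norm (indicator Q y * f y)) \<partial>conf Q N x \<eta>) < \<infinity>" .
  qed
  have e: "ennreal (indicator Q y * f y) = ennreal (indicator Q y * max 0 (f y))"
    "ennreal (- (indicator Q y * f y)) = ennreal (indicator Q y * max 0 (- f y))" for y
    by (auto simp: max_def ennreal_neg split: split_indicator)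
  have "(\<integral>y. indicator Q y * f y \<partial>conf Q N x \<eta>) = enn2real (ennreal (\<Sum>i<N. max 0 (f (x i)))) - enn2real (ennreal (\<Sum>i<N. max 0 (- f (x i))))"
    unfolding real_lebesgue_integral_def[OF i] e
    using nn[of "max 0"] nn[of "\<lambda>y. max 0 (- y)"] by simp
  also have "\<dots> = (\<Sum>i<N. max 0 (f (x i)) - max 0 (- f (x i)))" by (simp add: sum_nonneg sum_subtractf)
  also have "\<dots> = (\<Sum>i<N. f (x i))" by (intro sum.cong) auto
  finally show "(\<integral>y. indicator Q y * f y \<partial>conf Q N x \<eta>) = (\<Sum>i<N. f (x i))" .
qed

lemma integral_nth:
  fixes v :: "'a => real^'d::finite"
  assumes "\<And>l. integrable M (\<lambda>x. v x $ l)" shows "(\<integral>x. v x \<partial>M) $ l = (\<integral>x. v x $ l \<partial>M)"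
proof -
  have e: "v x = (\<Sum>l\<in>UNIV. (v x $ l) *\<^sub>R axis l 1)" for x
    by (auto simp: vec_eq_iff axis_def if_distrib cong: if_cong)
  have "(\<integral>x. v x \<partial>M) = (\<integral>x. (\<Sum>l\<in>UNIV. (v x $ l) *\<^sub>R axis l 1) \<partial>M)" using e by simp
  also have "\<dots> = (\<Sum>l\<in>UNIV. (\<integral>x. v x $ l \<partial>M) *\<^sub>R axis l 1)" using assms by simp
  finally show ?thesis by (simp add: axis_def if_distrib cong: if_cong)
qed

lemma complete_measurable_AE:
  fixes f h :: "'a => real"
  assumes f: "f \<in> borel_measurable (completion M)" and ae: "AE x in completion M. f x = h x"
  shows "h \<in> borel_measurable (completion M)"
proof (rule measurableI)
  fix B :: "real set" assume B: "B \<in> sets borel"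
  show "h -` B \<inter> space (completion M) \<in> sets (completion M)"
  proof (rule completion.in_sets_AE[OF _ measurable_sets[OF f B]])
    show "AE x in completion M. (x \<in> f -` B \<inter> space (completion M)) = (x \<in> h -` B \<inter> space (completion M))"
      using ae by eventually_elim simp
  qed simp
qed simp

context poisson_cube
begin

lemma avg_conf:
  fixes h :: "real^'d => real^'d"
  assumes k: "k \<le> n" and \<eta>: "\<eta> \<in> configs" and x: "\<And>i. i < N ==> x i \<in> cube n" and z: "z \<in> grid n k" and h: "h \<in> borel_measurable borel"
  shows "measure (conf (cube n) N x \<eta>) (cell k z) = real (card {i. i < N \<and> x i \<in> cell k z})"
    "avg (conf (cube n) N x \<eta>) (cell k z) h $ l =
      (\<Sum>i<N. indicator (cell k z) (x i) * h (x i) $ l) / real (card {i. i < N \<and> x i \<in> cell k z})"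
proof -
  let ?\<mu> = "conf (cube n) N x \<eta>" and ?V = "cell k z :: (real^'d) set"
  have "?V - cube n = {}" using cell_subset_cube[OF z k] by blast
  hence "emeasure \<eta> (?V - cube n) = 0" by (simp only: emeasure_empty)
  hence "emeasure ?\<mu> ?V = of_nat (card {i. i < N \<and> x i \<in> ?V})"
    by (simp only: emeasure_conf[OF \<eta> cube_borel cell_borel] add_0_right)
  thus mV: "measure ?\<mu> ?V = real (card {i. i < N \<and> x i \<in> ?V})" by (simp only: measure_def enn2real_of_nat)
  have ind: "indicator (cube n) y * (indicator ?V y * h y $ l) = (indicator ?V y *\<^sub>R h y) $ l" for y l
    using cell_subset_cube[OF z k] by (auto split: split_indicator)
  have m: "(\<lambda>y. indicator ?V y * h y $ l) \<in> borel_measurable borel" for l using h by measurable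
  note I = integral_conf[OF \<eta> cube_borel x m]
  have "(LINT y:?V|?\<mu>. h y) $ l = (\<integral>y. (indicator ?V y *\<^sub>R h y) $ l \<partial>?\<mu>)"
    unfolding set_lebesgue_integral_def by (rule integral_nth) (use I(1) in \<open>simp only: ind\<close>)
  also have "\<dots> = (\<Sum>i<N. indicator ?V (x i) * h (x i) $ l)" using I(2) by (simp only: ind)
  finally show "avg ?\<mu> ?V h $ l = (\<Sum>i<N. indicator ?V (x i) * h (x i) $ l) / real (card {i. i < N \<and> x i \<in> ?V})"
    by (simp add: avg_def mV)
qed

text \<open>The cell is held fixed, so that this is a function of the configuration alone and can be
  conditioned.\<close>

definition cavg :: "((real^'d) measure => real^'d => real^'d) => nat => real^'d => 'd => (real^'d) measure => real" where
  "cavg g k z l \<mu> = avg \<mu> (cell k z) (g \<mu>) $ l"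

lemma section_measurable:
  assumes g: "case_prod g \<in> borel_measurable (completion P \<Otimes>\<^sub>M borel)" and \<mu>: "\<mu> \<in> configs"
  shows "g \<mu> \<in> borel_measurable borel"
  using measurable_compose[OF measurable_Pair1' g, of \<mu>] \<mu> by simp

lemma cavg_T:
  assumes k: "k \<le> n" and g: "case_prod g \<in> borel_measurable (completion P \<Otimes>\<^sub>M borel)" and z: "z \<in> grid n k"
    and \<xi>: "\<xi> \<in> space (Om N)" "\<forall>i<N. snd \<xi> i \<in> cube n"
  shows "cavg g k z l (T N \<xi>) = (\<Sum>i<N. indicator (cell k z) (snd \<xi> i) * g (T N \<xi>) (snd \<xi> i) $ l) / real (card {i. i < N \<and> snd \<xi> i \<in> cell k z})"
    "measure (T N \<xi>) (cell k z) = real (card {i. i < N \<and> snd \<xi> i \<in> cell k z})"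
proof -
  have \<eta>: "fst \<xi> \<in> configs" using \<xi>(1) unfolding space_Om by (simp add: mem_Times_iff)
  have Te: "T N \<xi> = conf (cube n) N (snd \<xi>) (fst \<xi>)" by (simp add: T_def split_def)
  have gm: "g (T N \<xi>) \<in> borel_measurable borel" by (rule section_measurable[OF g T_configs[OF \<xi>(1)]])
  show "cavg g k z l (T N \<xi>) = (\<Sum>i<N. indicator (cell k z) (snd \<xi> i) * g (T N \<xi>) (snd \<xi> i) $ l) / real (card {i. i < N \<and> snd \<xi> i \<in> cell k z})"
    unfolding cavg_def using avg_conf(2)[OF k \<eta> _ z gm, of N "snd \<xi>" l] \<xi>(2) unfolding Te by blast
  show "measure (T N \<xi>) (cell k z) = real (card {i. i < N \<and> snd \<xi> i \<in> cell k z})"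
    unfolding Te by (rule avg_conf(1)[OF k \<eta> _ z borel_measurable_const]) (use \<xi>(2) in auto)
qed

text \<open>A Bochner integral against a varying measure is the difference of two nonnegative
  integrals, each covered by \<open>measurable_config_integral\<close>. The resulting formula holds
  almost surely, which is enough for measurability in the completion.\<close>

lemma cavg_measurable:
  assumes k: "k \<le> n" and g: "case_prod g \<in> borel_measurable (completion P \<Otimes>\<^sub>M borel)" and z: "z \<in> grid n k"
  shows "cavg g k z l \<in> borel_measurable (completion P)"
proof -
  let ?V = "cell k z :: (real^'d) set" and ?Q = "cube n :: (real^'d) set"
  have id: "(\<lambda>\<mu>. \<mu>) \<in> completion P \<rightarrow>\<^sub>M count_algebra (sets borel)"
    using measurable_completion[OF measurable_ident_sets[OF sets_P]] by simp
  define I where "I = (\<lambda>s \<mu>. if emeasure \<mu> ?Q < \<infinity> then \<integral>\<^sup>+y\<in>?Q. ennreal (s * (indicator ?V y * g \<mu> y $ l)) \<partial>\<mu> else 0)"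
  have Im: "I s \<in> borel_measurable (completion P)" for s
    unfolding I_def
  proof (rule measurable_config_integral[OF id _ cube_borel])
    have gl: "(\<lambda>p. g (fst p) (snd p) $ l) \<in> borel_measurable (completion P \<Otimes>\<^sub>M borel)"
      using measurable_compose[OF g vec_nth_measurable[of l]] by (simp add: split_def)
    have "(\<lambda>p. ennreal (s * (indicator ?V (snd p) * g (fst p) (snd p) $ l))) \<in> borel_measurable (completion P \<Otimes>\<^sub>M borel)"
      using gl by measurable
    thus "(\<lambda>(\<mu>, y). ennreal (s * (indicator ?V y * g \<mu> y $ l))) \<in> borel_measurable (completion P \<Otimes>\<^sub>M borel)"
      by (simp add: split_def)
  qed
  have cnt: "(\<lambda>\<mu>. measure \<mu> ?V) \<in> borel_measurable (completion P)"
    unfolding measure_def by (intro borel_measurable_enn2real measurable_completion count_meas cell_borel)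
  show ?thesis
  proof (rule complete_measurable_AE)
    show "(\<lambda>\<mu>. (enn2real (I 1 \<mu>) - enn2real (I (- 1) \<mu>)) / measure \<mu> ?V) \<in> borel_measurable (completion P)"
      using Im cnt by measurable
    show "AE \<mu> in completion P. (enn2real (I 1 \<mu>) - enn2real (I (- 1) \<mu>)) / measure \<mu> ?V = cavg g k z l \<mu>"
    proof (rule AE_completion)
      show "AE \<mu> in P. (enn2real (I 1 \<mu>) - enn2real (I (- 1) \<mu>)) / measure \<mu> ?V = cavg g k z l \<mu>"
        using AE_QN
      proof eventually_elim
        case (elim \<mu>)
        then obtain N where N: "\<mu> \<in> QN N" by auto
        hence \<mu>: "\<mu> \<in> configs" and fin: "emeasure \<mu> ?Q < \<infinity>" by (auto simp: QN_def of_nat_less_top)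
        obtain x where x: "x \<in> {..<N} \<rightarrow>\<^sub>E ?Q" "\<mu> = conf ?Q N x \<mu>" by (rule config_decomp[OF N])
        have xQ: "\<And>i. i < N ==> x i \<in> ?Q" using x(1) by auto
        have gm: "g \<mu> \<in> borel_measurable borel" by (rule section_measurable[OF g \<mu>])
        have m: "(\<lambda>y. indicator ?V y * g \<mu> y $ l) \<in> borel_measurable borel" using gm by measurable
        have i: "integrable \<mu> (\<lambda>y. indicator ?Q y * (indicator ?V y * g \<mu> y $ l))"
          and s: "(\<integral>y. indicator ?Q y * (indicator ?V y * g \<mu> y $ l) \<partial>\<mu>) = (\<Sum>i<N. indicator ?V (x i) * g \<mu> (x i) $ l)"
          using integral_conf[where N = N and x = x, OF \<mu> cube_borel xQ m] unfolding x(2)[symmetric] by blast+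
        have "enn2real (I 1 \<mu>) - enn2real (I (- 1) \<mu>) = (\<integral>y. indicator ?Q y * (indicator ?V y * g \<mu> y $ l) \<partial>\<mu>)"
        proof -
          have e: "ennreal (r * (indicator ?V y * g \<mu> y $ l)) * indicator ?Q y = ennreal (r * (indicator ?Q y * (indicator ?V y * g \<mu> y $ l)))" for r y
            by (simp split: split_indicator)
          have Ir: "I r \<mu> = (\<integral>\<^sup>+y. ennreal (r * (indicator ?Q y * (indicator ?V y * g \<mu> y $ l))) \<partial>\<mu>)" for r
            unfolding I_def using fin by (simp only: e if_True)
          show ?thesis unfolding real_lebesgue_integral_def[OF i] Ir by simp
        qed
        moreover have "cavg g k z l \<mu> = (\<Sum>i<N. indicator ?V (x i) * g \<mu> (x i) $ l) / measure \<mu> ?V"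
          using avg_conf(1)[where N = N and x = x, OF k \<mu> xQ z gm] avg_conf(2)[where N = N and x = x and l = l, OF k \<mu> xQ z gm] unfolding x(2)[symmetric] cavg_def by simp
        ultimately show ?case using s by simp
      qed
    qed
  qed
qed

text \<open>The square of an average over at least one point is at most the sum of the squares, and
  an empty average is 0; so the energy bounds the second moment.\<close>

lemma cavg_sqint:
  assumes k: "k \<le> n" and g: "case_prod g \<in> borel_measurable (completion P \<Otimes>\<^sub>M borel)" "energy P (cube n) g < \<infinity>" and z: "z \<in> grid n k"
  shows "integrable (completion P) (cavg g k z l)"
proof -
  interpret C: prob_space "completion P" by (rule prob_space_completion)
  have "L2_sq P (cavg g k z l) \<le> energy P (cube n) g"
    unfolding L2_sq_formula[OF cavg_measurable[OF k g(1) z]] energy_formula[OF g(1)]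
  proof (intro suminf_le summableI mult_left_mono nn_integral_mono_AE)
    fix N
    show "AE \<xi> in Om N. ennreal ((cavg g k z l (T N \<xi>))^2) \<le> (\<Sum>i<N. ennreal ((norm (g (T N \<xi>) (snd \<xi> i)))^2))"
      using AE_in_Q[of N] AE_space[of "Om N"]
    proof eventually_elim
      case (elim \<xi>)
      let ?J = "{i. i < N \<and> snd \<xi> i \<in> cell k z}" and ?y = "\<lambda>i. g (T N \<xi>) (snd \<xi> i)"
      have fin: "finite ?J" by simp
      have c: "cavg g k z l (T N \<xi>) = (\<Sum>i\<in>?J. ?y i $ l) / real (card ?J)"
        unfolding cavg_T(1)[OF k g(1) z elim(2,1)]
        by (intro arg_cong2[where f = "(/)"] refl sum.mono_neutral_cong_right) (auto simp: indicator_def)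
      have "(cavg g k z l (T N \<xi>))^2 \<le> (\<Sum>i\<in>?J. (?y i $ l)^2)"
      proof (cases "?J = {}")
        case False
        hence c1: "1 \<le> real (card ?J)" using fin by (simp add: Suc_le_eq card_gt_0_iff)
        have "(\<Sum>i\<in>?J. ?y i $ l)^2 \<le> (\<Sum>i\<in>?J. (?y i $ l)^2) * real (card ?J)" by (rule sum_squared_le_sum_of_squares)
        also have "\<dots> \<le> (\<Sum>i\<in>?J. (?y i $ l)^2) * (real (card ?J))^2"
          using c1 by (intro mult_left_mono self_le_power sum_nonneg) auto
        finally have le: "(\<Sum>i\<in>?J. ?y i $ l)^2 \<le> (\<Sum>i\<in>?J. (?y i $ l)^2) * (real (card ?J))^2" .
        have "0 < (real (card ?J))^2" by (rule zero_less_power) (use c1 in linarith)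
        thus ?thesis unfolding c power_divide using le by (simp only: pos_divide_le_eq)
      qed (simp only: c sum.empty, simp)
      also have "\<dots> \<le> (\<Sum>i<N. (?y i $ l)^2)" by (rule sum_mono2) auto
      also have "\<dots> \<le> (\<Sum>i<N. (norm (?y i))^2)"
        by (intro sum_mono power2_le_iff_abs_le[THEN iffD2]) (auto simp: component_le_norm_cart)
      finally show ?case by (simp add: sum_ennreal ennreal_leI)
    qed
  qed simp
  hence "L2_sq P (cavg g k z l) < \<infinity>" using g(2) by (rule le_less_trans)
  hence "sqint (completion P) (cavg g k z l)" unfolding L2_sq_def by (rule sqintI_nn[OF cavg_measurable[OF k g(1) z]])
  thus ?thesis by (rule C.sqint_integrable)
qed

text \<open>Two points in the same cell can be exchanged inside the integral over an invariant event,
  so a single gradient may be replaced by the average over its cell.\<close>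

lemma cell_average:
  assumes k: "k \<le> n" and g: "case_prod g \<in> borel_measurable (completion P \<Otimes>\<^sub>M borel)" "energy P (cube n) g < \<infinity>" and z: "z \<in> grid n k"
    and i: "i < N" and S: "S \<in> sets (resample_space.A (Om N) (coords N) Xc upc (\<lambda>_. Suc k))"
  shows "(\<integral>\<xi>. indicator S \<xi> * (indicator (cell k z) (snd \<xi> i) * gp g N (i, l) \<xi>) \<partial>Om N) =
    (\<integral>\<xi>. indicator S \<xi> * (indicator (cell k z) (snd \<xi> i) * up (cavg g k z l) N \<xi>) \<partial>Om N)"
proof -
  interpret R: resample_space "Om N" "coords N" Xc upc n by (rule resample_space_Om)
  have Sm [measurable]: "S \<in> sets (Om N)" using S R.subalg_A unfolding subalgebra_def by blast
  let ?V = "cell k z :: (real^'d) set"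
  define ind :: "nat => (real^'d) measure \<times> (nat => real^'d) => real" where "ind = (\<lambda>j \<xi>. indicator ?V (snd \<xi> j))"
  define cnt where "cnt = (\<lambda>\<xi>. measure (T N \<xi>) ?V)"
  have cm: "(j, l) \<in> coords N" if "j < N" for j using that by (simp add: coords_def)
  have gm [measurable]: "gp g N (j, l) \<in> borel_measurable (Om N)" if "j < N" for j by (rule gp(1)[OF g(1) cm[OF that]])
  have gi: "integrable (Om N) (gp g N (j, l))" if "j < N" for j
    by (rule R.sqint_integrable[OF energy_bound(1)[OF g cm[OF that]]])
  have im [measurable]: "ind j \<in> borel_measurable (Om N)" if "j < N" for j
    using point_measurable[OF that] unfolding ind_def by measurable
  have cntm [measurable]: "cnt \<in> borel_measurable (Om N)"
    unfolding cnt_def measure_def by (intro borel_measurable_enn2real measurable_compose[OF T_measurable] count_meas cell_borel)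
  \<comment> \<open>The gradient of the j-th point, weighted by the event that the points i and j'
    share the cell, divided by the number of points there. Summed over j' with j = i, the weights
    restore the indicator that point i is in the cell.\<close>
  define f where "f = (\<lambda>j j' \<xi>. indicator S \<xi> * (ind i \<xi> * ind j' \<xi> / cnt \<xi>) * gp g N (j, l) \<xi> :: real)"
  have cnt1: "ind i \<xi> \<noteq> 0 ==> 1 \<le> cnt \<xi>" "cnt \<xi> = (\<Sum>j<N. ind j \<xi>)"
    if \<xi>: "\<xi> \<in> space (Om N)" "\<forall>i<N. snd \<xi> i \<in> cube n" for \<xi>
  proof -
    have c: "cnt \<xi> = real (card {j. j < N \<and> snd \<xi> j \<in> ?V})" unfolding cnt_def by (rule cavg_T(2)[OF k g(1) z \<xi>])
    show "1 \<le> cnt \<xi>" if "ind i \<xi> \<noteq> 0"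
    proof -
      have "i \<in> {j. j < N \<and> snd \<xi> j \<in> ?V}" using that i by (auto simp: ind_def indicator_def split: if_splits)
      hence "card {j. j < N \<and> snd \<xi> j \<in> ?V} > 0" by (subst card_gt_0_iff) auto
      thus ?thesis unfolding c by linarith
    qed
    have "(\<Sum>j<N. ind j \<xi>) = (\<Sum>j\<in>{j. j < N \<and> snd \<xi> j \<in> ?V}. 1)"
      unfolding ind_def by (intro sum.mono_neutral_cong_right) (auto simp: indicator_def)
    thus "cnt \<xi> = (\<Sum>j<N. ind j \<xi>)" using c by simp
  qed
  \<comment> \<open>Wherever the weight is nonzero the point i is in the cell, so the count is at
    least 1 and the weight at most 1.\<close>
  have fi: "integrable (Om N) (f j j')" if j: "j < N" "j' < N" for j j'
  proof (rule Bochner_Integration.integrable_bound[OF gi[OF j(1)]])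
    note [measurable] = gm[OF j(1)] im[OF j(2)] im[OF i]
    show "f j j' \<in> borel_measurable (Om N)" unfolding f_def by measurable
    show "AE \<xi> in Om N. norm (f j j' \<xi>) \<le> norm (gp g N (j, l) \<xi>)"
      using AE_in_Q[of N] AE_space[of "Om N"]
    proof eventually_elim
      case (elim \<xi>)
      have "\<bar>indicator S \<xi> * (ind i \<xi> * ind j' \<xi> / cnt \<xi>)\<bar> \<le> 1"
      proof (cases "ind i \<xi> = 0")
        case False
        have "1 \<le> cnt \<xi>" by (rule cnt1(1)[OF elim(2,1) False])
        thus ?thesis by (simp add: ind_def indicator_def)
      qed simp
      hence "\<bar>indicator S \<xi> * (ind i \<xi> * ind j' \<xi> / cnt \<xi>)\<bar> * \<bar>gp g N (j, l) \<xi>\<bar> \<le> 1 * \<bar>gp g N (j, l) \<xi>\<bar>"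
        by (rule mult_right_mono) simp
      thus ?case by (simp add: f_def abs_mult)
    qed
  qed
  have swap: "(\<integral>\<xi>. f i j \<xi> \<partial>Om N) = (\<integral>\<xi>. f j j \<xi> \<partial>Om N)" if j: "j < N" for j
  proof -
    let ?\<sigma> = "Transposition.transpose i j"
    have p: "?\<sigma> permutes {..<N}" by (rule permutes_swap_id) (use i j in auto)
    have fm: "f i j \<in> borel_measurable (Om N)" "f j j \<in> borel_measurable (Om N)"
      using fi[OF i j] fi[OF j j] by (auto intro: borel_measurable_integrable)
    have "(\<integral>\<xi>. f i j \<xi> \<partial>Om N) = (\<integral>\<xi>. f i j (Sg N ?\<sigma> \<xi>) \<partial>Om N)" by (rule integral_Sg[OF p fm(1), symmetric])
    also have "\<dots> = (\<integral>\<xi>. f j j \<xi> \<partial>Om N)"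
    proof (rule integral_cong_AE)
      show "(\<lambda>\<xi>. f i j (Sg N ?\<sigma> \<xi>)) \<in> borel_measurable (Om N)" by (rule measurable_compose[OF Sg_measurable[OF p] fm(1)])
      show "f j j \<in> borel_measurable (Om N)" by (rule fm(2))
      show "AE \<xi> in Om N. f i j (Sg N ?\<sigma> \<xi>) = f j j \<xi>"
        using AE_Sg[OF p gp(2)[OF g(1) cm[OF i]]] gp(2)[OF g(1) cm[OF j]] AE_space[of "Om N"]
      proof eventually_elim
        case (elim \<xi>)
        obtain \<eta> x where e: "\<xi> = (\<eta>, x)" "\<eta> \<in> configs" "x \<in> {..<N} \<rightarrow>\<^sub>E UNIV" using elim(3) by (auto simp: space_Om)
        have sn: "snd (Sg N ?\<sigma> \<xi>) i = snd \<xi> j" "snd (Sg N ?\<sigma> \<xi>) j = snd \<xi> i" using i j by (simp_all add: Sg_def)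
        have TT: "T N (Sg N ?\<sigma> \<xi>) = T N \<xi>" by (rule T_Sg[OF p elim(3)])
        have ge: "gp g N (i, l) (Sg N ?\<sigma> \<xi>) = gp g N (j, l) \<xi>" using elim(1,2) by (simp add: sn TT)
        have inds: "ind i (Sg N ?\<sigma> \<xi>) = ind j \<xi>" "ind j (Sg N ?\<sigma> \<xi>) = ind i \<xi>" "cnt (Sg N ?\<sigma> \<xi>) = cnt \<xi>"
          by (simp_all add: ind_def cnt_def sn TT)
        \<comment> \<open>With both points in the cell, exchanging their labels moves coordinates
          within cells only and does not affect S; otherwise both integrands are 0.\<close>
        show ?case
        proof (cases "snd \<xi> i \<in> ?V \<and> snd \<xi> j \<in> ?V")
          case True
          have "(\<eta>, \<lambda>a\<in>{..<N}. x (?\<sigma> a)) \<in> S \<longleftrightarrow> (\<eta>, x) \<in> S"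
          proof (rule A_move[OF S e(2)])
            fix a l' assume a: "a < N"
            have "sim (Suc k) (x i $ l') (x j $ l')"
              by (rule sim_in_cell[OF grid_lattice[OF z], where l = l']) (use True e in \<open>auto simp: mem_cell\<close>)
            thus "sim (Suc k) ((\<lambda>a\<in>{..<N}. x (?\<sigma> a)) a $ l') (x a $ l')"
              using a by (auto simp: Transposition.transpose_def sim_sym[of _ "x j $ l'"])
          qed (use e in auto)
          hence "indicator S (Sg N ?\<sigma> \<xi>) = (indicator S \<xi> :: real)" by (simp add: Sg_def e indicator_def)
          thus ?thesis by (simp add: f_def inds ge mult.commute)
        next
          case False
          hence "ind i \<xi> * ind j \<xi> = 0" by (auto simp: ind_def)
          thus ?thesis by (auto simp: f_def inds)
        qed
      qed
    qed
    finally show ?thesis .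
  qed
  have "(\<integral>\<xi>. indicator S \<xi> * (indicator ?V (snd \<xi> i) * gp g N (i, l) \<xi>) \<partial>Om N) = (\<integral>\<xi>. (\<Sum>j<N. f i j \<xi>) \<partial>Om N)"
  proof (rule integral_cong_AE)
    note [measurable] = gm[OF i] im[OF i]
    have "(\<lambda>\<xi>. indicator S \<xi> * (ind i \<xi> * gp g N (i, l) \<xi>)) \<in> borel_measurable (Om N)" by measurable
    thus "(\<lambda>\<xi>. indicator S \<xi> * (indicator ?V (snd \<xi> i) * gp g N (i, l) \<xi>)) \<in> borel_measurable (Om N)" by (simp only: ind_def)
    show "(\<lambda>\<xi>. \<Sum>j<N. f i j \<xi>) \<in> borel_measurable (Om N)" by (intro borel_measurable_sum borel_measurable_integrable fi i) simp
    show "AE \<xi> in Om N. indicator S \<xi> * (indicator ?V (snd \<xi> i) * gp g N (i, l) \<xi>) = (\<Sum>j<N. f i j \<xi>)"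
      using AE_in_Q[of N] AE_space[of "Om N"]
    proof eventually_elim
      case (elim \<xi>)
      have "(\<Sum>j<N. f i j \<xi>) = indicator S \<xi> * (ind i \<xi> * (\<Sum>j<N. ind j \<xi>) / cnt \<xi>) * gp g N (i, l) \<xi>"
        by (simp add: f_def sum_distrib_left sum_distrib_right sum_divide_distrib)
      also have "\<dots> = indicator S \<xi> * (ind i \<xi> * gp g N (i, l) \<xi>)"
        using cnt1[OF elim(2,1)] by (cases "ind i \<xi> = 0") auto
      finally show ?case by (simp add: ind_def)
    qed
  qed
  also have "\<dots> = (\<Sum>j<N. \<integral>\<xi>. f i j \<xi> \<partial>Om N)" by (rule Bochner_Integration.integral_sum) (use fi i in auto)
  also have "\<dots> = (\<Sum>j<N. \<integral>\<xi>. f j j \<xi> \<partial>Om N)" by (intro sum.cong swap) auto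
  also have "\<dots> = (\<integral>\<xi>. (\<Sum>j<N. f j j \<xi>) \<partial>Om N)" by (rule Bochner_Integration.integral_sum[symmetric]) (use fi in auto)
  also have "\<dots> = (\<integral>\<xi>. indicator S \<xi> * (indicator ?V (snd \<xi> i) * up (cavg g k z l) N \<xi>) \<partial>Om N)"
  proof (rule integral_cong_AE)
    note am = up(1)[OF cavg_measurable[OF k g(1) z, of l], of N]
    note [measurable] = am im[OF i]
    have "(\<lambda>\<xi>. indicator S \<xi> * (ind i \<xi> * up (cavg g k z l) N \<xi>)) \<in> borel_measurable (Om N)" by measurable
    thus "(\<lambda>\<xi>. indicator S \<xi> * (indicator ?V (snd \<xi> i) * up (cavg g k z l) N \<xi>)) \<in> borel_measurable (Om N)" by (simp only: ind_def)
    show "(\<lambda>\<xi>. \<Sum>j<N. f j j \<xi>) \<in> borel_measurable (Om N)" by (intro borel_measurable_sum borel_measurable_integrable fi) auto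
    have "AE \<xi> in Om N. \<forall>j\<in>{..<N}. gp g N (j, l) \<xi> = g (T N \<xi>) (snd \<xi> j) $ l"
      by (rule AE_finite_allI) (use gp(2)[OF g(1) cm] in auto)
    thus "AE \<xi> in Om N. (\<Sum>j<N. f j j \<xi>) = indicator S \<xi> * (indicator ?V (snd \<xi> i) * up (cavg g k z l) N \<xi>)"
      using AE_in_Q[of N] AE_space[of "Om N"] up(2)[OF cavg_measurable[OF k g(1) z, of l], of N]
    proof eventually_elim
      case (elim \<xi>)
      have a: "up (cavg g k z l) N \<xi> = (\<Sum>j<N. ind j \<xi> * gp g N (j, l) \<xi>) / cnt \<xi>"
        unfolding elim(4) cavg_T(1)[OF k g(1) z elim(3,2)] cnt_def cavg_T(2)[OF k g(1) z elim(3,2)]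
        using elim(1) by (simp add: ind_def)
      have "(\<Sum>j<N. f j j \<xi>) = indicator S \<xi> * (ind i \<xi> * ((\<Sum>j<N. ind j \<xi> * gp g N (j, l) \<xi>) / cnt \<xi>))"
        by (simp add: f_def sum_distrib_left sum_divide_distrib mult.assoc)
      thus ?case unfolding a[symmetric] unfolding ind_def .
    qed
  qed
  finally show ?thesis .
qed

text \<open>Agrees with \<open>scale_avg\<close> off the walls. The finite sum of indicators
  separates the dependence on x from conditional expectations taken for fixed cells, which gives
  joint measurability.\<close>

definition pcw :: "((real^'d) measure => real^'d => real^'d) => nat => (real^'d) measure => real^'d => real^'d" where
  "pcw g k \<mu> x = (\<chi> l. \<Sum>z\<in>grid n k. indicator (cell k z) x * real_cond_exp (completion P) (scale_alg n k) (cavg g k z l) \<mu>)"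

lemma sum_grid_cell:
  fixes p z :: "real^'d"
  assumes "z \<in> grid n k" "p \<in> cell k z"
  shows "(\<Sum>z'\<in>grid n k. indicator (cell k z') p * h z') = (h z :: real)"
proof -
  have "(\<Sum>z'\<in>grid n k. indicator (cell k z') p * h z') = (\<Sum>z'\<in>grid n k. if z' = z then h z else 0)"
  proof (rule sum.cong[OF refl])
    fix z' :: "real^'d" assume z': "z' \<in> grid n k"
    show "indicator (cell k z') p * h z' = (if z' = z then h z else 0)"
    proof (cases "p \<in> cell k z'")
      case True
      hence "z' = z" using cell_unique[OF grid_lattice[OF z'] grid_lattice[OF assms(1)] _ assms(2)] by blast
      thus ?thesis using True by simp
    next
      case False
      hence "z' \<noteq> z" using assms(2) by blast
      thus ?thesis using False by simp
    qed
  qed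
  thus ?thesis using assms(1) by (simp add: finite_grid)
qed

lemma pcw_measurable: "case_prod (pcw g k) \<in> borel_measurable (completion P \<Otimes>\<^sub>M borel)"
proof -
  have c: "(\<lambda>p. real_cond_exp (completion P) (scale_alg n k) (cavg g k z l) (fst p)) \<in> borel_measurable (completion P \<Otimes>\<^sub>M (borel :: (real^'d) measure))" for z l
    by (rule measurable_compose[OF measurable_fst]) (rule borel_measurable_cond_exp2)
  have "(\<lambda>p. (\<chi> l. \<Sum>z\<in>grid n k. indicator (cell k z) (snd p) * real_cond_exp (completion P) (scale_alg n k) (cavg g k z l) (fst p)) :: real^'d)
      \<in> borel_measurable (completion P \<Otimes>\<^sub>M borel)"
    by (intro vec_lambda_measurable borel_measurable_sum borel_measurable_times c) measurable
  thus ?thesis by (simp add: pcw_def split_def)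
qed

text \<open>The two fields can differ at an atom in the cube only if it lies on a wall, and almost
  surely none does.\<close>

lemma energy_scale_avg:
  assumes k: "k \<le> n"
  shows "energy P (cube n) (scale_avg P n k g) = energy P (cube n) (pcw g k)"
proof (rule energy_cong_atoms)
  show "AE \<mu> in P. \<forall>y\<in>cube n. emeasure \<mu> {y} \<noteq> 0 --> scale_avg P n k g \<mu> y = pcw g k \<mu> y"
    using AE_count_null[OF wall_null[of k]] AE_space[of P]
  proof eventually_elim
    case (elim \<mu>)
    show ?case
    proof (intro ballI impI)
      fix y :: "real^'d" assume y: "y \<in> cube n" "emeasure \<mu> {y} \<noteq> 0"
      let ?W = "{p :: real^'d. \<exists>l. p $ l \<in> range (wall k)}"
      have "y \<notin> ?W"
      proof
        assume yW: "y \<in> ?W"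
        have \<mu>: "\<mu> \<in> configs" using elim(2) by simp
        have "?W \<in> sets lborel" using wall_null by (rule null_setsD2)
        hence "?W \<in> sets \<mu>" by (simp only: sets_lborel sets_configs[OF \<mu>])
        moreover have "{y} \<subseteq> ?W" using yW by (simp only: insert_subset empty_subsetI simp_thms)
        ultimately have "emeasure \<mu> {y} \<le> emeasure \<mu> ?W" by (intro emeasure_mono)
        thus False using y(2) unfolding elim(1) by simp
      qed
      then obtain z where z: "z \<in> grid n k" "y \<in> cell k z" using cell_exists[OF y(1) _ k] by blast
      show "scale_avg P n k g \<mu> y = pcw g k \<mu> y"
        unfolding scale_avg_def pcw_def cube_at_eq[OF grid_lattice[OF z(1)] z(2)] sum_grid_cell[OF z]
        by (simp add: cavg_def[abs_def])
    qed
  qed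
qed

text \<open>On the event that the point lies in a given cell, its gradient may be replaced under the
  integral by the cell average (\<open>cell_average\<close>), whose conditional expectation is known
  from \<open>cond_exp_lift\<close>. That event is itself invariant, so the contributions of the
  cells add up to the conditional expectation.\<close>

lemma cond_exp_gradient:
  assumes k: "k \<le> n" and g: "case_prod g \<in> borel_measurable (completion P \<Otimes>\<^sub>M borel)" "energy P (cube n) g < \<infinity>" and m: "m \<in> coords N"
  shows "AE \<xi> in Om N. resample_space.E (Om N) (coords N) Xc upc (\<lambda>_. Suc k) (gp g N m) \<xi> = gp (pcw g k) N m \<xi>"
proof -
  interpret R: resample_space "Om N" "coords N" Xc upc n by (rule resample_space_Om)
  interpret FA: finite_measure_subalgebra "Om N" "R.A (\<lambda>_. Suc k)" by (rule R.fsub)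
  obtain i l where mi: "m = (i, l)" "i < N" using m by (auto simp: coords_def)
  let ?E = "R.E (\<lambda>_. Suc k)"
  let ?a = "\<lambda>z. up (cavg g k z l) N"
  have ai: "integrable (completion P) (cavg g k z l)" if "z \<in> grid n k" for z by (rule cavg_sqint[OF k g that])
  have am: "?a z \<in> borel_measurable (Om N)" if "z \<in> grid n k" for z by (rule up(1)[OF cavg_measurable[OF k g(1) that]])
  have lift: "AE \<xi> in Om N. ?E (?a z) \<xi> = real_cond_exp (completion P) (scale_alg n k) (cavg g k z l) (T N \<xi>)" if "z \<in> grid n k" for z
    by (rule cond_exp_lift[OF k ai[OF that]])
  have uai: "integrable (Om N) (?a z)" if "z \<in> grid n k" for z by (rule up_integrable[OF ai[OF that]])
  define V where "V = (\<lambda>z. {\<xi> \<in> space (Om N). snd \<xi> i \<in> cell k z})"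
  have VA: "V z \<in> sets (R.A (\<lambda>_. Suc k))" if z: "z \<in> grid n k" for z
  proof -
    have "(\<lambda>\<xi>. snd \<xi> i \<in> cell k z) \<in> R.A (\<lambda>_. Suc k) \<rightarrow>\<^sub>M count_space UNIV"
    proof (rule R.measurable_AI)
      note [measurable] = point_measurable[OF mi(2)]
      show "Measurable.pred (Om N) (\<lambda>\<xi>. snd \<xi> i \<in> cell k z)" by measurable
      fix m' \<xi> t assume m': "m' \<in> coords N" and \<xi>: "\<xi> \<in> space (Om N)" and st: "sim (Suc k) (Xc m' \<xi>) t"
      have "sim (Suc k) (snd (upc m' \<xi> t) i $ l') (snd \<xi> i $ l')" for l'
        using st sim_sym by (auto simp: upc_def shift_nth Xc_def)
      thus "(snd (upc m' \<xi> t) i \<in> cell k z) = (snd \<xi> i \<in> cell k z)"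
        unfolding mem_cell using sim_cell_iff[OF grid_lattice[OF z]] by blast
    qed
    from measurable_sets[OF this, of "{True}"] show ?thesis by (simp add: V_def vimage_def Int_def conj_commute)
  qed
  have VM: "V z \<in> sets (Om N)" if "z \<in> grid n k" for z using VA[OF that] R.subalg_A unfolding subalgebra_def by blast
  define W where "W = (\<lambda>\<xi>. \<Sum>z\<in>grid n k. indicator (V z) \<xi> * ?E (?a z) \<xi>)"
  have Ei: "integrable (Om N) (?E (?a z))" if "z \<in> grid n k" for z
    unfolding R.E_def by (rule FA.real_cond_exp_int(1)[OF uai[OF that]])
  have "AE \<xi> in Om N. ?E (gp g N m) \<xi> = W \<xi>"
    unfolding R.E_def
  proof (rule FA.real_cond_exp_charact)
    have Gs: "sqint (Om N) (gp g N m)" by (rule energy_bound(1)[OF g m])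
    show Gi: "integrable (Om N) (gp g N m)" by (rule R.sqint_integrable[OF Gs])
    have Vi: "integrable (Om N) (\<lambda>\<xi>. indicator (V z) \<xi> * ?E (?a z) \<xi>)" if "z \<in> grid n k" for z
      using integrable_mult_indicator[OF VM[OF that] Ei[OF that]] by simp
    show "integrable (Om N) W" unfolding W_def by (rule Bochner_Integration.integrable_sum) (rule Vi)
    show "W \<in> borel_measurable (R.A (\<lambda>_. Suc k))"
      unfolding W_def by (intro borel_measurable_sum borel_measurable_times borel_measurable_indicator VA R.E_measurable_A)
    fix S assume S: "S \<in> sets (R.A (\<lambda>_. Suc k))"
    have Sm: "S \<in> sets (Om N)" using S R.subalg_A unfolding subalgebra_def by blast
    have SVi: "integrable (Om N) (\<lambda>\<xi>. indicator S \<xi> * (indicator (V z) \<xi> * h \<xi>))" if "z \<in> grid n k" "integrable (Om N) h" for z and h :: "_ => real"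
      using integrable_mult_indicator[OF Sm integrable_mult_indicator[OF VM[OF that(1)] that(2)]] by simp
    have "(\<integral>\<xi>\<in>S. gp g N m \<xi> \<partial>Om N) = (\<integral>\<xi>. (\<Sum>z\<in>grid n k. indicator S \<xi> * (indicator (V z) \<xi> * gp g N m \<xi>)) \<partial>Om N)"
      unfolding set_lebesgue_integral_def
    proof (rule integral_cong_AE)
      show "AE \<xi> in Om N. indicator S \<xi> *\<^sub>R gp g N m \<xi> = (\<Sum>z\<in>grid n k. indicator S \<xi> * (indicator (V z) \<xi> * gp g N m \<xi>))"
        using AE_grid_cell[OF k, of N] AE_space[of "Om N"]
      proof eventually_elim
        case (elim \<xi>)
        then obtain w where w: "w \<in> {..<N} \<rightarrow>\<^sub>E grid n k" "\<forall>i<N. snd \<xi> i \<in> cell k (w i)" by blast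
        have wz: "w i \<in> grid n k" "snd \<xi> i \<in> cell k (w i)" using w mi(2) by auto
        have "(\<Sum>z\<in>grid n k. indicator (V z) \<xi> * gp g N m \<xi>) = (\<Sum>z\<in>grid n k. indicator (cell k z) (snd \<xi> i) * gp g N m \<xi>)"
          using elim(2) by (intro sum.cong) (auto simp: V_def indicator_def)
        also have "\<dots> = gp g N m \<xi>" by (rule sum_grid_cell[OF wz])
        finally show ?case by (simp add: sum_distrib_left[symmetric])
      qed
    qed (use Gs Sm VM in \<open>auto intro!: borel_measurable_sum borel_measurable_times sqint_measurable\<close>)
    also have "\<dots> = (\<Sum>z\<in>grid n k. \<integral>\<xi>. indicator S \<xi> * (indicator (V z) \<xi> * gp g N m \<xi>) \<partial>Om N)"
      by (rule Bochner_Integration.integral_sum) (rule SVi[OF _ Gi])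
    also have "\<dots> = (\<Sum>z\<in>grid n k. \<integral>\<xi>. indicator S \<xi> * (indicator (V z) \<xi> * ?E (?a z) \<xi>) \<partial>Om N)"
    proof (rule sum.cong[OF refl])
      fix z :: "real^'d" assume z: "z \<in> grid n k"
      have Vc: "(\<integral>\<xi>. indicator S \<xi> * (indicator (V z) \<xi> * h \<xi>) \<partial>Om N) = (\<integral>\<xi>. indicator S \<xi> * (indicator (cell k z) (snd \<xi> i) * h \<xi>) \<partial>Om N)" for h :: "_ => real"
        by (rule Bochner_Integration.integral_cong) (auto simp: V_def indicator_def)
      \<comment> \<open>The position of the point among the cells belongs to the conditioning
        algebra, so it can be absorbed into the test event.\<close>
      have SV: "S \<inter> V z \<in> sets (R.A (\<lambda>_. Suc k))" using S VA[OF z] by blast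
      have "(\<integral>\<xi>. indicator S \<xi> * (indicator (V z) \<xi> * gp g N m \<xi>) \<partial>Om N) = (\<integral>\<xi>. indicator S \<xi> * (indicator (V z) \<xi> * ?a z \<xi>) \<partial>Om N)"
        unfolding Vc mi(1) by (rule cell_average[OF k g z mi(2) S])
      also have "\<dots> = (\<integral>\<xi>. indicator S \<xi> * (indicator (V z) \<xi> * ?E (?a z) \<xi>) \<partial>Om N)"
        using FA.real_cond_exp_intA[OF uai[OF z] SV]
        by (simp add: set_lebesgue_integral_def R.E_def indicator_inter_arith mult.assoc)
      finally show "(\<integral>\<xi>. indicator S \<xi> * (indicator (V z) \<xi> * gp g N m \<xi>) \<partial>Om N) =
          (\<integral>\<xi>. indicator S \<xi> * (indicator (V z) \<xi> * ?E (?a z) \<xi>) \<partial>Om N)" .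
    qed
    also have "\<dots> = (\<integral>\<xi>. (\<Sum>z\<in>grid n k. indicator S \<xi> * (indicator (V z) \<xi> * ?E (?a z) \<xi>)) \<partial>Om N)"
      by (rule Bochner_Integration.integral_sum[symmetric]) (rule SVi[OF _ Ei])
    also have "\<dots> = (\<integral>\<xi>\<in>S. W \<xi> \<partial>Om N)"
      by (simp add: set_lebesgue_integral_def W_def sum_distrib_left)
    finally show "(\<integral>\<xi>\<in>S. gp g N m \<xi> \<partial>Om N) = (\<integral>\<xi>\<in>S. W \<xi> \<partial>Om N)" .
  qed
  moreover have "AE \<xi> in Om N. \<forall>z\<in>grid n k. ?E (?a z) \<xi> = real_cond_exp (completion P) (scale_alg n k) (cavg g k z l) (T N \<xi>)"
    by (rule AE_finite_allI[OF finite_grid lift])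
  moreover note gp(2)[OF pcw_measurable[of g k] m] AE_space[of "Om N"]
  ultimately show ?thesis
  proof eventually_elim
    case (elim \<xi>)
    have "W \<xi> = (\<Sum>z\<in>grid n k. indicator (cell k z) (snd \<xi> i) * real_cond_exp (completion P) (scale_alg n k) (cavg g k z l) (T N \<xi>))"
      unfolding W_def using elim(2,4) by (intro sum.cong) (auto simp: V_def indicator_def)
    thus ?case using elim(1,3) by (simp add: pcw_def mi)
  qed
qed

end

section \<open>Minkowski's inequality over the number of points\<close>

lemma L2_set_le_suminf:
  fixes b :: "nat => real"
  assumes "(\<Sum>N. ennreal ((b N)^2)) < \<infinity>"
  shows "L2_set b {..<M} \<le> sqrt (enn2real (\<Sum>N. ennreal ((b N)^2)))"
proof -
  let ?S = "\<Sum>N. ennreal ((b N)^2)"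
  have "(\<Sum>N<M. ennreal ((b N)^2)) \<le> ?S" by (rule sum_le_suminf) auto
  moreover have "(\<Sum>N<M. ennreal ((b N)^2)) = ennreal (\<Sum>N<M. (b N)^2)" by (rule sum_ennreal) simp
  ultimately have le: "ennreal (\<Sum>N<M. (b N)^2) \<le> ?S" by (simp only:)
  have "enn2real (ennreal (\<Sum>N<M. (b N)^2)) \<le> enn2real ?S"
    by (rule enn2real_mono[OF le]) (use assms in \<open>simp only: infinity_ennreal_def\<close>)
  moreover have "enn2real (ennreal (\<Sum>N<M. (b N)^2)) = (\<Sum>N<M. (b N)^2)" by (rule enn2real_ennreal) (simp add: sum_nonneg)
  ultimately have "(\<Sum>N<M. (b N)^2) \<le> enn2real ?S" by (simp only:)
  thus ?thesis unfolding L2_set_def by (rule real_sqrt_le_mono)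
qed

text \<open>Minkowski's inequality for partial sums, followed by a limit. The series on the right
  must be finite, since \<open>enn2real\<close> sends infinity to 0.\<close>

lemma l2_suminf_minkowski:
  fixes a b :: "nat => real" and d :: "'k => nat => real"
  assumes le: "\<And>N. a N \<le> c * b N + c * (\<Sum>k\<in>K. w k * d k N)" and a: "\<And>N. 0 \<le> a N" and c: "0 \<le> c"
    and w: "\<And>k. k \<in> K ==> 0 \<le> w k" and K: "finite K"
    and b: "(\<Sum>N. ennreal ((b N)^2)) < \<infinity>" and d: "\<And>k. k \<in> K ==> (\<Sum>N. ennreal ((d k N)^2)) < \<infinity>"
  shows "sqrt (enn2real (\<Sum>N. ennreal ((a N)^2))) \<le> c * sqrt (enn2real (\<Sum>N. ennreal ((b N)^2))) +
    c * (\<Sum>k\<in>K. w k * sqrt (enn2real (\<Sum>N. ennreal ((d k N)^2))))" (is "_ \<le> ?R")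
proof -
  have part: "L2_set a {..<M} \<le> ?R" for M
  proof -
    have "L2_set a {..<M} \<le> L2_set (\<lambda>N. c * b N + c * (\<Sum>k\<in>K. w k * d k N)) {..<M}"
      by (rule L2_set_mono[OF le a])
    also have "\<dots> \<le> L2_set (\<lambda>N. c * b N) {..<M} + L2_set (\<lambda>N. c * (\<Sum>k\<in>K. w k * d k N)) {..<M}"
      by (rule L2_set_triangle_ineq)
    also have "\<dots> = c * L2_set b {..<M} + c * L2_set (\<lambda>N. \<Sum>k\<in>K. w k * d k N) {..<M}"
      using c by (simp add: L2_set_right_distrib)
    also have "\<dots> \<le> ?R"
    proof (intro add_mono mult_left_mono L2_set_le_suminf b c)
      have "L2_set (\<lambda>N. \<Sum>k\<in>K. w k * d k N) {..<M} \<le> (\<Sum>k\<in>K. L2_set (\<lambda>N. w k * d k N) {..<M})"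
        by (rule L2_set_sum_le[OF K])
      also have "\<dots> = (\<Sum>k\<in>K. w k * L2_set (d k) {..<M})" using w by (intro sum.cong) (auto simp: L2_set_right_distrib)
      also have "\<dots> \<le> (\<Sum>k\<in>K. w k * sqrt (enn2real (\<Sum>N. ennreal ((d k N)^2))))"
        by (intro sum_mono mult_left_mono L2_set_le_suminf d w)
      finally show "L2_set (\<lambda>N. \<Sum>k\<in>K. w k * d k N) {..<M} \<le> (\<Sum>k\<in>K. w k * sqrt (enn2real (\<Sum>N. ennreal ((d k N)^2))))" .
    qed
    finally show ?thesis .
  qed
  have R0: "0 \<le> ?R" using part[of 0] by (simp add: L2_set_def)
  have "(\<Sum>N. ennreal ((a N)^2)) \<le> ennreal (?R^2)"
  proof (rule suminf_le_const[OF summableI])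
    fix M
    have "(\<Sum>N<M. ennreal ((a N)^2)) = ennreal ((L2_set a {..<M})^2)"
      by (simp add: L2_set_def sum_nonneg)
    also have "\<dots> \<le> ennreal (?R^2)" by (intro ennreal_leI power_mono part) (simp add: L2_set_def sum_nonneg)
    finally show "(\<Sum>N<M. ennreal ((a N)^2)) \<le> ennreal (?R^2)" .
  qed
  hence "enn2real (\<Sum>N. ennreal ((a N)^2)) \<le> enn2real (ennreal (?R^2))" by (rule enn2real_mono) simp
  hence "enn2real (\<Sum>N. ennreal ((a N)^2)) \<le> ?R^2" by simp
  thus ?thesis by (intro real_le_lsqrt R0) auto
qed

context poisson_cube
begin

lemma poisson_multiscale_poincare:
  assumes H: "(u, g) \<in> H1 P (cube n)"
    and mean: "AE \<mu> in completion P. real_cond_exp (completion P) (scale_alg n n) u \<mu> = 0"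
  shows "sqrt (enn2real (L2_sq P u)) \<le> 6 * sqrt (enn2real (energy P (cube n) g)) +
    6 * (\<Sum>k\<in>{..n}. 3 ^ k * sqrt (enn2real (energy P (cube n) (scale_avg P n k g))))"
proof -
  interpret C: prob_space "completion P" by (rule prob_space_completion)
  have um: "u \<in> borel_measurable (completion P)" and gm: "case_prod g \<in> borel_measurable (completion P \<Otimes>\<^sub>M borel)"
    using H by (auto simp: H1_def)
  note fin = H1_ibp(4,5)[OF H]
  have ui: "integrable (completion P) u"
    by (rule C.sqint_integrable) (rule sqintI_nn[OF um fin(1)[unfolded L2_sq_def]])
  have pw: "sqint (Om N) (gp (pcw g k) N m)" "nrm2 (Om N) (gp (pcw g k) N m) \<le> nrm2 (Om N) (gp g N m)"
    "nrm2 (Om N) (gp (pcw g k) N m) = nrm2 (Om N) (resample_space.E (Om N) (coords N) Xc upc (\<lambda>_. Suc k) (gp g N m))"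
    if k: "k \<le> n" and m: "m \<in> coords N" for k N m
  proof -
    interpret R: resample_space "Om N" "coords N" Xc upc n by (rule resample_space_Om)
    note E = R.E_sqint[OF H1_ibp(2)[OF H m], of "\<lambda>_. Suc k"]
    note c = sqint_AE_cong[OF E(1) gp(1)[OF pcw_measurable m] cond_exp_gradient[OF k gm fin(2) m]]
    show "sqint (Om N) (gp (pcw g k) N m)" "nrm2 (Om N) (gp (pcw g k) N m) = nrm2 (Om N) (R.E (\<lambda>_. Suc k) (gp g N m))"
      by (rule c)+
    show "nrm2 (Om N) (gp (pcw g k) N m) \<le> nrm2 (Om N) (gp g N m)" unfolding c(2) by (rule E(2))
  qed
  \<comment> \<open>Square roots of the weights turn the decompositions over N into l2
    norms.\<close>
  define a where "a = (\<lambda>N. sqrt (pN N) * nrm2 (Om N) (up u N))"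
  define b where "b = (\<lambda>h N. sqrt (pN N) * L2_set (\<lambda>m. nrm2 (Om N) (gp h N m)) (coords N))"
  have Lu: "L2_sq P u = (\<Sum>N. ennreal ((a N)^2))"
    unfolding L2_up[OF um] using pN_pos
    by (intro suminf_cong) (simp add: a_def nn_integral_sq[OF H1_ibp(1)[OF H]] power_mult_distrib ennreal_mult less_imp_le)
  have bsq: "(b h N)^2 = pN N * (\<Sum>m\<in>coords N. (nrm2 (Om N) (gp h N m))^2)" for h N
    using pN_pos[of N] by (simp add: b_def power_mult_distrib L2_set_def sum_nonneg)
  have Lg: "energy P (cube n) g = (\<Sum>N. ennreal ((b g N)^2))"
    unfolding bsq by (rule energy_nrm[OF gm H1_ibp(2)[OF H]])
  have Ls: "energy P (cube n) (scale_avg P n k g) = (\<Sum>N. ennreal ((b (pcw g k) N)^2))" if k: "k \<le> n" for k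
    unfolding energy_scale_avg[OF k] bsq by (rule energy_nrm[OF pcw_measurable pw(1)[OF k]])
  \<comment> \<open>Conditional expectation contracts each component, so the averaged energies are
    finite along with that of g.\<close>
  have fs: "(\<Sum>N. ennreal ((b (pcw g k) N)^2)) < \<infinity>" if k: "k \<le> n" for k
  proof -
    have "(\<Sum>N. ennreal ((b (pcw g k) N)^2)) \<le> (\<Sum>N. ennreal ((b g N)^2))"
    proof (intro suminf_le summableI ennreal_leI)
      show "(b (pcw g k) N)^2 \<le> (b g N)^2" for N
        unfolding bsq using pN_pos[of N] by (intro mult_left_mono sum_mono power_mono pw(2)[OF k]) auto
    qed
    thus ?thesis using fin(2) unfolding Lg by (rule le_less_trans)
  qed
  have step: "a N \<le> 6 * b g N + 6 * (\<Sum>k\<in>{..n}. 3 ^ k * b (pcw g k) N)" for N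
  proof -
    interpret R: resample_space "Om N" "coords N" Xc upc n by (rule resample_space_Om)
    \<comment> \<open>\<open>scale_alg n n\<close> corresponds to level \<open>Suc n\<close>, so the
      hypothesis on u becomes the vanishing of its mean at the coarsest level.\<close>
    have "AE \<mu> in P. real_cond_exp (completion P) (scale_alg n n) u \<mu> = 0" using mean by (simp only: AE_completion_iff)
    from AE_T[OF this, of N] cond_exp_lift[OF order.refl ui, of N]
    have top: "AE \<xi> in Om N. R.E (\<lambda>_. Suc n) (up u N) \<xi> = 0" by eventually_elim simp
    have "nrm2 (Om N) (up u N) \<le> 6 * L2_set (\<lambda>m. nrm2 (Om N) (gp g N m)) (coords N) +
        6 * (\<Sum>j\<le>n. 3 ^ j * L2_set (\<lambda>m. nrm2 (Om N) (R.E (\<lambda>_. Suc j) (gp g N m))) (coords N))"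
      by (rule R.multiscale_poincare[OF H1_ibp(1)[OF H] H1_ibp(2)[OF H] H1_ibp(3)[OF H] top])
    also have "(\<Sum>j\<le>n. 3 ^ j * L2_set (\<lambda>m. nrm2 (Om N) (R.E (\<lambda>_. Suc j) (gp g N m))) (coords N)) =
        (\<Sum>j\<le>n. 3 ^ j * L2_set (\<lambda>m. nrm2 (Om N) (gp (pcw g j) N m)) (coords N))"
      by (intro sum.cong refl arg_cong2[where f = "(*)"] L2_set_cong) (simp add: pw(3))
    finally have "sqrt (pN N) * nrm2 (Om N) (up u N) \<le> sqrt (pN N) * (6 * L2_set (\<lambda>m. nrm2 (Om N) (gp g N m)) (coords N) +
        6 * (\<Sum>j\<le>n. 3 ^ j * L2_set (\<lambda>m. nrm2 (Om N) (gp (pcw g j) N m)) (coords N)))"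
      using pN_pos[of N] by (intro mult_left_mono) auto
    thus ?thesis by (simp add: a_def b_def distrib_left sum_distrib_left mult.left_commute)
  qed
  have "sqrt (enn2real (\<Sum>N. ennreal ((a N)^2))) \<le> 6 * sqrt (enn2real (\<Sum>N. ennreal ((b g N)^2))) +
      6 * (\<Sum>k\<in>{..n}. 3 ^ k * sqrt (enn2real (\<Sum>N. ennreal ((b (pcw g k) N)^2))))"
  proof (rule l2_suminf_minkowski[OF step])
    show "0 \<le> a N" for N using pN_pos[of N] by (simp add: a_def)
    show "(\<Sum>N. ennreal ((b g N)^2)) < \<infinity>" using fin(2) by (simp only: Lg)
  qed (use fs in auto)
  thus ?thesis unfolding Lu Lg using Ls by simp
qed

end

theorem proposition3p8:
  shows "\<exists>C::real. \<forall>\<rho>>0. \<forall>P :: (real^'d::finite) measure measure. poisson_law \<rho> P \<longrightarrow>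
    (\<forall>n u g. (u, g) \<in> H1 P (cube n) \<longrightarrow>
       (AE \<mu> in completion P. real_cond_exp (completion P) (scale_alg n n) u \<mu> = 0) \<longrightarrow>
       sqrt (enn2real (L2_sq P u)) \<le>
         C * sqrt (enn2real (energy P (cube n) g)) +
         C * (\<Sum>k=0..n. 3 ^ k * sqrt (enn2real (energy P (cube n) (scale_avg P n k g)))))"
\<comment> \<open>An absolute constant: it stems from the one-dimensional estimates, which are the
  same for every dimension and density.\<close>
proof (rule exI[of _ 6], intro allI impI)
  fix \<rho> :: real and P :: "(real^'d) measure measure" and n u g
  assume a: "0 < \<rho>" "poisson_law \<rho> P" "(u, g) \<in> H1 P (cube n)"
    "AE \<mu> in completion P. real_cond_exp (completion P) (scale_alg n n) u \<mu> = 0"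
  interpret poisson_cube \<rho> P n by unfold_locales (use a in auto)
  show "sqrt (enn2real (L2_sq P u)) \<le> 6 * sqrt (enn2real (energy P (cube n) g)) +
      6 * (\<Sum>k=0..n. 3 ^ k * sqrt (enn2real (energy P (cube n) (scale_avg P n k g))))"
    using poisson_multiscale_poincare[OF a(3,4)] by (simp add: atLeast0AtMost)
qed

end
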